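(* Assume that $F_Y$ and $F_X$ are continuous (no atoms for the marginals). Then $\widehat\rho_n^{\mathrm{CvM}}$ is consistent: $$\lim_{n\to\infty}\widehat\rho_n^{\mathrm{CvM}}=\rho^{\mathrm{CvM}}\quad\text{almost surely}.$$ Furthermore, define $$\Delta_n:=\frac1n\sum_{i=1}^n\int_{\mathbb R}\mathbb E\left[\left(\varphi(t,X_{\sigma_n(i-1)})-\varphi(t,X_{\sigma_n(i)})\right)^2\right]dF_Y(t)=\int_{\mathbb R}\mathbb E\left[\left(\varphi(t,X_1)-\varphi(t,X_{N_n(1)})\right)^2\right]dF_Y(t).$$ Then $\Delta_n\to0$ as $n\to\infty$, and $$\sqrt n\left(\widehat\rho_n^{\mathrm{CvM}}-\rho^{\mathrm{CvM}}+3\Delta_n\right)\xrightarrow{\ \mathcal L\ }\mathcal N(0,\sigma^2_{\mathrm{CvM}}),$$ where $$\frac1{36}\sigma^2_{\mathrm{CvM}}=\int_{\mathbb R}\int_{\mathbb R}C_{\mathcal X,\mathcal X}(t,s)\,dF_Y(t)\,dF_Y(s)+\int_{\mathbb R}\int_{\mathbb R}C_{\mathcal Y,\mathcal Y}(t,s)\,dT(t)\,dT(s)-2\int_{\mathbb R}\int_{\mathbb R}C_{\mathcal X,\mathcal Y}(t,s)\,dF_Y(t)\,dT(s)$$ and $$\begin{aligned}C_{\mathcal X,\mathcal X}(t,s)=&\ \mathbb E\left[F_{Y|X}(t)^2F_{Y|X}(s)^2\right]-\mathbb E\left[F_{Y|X}(t)^2\right]\mathbb E\left[F_{Y|X}(s)^2\right]\\&+\mathbb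 E\left[\left(F_{Y|X}(t\wedge s)+3F_{Y|X}(t)F_{Y|X}(s)\right)\left(F_{Y|X}(t\wedge s)-F_{Y|X}(t)F_{Y|X}(s)\right)\right],\\C_{\mathcal X,\mathcal Y}(t,s)=&\ \mathbb E\left[F_{Y|X}(t)^2F_{Y|X}(s)\right]-\mathbb E\left[F_{Y|X}(t)^2\right]\mathbb E\left[F_{Y|X}(s)\right]\\&+\mathbb E\left[2F_{Y|X}(t)\left(F_{Y|X}(t\wedge s)-F_{Y|X}(t)F_{Y|X}(s)\right)\right],\\C_{\mathcal Y,\mathcal Y}(t,s)=&\ F_Y(t\wedge s)-F_Y(t)F_Y(s).\end{aligned}$$ In particular, if $\lim_{n\to\infty}\sqrt n\,\Delta_n=0$, then $$\sqrt n\left[\widehat\rho_n^{\mathrm{CvM}}-\rho^{\mathrm{CvM}}\right]\xrightarrow{\ \mathcal L\ }\mathcal N(0,\sigma^2_{\mathrm{CvM}}).$$ The condition $\lim_{n\to\infty}\sqrt n\,\Delta_n=0$ is implied, for example, by $\varphi(t,\cdot)$ having a bounded quadratic variation ($2$-variation), uniformly in $t$.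
   Context: Model: $X$ and $\varepsilon$ are independent real random variables, $f:\mathbb R\times\mathbb R\to\mathbb R$ is measurable, $Y=f(X,\varepsilon)$. Let $(X_i)_{i\ge1}$ be i.i.d. copies of $X$ and $(\varepsilon_i)_{i\ge1}$ i.i.d. copies of $\varepsilon$, the two sequences being independent, and $Y_i=f(X_i,\varepsilon_i)$. $F_X,F_Y$ are the cumulative distribution functions of $X,Y$. Set $\varphi(t,x):=\mathbb P(f(x,\varepsilon)\le t)=\mathbb P(Y\le t\mid X=x)$, $F_{Y|X}(t):=\varphi(t,X)$ (the random conditional CDF), and $T(t):=\mathbb E[F_{Y|X}(t)^2]$, a nondecreasing function of $t$ (so $dT$ is its Stieltjes measure). Ranks: almost surely there is a unique permutation $\sigma_n$ of $\{1,\dots,n\}$ with $X_{\sigma_n(1)}<\cdots<X_{\sigma_n(n)}$. It is extended $n$-periodically, so $\sigma_n(0)=\sigma_n(n)$ and $\sigma_n(n+1)=\sigma_n(1)$. For $j\in\{1,\dots,n\}$, $N_n(j):=\sigma_n(\sigma_n^{-1}(j)+1)$ where $\sigma_n^{-1}(j)\in\{1,\dots,n\}$: the index of the right neighbour of $X_j$, the successor of the largest observation being the smallest one. Cramér–von Mises index: $$\rho^{\mathrm{CvM}}:=\frac{\int_{\mathbb R}\mathbb E\left[(F_{Y|X}(t)-F_Y(t))^2\right]dF_Y(t)}{\int_{\mathbb R}F_Y(t)(1-F_Y(t))\,dF_Y(t)},$$ which for continuous $F_Y$ equals $6\int_{\mathbb R}\mathbb E[F_{Y|X}(t)^2]\,dF_Y(t)-2$.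 Rank estimator: with $F_n(t)=\frac1n\sum_{i=1}^n\mathbf 1_{\{Y_i\le t\}}$ the empirical CDF of the $Y_i$ and $$T_n(t):=\frac1n\sum_{i=1}^n\mathbf 1_{\{Y_{\sigma_n(i)}\le t\}}\mathbf 1_{\{Y_{\sigma_n(i+1)}\le t\}}=\frac1n\sum_{i=1}^n\mathbf 1_{\{\max(Y_i,Y_{N_n(i)})\le t\}},$$ put $T_n^{\mathrm{CvM}}:=\int_{\mathbb R}T_n(t)\,dF_n(t)$ and $\widehat\rho_n^{\mathrm{CvM}}:=6\,T_n^{\mathrm{CvM}}-2$. $\varphi(t,\cdot)$ has bounded $2$-variation uniformly in $t$ if $\sup_{t}\sup\sum_i(\varphi(t,x_{i+1})-\varphi(t,x_i))^2<\infty$, the inner supremum being over all finite increasing sequences $x_1<\cdots<x_m$. $\xrightarrow{\mathcal L}$ denotes convergence in law; $t\wedge s=\min(t,s)$. *)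

theory Defs
  imports "HOL-Probability.Probability"
begin

section \<open>Rank permutation and right neighbours\<close>

text \<open>
  Data are functions on \<open>nat\<close> of which only the values at \<open>1, \<dots>, n\<close> matter.
  The ordering permutation exists (uniquely) iff there are no ties among \<open>x 1, \<dots>, x n\<close>.
  Ties only occur on a null set below; there the value is fixed to \<open>id\<close>, so that statistics
  built from it are honest (measurable) random variables.
\<close>

definition is_rank_perm :: "nat \<Rightarrow> (nat \<Rightarrow> real) \<Rightarrow> (nat \<Rightarrow> nat) \<Rightarrow> bool" where
  "is_rank_perm n x \<pi> \<longleftrightarrow> \<pi> permutes {1..n} \<and> strict_mono_on {1..n} (\<lambda>i. x (\<pi> i))"

definition rank_perm :: "nat \<Rightarrow> (nat \<Rightarrow> real) \<Rightarrow> nat \<Rightarrow> nat" where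
  "rank_perm n x = (if \<exists>\<pi>. is_rank_perm n x \<pi> then (THE \<pi>. is_rank_perm n x \<pi>) else id)"

text \<open>
  The \<open>n\<close>-periodic extension \<open>\<sigma>\<^sub>n\<close>: the index \<open>1 + (i + n - 1) mod n\<close> is the representative of
  \<open>i\<close> modulo \<open>n\<close> in \<open>{1..n}\<close>, so that \<open>\<sigma>\<^sub>n 0 = \<sigma>\<^sub>n n\<close> and \<open>\<sigma>\<^sub>n (n + 1) = \<sigma>\<^sub>n 1\<close>.
\<close>

definition rank_perm_ext :: "nat \<Rightarrow> (nat \<Rightarrow> real) \<Rightarrow> nat \<Rightarrow> nat" where
  "rank_perm_ext n x i = rank_perm n x (1 + (i + n - 1) mod n)"

definition right_neighbour :: "nat \<Rightarrow> (nat \<Rightarrow> real) \<Rightarrow> nat \<Rightarrow> nat" where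
  "right_neighbour n x j = rank_perm_ext n x (inv (rank_perm n x) j + 1)"

section \<open>The rank estimator, as a function of the data\<close>

definition empirical_cdf :: "nat \<Rightarrow> (nat \<Rightarrow> real) \<Rightarrow> real \<Rightarrow> real" where
  "empirical_cdf n y t = (1 / real n) * (\<Sum>i=1..n. indicator {..t} (y i))"

definition rank_T :: "nat \<Rightarrow> (nat \<Rightarrow> real) \<Rightarrow> (nat \<Rightarrow> real) \<Rightarrow> real \<Rightarrow> real" where
  "rank_T n x y t = (1 / real n) *
     (\<Sum>i=1..n. indicator {..t} (y (rank_perm_ext n x i)) *
                indicator {..t} (y (rank_perm_ext n x (i + 1))))"

text \<open>\<open>interval_measure F\<close> is the Lebesgue--Stieltjes measure \<open>dF\<close>.\<close>

definition rank_T_CvM :: "nat \<Rightarrow> (nat \<Rightarrow> real) \<Rightarrow> (nat \<Rightarrow> real) \<Rightarrow> real" where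
  "rank_T_CvM n x y = (\<integral>t. rank_T n x y t \<partial>interval_measure (empirical_cdf n y))"

definition rho_CvM_hat :: "nat \<Rightarrow> (nat \<Rightarrow> real) \<Rightarrow> (nat \<Rightarrow> real) \<Rightarrow> real" where
  "rho_CvM_hat n x y = 6 * rank_T_CvM n x y - 2"

section \<open>Population quantities\<close>

text \<open>\<open>cond_cdf M \<epsilon> f t x\<close> is \<open>\<phi>(t, x) = P(f(x, \<epsilon>) \<le> t)\<close>; the random conditional CDF of \<open>Y\<close>
  given \<open>X\<close> is \<open>\<omega> \<mapsto> \<phi>(t, X \<omega>)\<close>.\<close>

definition cond_cdf ::
    "'a measure \<Rightarrow> ('a \<Rightarrow> real) \<Rightarrow> (real \<times> real \<Rightarrow> real) \<Rightarrow> real \<Rightarrow> real \<Rightarrow> real" where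
  "cond_cdf M \<epsilon> f t x = measure M {\<omega> \<in> space M. f (x, \<epsilon> \<omega>) \<le> t}"

abbreviation cdf_of :: "'a measure \<Rightarrow> ('a \<Rightarrow> real) \<Rightarrow> real \<Rightarrow> real" where
  "cdf_of M Z \<equiv> cdf (distr M borel Z)"

definition rho_CvM ::
    "'a measure \<Rightarrow> ('a \<Rightarrow> real) \<Rightarrow> ('a \<Rightarrow> real) \<Rightarrow> (real \<Rightarrow> real \<Rightarrow> real) \<Rightarrow> real" where
  "rho_CvM M X Y \<phi> =
     (\<integral>t. (\<integral>\<omega>. (\<phi> t (X \<omega>) - cdf_of M Y t)\<^sup>2 \<partial>M) \<partial>interval_measure (cdf_of M Y)) /
     (\<integral>t. cdf_of M Y t * (1 - cdf_of M Y t) \<partial>interval_measure (cdf_of M Y))"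

definition T_fun :: "'a measure \<Rightarrow> ('a \<Rightarrow> real) \<Rightarrow> (real \<Rightarrow> real \<Rightarrow> real) \<Rightarrow> real \<Rightarrow> real" where
  "T_fun M X \<phi> t = (\<integral>\<omega>. (\<phi> t (X \<omega>))\<^sup>2 \<partial>M)"

definition Delta_CvM ::
    "'a measure \<Rightarrow> ('a \<Rightarrow> real) \<Rightarrow> (real \<Rightarrow> real \<Rightarrow> real) \<Rightarrow> (nat \<Rightarrow> 'a \<Rightarrow> real) \<Rightarrow> nat \<Rightarrow> real" where
  "Delta_CvM M Y \<phi> Xs n = (1 / real n) * (\<Sum>i=1..n.
     \<integral>t. (\<integral>\<omega>. (\<phi> t (Xs (rank_perm_ext n (\<lambda>k. Xs k \<omega>) (i - 1)) \<omega>)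
             - \<phi> t (Xs (rank_perm_ext n (\<lambda>k. Xs k \<omega>) i) \<omega>))\<^sup>2 \<partial>M)
       \<partial>interval_measure (cdf_of M Y))"

definition C_XX ::
    "'a measure \<Rightarrow> ('a \<Rightarrow> real) \<Rightarrow> (real \<Rightarrow> real \<Rightarrow> real) \<Rightarrow> real \<Rightarrow> real \<Rightarrow> real" where
  "C_XX M X \<phi> t s =
     (\<integral>\<omega>. (\<phi> t (X \<omega>))\<^sup>2 * (\<phi> s (X \<omega>))\<^sup>2 \<partial>M)
     - (\<integral>\<omega>. (\<phi> t (X \<omega>))\<^sup>2 \<partial>M) * (\<integral>\<omega>. (\<phi> s (X \<omega>))\<^sup>2 \<partial>M)
     + (\<integral>\<omega>. (\<phi> (min t s) (X \<omega>) + 3 * \<phi> t (X \<omega>) * \<phi> s (X \<omega>))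
           * (\<phi> (min t s) (X \<omega>) - \<phi> t (X \<omega>) * \<phi> s (X \<omega>)) \<partial>M)"

definition C_XY ::
    "'a measure \<Rightarrow> ('a \<Rightarrow> real) \<Rightarrow> (real \<Rightarrow> real \<Rightarrow> real) \<Rightarrow> real \<Rightarrow> real \<Rightarrow> real" where
  "C_XY M X \<phi> t s =
     (\<integral>\<omega>. (\<phi> t (X \<omega>))\<^sup>2 * \<phi> s (X \<omega>) \<partial>M)
     - (\<integral>\<omega>. (\<phi> t (X \<omega>))\<^sup>2 \<partial>M) * (\<integral>\<omega>. \<phi> s (X \<omega>) \<partial>M)
     + (\<integral>\<omega>. 2 * \<phi> t (X \<omega>) * (\<phi> (min t s) (X \<omega>) - \<phi> t (X \<omega>) * \<phi> s (X \<omega>)) \<partial>M)"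

definition C_YY :: "'a measure \<Rightarrow> ('a \<Rightarrow> real) \<Rightarrow> real \<Rightarrow> real \<Rightarrow> real" where
  "C_YY M Y t s = cdf_of M Y (min t s) - cdf_of M Y t * cdf_of M Y s"

definition sigma2_CvM ::
    "'a measure \<Rightarrow> ('a \<Rightarrow> real) \<Rightarrow> ('a \<Rightarrow> real) \<Rightarrow> (real \<Rightarrow> real \<Rightarrow> real) \<Rightarrow> real" where
  "sigma2_CvM M X Y \<phi> = 36 *
     ((\<integral>s. (\<integral>t. C_XX M X \<phi> t s \<partial>interval_measure (cdf_of M Y)) \<partial>interval_measure (cdf_of M Y))
      + (\<integral>s. (\<integral>t. C_YY M Y t s \<partial>interval_measure (T_fun M X \<phi>)) \<partial>interval_measure (T_fun M X \<phi>))
      - 2 * (\<integral>s. (\<integral>t. C_XY M X \<phi> t s \<partial>interval_measure (cdf_of M Y))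
               \<partial>interval_measure (T_fun M X \<phi>)))"

text \<open>Normal law with mean \<open>m\<close> and variance \<open>v \<ge> 0\<close>; for \<open>v = 0\<close> it is the Dirac mass at \<open>m\<close>
  (this does occur as a limit, e.g. when \<open>Y = X\<close>).\<close>

definition normal_law :: "real \<Rightarrow> real \<Rightarrow> real measure" where
  "normal_law m v =
     (if v = 0 then return borel m else density lborel (\<lambda>x. ennreal (normal_density m (sqrt v) x)))"

text \<open>A finite increasing sequence \<open>x\<^sub>1 < \<dots> < x\<^sub>m\<close> is a pair \<open>(m, x)\<close> with \<open>x\<close> strictly increasing
  on \<open>{1..m}\<close>. The suprema are taken in \<open>[0, \<infinity>]\<close>.\<close>

definition uniformly_bounded_2_variation :: "(real \<Rightarrow> real \<Rightarrow> real) \<Rightarrow> bool" where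
  "uniformly_bounded_2_variation \<phi> \<longleftrightarrow>
     (SUP t. SUP (m, x) \<in> {(m :: nat, x :: nat \<Rightarrow> real). strict_mono_on {1..m} x}.
        ennreal (\<Sum>i=1..<m. (\<phi> t (x (i + 1)) - \<phi> t (x i))\<^sup>2)) < \<infinity>"

end

theory Submission
  imports Defs "HOL-Probability.Probability"
begin

text \<open>
  Let \<open>w = F\<^sub>Y(Y)\<close>, \<open>u = T(Y)\<close> and \<open>H(a, b) = 1 - max a b\<close>. Integrating \<open>T\<^sub>n\<close> against the law of \<open>Y\<close>
  gives the mean of \<open>H(w\<^sub>i, w\<^sub>j)\<close> over neighbouring pairs, and replacing the law of \<open>Y\<close> by the empirical law
  adds the mean of the \<open>u\<^sub>i\<close> up to a remainder whose second moment is \<open>o(1/n)\<close>, because \<open>T\<^sub>n - T\<close> is small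
  and moves by \<open>O(1/n)\<close> when one observation is changed. Neighbouring observations have almost equal conditional
  laws: an indicator of a half-line jumps at most once along the ordered sample, so by density the average jump
  of any measurable function of the position tends to zero. Hence, conditionally on the positions, the
  Efron-Stein inequality allows one to replace \<open>X\<^sub>i\<close> by its neighbour inside the kernel, at the price of the bias
  \<open>\<Delta>\<^sub>n / 2\<close>. What is left is an i.i.d. sum plus martingale differences along the ordered sample; the product of the
  factors \<open>1 + \<i> s \<xi>\<^sub>k\<close> has mean one (integrate out the noises from the last one backwards), and comparing it with
  the characteristic function gives the Gaussian limit. Almost sure convergence needs only the variance bound
  \<open>O(1/n)\<close>, used along the squares.
\<close>

section \<open>Consecutive pairs of a list\<close>

text \<open>No smoothness of \<open>\<phi>\<close> in its second argument is assumed, so replacing a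
  position by its neighbour has a cost without rate. The bookkeeping keeps this cost out of the mean
  except through an exact identity: if \<open>mm x y\<close> is the mean of \<open>H\<close> over
  two independent noises at \<open>x\<close> and \<open>y\<close>, then
  \<open>2 * mm x y = mm x x + mm y y - dd x y\<close> with \<open>dd\<close> a squared L2 distance
  of conditional distribution functions. The diagonal terms belong to the i.i.d. sum, the
  \<open>dd\<close> terms are the bias, and the factor 6 of the index turns half of Delta into 3
  Delta. All other costs occur in second moments only; for sums these are o(n), which the
  normalisation by sqrt n absorbs. The neighbour relation is itself random. At a fixed design it is
  a fixed list, so independence of the noises can be used pair by pair; over the design, deleting
  one index alters at most three pairs, which is enough for Efron-Stein. The cyclic pair from the
  largest to the smallest observation is left out of the analysis and restored at the end for
  O(1/n).\<close>

text \<open>Encoded as a set, so that neighbour sums are finite sums indexed by pairs. For a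
  distinct list nothing is lost, since then no pair occurs twice.\<close>

definition adj :: "'i list => ('i \<times> 'i) set" where
  "adj l = set (zip l (tl l))"

lemma adj_simps [simp]:
  "adj [] = {}" "adj [a] = {}" "adj (a # b # l) = insert (a, b) (adj (b # l))"
  by (auto simp: adj_def)

lemma finite_adj [simp]: "finite (adj l)"
  by (simp add: adj_def)

lemma adj_in_set:
  assumes "p \<in> adj l"
  shows "fst p \<in> set l" "snd p \<in> set (tl l)" "snd p \<in> set l"
proof -
  show "fst p \<in> set l" "snd p \<in> set (tl l)"
    using assms set_zip_leftD[of "fst p" "snd p"] set_zip_rightD[of "fst p" "snd p"]
    by (auto simp: adj_def)
  then show "snd p \<in> set l" by (cases l) auto
qed

lemma adj_neq: "distinct l ==> p \<in> adj l ==> fst p ~= snd p"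
proof (induction l rule: induct_list012)
  case (3 a b l)
  then show ?case using adj_in_set(3)[of p "b # l"] by auto
qed auto

lemma card_adj_le: "card (adj l) <= length l"
  unfolding adj_def by (rule order_trans[OF card_length]) simp

text \<open>Concatenation creates exactly one new pair, the seam \<open>(last u, hd v)\<close>;
  distinctness keeps the three groups of pairs disjoint.\<close>

lemma sum_adj_append:
  fixes K :: "'i \<times> 'i => real"
  assumes "distinct (u @ v)"
  shows "sum K (adj (u @ v)) =
    sum K (adj u) + sum K (adj v) + (if u ~= [] \<and> v ~= [] then K (last u, hd v) else 0)"
  using assms
proof (induction u rule: induct_list012)
  case (2 a)
  then show ?case
  proof (cases v)
    case (Cons b v')
    then have "(a, b) \<notin> adj v"
      using 2 adj_in_set(1)[of "(a, b)" v] by auto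
    then show ?thesis using Cons by (simp add: add.commute)
  qed simp
next
  case (3 a b u)
  have *: "(a, b) \<notin> adj (b # u)" "(a, b) \<notin> adj (b # u @ v)"
    using 3(3) adj_in_set(1)[of "(a, b)" "b # u"] adj_in_set(1)[of "(a, b)" "b # u @ v"] by auto
  then show ?case using 3 by auto
qed auto

lemma adj_snoc: "adj (l @ [a, b]) = insert (a, b) (adj (l @ [a]))"
  by (induction l rule: induct_list012) auto

text \<open>Every element except the head is the second entry of exactly one pair. This lemma and
  its mirror image \<open>sum_adj_fst\<close> turn neighbour sums into sums over all observations at
  the price of one boundary term.\<close>

lemma sum_adj_snd:
  fixes q :: "'i => real"
  assumes "distinct l" "l ~= []"
  shows "(\<Sum>p\<in>adj l. q (snd p)) = sum q (set l) - q (hd l)"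
  using assms
proof (induction l rule: induct_list012)
  case (3 a b l)
  have "(a, b) \<notin> adj (b # l)"
    using 3(3) adj_in_set(1)[of "(a, b)" "b # l"] by auto
  then show ?case using 3 by auto
qed auto

lemma sum_adj_fst:
  fixes q :: "'i => real"
  assumes "distinct l" "l ~= []"
  shows "(\<Sum>p\<in>adj l. q (fst p)) = sum q (set l) - q (last l)"
  using assms
proof (induction l rule: induct_list012)
  case (3 a b l)
  have "(a, b) \<notin> adj (b # l)"
    using 3(3) adj_in_set(1)[of "(a, b)" "b # l"] by auto
  then show ?case using 3 by auto
qed auto

section \<open>Pairs through a fixed index, and deletion of that index\<close>

definition adj_at :: "'i => 'i list => ('i \<times> 'i) set" where
  "adj_at j l = {p \<in> adj l. fst p = j \<or> snd p = j}"

lemma finite_adj_at [simp]: "finite (adj_at j l)"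
  by (simp add: adj_at_def)

lemma adj_at_empty: "j \<notin> set l ==> adj_at j l = {}"
  by (auto simp: adj_at_def dest: adj_in_set(1,3))

lemma sum_adj_at_split:
  fixes K :: "'i \<times> 'i => real"
  assumes "distinct (u @ j # v)"
  shows "sum K (adj_at j (u @ j # v)) =
    (if u ~= [] then K (last u, j) else 0) + (if v ~= [] then K (j, hd v) else 0)"
proof -
  define K' where "K' p = (if fst p = j \<or> snd p = j then K p else 0)" for p
  have "sum K (adj_at j (u @ j # v)) = sum K' (adj (u @ j # v))"
    unfolding adj_at_def K'_def by (rule sum.inter_filter) simp
  also have "\<dots> = sum K' (adj u) + sum K' (adj (j # v)) + (if u ~= [] then K (last u, j) else 0)"
    by (subst sum_adj_append) (use assms in \<open>auto simp: K'_def\<close>)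
  also have "sum K' (adj u) = 0"
    using assms by (intro sum.neutral ballI) (auto simp: K'_def dest: adj_in_set(1,3))
  also have "sum K' (adj (j # v)) = sum K' (adj v) + (if v ~= [] then K (j, hd v) else 0)"
    using assms sum_adj_append[of "[j]" v K'] by (auto simp: K'_def)
  also have "sum K' (adj v) = 0"
    using assms by (intro sum.neutral ballI) (auto simp: K'_def dest: adj_in_set(1,3))
  finally show ?thesis by simp
qed

lemma sum_adj_remove_split:
  fixes K :: "'i \<times> 'i => real"
  assumes "distinct (u @ j # v)"
  shows "sum K (adj (u @ j # v)) - sum K (adj (u @ v)) =
    sum K (adj_at j (u @ j # v)) - (if u ~= [] \<and> v ~= [] then K (last u, hd v) else 0)"
proof -
  have "sum K (adj (u @ j # v)) = sum K (adj u) + sum K (adj ([j] @ v)) +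
      (if u ~= [] then K (last u, j) else 0)"
    by (subst sum_adj_append) (use assms in auto)
  also have "sum K (adj ([j] @ v)) = sum K (adj v) + (if v ~= [] then K (j, hd v) else 0)"
    by (subst sum_adj_append) (use assms in auto)
  moreover have "sum K (adj (u @ v)) =
      sum K (adj u) + sum K (adj v) + (if u ~= [] \<and> v ~= [] then K (last u, hd v) else 0)"
    by (rule sum_adj_append) (use assms in auto)
  ultimately show ?thesis
    unfolding sum_adj_at_split[OF assms] by linarith
qed

lemma distinct_remove_split:
  assumes "distinct l" "j \<in> set l"
  obtains u v where "l = u @ j # v" "filter (%i. i ~= j) l = u @ v"
proof -
  obtain u v where l: "l = u @ j # v" using split_list[OF assms(2)] by blast
  moreover have "filter (%i. i ~= j) u = u" "filter (%i. i ~= j) v = v"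
    using assms(1) l by (auto intro!: filter_True)
  ultimately have "filter (%i. i ~= j) l = u @ v"
    by simp
  with l that show thesis by blast
qed

lemma sum_adj_at_le:
  fixes K :: "'i \<times> 'i => real"
  assumes "distinct l" "!!p. p \<in> adj l ==> K p <= B" "0 <= B"
  shows "sum K (adj_at j l) <= 2 * B"
proof (cases "j \<in> set l")
  case True
  obtain u v where l: "l = u @ j # v" using split_list[OF True] by blast
  have d: "distinct (u @ j # v)" using assms(1) l by simp
  \<comment> \<open>\<open>K\<close> is bounded only on pairs of the list. Cutting it off elsewhere
    gives a bound at \<open>(last u, j)\<close> and \<open>(j, hd v)\<close> even if
    \<open>u\<close> or \<open>v\<close> is empty.\<close>
  define K' where "K' p = (if p \<in> adj l then K p else 0)" for p
  have k: "K' p <= B" for p using assms by (auto simp: K'_def)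
  have "sum K (adj_at j l) = sum K' (adj_at j l)"
    by (rule sum.cong) (auto simp: K'_def adj_at_def)
  also have "\<dots> <= 2 * B"
    unfolding l sum_adj_at_split[OF d] using k[of "(last u, j)"] k[of "(j, hd v)"] assms(3) by auto
  finally show ?thesis .
next
  case False
  then have "adj_at j l = {}" by (rule adj_at_empty)
  then show ?thesis using assms by simp
qed

lemma card_adj_at: "distinct l ==> card (adj_at j l) <= 2"
  using sum_adj_at_le[of l "%_. 1" 1 j] by simp

text \<open>Double counting: each pair is seen from its two endpoints. This is how the local changes
  in the Efron-Stein bounds add up to a global sum.\<close>

lemma sum_sum_adj_at:
  fixes K :: "'i \<times> 'i => real"
  assumes "distinct l" "set l \<subseteq> I" "finite I"
  shows "(\<Sum>j\<in>I. sum K (adj_at j l)) = 2 * sum K (adj l)"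
proof -
  have "sum K (adj_at j l) = (\<Sum>p\<in>adj l. if fst p = j \<or> snd p = j then K p else 0)" for j
    unfolding adj_at_def by (rule sum.inter_filter) simp
  then have "(\<Sum>j\<in>I. sum K (adj_at j l)) = (\<Sum>j\<in>I. \<Sum>p\<in>adj l. if fst p = j \<or> snd p = j then K p else 0)"
    by simp
  also have "\<dots> = (\<Sum>p\<in>adj l. \<Sum>j\<in>I. if fst p = j \<or> snd p = j then K p else 0)"
    by (rule sum.swap)
  also have "\<dots> = (\<Sum>p\<in>adj l. 2 * K p)"
  proof (rule sum.cong[OF refl])
    fix p assume p: "p \<in> adj l"
    have "(\<Sum>j\<in>I. if fst p = j \<or> snd p = j then K p else 0) =
        (\<Sum>j\<in>I. (if fst p = j then K p else 0) + (if snd p = j then K p else 0))"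
      using adj_neq[OF assms(1) p] by (intro sum.cong[OF refl]) auto
    also have "\<dots> = 2 * K p"
      using adj_in_set(1,3)[OF p] assms(2,3) by (simp add: sum.distrib subsetD)
    finally show "(\<Sum>j\<in>I. if fst p = j \<or> snd p = j then K p else 0) = 2 * K p" .
  qed
  also have "\<dots> = 2 * sum K (adj l)"
    by (rule sum_distrib_left[symmetric])
  finally show ?thesis .
qed

text \<open>Deleting \<open>j\<close> exchanges the pairs \<open>(a, j)\<close> and
  \<open>(j, b)\<close> for \<open>(a, b)\<close>. The factor 2 pays once for the lost pairs and
  once, through the triangle inequality, for the new one.\<close>

lemma sum_adj_remove_le:
  fixes K \<delta> :: "'i \<times> 'i => real"
  assumes l: "distinct l" and c: "0 <= c"
    and K: "!!p. \<bar>K p\<bar> <= c * \<delta> p"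
    and tri: "!!a b. \<delta> (a, b) <= \<delta> (a, j) + \<delta> (j, b)"
  shows "\<bar>sum K (adj l) - sum K (adj (filter (%i. i ~= j) l))\<bar> <= 2 * c * sum \<delta> (adj_at j l)"
proof (cases "j \<in> set l")
  case True
  obtain u v where l': "l = u @ j # v" "filter (%i. i ~= j) l = u @ v"
    by (rule distinct_remove_split[OF l True])
  have d: "distinct (u @ j # v)" using l l' by simp
  have pos: "0 <= c * \<delta> p" for p using K[of p] by linarith
  have t: "c * \<delta> (a, b) <= c * \<delta> (a, j) + c * \<delta> (j, b)" for a b
    using mult_left_mono[OF tri[of a b] c] unfolding distrib_left .
  have eq: "2 * c * sum \<delta> (adj_at j l) = 2 * (\<Sum>p\<in>adj_at j l. c * \<delta> p)"
    by (simp only: sum_distrib_left[symmetric] mult.assoc)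
  show ?thesis
    unfolding l'(2) eq unfolding l'(1) sum_adj_remove_split[OF d] sum_adj_at_split[OF d]
    using K[of "(last u, j)"] K[of "(j, hd v)"] K[of "(last u, hd v)"] t[of "last u" "hd v"]
      pos[of "(last u, j)"] pos[of "(j, hd v)"]
    by (cases "u = []"; cases "v = []"; simp; linarith)
next
  case False
  then have "filter (%i. i ~= j) l = l" by (auto simp: filter_id_conv)
  moreover have "adj_at j l = {}" using False by (rule adj_at_empty)
  ultimately show ?thesis by simp
qed

text \<open>At most two pairs disappear and at most one appears, so for values in [0, 1] the sum
  drops by at most 2 and grows by at most 1.\<close>

lemma sum_adj_remove_le_2:
  fixes K :: "'i \<times> 'i => real"
  assumes l: "distinct l" and K: "!!p. 0 <= K p" "!!p. K p <= 1"
  shows "\<bar>sum K (adj l) - sum K (adj (filter (%i. i ~= j) l))\<bar> <= 2"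
proof (cases "j \<in> set l")
  case True
  obtain u v where l': "l = u @ j # v" "filter (%i. i ~= j) l = u @ v"
    by (rule distinct_remove_split[OF l True])
  have d: "distinct (u @ j # v)" using l l' by simp
  show ?thesis
    unfolding l'(2) unfolding l'(1) sum_adj_remove_split[OF d] sum_adj_at_split[OF d]
    using K(1)[of "(last u, j)"] K(1)[of "(j, hd v)"] K(1)[of "(last u, hd v)"]
      K(2)[of "(last u, j)"] K(2)[of "(j, hd v)"] K(2)[of "(last u, hd v)"]
    by (cases "u = []"; cases "v = []"; simp; linarith)
next
  case False
  then have "filter (%i. i ~= j) l = l" by (auto simp: filter_id_conv)
  then show ?thesis by simp
qed

section \<open>The indices sorted by position\<close>

text \<open>Makes sense for all data, ties included, and depends on finitely many comparisons, hence
  is measurable. Without ties it lists the values of the rank permutation, see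
  \<open>rank_perm_map\<close>.\<close>

definition ord_list :: "nat => (nat => real) => nat list" where
  "ord_list n x = sort_key x [1..<Suc n]"

lemma ord_list_simps [simp]:
  "distinct (ord_list n x)" "set (ord_list n x) = {1..n}" "length (ord_list n x) = n"
  "sorted (map x (ord_list n x))"
  by (auto simp: ord_list_def)

lemma ord_list_Nil_iff [simp]: "ord_list n x = [] \<longleftrightarrow> n = 0"
  by (metis length_0_conv ord_list_simps(3))

lemma insort_key_cong: "(!!i. i \<in> insert a (set l) ==> x i = y i) ==> insort_key x a l = insort_key y a l"
  by (induction l) auto

lemma sort_key_cong: "(!!i. i \<in> set l ==> x i = y i) ==> sort_key x l = sort_key y l"
proof (induction l)
  case (Cons a l)
  then have "sort_key x l = sort_key y l" by simp
  moreover have "insort_key x a (sort_key y l) = insort_key y a (sort_key y l)"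
    using Cons(2) by (intro insort_key_cong) auto
  ultimately show ?case by simp
qed auto

lemma ord_list_cong: "(!!i. i \<in> {1..n} ==> x i = y i) ==> ord_list n x = ord_list n y"
  unfolding ord_list_def by (rule sort_key_cong) auto

text \<open>Once \<open>j\<close> is deleted, the order no longer depends on \<open>x j\<close>.
  This supplies the leave-one-out statistics for the Efron-Stein inequality.\<close>

lemma filter_ord_list_upd:
  "filter (%i. i ~= j) (ord_list n (x(j := u))) = filter (%i. i ~= j) (ord_list n x)"
  unfolding ord_list_def filter_sort by (rule sort_key_cong) auto

lemma filter_ord_list_Suc:
  "filter (%i. i ~= Suc n) (ord_list (Suc n) x) = ord_list n x"
proof -
  have "filter (%i. i ~= Suc n) [1..<Suc (Suc n)] = [1..<Suc n]"
    by (auto simp: filter_id_conv)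
  then show ?thesis unfolding ord_list_def filter_sort by simp
qed

lemma measurable_insort_key:
  assumes "!!i. i \<in> insert a (set l) ==> (%\<omega>. x \<omega> i) \<in> borel_measurable M"
  shows "(%\<omega>. insort_key (x \<omega> :: nat => real) a l) \<in> measurable M (count_space UNIV)"
  using assms
proof (induction l)
  case (Cons b l)
  have [measurable]: "(%\<omega>. x \<omega> a) \<in> borel_measurable M" "(%\<omega>. x \<omega> b) \<in> borel_measurable M"
    using Cons by auto
  have [measurable]: "(%\<omega>. insort_key (x \<omega>) a l) \<in> measurable M (count_space UNIV)"
    using Cons by auto
  have [measurable]: "(#) b \<in> measurable (count_space UNIV) (count_space UNIV)"
    by simp
  show ?case
    unfolding insort_key.simps by measurable
qed auto

lemma measurable_sort_key:
  assumes "!!i. i \<in> set l ==> (%\<omega>. x \<omega> i) \<in> borel_measurable M"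
  shows "(%\<omega>. sort_key (x \<omega> :: nat => real) l) \<in> measurable M (count_space UNIV)"
  using assms
proof (induction l)
  case (Cons a l)
  \<comment> \<open>Restricting the range to lists over \<open>set l\<close> keeps only coordinates
    whose measurability is known; there are countably many such lists, so composition goes value by
    value.\<close>
  have g: "(%\<omega>. sort_key (x \<omega>) l) \<in> measurable M (count_space (lists (set l)))"
    by (rule measurable_count_space_extend[OF subset_UNIV])
      (use Cons in \<open>auto simp: in_lists_conv_set\<close>)
  have "(%\<omega>. insort_key (x \<omega>) a (sort_key (x \<omega>) l)) \<in> measurable M (count_space UNIV)"
    by (rule measurable_compose_countable'[where f="%l \<omega>. insort_key (x \<omega>) a l", OF _ g])
      (use Cons in \<open>auto intro!: measurable_insort_key simp: in_lists_conv_set\<close>)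
  then show ?case by simp
qed auto

lemma measurable_ord_list:
  assumes "!!i. i \<in> {1..n} ==> (%\<omega>. x \<omega> i) \<in> borel_measurable M"
  shows "(%\<omega>. ord_list n (x \<omega>)) \<in> measurable M (count_space UNIV)"
  unfolding ord_list_def using assms by (intro measurable_sort_key) auto

text \<open>The index set of the sum is random but takes countably many values, and for each of them
  the sum is a fixed finite sum of measurable functions.\<close>

lemma measurable_adj_sum:
  fixes K :: "'a => nat \<times> nat => real"
  assumes g: "g \<in> measurable M (count_space UNIV)"
    and "!!\<omega>. \<omega> \<in> space M ==> set (g \<omega>) \<subseteq> I"
    and K: "!!p. p \<in> I \<times> I ==> (%\<omega>. K \<omega> p) \<in> borel_measurable M"
  shows "(%\<omega>. \<Sum>p\<in>adj (g \<omega>). K \<omega> p) \<in> borel_measurable M"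
proof -
  have g: "g \<in> measurable M (count_space (lists I))"
    by (rule measurable_count_space_extend[OF subset_UNIV])
      (use assms in \<open>auto simp: in_lists_conv_set\<close>)
  show ?thesis
  proof (rule measurable_compose_countable'[where f="%l \<omega>. \<Sum>p\<in>adj l. K \<omega> p", OF _ g])
    fix l assume "l \<in> lists I"
    then have "p \<in> I \<times> I" if "p \<in> adj l" for p
      using adj_in_set[OF that] by (cases p) (auto simp: in_lists_conv_set)
    then show "(%\<omega>. \<Sum>p\<in>adj l. K \<omega> p) \<in> borel_measurable M"
      by (intro borel_measurable_sum K)
  qed auto
qed

section \<open>Products of characteristic functions\<close>

lemma exp_minus_bounds:
  fixes t :: real
  assumes "0 <= t"
  shows "\<bar>exp (-t) - (1 - t)\<bar> <= t\<^sup>2"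
proof -
  have 1: "1 - t <= exp (-t)" using exp_ge_add_one_self[of "-t"] by simp
  have "exp (-t) <= 1 / (1 + t)"
    using exp_ge_add_one_self[of t] assms
    by (simp add: exp_minus divide_simps)
  also have "\<dots> <= 1 - t + t\<^sup>2"
    using assms by (simp add: divide_simps) (simp add: algebra_simps power2_eq_square)
  finally show ?thesis using 1 by linarith
qed

lemma norm_one_plus_imaginary_le: "norm (1 + \<i> * complex_of_real z) <= exp (z\<^sup>2 / 2)"
proof -
  have "(norm (1 + \<i> * complex_of_real z))\<^sup>2 = 1 + z\<^sup>2"
    by (simp add: cmod_power2)
  also have "\<dots> <= exp (z\<^sup>2)" using exp_ge_add_one_self[of "z\<^sup>2"] by simp
  also have "\<dots> = (exp (z\<^sup>2 / 2))\<^sup>2" by (simp add: power2_eq_square exp_add[symmetric])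
  finally show ?thesis by (rule power2_le_imp_le) simp
qed

text \<open>Two intermediate points: the second order Taylor polynomial \<open>?a\<close>, and the
  product \<open>?b\<close> in which the real exponential is linearised. They differ by exactly
  \<open>\<i> * z^3 / 2\<close>, so all errors are cubic; 1/6 + 1/2 + 1/2 is rounded up to
  2.\<close>

lemma iexp_factorization:
  fixes z :: real
  assumes "\<bar>z\<bar> <= 1"
  shows "norm (iexp z - (1 + \<i> * z) * exp (-(z\<^sup>2 / 2))) <= 2 * \<bar>z\<bar> ^ 3"
proof -
  let ?a = "1 + \<i> * z - z\<^sup>2 / 2" and ?b = "(1 + \<i> * z) * (1 - z\<^sup>2 / 2)"
  have tri: "norm (a - d) <= norm (a - b) + norm (b - c) + norm (c - d)" for a b c d :: complex
    using norm_triangle_ineq[of "a - b" "b - d"] norm_triangle_ineq[of "b - c" "c - d"] by simp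
  have 1: "norm (iexp z - ?a) <= \<bar>z\<bar> ^ 3 / 6"
  proof -
    have "(\<Sum>k\<le>2. (\<i> * complex_of_real z) ^ k / fact k) = ?a"
    proof -
      have "{..2::nat} = {0, 1, 2}" by auto
      then show ?thesis by (simp add: power_mult_distrib)
    qed
    then show ?thesis using iexp_approx1[of z 2] by (simp add: numeral_3_eq_3 numeral_2_eq_2)
  qed
  have 2: "norm (?a - ?b) = \<bar>z\<bar> ^ 3 / 2"
  proof -
    have "?a - ?b = \<i> * complex_of_real (z ^ 3 / 2)"
      by (simp add: field_simps power3_eq_cube power2_eq_square)
    then show ?thesis by (simp only: norm_mult norm_ii norm_of_real) (simp add: power_abs)
  qed
  have 3: "norm (?b - (1 + \<i> * z) * exp (-(z\<^sup>2 / 2))) <= \<bar>z\<bar> ^ 3 / 2"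
  proof -
    have "?b - (1 + \<i> * z) * exp (-(z\<^sup>2 / 2)) =
        (1 + \<i> * z) * complex_of_real ((1 - z\<^sup>2 / 2) - exp (-(z\<^sup>2 / 2)))"
      by (simp add: algebra_simps exp_of_real[symmetric])
    then have "norm (?b - (1 + \<i> * z) * exp (-(z\<^sup>2 / 2))) =
        norm (1 + \<i> * z) * \<bar>(1 - z\<^sup>2 / 2) - exp (-(z\<^sup>2 / 2))\<bar>"
      by (simp only: norm_mult norm_of_real)
    also have "\<dots> <= 2 * (z\<^sup>2 / 2)\<^sup>2"
    proof (rule mult_mono)
      show "norm (1 + \<i> * complex_of_real z) <= 2"
        using assms by (intro order_trans[OF norm_triangle_ineq]) (simp add: norm_mult)
      show "\<bar>1 - z\<^sup>2 / 2 - exp (- (z\<^sup>2 / 2))\<bar> <= (z\<^sup>2 / 2)\<^sup>2"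
        using exp_minus_bounds[of "z\<^sup>2 / 2"] by (simp add: abs_minus_commute)
    qed auto
    also have "\<dots> = \<bar>z\<bar> ^ 3 * \<bar>z\<bar> / 2"
      by (simp add: power2_eq_square power3_eq_cube power_divide abs_mult_self_eq mult.assoc)
    also have "\<dots> <= \<bar>z\<bar> ^ 3 / 2"
      using mult_left_mono[OF assms, of "\<bar>z\<bar> ^ 3"] by simp
    finally show ?thesis .
  qed
  have "norm (iexp z - (1 + \<i> * z) * exp (-(z\<^sup>2 / 2))) <= norm (iexp z - ?a) + norm (?a - ?b)
      + norm (?b - (1 + \<i> * z) * exp (-(z\<^sup>2 / 2)))"
    by (rule tri)
  also have "\<dots> <= \<bar>z\<bar> ^ 3 / 6 + \<bar>z\<bar> ^ 3 / 2 + \<bar>z\<bar> ^ 3 / 2"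
    using 1 2 3 by linarith
  also have "\<dots> <= 2 * \<bar>z\<bar> ^ 3" by simp
  finally show ?thesis .
qed

lemma abs_exp_minus_diff_le:
  fixes x y :: real
  assumes "0 <= x" "0 <= y"
  shows "\<bar>exp (-x) - exp (-y)\<bar> <= \<bar>x - y\<bar>"
proof -
  have *: "exp (-a) - exp (-b) <= b - a" if "0 <= a" "a <= b" for a b :: real
  proof -
    have "exp (-a) - exp (-b) = exp (-a) * (1 - exp (-(b - a)))"
      by (simp add: algebra_simps exp_add[symmetric])
    also have "\<dots> <= 1 * (1 - exp (-(b - a)))"
      using that by (intro mult_right_mono) auto
    also have "\<dots> <= b - a" using exp_ge_add_one_self[of "a - b"] by (simp add: algebra_simps)
    finally show ?thesis .
  qed
  show ?thesis
    using *[of x y] *[of y x] assms by (cases "x <= y") (auto simp: abs_if)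
qed

text \<open>McLeish's argument for the martingale central limit theorem: factor
  \<open>exp(iz) \<approx> (1 + iz) exp(-z\<^sup>2/2)\<close>; the products of the first factors have mean one and
  are bounded, the products of the second ones are nearly constant.\<close>

lemma (in prob_space) char_bound_mcleish:
  fixes z :: "'j => 'a => real"
  assumes J: "finite J" and m: "!!j. j \<in> J ==> z j \<in> borel_measurable M"
    and b: "!!j x. j \<in> J ==> x \<in> space M ==> \<bar>z j x\<bar> <= b" "0 <= b" "b <= 1"
    and N: "!!x. x \<in> space M ==> real (card {j \<in> J. z j x ~= 0}) <= N"
    and v: "0 <= v"
    and one: "(\<integral>x. (\<Prod>j\<in>J. 1 + \<i> * complex_of_real (z j x)) \<partial>M) = 1"
  shows "norm ((\<integral>x. iexp (\<Sum>j\<in>J. z j x) \<partial>M) - complex_of_real (exp (-(v / 2)))) <=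
    2 * N * b ^ 3 + exp (N * b\<^sup>2 / 2) / 2 * (\<integral>x. \<bar>(\<Sum>j\<in>J. (z j x)\<^sup>2) - v\<bar> \<partial>M)"
proof -
  define T where "T x = (\<Prod>j\<in>J. 1 + \<i> * complex_of_real (z j x))" for x
  define V where "V x = (\<Sum>j\<in>J. (z j x)\<^sup>2)" for x
  \<comment> \<open>Only nonzero terms are counted. In the application \<open>J\<close> contains all
    conceivable pairs, while at most \<open>2 * n\<close> of them are active at a time.\<close>
  have powN: "(\<Sum>j\<in>J. \<bar>z j x\<bar> ^ Suc k) <= N * b ^ Suc k" if x: "x \<in> space M" for x k
  proof -
    have "(\<Sum>j\<in>J. \<bar>z j x\<bar> ^ Suc k) = (\<Sum>j\<in>{j \<in> J. z j x ~= 0}. \<bar>z j x\<bar> ^ Suc k)"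
      by (rule sum.mono_neutral_right) (use J in auto)
    also have "\<dots> <= of_nat (card {j \<in> J. z j x ~= 0}) * b ^ Suc k"
      by (rule sum_bounded_above) (use b(1)[OF _ x] in \<open>auto intro!: power_mono simp del: power_Suc\<close>)
    also have "\<dots> <= N * b ^ Suc k"
      by (rule mult_right_mono) (use N[OF x] b(2) in auto)
    finally show ?thesis .
  qed
  have [measurable]: "T \<in> borel_measurable M" "V \<in> borel_measurable M"
    using m unfolding T_def V_def by (auto intro!: borel_measurable_prod borel_measurable_sum)
  have [measurable]: "(%x. \<Sum>j\<in>J. z j x) \<in> borel_measurable M"
    using m by (auto intro!: borel_measurable_sum)
  have V0: "0 <= V x" for x unfolding V_def by (intro sum_nonneg) auto
  have VN: "V x <= N * b\<^sup>2" if "x \<in> space M" for x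
    using powN[OF that, of "Suc 0"] unfolding V_def by (simp add: power2_eq_square)
  have Tb: "norm (T x) <= exp (N * b\<^sup>2 / 2)" if "x \<in> space M" for x
  proof -
    have "norm (T x) <= (\<Prod>j\<in>J. exp ((z j x)\<^sup>2 / 2))"
      unfolding T_def prod_norm[symmetric] by (intro prod_mono) (auto simp: norm_one_plus_imaginary_le)
    also have "\<dots> = exp (V x / 2)"
      unfolding V_def by (simp add: exp_sum J sum_divide_distrib)
    also have "\<dots> <= exp (N * b\<^sup>2 / 2)" using VN[OF that] by simp
    finally show ?thesis .
  qed
  \<comment> \<open>\<open>norm_prod_diff\<close> asks for factors of norm at most one; the damping
    \<open>exp (-((z j x)\<^sup>2 / 2))\<close> compensates the growth of the factor with the
    imaginary part.\<close>
  have step1: "norm (iexp (\<Sum>j\<in>J. z j x) - T x * exp (-(V x / 2))) <= 2 * N * b ^ 3" if x: "x \<in> space M" for x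
  proof -
    have e1: "iexp (\<Sum>j\<in>J. z j x) = (\<Prod>j\<in>J. iexp (z j x))"
      by (simp add: exp_sum[OF J, symmetric] sum_distrib_left)
    have "complex_of_real (exp (-(V x / 2))) = of_real (\<Prod>j\<in>J. exp (-((z j x)\<^sup>2 / 2)))"
      unfolding V_def by (simp add: exp_sum[OF J, symmetric] sum_negf sum_divide_distrib)
    then have e2: "T x * exp (-(V x / 2)) = (\<Prod>j\<in>J. (1 + \<i> * z j x) * exp (-((z j x)\<^sup>2 / 2)))"
      unfolding T_def by (simp add: prod.distrib)
    have "norm (iexp (\<Sum>j\<in>J. z j x) - T x * exp (-(V x / 2))) <=
        (\<Sum>j\<in>J. norm (iexp (z j x) - (1 + \<i> * z j x) * exp (-((z j x)\<^sup>2 / 2))))"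
      unfolding e1 e2
    proof (rule norm_prod_diff)
      fix j
      have "norm (1 + \<i> * z j x) * exp (-((z j x)\<^sup>2 / 2)) <= exp ((z j x)\<^sup>2 / 2) * exp (-((z j x)\<^sup>2 / 2))"
        by (intro mult_right_mono norm_one_plus_imaginary_le) auto
      also have "\<dots> = 1" by (simp add: exp_add[symmetric])
      finally show "norm ((1 + \<i> * z j x) * exp (-((z j x)\<^sup>2 / 2))) <= 1"
        by (simp add: norm_mult)
    qed (simp add: norm_exp_i_times)
    also have "\<dots> <= (\<Sum>j\<in>J. 2 * \<bar>z j x\<bar> ^ 3)"
    proof (rule sum_mono)
      fix j assume j: "j \<in> J"
      show "norm (iexp (z j x) - (1 + \<i> * z j x) * exp (-((z j x)\<^sup>2 / 2))) <= 2 * \<bar>z j x\<bar> ^ 3"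
        by (rule iexp_factorization) (use b(1)[OF j x] b(3) in linarith)
    qed
    also have "\<dots> <= 2 * N * b ^ 3"
      using powN[OF x, of 2] by (simp add: sum_distrib_left[symmetric] eval_nat_numeral)
    finally show ?thesis .
  qed
  \<comment> \<open>Freezes the exponential at \<open>v\<close>. As \<open>T\<close> is bounded,
    only the mean absolute fluctuation of \<open>V\<close> around \<open>v\<close> is paid for;
    after that, assumption \<open>one\<close> evaluates the integral of \<open>T\<close>.\<close>
  have step2: "norm (T x * exp (-(V x / 2)) - T x * exp (-(v / 2))) <= exp (N * b\<^sup>2 / 2) / 2 * \<bar>V x - v\<bar>"
    if x: "x \<in> space M" for x
  proof -
    have "norm (T x * exp (-(V x / 2)) - T x * exp (-(v / 2))) = norm (T x) * \<bar>exp (-(V x / 2)) - exp (-(v / 2))\<bar>"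
      by (simp only: right_diff_distrib[symmetric] of_real_diff[symmetric] norm_mult norm_of_real)
    also have "\<dots> <= exp (N * b\<^sup>2 / 2) * \<bar>V x / 2 - v / 2\<bar>"
      using V0 v by (intro mult_mono Tb x abs_exp_minus_diff_le) auto
    finally show ?thesis by (simp add: diff_divide_distrib[symmetric])
  qed
  have i1: "integrable M (%x. iexp (\<Sum>j\<in>J. z j x))"
  proof (rule integrable_const_bound[of _ 1])
    show "(%x. iexp (\<Sum>j\<in>J. z j x)) \<in> borel_measurable M"
      by (rule measurable_compose[where g="%y. iexp y" and N=borel])
        (auto intro!: borel_measurable_continuous_onI continuous_intros)
  qed auto
  have iT: "integrable M T"
    by (rule integrable_const_bound[of _ "exp (N * b\<^sup>2 / 2)"]) (use Tb in auto)
  have iV: "integrable M (%x. \<bar>V x - v\<bar>)"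
  proof (rule integrable_const_bound[of _ "N * b\<^sup>2 + v"])
    show "AE x in M. norm \<bar>V x - v\<bar> <= N * b\<^sup>2 + v"
    proof (rule AE_I2)
      fix x assume "x \<in> space M"
      then show "norm \<bar>V x - v\<bar> <= N * b\<^sup>2 + v" using V0[of x] VN[of x] v by simp
    qed
  qed measurable
  have iT2: "integrable M (%x. T x * exp (-(v / 2)))" using iT by simp
  have "(\<integral>x. iexp (\<Sum>j\<in>J. z j x) \<partial>M) - exp (-(v / 2)) =
      (\<integral>x. iexp (\<Sum>j\<in>J. z j x) - T x * exp (-(v / 2)) \<partial>M)"
    using i1 iT2 iT one by (simp add: T_def[symmetric])
  also have "norm \<dots> <= (\<integral>x. norm (iexp (\<Sum>j\<in>J. z j x) - T x * exp (-(v / 2))) \<partial>M)"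
    by (rule integral_norm_bound)
  also have "\<dots> <= (\<integral>x. 2 * N * b ^ 3 + exp (N * b\<^sup>2 / 2) / 2 * \<bar>V x - v\<bar> \<partial>M)"
  proof (rule integral_mono)
    fix x assume x: "x \<in> space M"
    show "norm (iexp (\<Sum>j\<in>J. z j x) - T x * exp (-(v / 2))) <= 2 * N * b ^ 3 + exp (N * b\<^sup>2 / 2) / 2 * \<bar>V x - v\<bar>"
      using norm_triangle_ineq[of "iexp (\<Sum>j\<in>J. z j x) - T x * exp (-(V x / 2))"
          "T x * exp (-(V x / 2)) - T x * exp (-(v / 2))"] step1[OF x] step2[OF x] by simp
  qed (use i1 iT2 iV in auto)
  also have "\<dots> = 2 * N * b ^ 3 + exp (N * b\<^sup>2 / 2) / 2 * (\<integral>x. \<bar>V x - v\<bar> \<partial>M)"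
    using iV by (simp add: prob_space)
  finally show ?thesis unfolding V_def .
qed

section \<open>The Efron-Stein inequality\<close>

lemma (in prob_space) integrable_bounded:
  fixes F :: "'a => 'b::{banach,second_countable_topology}"
  assumes "F \<in> borel_measurable M" "!!x. x \<in> space M ==> norm (F x) <= B"
  shows "integrable M F"
  by (rule integrable_const_bound[of _ B]) (use assms in auto)

text \<open>No measurability is assumed: a non-integrable function has integral 0, which obeys the
  bound as well.\<close>

lemma (in prob_space) integral_bounded:
  fixes F :: "'a => 'b::{banach,second_countable_topology}"
  assumes "!!x. x \<in> space M ==> norm (F x) <= B" "0 <= B"
  shows "norm (\<integral>x. F x \<partial>M) <= B"
proof (cases "integrable M F")
  case True
  have "norm (\<integral>x. F x \<partial>M) <= (\<integral>x. norm (F x) \<partial>M)"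
    by (rule integral_norm_bound)
  also have "\<dots> <= (\<integral>x. B \<partial>M)"
    using True assms by (intro integral_mono) auto
  finally show ?thesis by (simp add: prob_space)
qed (use assms in \<open>simp add: not_integrable_integral_eq\<close>)

lemma (in prob_space) abs_integral_bounded:
  fixes F :: "'a => real"
  assumes "!!x. x \<in> space M ==> \<bar>F x\<bar> <= B" "0 <= B"
  shows "\<bar>\<integral>x. F x \<partial>M\<bar> <= B"
  using integral_bounded[of F B] assms by simp

lemma (in prob_space) square_integral_le:
  fixes F :: "'a => real"
  assumes F: "F \<in> borel_measurable M" "!!x. x \<in> space M ==> \<bar>F x\<bar> <= B"
  shows "(\<integral>x. F x \<partial>M)\<^sup>2 <= (\<integral>x. (F x)\<^sup>2 \<partial>M)"
proof -
  have i: "integrable M F" by (rule integrable_bounded[of _ B]) (use assms in auto)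
  have i2: "integrable M (%x. (F x)\<^sup>2)"
    by (rule integrable_bounded[of _ "B\<^sup>2"]) (use assms in \<open>auto simp: abs_le_square_iff[symmetric] intro: order_trans[OF _ abs_ge_self]\<close>)
  have "0 <= variance F" by (rule variance_positive)
  then show ?thesis using variance_eq[OF i i2] by simp
qed

lemma (in prob_space) abs_integral_le_sqrt:
  fixes F :: "'a => real"
  assumes F: "F \<in> borel_measurable M" "!!x. x \<in> space M ==> \<bar>F x\<bar> <= B"
    and c: "(\<integral>x. (F x)\<^sup>2 \<partial>M) <= c"
  shows "(\<integral>x. \<bar>F x\<bar> \<partial>M) <= sqrt c"
proof -
  have "(\<integral>x. \<bar>F x\<bar> \<partial>M)\<^sup>2 <= (\<integral>x. \<bar>F x\<bar>\<^sup>2 \<partial>M)"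
    by (rule square_integral_le[of _ B]) (use F in auto)
  also have "\<dots> <= c" using c by simp
  finally show ?thesis by (rule real_le_rsqrt)
qed

lemma abs_square_le: "\<bar>a\<bar> <= b ==> a\<^sup>2 <= b\<^sup>2" for a b :: real
  by (metis abs_le_square_iff abs_of_nonneg abs_ge_zero order_trans)

section \<open>Integrating out single coordinates of a product measure\<close>

context
  fixes M :: "'i => 'a measure"
  assumes M: "!!i. prob_space (M i)"
begin

lemma prob_PiM: "prob_space (PiM I M)"
  by (rule prob_space_PiM) (rule M)

lemma product_sigma_finite: "product_sigma_finite M"
  by (simp add: product_sigma_finite_def M prob_space_imp_sigma_finite)

lemma measurable_upd_pair:
  "i \<in> I ==> (%(x, u). x(i := u)) \<in> measurable (PiM I M \<Otimes>\<^sub>M M i) (PiM I M)"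
  using measurable_add_dim[of i I M] by (simp add: insert_absorb)

lemma upd_in_space: "i \<in> I ==> x \<in> space (PiM I M) ==> u \<in> space (M i) ==> x(i := u) \<in> space (PiM I M)"
  by (auto simp: space_PiM PiE_def extensional_def)

lemma upd_in_space_insert:
  "x \<in> space (PiM I M) ==> u \<in> space (M i) ==> x(i := u) \<in> space (PiM (insert i I) M)"
  by (auto simp: space_PiM PiE_def extensional_def)

lemma integral_PiM_insert:
  fixes F :: "_ => 'b::{banach,second_countable_topology}"
  assumes "finite J" "i \<notin> J" "F \<in> borel_measurable (PiM (insert i J) M)"
    and "!!x. x \<in> space (PiM (insert i J) M) ==> norm (F x) <= B"
  shows "(\<integral>x. F x \<partial>PiM (insert i J) M) = (\<integral>x. \<integral>u. F (x(i := u)) \<partial>M i \<partial>PiM J M)"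
    and "(\<integral>x. F x \<partial>PiM (insert i J) M) = (\<integral>u. \<integral>x. F (x(i := u)) \<partial>PiM J M \<partial>M i)"
proof -
  interpret product_sigma_finite M by (rule product_sigma_finite)
  interpret P: prob_space "PiM (insert i J) M" by (rule prob_PiM)
  interpret Q: prob_space "PiM J M" by (rule prob_PiM)
  interpret Mi: prob_space "M i" by (rule M)
  interpret pp: pair_prob_space "PiM J M" "M i" ..
  have *: "integrable (PiM (insert i J) M) F"
    by (rule P.integrable_bounded[of _ B]) (use assms in auto)
  show 1: "(\<integral>x. F x \<partial>PiM (insert i J) M) = (\<integral>x. \<integral>u. F (x(i := u)) \<partial>M i \<partial>PiM J M)"
    by (rule product_integral_insert) (use assms * in auto)
  have m: "(%(x, u). F (x(i := u))) \<in> borel_measurable (PiM J M \<Otimes>\<^sub>M M i)"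
    using measurable_compose[OF measurable_add_dim assms(3)] by (simp add: case_prod_beta')
  have "integrable (PiM J M \<Otimes>\<^sub>M M i) (%(x, u). F (x(i := u)))"
    by (rule pp.P.integrable_bounded[of _ B])
      (use m assms(4) in \<open>auto simp: space_pair_measure upd_in_space_insert\<close>)
  from pp.Fubini_integral[OF this] 1
  show "(\<integral>x. F x \<partial>PiM (insert i J) M) = (\<integral>u. \<integral>x. F (x(i := u)) \<partial>PiM J M \<partial>M i)"
    by simp
qed

lemma measurable_resample:
  fixes F :: "_ => 'b::{banach,second_countable_topology}"
  assumes "i \<in> I" "F \<in> borel_measurable (PiM I M)"
  shows "(%x. \<integral>u. F (x(i := u)) \<partial>M i) \<in> borel_measurable (PiM I M)"
proof -
  interpret Mi: prob_space "M i" by (rule M)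
  have "(%(x, u). F (x(i := u))) \<in> borel_measurable (PiM I M \<Otimes>\<^sub>M M i)"
    using measurable_compose[OF measurable_upd_pair assms(2)] assms(1) by (simp add: case_prod_beta')
  then show ?thesis by (rule Mi.borel_measurable_lebesgue_integral)
qed

text \<open>Tower property for one coordinate. A second update at \<open>i\<close> overwrites the
  first, so the resampled function is constant in the coordinate that is split off.\<close>

lemma integral_resample:
  fixes F :: "_ => 'b::{banach,second_countable_topology}"
  assumes I: "finite I" "i \<in> I" and F: "F \<in> borel_measurable (PiM I M)"
    and B: "!!x. x \<in> space (PiM I M) ==> norm (F x) <= B"
  shows "(\<integral>x. F x \<partial>PiM I M) = (\<integral>x. \<integral>u. F (x(i := u)) \<partial>M i \<partial>PiM I M)"
proof -
  interpret P: prob_space "PiM I M" by (rule prob_PiM)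
  interpret Mi: prob_space "M i" by (rule M)
  define J where "J = I - {i}"
  have J: "finite J" "i \<notin> J" "I = insert i J" using I by (auto simp: J_def)
  have B0: "0 <= B" using B P.not_empty norm_ge_zero order_trans by blast
  have nG: "norm (\<integral>u. F (x(i := u)) \<partial>M i) <= B" if "x \<in> space (PiM I M)" for x
    by (rule Mi.integral_bounded) (use that B0 in \<open>auto intro!: B upd_in_space I\<close>)
  have "(\<integral>x. \<integral>u. F (x(i := u)) \<partial>M i \<partial>PiM I M) =
      (\<integral>x. \<integral>v. \<integral>u. F ((x(i := v))(i := u)) \<partial>M i \<partial>M i \<partial>PiM J M)"
    unfolding J(3) by (rule integral_PiM_insert(1)[of J i _ B])
      (use J nG measurable_resample[OF I(2) F] in auto)
  also have "\<dots> = (\<integral>x. \<integral>u. F (x(i := u)) \<partial>M i \<partial>PiM J M)"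
    by (simp add: Mi.prob_space)
  also have "\<dots> = (\<integral>x. F x \<partial>PiM I M)"
    unfolding J(3) by (rule integral_PiM_insert(1)[of J i _ B, symmetric]) (use J F B in auto)
  finally show ?thesis by simp
qed

lemma integral_PiM_component:
  fixes g :: "_ => 'b::{banach,second_countable_topology}"
  assumes I: "finite I" "i \<in> I" and g: "g \<in> borel_measurable (M i)"
  shows "(\<integral>x. g (x i) \<partial>PiM I M) = (\<integral>u. g u \<partial>M i)"
proof -
  have "(\<integral>x. g (x i) \<partial>PiM I M) = (\<integral>u. g u \<partial>distr (PiM I M) (M i) (%x. x i))"
    by (rule integral_distr[symmetric]) (use I g in simp_all)
  also have "distr (PiM I M) (M i) (%x. x i) = M i"
    by (rule distr_PiM_component) (use I M in auto)
  finally show ?thesis .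
qed

lemma integral_PiM_pair:
  fixes g :: "'a => 'a => 'b::{banach,second_countable_topology}"
  assumes I: "finite I" "i \<in> I" "j \<in> I" "i ~= j"
    and g: "(%(u, v). g u v) \<in> borel_measurable (M i \<Otimes>\<^sub>M M j)"
    and B: "!!u v. u \<in> space (M i) ==> v \<in> space (M j) ==> norm (g u v) <= B"
  shows "(\<integral>x. g (x i) (x j) \<partial>PiM I M) = (\<integral>u. \<integral>v. g u v \<partial>M j \<partial>M i)"
proof -
  interpret Mj: prob_space "M j" by (rule M)
  have sp: "x \<in> space (PiM I M) ==> k \<in> I ==> x k \<in> space (M k)" for x k
    by (auto simp: space_PiM)
  have "(%x. (x i, x j)) \<in> measurable (PiM I M) (M i \<Otimes>\<^sub>M M j)"
    using I by (intro measurable_Pair measurable_component_singleton)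
  from measurable_compose[OF this g]
  have "(\<integral>x. g (x i) (x j) \<partial>PiM I M) = (\<integral>x. \<integral>v. g ((x(j := v)) i) ((x(j := v)) j) \<partial>M j \<partial>PiM I M)"
    by (intro integral_resample[of _ _ _ B]) (use I B sp in auto)
  also have "\<dots> = (\<integral>x. \<integral>v. g (x i) v \<partial>M j \<partial>PiM I M)" using I by simp
  also have "\<dots> = (\<integral>u. \<integral>v. g u v \<partial>M j \<partial>M i)"
    by (rule integral_PiM_component) (use I Mj.borel_measurable_lebesgue_integral[OF g] in auto)
  finally show ?thesis .
qed

text \<open>The Efron--Stein inequality: splitting off one coordinate, the variance is the mean of the
  conditional variance plus the variance of the conditional mean, and Jensen's inequality moves
  the latter inside the integral.\<close>

lemma efron_stein:
  fixes Z :: "('i => 'a) => real" and W :: "'i => ('i => 'a) => real"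
  assumes "finite I"
    and "Z \<in> borel_measurable (PiM I M)" "!!x. x \<in> space (PiM I M) ==> \<bar>Z x\<bar> <= B"
    and "!!i. i \<in> I ==> W i \<in> borel_measurable (PiM I M)"
    and "!!i x. i \<in> I ==> x \<in> space (PiM I M) ==> \<bar>W i x\<bar> <= B"
    and "!!i x u. i \<in> I ==> x \<in> space (PiM I M) ==> u \<in> space (M i) ==> W i (x(i := u)) = W i x"
  shows "(\<integral>x. (Z x)\<^sup>2 \<partial>PiM I M) - (\<integral>x. Z x \<partial>PiM I M)\<^sup>2 <= (\<Sum>i\<in>I. \<integral>x. (Z x - W i x)\<^sup>2 \<partial>PiM I M)"
  using assms
proof (induction I arbitrary: Z W rule: finite_induct)
  case empty
  have "prob_space (PiM {} M)" by (rule prob_space_PiM) simp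
  then show ?case
    by (simp add: PiM_empty lebesgue_integral_count_space_finite)
next
  case (insert j J)
  interpret P: prob_space "PiM (insert j J) M" by (rule prob_PiM)
  interpret Q: prob_space "PiM J M" by (rule prob_PiM)
  interpret Mj: prob_space "M j" by (rule M)
  interpret pp: pair_prob_space "PiM J M" "M j" ..
  let ?P = "PiM (insert j J) M" and ?Q = "PiM J M"
  note Zm [measurable] = insert.prems(1) and Zb = insert.prems(2)
  note Wm = insert.prems(3) and Wb = insert.prems(4) and Wi = insert.prems(5)
  note sp = upd_in_space_insert[of _ J _ j]
  have B0: "0 <= B" using Zb P.not_empty abs_ge_zero order_trans by blast
  have swap: "(\<integral>x. F x \<partial>?P) = (\<integral>u. \<integral>x. F (x(j := u)) \<partial>?Q \<partial>M j)"
    and intu: "integrable (M j) (%u. \<integral>x. F (x(j := u)) \<partial>?Q)"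
    and intx: "u \<in> space (M j) ==> integrable ?Q (%x. F (x(j := u)))"
    and measx: "u \<in> space (M j) ==> (%x. F (x(j := u))) \<in> borel_measurable ?Q"
    if F: "F \<in> borel_measurable ?P" "!!x. x \<in> space ?P ==> \<bar>F x\<bar> <= C"
    for F :: "('i => 'a) => real" and C u
  proof -
    have C0: "0 <= C" using F(2) P.not_empty abs_ge_zero order_trans by blast
    have m: "(%(u, x). F (x(j := u))) \<in> borel_measurable (M j \<Otimes>\<^sub>M ?Q)"
      using measurable_compose[OF measurable_pair_swap' measurable_compose[OF measurable_add_dim F(1)]]
      by (simp add: case_prod_beta')
    show "(\<integral>x. F x \<partial>?P) = (\<integral>u. \<integral>x. F (x(j := u)) \<partial>?Q \<partial>M j)"
      by (rule integral_PiM_insert(2)[of _ _ _ C]) (use insert(1,2) F in auto)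
    show "integrable (M j) (%u. \<integral>x. F (x(j := u)) \<partial>?Q)"
      by (rule Mj.integrable_bounded[of _ C])
        (use Q.borel_measurable_lebesgue_integral[OF m] C0 in
          \<open>auto intro!: Q.abs_integral_bounded F sp\<close>)
    show mm: "(%x. F (x(j := u))) \<in> borel_measurable ?Q" if u: "u \<in> space (M j)" for u
      using measurable_compose[OF measurable_Pair1'[OF u] m] by simp
    show "integrable ?Q (%x. F (x(j := u)))" if u: "u \<in> space (M j)" for u
      by (rule Q.integrable_bounded[of _ C]) (use mm[OF u] u in \<open>auto intro!: F sp\<close>)
  qed
  have sqZ: "\<bar>(Z x)\<^sup>2\<bar> <= B\<^sup>2" if "x \<in> space ?P" for x
    using abs_square_le[OF Zb[OF that]] by simp
  have sqD: "\<bar>(Z x - W i x)\<^sup>2\<bar> <= (2 * B)\<^sup>2" if "x \<in> space ?P" "i \<in> insert j J" for x i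
    using abs_square_le[of "Z x - W i x" "2 * B"] Zb[OF that(1)] Wb[OF that(2,1)] by simp
  have Dm: "(%x. (Z x - W i x)\<^sup>2) \<in> borel_measurable ?P" if "i \<in> insert j J" for i
    using Wm[OF that] by measurable
  have Z2m: "(%x. (Z x)\<^sup>2) \<in> borel_measurable ?P" by measurable
  \<comment> \<open>\<open>z\<close> is the conditional mean of \<open>Z\<close> given coordinate
    \<open>j\<close>; on each section the induction hypothesis bounds the conditional variance
    around it.\<close>
  define z where "z u = (\<integral>x. Z (x(j := u)) \<partial>?Q)" for u
  have zi: "integrable (M j) z" unfolding z_def by (rule intu[OF Zm Zb])
  have zb: "\<bar>z u\<bar> <= B" if "u \<in> space (M j)" for u
    unfolding z_def by (rule Q.abs_integral_bounded)
      (use that B0 in \<open>auto intro!: Zb sp\<close>)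
  have z2i: "integrable (M j) (%u. (z u)\<^sup>2)"
    by (rule Mj.integrable_bounded[of _ "B\<^sup>2"]) (use zi zb in \<open>auto intro: abs_square_le\<close>)
  have IH: "(\<integral>x. (Z (x(j := u)))\<^sup>2 \<partial>?Q) - (z u)\<^sup>2 <= (\<Sum>i\<in>J. \<integral>x. (Z (x(j := u)) - W i (x(j := u)))\<^sup>2 \<partial>?Q)"
    if u: "u \<in> space (M j)" for u
    unfolding z_def
  proof (rule insert.IH)
    fix i x v assume i: "i \<in> J" and x: "x \<in> space ?Q" and v: "v \<in> space (M i)"
    have "x(i := v, j := u) = (x(j := u))(i := v)"
      using i insert(2) by (auto simp: fun_upd_twist)
    then show "W i (x(i := v, j := u)) = W i (x(j := u))"
      by (simp only:) (rule Wi[OF insertI2[OF i] sp[OF x u] v])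
  next
    show "(%x. Z (x(j := u))) \<in> borel_measurable ?Q"
      by (rule measx[OF Zm Zb u])
    show "(%x. W i (x(j := u))) \<in> borel_measurable ?Q" if "i \<in> J" for i
      by (rule measx[OF Wm Wb u]) (use that in auto)
    show "\<bar>Z (x(j := u))\<bar> <= B" if "x \<in> space ?Q" for x
      by (rule Zb[OF sp[OF that u]])
    show "\<bar>W i (x(j := u))\<bar> <= B" if "i \<in> J" "x \<in> space ?Q" for i x
      by (rule Wb[OF insertI2[OF that(1)] sp[OF that(2) u]])
  qed
  have "(\<integral>x. (Z x)\<^sup>2 \<partial>?P) - (\<integral>u. (z u)\<^sup>2 \<partial>M j) = (\<integral>u. (\<integral>x. (Z (x(j := u)))\<^sup>2 \<partial>?Q) - (z u)\<^sup>2 \<partial>M j)"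
    using swap[OF Z2m sqZ] intu[OF Z2m sqZ] z2i by simp
  also have "\<dots> <= (\<integral>u. (\<Sum>i\<in>J. \<integral>x. (Z (x(j := u)) - W i (x(j := u)))\<^sup>2 \<partial>?Q) \<partial>M j)"
    by (rule integral_mono) (use intu[OF Z2m sqZ] z2i IH intu[OF Dm sqD] in auto)
  also have "\<dots> = (\<Sum>i\<in>J. \<integral>u. \<integral>x. (Z (x(j := u)) - W i (x(j := u)))\<^sup>2 \<partial>?Q \<partial>M j)"
    by (rule Bochner_Integration.integral_sum) (use intu[OF Dm sqD] in auto)
  also have "\<dots> = (\<Sum>i\<in>J. \<integral>x. (Z x - W i x)\<^sup>2 \<partial>?P)"
    by (rule sum.cong[OF refl], rule swap[OF Dm sqD, symmetric]) auto
  finally have 1: "(\<integral>x. (Z x)\<^sup>2 \<partial>?P) - (\<integral>u. (z u)\<^sup>2 \<partial>M j) <= (\<Sum>i\<in>J. \<integral>x. (Z x - W i x)\<^sup>2 \<partial>?P)" .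
  \<comment> \<open>\<open>W j\<close> is invariant under changes of coordinate \<open>j\<close>, so
    an arbitrary value \<open>u0\<close> may be inserted; \<open>c\<close> is the mean of
    \<open>W j\<close> on every section.\<close>
  obtain u0 where u0: "u0 \<in> space (M j)" using Mj.not_empty by blast
  define c where "c = (\<integral>x. W j (x(j := u0)) \<partial>?Q)"
  have Wj: "W j (x(j := u)) = W j (x(j := u0))" if "x \<in> space ?Q" "u \<in> space (M j)" for x u
    using Wi[OF insertI1 sp[OF that(1) u0] that(2)] unfolding fun_upd_upd .
  have jm: "W j \<in> borel_measurable ?P" "!!x. x \<in> space ?P ==> \<bar>W j x\<bar> <= B"
    using Wm[of j] Wb[of j] by auto
  have zc: "(z u - c)\<^sup>2 <= (\<integral>x. (Z (x(j := u)) - W j (x(j := u)))\<^sup>2 \<partial>?Q)" if u: "u \<in> space (M j)" for u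
  proof -
    have c: "c = (\<integral>x. W j (x(j := u)) \<partial>?Q)"
      unfolding c_def by (rule Bochner_Integration.integral_cong) (use Wj u in auto)
    have "z u - c = (\<integral>x. Z (x(j := u)) - W j (x(j := u)) \<partial>?Q)"
      unfolding z_def c
      by (rule Bochner_Integration.integral_diff[OF intx[OF Zm Zb u] intx[OF jm u], symmetric])
    also have "\<dots>\<^sup>2 <= (\<integral>x. (Z (x(j := u)) - W j (x(j := u)))\<^sup>2 \<partial>?Q)"
    proof (rule Q.square_integral_le[of _ "2 * B"])
      show "(%x. Z (x(j := u)) - W j (x(j := u))) \<in> borel_measurable ?Q"
        using measx[OF Zm Zb u] measx[OF jm u] by measurable
      show "\<bar>Z (x(j := u)) - W j (x(j := u))\<bar> <= 2 * B" if "x \<in> space ?Q" for x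
        using Zb[OF sp[OF that u]] jm(2)[OF sp[OF that u]] by linarith
    qed
    finally show ?thesis .
  qed
  have zci: "integrable (M j) (%u. (z u - c)\<^sup>2)"
    using zi z2i by (simp add: power2_diff)
  \<comment> \<open>The variance is the smallest mean square distance to a constant, hence at most
    the distance to \<open>c\<close>.\<close>
  have "(\<integral>u. (z u)\<^sup>2 \<partial>M j) - (\<integral>u. z u \<partial>M j)\<^sup>2 = Mj.variance z"
    using Mj.variance_eq[OF zi z2i] by simp
  also have "\<dots> = (\<integral>u. (z u - c)\<^sup>2 \<partial>M j) - ((\<integral>u. z u \<partial>M j) - c)\<^sup>2"
    unfolding Mj.variance_eq[OF zi z2i] using zi z2i
    by (simp add: power2_diff Mj.prob_space algebra_simps)
  also have "\<dots> <= (\<integral>u. (z u - c)\<^sup>2 \<partial>M j)" by simp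
  also have "\<dots> <= (\<integral>u. \<integral>x. (Z (x(j := u)) - W j (x(j := u)))\<^sup>2 \<partial>?Q \<partial>M j)"
    by (rule integral_mono) (use zci zc intu[OF Dm sqD] in auto)
  also have "\<dots> = (\<integral>x. (Z x - W j x)\<^sup>2 \<partial>?P)"
    by (rule swap[OF Dm sqD, symmetric]) auto
  finally have 2: "(\<integral>u. (z u)\<^sup>2 \<partial>M j) - (\<integral>u. z u \<partial>M j)\<^sup>2 <= (\<integral>x. (Z x - W j x)\<^sup>2 \<partial>?P)" .
  have "(\<integral>x. Z x \<partial>?P) = (\<integral>u. z u \<partial>M j)"
    unfolding z_def by (rule swap[OF Zm Zb])
  then show ?case using 1 2 insert(1,2) by simp
qed

text \<open>Each \<open>r p\<close> sees only the two coordinates of \<open>p\<close>. Resampling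
  one coordinate touches at most two terms, which costs a factor 2 in the square; every pair is
  counted from both its ends, which gives another 2.\<close>

lemma efron_stein_adj:
  fixes r :: "'i \<times> 'i => ('i => 'a) => real"
  assumes I: "finite I" "distinct l" "set l \<subseteq> I"
    and m: "!!p. p \<in> adj l ==> r p \<in> borel_measurable (PiM I M)"
    and b: "!!p x. p \<in> adj l ==> x \<in> space (PiM I M) ==> \<bar>r p x\<bar> <= B"
    and inv: "!!p x j u. p \<in> adj l ==> j ~= fst p ==> j ~= snd p ==> x \<in> space (PiM I M) ==>
      u \<in> space (M j) ==> r p (x(j := u)) = r p x"
  shows "(\<integral>x. (\<Sum>p\<in>adj l. r p x)\<^sup>2 \<partial>PiM I M) - (\<integral>x. (\<Sum>p\<in>adj l. r p x) \<partial>PiM I M)\<^sup>2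
    <= 4 * (\<Sum>p\<in>adj l. \<integral>x. (r p x)\<^sup>2 \<partial>PiM I M)"
proof -
  interpret P: prob_space "PiM I M" by (rule prob_PiM)
  let ?P = "PiM I M"
  define W where "W j x = (\<Sum>p\<in>adj l - adj_at j l. r p x)" for j x
  obtain x0 where x0: "x0 \<in> space ?P" using P.not_empty ex_in_conv by metis
  have B0: "adj l ~= {} ==> 0 <= B" using b[OF _ x0] abs_ge_zero order_trans by blast
  have bs: "\<bar>\<Sum>p\<in>A. r p x\<bar> <= card (adj l) * B" if "x \<in> space ?P" "A \<subseteq> adj l" for A x
  proof (cases "adj l = {}")
    case False
    have "\<bar>\<Sum>p\<in>A. r p x\<bar> <= (\<Sum>p\<in>A. \<bar>r p x\<bar>)"
      by (rule sum_abs)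
    also have "\<dots> <= of_nat (card A) * B"
      by (rule sum_bounded_above) (use that b in blast)
    also have "\<dots> <= card (adj l) * B"
      using B0[OF False] that by (auto intro!: mult_right_mono card_mono)
    finally show ?thesis .
  qed (use that in auto)
  have sqi: "integrable ?P (%x. (r p x)\<^sup>2)" if "p \<in> adj l" for p
    by (rule P.integrable_bounded[of _ "B\<^sup>2"])
      (use m[OF that] b[OF that] in \<open>auto intro!: abs_square_le borel_measurable_power\<close>)
  have "(\<integral>x. (\<Sum>p\<in>adj l. r p x)\<^sup>2 \<partial>?P) - (\<integral>x. (\<Sum>p\<in>adj l. r p x) \<partial>?P)\<^sup>2
      <= (\<Sum>j\<in>I. \<integral>x. ((\<Sum>p\<in>adj l. r p x) - W j x)\<^sup>2 \<partial>?P)"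
  proof (rule efron_stein[of _ _ "card (adj l) * B"])
    show "W j (x(j := u)) = W j x" if "j \<in> I" "x \<in> space ?P" "u \<in> space (M j)" for j x u
      unfolding W_def by (rule sum.cong[OF refl], rule inv) (use that in \<open>auto simp: adj_at_def\<close>)
  qed (use I bs m in \<open>auto simp: W_def\<close>)
  also have "\<dots> <= (\<Sum>j\<in>I. \<Sum>p\<in>adj_at j l. 2 * (\<integral>x. (r p x)\<^sup>2 \<partial>?P))"
  proof (rule sum_mono)
    fix j assume "j \<in> I"
    have sub: "adj_at j l \<subseteq> adj l" by (auto simp: adj_at_def)
    have eq: "(\<Sum>p\<in>adj l. r p x) - W j x = (\<Sum>p\<in>adj_at j l. r p x)" for x
      unfolding W_def using sum_diff[OF finite_adj sub, of "%p. r p x"] by simp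
    have le: "(\<Sum>p\<in>adj_at j l. r p x)\<^sup>2 <= (\<Sum>p\<in>adj_at j l. 2 * (r p x)\<^sup>2)" for x
    proof -
      have "(\<Sum>p\<in>adj_at j l. r p x)\<^sup>2 <= card (adj_at j l) * (\<Sum>p\<in>adj_at j l. (r p x)\<^sup>2)"
        using sum_squared_le_sum_of_squares[of "%p. r p x" "adj_at j l"] by (simp add: mult.commute)
      also have "\<dots> <= 2 * (\<Sum>p\<in>adj_at j l. (r p x)\<^sup>2)"
        using card_adj_at[OF I(2), of j] by (intro mult_right_mono sum_nonneg) auto
      finally show ?thesis by (simp add: sum_distrib_left)
    qed
    have "(\<integral>x. ((\<Sum>p\<in>adj l. r p x) - W j x)\<^sup>2 \<partial>?P) <= (\<integral>x. (\<Sum>p\<in>adj_at j l. 2 * (r p x)\<^sup>2) \<partial>?P)"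
      unfolding eq
    proof (rule integral_mono)
      show "integrable ?P (%x. (\<Sum>p\<in>adj_at j l. r p x)\<^sup>2)"
      proof (rule P.integrable_bounded[of _ "(card (adj l) * B)\<^sup>2"])
        show "(%x. (\<Sum>p\<in>adj_at j l. r p x)\<^sup>2) \<in> borel_measurable ?P"
          using m sub by (intro borel_measurable_power borel_measurable_sum) auto
        show "norm ((\<Sum>p\<in>adj_at j l. r p x)\<^sup>2) <= (card (adj l) * B)\<^sup>2" if "x \<in> space ?P" for x
          using abs_square_le[OF bs[OF that sub]] by simp
      qed
      show "integrable ?P (%x. \<Sum>p\<in>adj_at j l. 2 * (r p x)\<^sup>2)"
        using sqi sub by (intro Bochner_Integration.integrable_sum integrable_mult_right) auto
    qed (rule le)
    also have "\<dots> = (\<Sum>p\<in>adj_at j l. 2 * (\<integral>x. (r p x)\<^sup>2 \<partial>?P))"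
      using sqi sub by (subst Bochner_Integration.integral_sum) auto
    finally show "(\<integral>x. ((\<Sum>p\<in>adj l. r p x) - W j x)\<^sup>2 \<partial>?P) <= (\<Sum>p\<in>adj_at j l. 2 * (\<integral>x. (r p x)\<^sup>2 \<partial>?P))" .
  qed
  also have "\<dots> = 2 * (\<Sum>p\<in>adj l. 2 * (\<integral>x. (r p x)\<^sup>2 \<partial>?P))"
    by (rule sum_sum_adj_at) (use I in auto)
  also have "\<dots> = 4 * (\<Sum>p\<in>adj l. \<integral>x. (r p x)\<^sup>2 \<partial>?P)"
    by (simp add: sum_distrib_left)
  finally show ?thesis .
qed

text \<open>The martingale property without conditional expectations. The last index of the list
  occurs only in the last pair, so integrating out its coordinate replaces that factor by its mean,
  which is one. Hence the induction from the end.\<close>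

lemma integral_adj_prod:
  fixes h :: "'i \<times> 'i => ('i => 'a) => real"
  assumes I: "finite I" "distinct l" "set l \<subseteq> I"
    and m: "!!p. p \<in> adj l ==> h p \<in> borel_measurable (PiM I M)"
    and b: "!!p x. p \<in> adj l ==> x \<in> space (PiM I M) ==> \<bar>h p x\<bar> <= B"
    and inv: "!!p x j u. p \<in> adj l ==> j ~= fst p ==> j ~= snd p ==> x \<in> space (PiM I M) ==>
      u \<in> space (M j) ==> h p (x(j := u)) = h p x"
    and zero: "!!p x. p \<in> adj l ==> x \<in> space (PiM I M) ==> (\<integral>u. h p (x(snd p := u)) \<partial>M (snd p)) = 0"
  shows "(\<integral>x. (\<Prod>p\<in>adj l. 1 + \<i> * complex_of_real (h p x)) \<partial>PiM I M) = 1"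
  using I(2,3) m b inv zero
proof (induction l rule: rev_induct)
  case Nil
  interpret P: prob_space "PiM I M" by (rule prob_PiM)
  show ?case by (simp add: P.prob_space)
next
  case (snoc b l)
  interpret P: prob_space "PiM I M" by (rule prob_PiM)
  interpret Mb: prob_space "M b" by (rule M)
  show ?case
  proof (cases l rule: rev_cases)
    case Nil
    then show ?thesis by (simp add: P.prob_space)
  next
    case l: (snoc l' a)
    let ?P = "PiM I M" and ?f = "%p x. 1 + \<i> * complex_of_real (h p x)"
    have adj: "adj (l @ [b]) = insert (a, b) (adj l)"
      using adj_snoc[of l' a b] l by simp
    have nb: "j ~= b" if "p \<in> adj l" "j = fst p \<or> j = snd p" for p j
      using adj_in_set(1,3)[OF that(1)] that(2) snoc.prems(1) by auto
    have notin: "(a, b) \<notin> adj l" using nb[of "(a, b)" b] by auto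
    have bI: "b \<in> I" using snoc.prems(2) by simp
    note mm = snoc.prems(3)[unfolded adj] and bb = snoc.prems(4)[unfolded adj]
      and ii = snoc.prems(5)[unfolded adj] and zz = snoc.prems(6)[unfolded adj]
    have nf: "norm (?f p x) <= 1 + B" if "p \<in> adj (l @ [b])" "x \<in> space ?P" for p x
      using bb[of p x] that adj by (intro order_trans[OF norm_triangle_ineq]) (auto simp: norm_mult)
    have mp: "(%x. \<Prod>p\<in>adj (l @ [b]). ?f p x) \<in> borel_measurable ?P"
      using mm unfolding adj by (intro borel_measurable_prod) auto
    have "(\<integral>x. (\<Prod>p\<in>adj (l @ [b]). ?f p x) \<partial>?P) =
        (\<integral>x. \<integral>u. (\<Prod>p\<in>adj (l @ [b]). ?f p (x(b := u))) \<partial>M b \<partial>?P)"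
    proof (rule integral_resample[OF I(1) bI mp])
      fix x assume "x \<in> space ?P"
      then show "norm (\<Prod>p\<in>adj (l @ [b]). ?f p x) <= (\<Prod>p\<in>adj (l @ [b]). 1 + B)"
        using nf unfolding prod_norm[symmetric] by (intro prod_mono) auto
    qed
    also have "\<dots> = (\<integral>x. (\<Prod>p\<in>adj l. ?f p x) \<partial>?P)"
    proof (rule Bochner_Integration.integral_cong[OF refl])
      fix x assume x: "x \<in> space ?P"
      have meas: "(%u. h (a, b) (x(b := u))) \<in> borel_measurable (M b)"
        using measurable_compose[OF measurable_compose[OF measurable_Pair1'[OF x] measurable_upd_pair[OF bI]]
            mm[of "(a, b)"]] by (simp add: fun_upd_def)
      have i: "integrable (M b) (%u. h (a, b) (x(b := u)))"
        by (rule Mb.integrable_bounded[of _ B]) (use meas bb[of "(a, b)"] upd_in_space[OF bI x] in auto)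
      have "(\<integral>u. (\<Prod>p\<in>adj (l @ [b]). ?f p (x(b := u))) \<partial>M b) =
          (\<integral>u. ?f (a, b) (x(b := u)) * (\<Prod>p\<in>adj l. ?f p x) \<partial>M b)"
      proof (rule Bochner_Integration.integral_cong[OF refl])
        fix u assume u: "u \<in> space (M b)"
        have "?f p (x(b := u)) = ?f p x" if "p \<in> adj l" for p
          using nb[OF that] that x u by (subst ii) auto
        then show "(\<Prod>p\<in>adj (l @ [b]). ?f p (x(b := u))) = ?f (a, b) (x(b := u)) * (\<Prod>p\<in>adj l. ?f p x)"
          using notin by (simp add: adj)
      qed
      also have "\<dots> = (\<integral>u. ?f (a, b) (x(b := u)) \<partial>M b) * (\<Prod>p\<in>adj l. ?f p x)"
        by (rule integral_mult_left_zero)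
      also have "(\<integral>u. ?f (a, b) (x(b := u)) \<partial>M b) = 1"
      proof -
        have "(\<integral>u. h (a, b) (x(b := u)) \<partial>M b) = 0"
          using zz[of "(a, b)" x, unfolded snd_conv] x by blast
        then show ?thesis using i by (simp add: Mb.prob_space)
      qed
      finally show "(\<integral>u. (\<Prod>p\<in>adj (l @ [b]). ?f p (x(b := u))) \<partial>M b) = (\<Prod>p\<in>adj l. ?f p x)"
        unfolding mult_1 .
    qed
    also have "\<dots> = 1"
      by (rule snoc.IH) (use snoc.prems(1,2) mm bb ii zz in auto)
    finally show ?thesis .
  qed
qed

end

section \<open>Jumps between neighbouring observations\<close>

declare One_nat_def [simp del]

lemma sum_adj_both_le:
  fixes q :: "'i => real"
  assumes "distinct l" "!!i. 0 <= q i"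
  shows "(\<Sum>p\<in>adj l. q (fst p) + q (snd p)) <= 2 * sum q (set l)"
proof (cases "l = []")
  case False
  then show ?thesis
    using sum_adj_fst[OF assms(1) False, of q] sum_adj_snd[OF assms(1) False, of q]
      assms(2)[of "hd l"] assms(2)[of "last l"]
    by (simp add: sum.distrib)
qed simp

text \<open>Along a sorted list the indicator of a lower half-line is nonincreasing, so its total
  variation telescopes to first minus last value.\<close>

lemma sorted_jump_le:
  fixes x :: "'i => real"
  assumes "sorted (map x l)" "l ~= []"
  shows "(\<Sum>p\<in>adj l. \<bar>indicator {..c} (x (fst p)) - indicator {..c} (x (snd p))\<bar>)
    <= (indicator {..c} (x (hd l)) :: real)"
  using assms
proof (induction l rule: induct_list012)
  case (3 a b l)
  let ?t = "%p. \<bar>indicator {..c} (x (fst p)) - indicator {..c} (x (snd p))\<bar> :: real"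
  have "sum ?t (adj (a # b # l)) <= ?t (a, b) + sum ?t (adj (b # l))"
    by (cases "(a, b) \<in> adj (b # l)") (simp_all add: insert_absorb)
  moreover have "sum ?t (adj (b # l)) <= indicator {..c} (x b)"
    using 3 by simp
  moreover have "x a <= x b" using 3 by simp
  ultimately show ?case by (auto simp: indicator_def split: if_splits)
qed auto

lemma Int_stable_atMost': "Int_stable (range (%c. {..c::real}))"
  unfolding Int_stable_def
proof safe
  fix a b :: real
  have "{..a} \<inter> {..b} = {..min a b}" by auto
  then show "{..a} \<inter> {..b} \<in> range (%c. {..c})" by auto
qed

section \<open>The product model: positions with law \<open>\<mu>\<close>, noises with law
  \<open>\<nu>\<close>\<close>

locale two_laws =
  fixes \<mu> \<nu> :: "real measure"
  assumes prob_mu: "prob_space \<mu>" and prob_nu: "prob_space \<nu>"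
    and sets_mu [simp, measurable_cong]: "sets \<mu> = sets borel"
    and sets_nu [simp, measurable_cong]: "sets \<nu> = sets borel"
begin

sublocale mu: prob_space \<mu> by (rule prob_mu)
sublocale nu: prob_space \<nu> by (rule prob_nu)

abbreviation XM :: "nat => (nat => real) measure" where "XM n \<equiv> PiM {1..n} (%_. \<mu>)"
abbreviation EM :: "nat => (nat => real) measure" where "EM n \<equiv> PiM {1..n} (%_. \<nu>)"
abbreviation PM :: "nat => ((nat => real) \<times> (nat => real)) measure" where "PM n \<equiv> XM n \<Otimes>\<^sub>M EM n"

lemma space_mu [simp]: "space \<mu> = UNIV" and space_nu [simp]: "space \<nu> = UNIV"
  using sets_eq_imp_space_eq[OF sets_mu] sets_eq_imp_space_eq[OF sets_nu] by auto

lemma prob_XM: "prob_space (XM n)" and prob_EM: "prob_space (EM n)"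
  by (auto intro!: prob_space_PiM prob_mu prob_nu)

lemma pair_prob_PM: "pair_prob_space (XM n) (EM n)"
  by (simp add: pair_prob_space_def pair_sigma_finite_def prob_XM prob_EM prob_space_imp_sigma_finite)

lemma prob_PM: "prob_space (PM n)"
proof -
  interpret pair_prob_space "XM n" "EM n" by (rule pair_prob_PM)
  show ?thesis by (rule P.prob_space_axioms)
qed

lemma meas_comp:
  assumes "i \<in> {1..n}"
  shows "(%x. x i) \<in> borel_measurable (XM n)" "(%x. x i) \<in> borel_measurable (EM n)"
    "(%z. fst z i) \<in> borel_measurable (PM n)" "(%z. snd z i) \<in> borel_measurable (PM n)"
proof -
  show 1: "(%x. x i) \<in> borel_measurable (XM n)" "(%x. x i) \<in> borel_measurable (EM n)"
    using measurable_component_singleton[OF assms, of "%_. \<mu>"]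
      measurable_component_singleton[OF assms, of "%_. \<nu>"]
    by (simp_all cong: measurable_cong_sets)
  show "(%z. fst z i) \<in> borel_measurable (PM n)" "(%z. snd z i) \<in> borel_measurable (PM n)"
    using measurable_compose[OF measurable_fst 1(1)] measurable_compose[OF measurable_snd 1(2)] by auto
qed

lemma meas_ord: "ord_list n \<in> measurable (XM n) (count_space UNIV)"
  "(%z. ord_list n (fst z)) \<in> measurable (PM n) (count_space UNIV)"
  using measurable_ord_list[of n "%x. x" "XM n"] measurable_ord_list[of n fst "PM n"]
  by (auto simp: meas_comp)

lemma adj_ord_list:
  "p \<in> adj (ord_list n x) ==> fst p \<in> {1..n} \<and> snd p \<in> {1..n} \<and> fst p ~= snd p"
  using adj_in_set(1,3)[of p "ord_list n x"] adj_neq[of "ord_list n x" p] by auto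

lemma meas_adj_XM:
  fixes K :: "(nat => real) => nat \<times> nat => real"
  assumes "!!i j. i \<in> {1..n} ==> j \<in> {1..n} ==> (%x. K x (i, j)) \<in> borel_measurable (XM n)"
  shows "(%x. \<Sum>p\<in>adj (ord_list n x). K x p) \<in> borel_measurable (XM n)"
  by (rule measurable_adj_sum[where I="{1..n}" and g="ord_list n"]) (use meas_ord assms in auto)

lemma meas_adj_PM:
  fixes K :: "(nat => real) \<times> (nat => real) => nat \<times> nat => real"
  assumes "!!i j. i \<in> {1..n} ==> j \<in> {1..n} ==> (%z. K z (i, j)) \<in> borel_measurable (PM n)"
  shows "(%z. \<Sum>p\<in>adj (ord_list n (fst z)). K z p) \<in> borel_measurable (PM n)"
  by (rule measurable_adj_sum[where I="{1..n}" and g="%z. ord_list n (fst z)"]) (use meas_ord assms in auto)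

lemma card_adj_ord_list: "card (adj (ord_list n x)) <= n"
  using card_adj_le[of "ord_list n x"] by simp

lemma abs_sum_adj_le:
  fixes K :: "nat \<times> nat => real"
  assumes "!!p. p \<in> adj (ord_list n x) ==> \<bar>K p\<bar> <= C" "0 <= C"
  shows "\<bar>\<Sum>p\<in>adj (ord_list n x). K p\<bar> <= n * C"
proof -
  have "\<bar>\<Sum>p\<in>adj (ord_list n x). K p\<bar> <= (\<Sum>p\<in>adj (ord_list n x). \<bar>K p\<bar>)" by (rule sum_abs)
  also have "\<dots> <= card (adj (ord_list n x)) * C"
    by (rule sum_bounded_above) (use assms in blast)
  also have "\<dots> <= n * C"
    using card_adj_ord_list[of n x] assms(2) by (intro mult_right_mono) auto
  finally show ?thesis .
qed

lemma PM_iterate: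
  fixes F :: "_ => 'b::{banach,second_countable_topology}"
  assumes "F \<in> borel_measurable (PM n)" "!!z. z \<in> space (PM n) ==> norm (F z) <= B"
  shows "(\<integral>z. F z \<partial>PM n) = (\<integral>x. \<integral>e. F (x, e) \<partial>EM n \<partial>XM n)"
proof -
  interpret pair_prob_space "XM n" "EM n" by (rule pair_prob_PM)
  have "integrable (PM n) F"
    by (rule P.integrable_bounded[of _ B]) (use assms in auto)
  then show ?thesis by (rule integral_fst'[symmetric])
qed

lemma PM_inner_integrable:
  fixes F :: "_ => 'b::{banach,second_countable_topology}"
  assumes "F \<in> borel_measurable (PM n)" "!!z. z \<in> space (PM n) ==> norm (F z) <= B"
  shows "integrable (XM n) (%x. \<integral>e. F (x, e) \<partial>EM n)"
proof -
  interpret pair_prob_space "XM n" "EM n" by (rule pair_prob_PM)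
  have "integrable (PM n) F"
    by (rule P.integrable_bounded[of _ B]) (use assms in auto)
  then show ?thesis by (rule integrable_fst')
qed

text \<open>The form in which conditional bounds are used: an estimate of the noise integral at
  every fixed design is integrated over the designs.\<close>

lemma PM_integral_mono:
  fixes F :: "_ => real"
  assumes F: "F \<in> borel_measurable (PM n)" "!!z. z \<in> space (PM n) ==> \<bar>F z\<bar> <= B"
    and c: "integrable (XM n) c" "!!x. x \<in> space (XM n) ==> (\<integral>e. F (x, e) \<partial>EM n) <= c x"
  shows "(\<integral>z. F z \<partial>PM n) <= (\<integral>x. c x \<partial>XM n)"
  using PM_iterate[of F n B] PM_inner_integrable[of F n B] F c by (auto intro: integral_mono)

lemma PM_integral_fst:
  fixes g :: "_ => real"
  assumes "g \<in> borel_measurable (XM n)" "!!x. x \<in> space (XM n) ==> \<bar>g x\<bar> <= B"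
  shows "(\<integral>z. g (fst z) \<partial>PM n) = (\<integral>x. g x \<partial>XM n)"
proof -
  interpret E: prob_space "EM n" by (rule prob_EM)
  have "(\<integral>z. g (fst z) \<partial>PM n) = (\<integral>x. \<integral>e. g (fst (x, e)) \<partial>EM n \<partial>XM n)"
    by (rule PM_iterate[of _ _ B]) (use assms measurable_compose[OF measurable_fst assms(1)] in \<open>auto simp: space_pair_measure\<close>)
  then show ?thesis by (simp add: E.prob_space)
qed

lemma XM_integral_component: "i \<in> {1..n} ==> g \<in> borel_measurable borel ==> (\<integral>x. g (x i) \<partial>XM n) = (\<integral>a. g a \<partial>\<mu>)"
  for g :: "real => real"
  by (rule integral_PiM_component) (auto intro: prob_mu)

text \<open>The sets whose indicator has o(n) expected jumps along the ordered sample are closed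
  under complements and countable disjoint unions and contain the half-lines, which jump at most
  once. So every Borel section qualifies, and dominated convergence integrates over the parameter.
  Later the parameter is a noise, or a noise together with a level.\<close>

lemma indicator_section_jump:
  fixes R :: "'r measure"
  assumes R: "prob_space R" and A: "A \<in> sets (borel \<Otimes>\<^sub>M R)"
  shows "(%n. (\<integral>x. (\<Sum>p\<in>adj (ord_list n x).
      \<integral>r. \<bar>indicator A (x (fst p), r) - indicator A (x (snd p), r)\<bar> \<partial>R) \<partial>XM n) / real n)
    \<longlonglongrightarrow> 0"
proof -
  interpret R: prob_space R by (rule R)
  interpret XM: prob_space "XM n" for n by (rule prob_XM)
  define jump :: "nat => real set => (nat => real) => real" where
    "jump n B x = (\<Sum>p\<in>adj (ord_list n x). \<bar>indicator B (x (fst p)) - indicator B (x (snd p))\<bar>)" for n B x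
  have jm: "jump n B \<in> borel_measurable (XM n)" if [measurable]: "B \<in> sets borel" for n B
    unfolding jump_def
  proof (rule meas_adj_XM)
    fix i j assume ij: "i \<in> {1..n}" "j \<in> {1..n}"
    have *: "(%x. indicator B (x k) :: real) \<in> borel_measurable (XM n)" if "k \<in> {1..n}" for k
      by (rule measurable_compose[OF meas_comp(1)[OF that]]) simp
    show "(%x. \<bar>indicator B (x (fst (i, j))) - indicator B (x (snd (i, j)))\<bar> :: real) \<in> borel_measurable (XM n)"
      unfolding fst_conv snd_conv
      by (rule borel_measurable_abs[OF borel_measurable_diff[OF *[OF ij(1)] *[OF ij(2)]]])
  qed
  have j0: "0 <= jump n B x" for n B x unfolding jump_def by (intro sum_nonneg) auto
  have jn: "jump n B x <= n" for n B x
    using abs_sum_adj_le[of n x "%p. \<bar>indicator B (x (fst p)) - indicator B (x (snd p))\<bar>" 1]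
    by (auto simp: jump_def indicator_def)
  have ji: "integrable (XM n) (jump n B)" if "B \<in> sets borel" for n B
    by (rule XM.integrable_bounded[where B="real n"]) (use that jm j0 jn in auto)
  define lim where "lim B \<longleftrightarrow> (%n. (\<integral>x. jump n B x \<partial>XM n) / n) \<longlonglongrightarrow> 0" for B
  have main: "lim B" if "B \<in> sigma_sets UNIV (range (%c. {..c::real}))" for B
    using that
  proof (induct rule: sigma_sets_induct_disjoint[OF Int_stable_atMost' Pow_UNIV[THEN equalityD2, THEN subset_trans[OF subset_UNIV]],
      consumes 1, case_names basic empty compl union])
    case (basic B)
    then obtain c where B: "B = {..c}" by auto
    have le1: "jump n B x <= 1" for n x
    proof (cases "n = 0")
      case False
      have "jump n B x <= indicator {..c} (x (hd (ord_list n x)))"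
        using sorted_jump_le[of x "ord_list n x" c] False unfolding jump_def B by simp
      also have "\<dots> <= 1" by (simp add: indicator_def)
      finally show ?thesis .
    qed (simp add: jump_def ord_list_def)
    have "(\<integral>x. jump n B x \<partial>XM n) <= 1" for n
      using integral_mono[OF ji, of B n "%_. 1"] le1 B XM.prob_space[of n] by simp
    then have "(\<integral>x. jump n B x \<partial>XM n) / n <= 1 / n" for n by (intro divide_right_mono) auto
    moreover have "0 <= (\<integral>x. jump n B x \<partial>XM n) / n" for n
      using j0 by (intro divide_nonneg_nonneg integral_nonneg) auto
    ultimately show ?case
      unfolding lim_def by (intro tendsto_sandwich[OF _ _ tendsto_const lim_1_over_n]) auto
  next
    case empty
    then show ?case by (simp add: lim_def jump_def)
  next
    case (compl B)
    have "jump n (UNIV - B) = jump n B" for n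
      unfolding jump_def by (intro ext sum.cong refl) (auto simp: indicator_def)
    with compl show ?case by (simp add: lim_def)
  next
    case (union B)
    have Bs: "B i \<in> sets borel" for i
      using union(2) by (auto simp: borel_eq_atMost)
    have Bs': "(\<Union>i\<in>I. B i) \<in> sets borel" for I using Bs by auto
    \<comment> \<open>Tails of the disjoint union decrease to the empty set, so their
      \<open>\<mu>\<close>-mass becomes small; the finitely many remaining sets are covered by the
      hypothesis.\<close>
    define R where "R k = (\<Union>i\<in>{k..}. B i)" for k
    have Rs: "R k \<in> sets borel" for k unfolding R_def by (rule Bs')
    have "(%k. measure \<mu> (R k)) \<longlonglongrightarrow> measure \<mu> (\<Inter>k. R k)"
    proof (rule mu.finite_Lim_measure_decseq)
      show "decseq R" unfolding decseq_def R_def by (intro allI impI UN_mono) auto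
    qed (use Rs in auto)
    moreover have "(\<Inter>k. R k) = {}"
    proof -
      have False if a: "\<forall>k. a \<in> R k" for a
      proof -
        obtain i where i: "a \<in> B i" using a[rule_format, of 0] by (auto simp: R_def)
        obtain j where j: "j \<ge> Suc i" "a \<in> B j" using a[rule_format, of "Suc i"] by (auto simp: R_def)
        have "B i \<inter> B j = {}" by (rule disjoint_family_onD[OF union(1)]) (use j in auto)
        then show False using i j by auto
      qed
      then show ?thesis by auto
    qed
    ultimately have R0: "(%k. measure \<mu> (R k)) \<longlonglongrightarrow> 0" by simp
    show ?case
      unfolding lim_def
    proof (rule LIMSEQ_I)
      fix \<epsilon> :: real assume e: "0 < \<epsilon>"
      \<comment> \<open>A quarter, because an observation belongs to at most two pairs and the tail
        therefore costs twice its mass, that is, less than half of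
        \<open>\<epsilon>\<close>.\<close>
      obtain k where k: "measure \<mu> (R k) < \<epsilon> / 4"
        using LIMSEQ_D[OF R0, of "\<epsilon> / 4"] e by (auto simp: abs_less_iff)
      have "(%n. (\<Sum>i<k. (\<integral>x. jump n (B i) x \<partial>XM n) / n)) \<longlonglongrightarrow> (\<Sum>i<k. 0)"
        using union(3) unfolding lim_def by (intro tendsto_sum) auto
      then obtain N where N': "\<forall>n\<ge>N. norm ((\<Sum>i<k. (\<integral>x. jump n (B i) x \<partial>XM n) / n) - (\<Sum>i<k. 0)) < \<epsilon> / 2"
        using LIMSEQ_D[of _ _ "\<epsilon> / 2"] e by (meson half_gt_zero)
      have N: "(\<Sum>i<k. (\<integral>x. jump n (B i) x \<partial>XM n) / n) < \<epsilon> / 2" if "n \<ge> N" for n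
        using N'[rule_format, OF that] by simp
      have bound: "(\<integral>x. jump n (\<Union>i. B i) x \<partial>XM n) / n < \<epsilon>" if n: "n \<ge> max N 1" for n
      proof -
        have split: "indicator (\<Union>i. B i) a = (\<Sum>i<k. indicator (B i) a) + (indicator (R k) a :: real)" for a
        proof -
          have "(\<Union>i. B i) = (\<Union>i\<in>{..<k} \<union> {k..}. B i)" by (rule SUP_cong) auto
          then have "(\<Union>i. B i) = (\<Union>i<k. B i) \<union> R k" unfolding R_def by auto
          moreover have "(\<Union>i<k. B i) \<inter> R k = {}"
          proof -
            have "B i \<inter> B j = {}" if "i < k" "k <= j" for i j
              by (rule disjoint_family_onD[OF union(1)]) (use that in auto)
            then show ?thesis unfolding R_def by auto
          qed
          moreover have "indicator (\<Union>i<k. B i) a = (\<Sum>i<k. indicator (B i) a :: real)"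
            using union(1) by (intro indicator_UN_disjoint) (auto simp: disjoint_family_on_def)
          ultimately show ?thesis by (metis indicator_add)
        qed
        have pw: "jump n (\<Union>i. B i) x <= (\<Sum>i<k. jump n (B i) x) + 2 * (\<Sum>i\<in>{1..n}. indicator (R k) (x i))" for x
        proof -
          have "jump n (\<Union>i. B i) x <= (\<Sum>p\<in>adj (ord_list n x).
              (\<Sum>i<k. \<bar>indicator (B i) (x (fst p)) - indicator (B i) (x (snd p))\<bar>) +
              (indicator (R k) (x (fst p)) + indicator (R k) (x (snd p))))"
            unfolding jump_def
          proof (rule sum_mono)
            fix p :: "nat \<times> nat"
            have "\<bar>(\<Sum>i<k. indicator (B i) (x (fst p))) - (\<Sum>i<k. indicator (B i) (x (snd p)))\<bar>
                <= (\<Sum>i<k. \<bar>indicator (B i) (x (fst p)) - indicator (B i) (x (snd p)) :: real\<bar>)"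
              unfolding sum_subtractf[symmetric] by (rule sum_abs)
            moreover have "\<bar>indicator (R k) (x (fst p)) - indicator (R k) (x (snd p)) :: real\<bar>
                <= indicator (R k) (x (fst p)) + indicator (R k) (x (snd p))"
              by (auto simp: indicator_def)
            ultimately show "\<bar>indicator (\<Union>i. B i) (x (fst p)) - indicator (\<Union>i. B i) (x (snd p)) :: real\<bar> <=
              (\<Sum>i<k. \<bar>indicator (B i) (x (fst p)) - indicator (B i) (x (snd p))\<bar>) +
              (indicator (R k) (x (fst p)) + indicator (R k) (x (snd p)))"
              unfolding split by linarith
          qed
          also have "\<dots> = (\<Sum>i<k. jump n (B i) x) +
              (\<Sum>p\<in>adj (ord_list n x). indicator (R k) (x (fst p)) + indicator (R k) (x (snd p)))"
            unfolding jump_def by (subst sum.swap) (rule sum.distrib)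
          also have "(\<Sum>p\<in>adj (ord_list n x). indicator (R k) (x (fst p)) + indicator (R k) (x (snd p)))
              <= 2 * (\<Sum>i\<in>{1..n}. indicator (R k) (x i) :: real)"
            using sum_adj_both_le[of "ord_list n x" "%i. indicator (R k) (x i)"] by simp
          finally show ?thesis by simp
        qed
        have Ri: "integrable (XM n) (%x. indicator (R k) (x i) :: real)" if "i \<in> {1..n}" for i
        proof (rule XM.integrable_bounded[where B=1])
          have "(indicator (R k) :: real => real) \<in> borel_measurable borel" using Rs by simp
          then show "(%x. indicator (R k) (x i) :: real) \<in> borel_measurable (XM n)"
            by (rule measurable_compose[OF meas_comp(1)[OF that]])
        qed (simp add: indicator_def)
        have "(\<integral>x. jump n (\<Union>i. B i) x \<partial>XM n) <=
            (\<integral>x. (\<Sum>i<k. jump n (B i) x) + 2 * (\<Sum>i\<in>{1..n}. indicator (R k) (x i)) \<partial>XM n)"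
          using ji Bs Bs'[of UNIV] Ri pw
          by (intro integral_mono Bochner_Integration.integrable_add Bochner_Integration.integrable_sum integrable_mult_right) auto
        also have "\<dots> = (\<Sum>i<k. \<integral>x. jump n (B i) x \<partial>XM n) + 2 * (\<Sum>i\<in>{1..n}. \<integral>x. indicator (R k) (x i) \<partial>XM n)"
          using ji Bs Ri
          by (subst Bochner_Integration.integral_add)
            (auto intro!: Bochner_Integration.integrable_sum integrable_mult_right simp: Bochner_Integration.integral_sum)
        also have "(\<Sum>i\<in>{1..n}. \<integral>x. indicator (R k) (x i) \<partial>XM n) = (\<Sum>i\<in>{1..n}. measure \<mu> (R k))"
          by (intro sum.cong refl, subst XM_integral_component) (use Rs in auto)
        finally have "(\<integral>x. jump n (\<Union>i. B i) x \<partial>XM n) <=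
            (\<Sum>i<k. \<integral>x. jump n (B i) x \<partial>XM n) + 2 * (n * measure \<mu> (R k))" by simp
        then have "(\<integral>x. jump n (\<Union>i. B i) x \<partial>XM n) / n <=
            ((\<Sum>i<k. \<integral>x. jump n (B i) x \<partial>XM n) + 2 * (n * measure \<mu> (R k))) / n"
          by (rule divide_right_mono) simp
        also have "\<dots> = (\<Sum>i<k. (\<integral>x. jump n (B i) x \<partial>XM n) / n) + 2 * measure \<mu> (R k)"
          using n by (simp add: add_divide_distrib sum_divide_distrib)
        also have "\<dots> < \<epsilon> / 2 + 2 * (\<epsilon> / 4)"
          using N[of n] k n by (intro add_strict_mono) auto
        finally show ?thesis by simp
      qed
      have "0 <= (\<integral>x. jump n (\<Union>i. B i) x \<partial>XM n)" for n
        by (rule Bochner_Integration.integral_nonneg) (rule j0)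
      then show "\<exists>no. \<forall>n\<ge>no. norm ((\<integral>x. jump n (\<Union>i. B i) x \<partial>XM n) / n - 0) < \<epsilon>"
        using bound by (intro exI[of _ "max N 1"]) auto
    qed
  qed
  define S where "S r = {x. (x, r) \<in> A}" for r
  have Ssets: "S r \<in> sets borel" if "r \<in> space R" for r
    using sets_Pair2[OF A, of r] by (simp add: S_def vimage_def)
  have ind: "indicator A (a, r) = (indicator (S r) a :: real)" for a r by (auto simp: S_def indicator_def)
  have Am [measurable]: "(indicator A :: _ => real) \<in> borel_measurable (borel \<Otimes>\<^sub>M R)" using A by simp
  have jm2: "(%(x, r). jump n (S r) x) \<in> borel_measurable (XM n \<Otimes>\<^sub>M R)" for n
  proof -
    have "(%z. \<Sum>p\<in>adj (ord_list n (fst z)). \<bar>indicator A (fst z (fst p), snd z) - indicator A (fst z (snd p), snd z) :: real\<bar>)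
        \<in> borel_measurable (XM n \<Otimes>\<^sub>M R)"
    proof (rule measurable_adj_sum[where I="{1..n}"])
      show "(%z. ord_list n (fst z)) \<in> measurable (XM n \<Otimes>\<^sub>M R) (count_space UNIV)"
        by (rule measurable_compose[OF measurable_fst meas_ord(1)])
      fix p assume "p \<in> {1..n} \<times> {1..n}"
      then have [measurable]: "(%z. fst z (fst p)) \<in> borel_measurable (XM n \<Otimes>\<^sub>M R)"
        "(%z. fst z (snd p)) \<in> borel_measurable (XM n \<Otimes>\<^sub>M R)"
        by (auto intro!: measurable_compose[OF measurable_fst meas_comp(1)])
      show "(%z. \<bar>indicator A (fst z (fst p), snd z) - indicator A (fst z (snd p), snd z) :: real\<bar>)
        \<in> borel_measurable (XM n \<Otimes>\<^sub>M R)" by measurable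
    qed auto
    then show ?thesis by (simp add: jump_def ind case_prod_beta')
  qed
  interpret pp: pair_prob_space "XM n" R for n ..
  have jint: "integrable (XM n \<Otimes>\<^sub>M R) (%(x, r). jump n (S r) x)" for n
    by (rule pp.P.integrable_bounded[where B="real n"]) (use jm2 j0 jn in auto)
  \<comment> \<open>At most n pairs can jump, so the averages are bounded by 1 and converge under
    the integral over \<open>r\<close>.\<close>
  have conv: "(%n. \<integral>r. (\<integral>x. jump n (S r) x \<partial>XM n) / n \<partial>R) \<longlonglongrightarrow> (\<integral>r. 0 \<partial>R)"
  proof (rule integral_dominated_convergence[where w="%_. 1"])
    show "(%r. (\<integral>x. jump n (S r) x \<partial>XM n) / n) \<in> borel_measurable R" for n
    proof -
      have "(%(r, x). jump n (S r) x) \<in> borel_measurable (R \<Otimes>\<^sub>M XM n)"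
        using measurable_compose[OF measurable_pair_swap' jm2] by (simp add: case_prod_beta')
      then have "(%r. \<integral>x. jump n (S r) x \<partial>XM n) \<in> borel_measurable R"
        by (rule XM.borel_measurable_lebesgue_integral)
      then show ?thesis by measurable
    qed
    show "AE r in R. (%n. (\<integral>x. jump n (S r) x \<partial>XM n) / n) \<longlonglongrightarrow> 0"
      using main[unfolded lim_def] Ssets by (intro AE_I2) (auto simp: borel_eq_atMost)
    show "AE r in R. norm ((\<integral>x. jump n (S r) x \<partial>XM n) / n) <= 1" for n
    proof (rule AE_I2)
      fix r
      have "\<bar>\<integral>x. jump n (S r) x \<partial>XM n\<bar> <= n"
        by (rule XM.abs_integral_bounded) (use j0 jn in auto)
      then show "norm ((\<integral>x. jump n (S r) x \<partial>XM n) / n) <= 1"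
        by (cases "n = 0") (auto simp: divide_simps)
    qed
  qed auto
  have eq: "(\<integral>r. (\<integral>x. jump n (S r) x \<partial>XM n) / n \<partial>R) = (\<integral>x. (\<Sum>p\<in>adj (ord_list n x).
      \<integral>r. \<bar>indicator A (x (fst p), r) - indicator A (x (snd p), r)\<bar> \<partial>R) \<partial>XM n) / n" for n
  proof -
    have "(\<integral>r. (\<integral>x. jump n (S r) x \<partial>XM n) / n \<partial>R) = (\<integral>r. \<integral>x. jump n (S r) x \<partial>XM n \<partial>R) / n" by simp
    also have "(\<integral>r. \<integral>x. jump n (S r) x \<partial>XM n \<partial>R) = (\<integral>x. \<integral>r. jump n (S r) x \<partial>R \<partial>XM n)"
      by (rule pp.Fubini_integral[OF jint])
    also have "\<dots> = (\<integral>x. (\<Sum>p\<in>adj (ord_list n x).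
      \<integral>r. \<bar>indicator A (x (fst p), r) - indicator A (x (snd p), r)\<bar> \<partial>R) \<partial>XM n)"
      unfolding jump_def ind[symmetric]
    proof (intro Bochner_Integration.integral_cong refl Bochner_Integration.integral_sum)
      fix x and p :: "nat \<times> nat"
      show "integrable R (%r. \<bar>indicator A (x (fst p), r) - indicator A (x (snd p), r) :: real\<bar>)"
      proof (rule R.integrable_bounded[where B=1])
        show "(%r. \<bar>indicator A (x (fst p), r) - indicator A (x (snd p), r) :: real\<bar>) \<in> borel_measurable R"
          by measurable
      qed (simp add: indicator_def)
    qed
    finally show ?thesis .
  qed
  show ?thesis using conv unfolding eq by simp
qed

section \<open>Laws of large numbers from second moment bounds\<close>

text \<open>Efron-Stein with the i-th summand left out: the difference is one centred summand,
  bounded by \<open>2 * C\<close>.\<close>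

lemma iid_lln_square:
  fixes g :: "real => real"
  assumes g [measurable]: "g \<in> borel_measurable borel" and b: "!!a. \<bar>g a\<bar> <= C"
  shows "(\<integral>x. ((\<Sum>i\<in>{1..n}. g (x i)) - n * (\<integral>a. g a \<partial>\<mu>))\<^sup>2 \<partial>XM n) <= 4 * C\<^sup>2 * n"
proof -
  interpret XM: prob_space "XM n" by (rule prob_XM)
  define m where "m = (\<integral>a. g a \<partial>\<mu>)"
  have C0: "0 <= C" using b abs_ge_zero order_trans by blast
  have mb: "\<bar>m\<bar> <= C" unfolding m_def by (rule mu.abs_integral_bounded) (use b C0 in auto)
  have hb: "\<bar>g a - m\<bar> <= 2 * C" for a using b[of a] mb by linarith
  note [measurable] = meas_comp(1)
  define Z where "Z x = (\<Sum>i\<in>{1..n}. g (x i) - m)" for x :: "nat => real"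
  have cm: "(%x. g (x i) - m) \<in> borel_measurable (XM n)" if "i \<in> {1..n}" for i
    using measurable_compose[OF meas_comp(1)[OF that] g] by measurable
  have Zm: "Z \<in> borel_measurable (XM n)" unfolding Z_def using cm by (intro borel_measurable_sum) auto
  have Zb: "\<bar>\<Sum>i\<in>J. g (x i) - m\<bar> <= n * (2 * C)" if "J \<subseteq> {1..n}" for J and x :: "nat => real"
  proof -
    have "\<bar>\<Sum>i\<in>J. g (x i) - m\<bar> <= (\<Sum>i\<in>J. \<bar>g (x i) - m\<bar>)" by (rule sum_abs)
    also have "\<dots> <= card J * (2 * C)" by (rule sum_bounded_above) (use hb in blast)
    also have "\<dots> <= n * (2 * C)"
      using card_mono[OF _ that] C0 by (intro mult_right_mono) auto
    finally show ?thesis .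
  qed
  have gi: "integrable (XM n) (%x. g (x i))" if "i \<in> {1..n}" for i
    by (rule XM.integrable_bounded[of _ C])
      (use measurable_compose[OF meas_comp(1)[OF that] g] b in auto)
  have Zi: "(\<integral>x. Z x \<partial>XM n) = 0"
    unfolding Z_def using gi
    by (simp add: XM_integral_component m_def XM.prob_space)
  have "(\<integral>x. (Z x)\<^sup>2 \<partial>XM n) - (\<integral>x. Z x \<partial>XM n)\<^sup>2 <= (\<Sum>i\<in>{1..n}. \<integral>x. (Z x - (\<Sum>j\<in>{1..n} - {i}. g (x j) - m))\<^sup>2 \<partial>XM n)"
  proof (rule efron_stein[of _ _ _ "n * (2 * C)"])
    show "(%x. \<Sum>j\<in>{1..n} - {i}. g (x j) - m) \<in> borel_measurable (XM n)" for i
      using cm by (intro borel_measurable_sum) auto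
    show "(\<Sum>j\<in>{1..n} - {i}. g ((x(i := u)) j) - m) = (\<Sum>j\<in>{1..n} - {i}. g (x j) - m)" for i u and x :: "nat => real"
      by (rule sum.cong) auto
  qed (use Zm Zb in \<open>auto simp: Z_def intro: prob_mu\<close>)
  also have "\<dots> <= (\<Sum>i\<in>{1..n}. 4 * C\<^sup>2)"
  proof (rule sum_mono)
    fix i assume i: "i \<in> {1..n}"
    have eq: "Z x - (\<Sum>j\<in>{1..n} - {i}. g (x j) - m) = g (x i) - m" for x
      unfolding Z_def using i by (simp add: sum.remove[of "{1..n}" i])
    have "\<bar>\<integral>x. (g (x i) - m)\<^sup>2 \<partial>XM n\<bar> <= (2 * C)\<^sup>2"
      by (rule XM.abs_integral_bounded) (use abs_square_le[OF hb] in auto)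
    then show "(\<integral>x. (Z x - (\<Sum>j\<in>{1..n} - {i}. g (x j) - m))\<^sup>2 \<partial>XM n) <= 4 * C\<^sup>2"
      unfolding eq by (simp add: power_mult_distrib)
  qed
  finally show ?thesis
    unfolding Zi by (simp add: Z_def sum_subtractf m_def mult_ac)
qed

lemma iid_lln:
  fixes g :: "real => real"
  assumes g [measurable]: "g \<in> borel_measurable borel" and b: "!!a. \<bar>g a\<bar> <= C"
  shows "(\<integral>x. \<bar>(\<Sum>i\<in>{1..n}. g (x i)) - n * (\<integral>a. g a \<partial>\<mu>)\<bar> \<partial>XM n) <= 2 * C * sqrt n"
proof -
  interpret XM: prob_space "XM n" by (rule prob_XM)
  have C0: "0 <= C" using b abs_ge_zero order_trans by blast
  have mb: "\<bar>\<integral>a. g a \<partial>\<mu>\<bar> <= C" by (rule mu.abs_integral_bounded) (use b C0 in auto)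
  have "(\<integral>x. \<bar>(\<Sum>i\<in>{1..n}. g (x i)) - n * (\<integral>a. g a \<partial>\<mu>)\<bar> \<partial>XM n) <= sqrt (4 * C\<^sup>2 * n)"
  proof (rule XM.abs_integral_le_sqrt[OF _ _ iid_lln_square[OF g b]])
    show "(%x. (\<Sum>i\<in>{1..n}. g (x i)) - n * (\<integral>a. g a \<partial>\<mu>)) \<in> borel_measurable (XM n)"
      using measurable_compose[OF meas_comp(1) g] by (intro borel_measurable_diff borel_measurable_sum) auto
    show "\<bar>(\<Sum>i\<in>{1..n}. g (x i)) - n * (\<integral>a. g a \<partial>\<mu>)\<bar> <= n * C + n * C" for x
    proof -
      have "\<bar>\<Sum>i\<in>{1..n}. g (x i)\<bar> <= (\<Sum>i\<in>{1..n}. \<bar>g (x i)\<bar>)" by (rule sum_abs)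
      also have "\<dots> <= (\<Sum>i\<in>{1..n}. C)" by (intro sum_mono b)
      also have "\<dots> = n * C" by simp
      finally have "\<bar>\<Sum>i\<in>{1..n}. g (x i)\<bar> <= n * C" .
      moreover have "\<bar>n * (\<integral>a. g a \<partial>\<mu>)\<bar> <= n * C" using mb by (simp add: abs_mult mult_left_mono)
      ultimately show ?thesis by linarith
    qed
  qed
  also have "sqrt (4 * C\<^sup>2 * n) = 2 * C * sqrt n"
    using C0 by (simp add: real_sqrt_mult)
  finally show ?thesis .
qed

end

lemma square_sum_le: "(a + b)\<^sup>2 <= 2 * a\<^sup>2 + 2 * b\<^sup>2" for a b :: real
  using sum_squares_bound[of a b] by (simp add: power2_sum)

context two_laws
begin

text \<open>At a fixed design the order is a fixed list, so \<open>efron_stein_adj\<close> applies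
  to the noises; centred summands make the subtracted square of the mean vanish.\<close>

lemma EM_adj_square:
  fixes g :: "nat \<times> nat => real => real => real"
  assumes m: "!!p. p \<in> adj (ord_list n x) ==> (%(u, v). g p u v) \<in> borel_measurable (borel \<Otimes>\<^sub>M borel)"
    and b: "!!p u v. p \<in> adj (ord_list n x) ==> \<bar>g p u v\<bar> <= B"
    and z: "!!p. p \<in> adj (ord_list n x) ==> (\<integral>u. \<integral>v. g p u v \<partial>\<nu> \<partial>\<nu>) = 0"
  shows "(\<integral>e. (\<Sum>p\<in>adj (ord_list n x). g p (e (fst p)) (e (snd p)))\<^sup>2 \<partial>EM n)
    <= 4 * (\<Sum>p\<in>adj (ord_list n x). \<integral>u. \<integral>v. (g p u v)\<^sup>2 \<partial>\<nu> \<partial>\<nu>)"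
proof -
  interpret E: prob_space "EM n" by (rule prob_EM)
  let ?l = "ord_list n x"
  have m': "(%(u, v). g p u v) \<in> borel_measurable (\<nu> \<Otimes>\<^sub>M \<nu>)" if "p \<in> adj ?l" for p
    using m[OF that] by (simp cong: measurable_cong_sets sets_pair_measure_cong)
  have meas: "(%e. g p (e (fst p)) (e (snd p))) \<in> borel_measurable (EM n)" if "p \<in> adj ?l" for p
  proof -
    have "(%e. (e (fst p), e (snd p))) \<in> measurable (EM n) (borel \<Otimes>\<^sub>M borel)"
      using adj_ord_list[OF that] by (intro measurable_Pair meas_comp(2)) auto
    from measurable_compose[OF this m[OF that]] show ?thesis by simp
  qed
  have pair: "(\<integral>e. h (e (fst p)) (e (snd p)) \<partial>EM n) = (\<integral>u. \<integral>v. h u v \<partial>\<nu> \<partial>\<nu>)"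
    if "p \<in> adj ?l" "(%(u, v). h u v) \<in> borel_measurable (\<nu> \<Otimes>\<^sub>M \<nu>)" "!!u v. \<bar>h u v\<bar> <= D"
    for p D and h :: "real => real => real"
    by (rule integral_PiM_pair[where B=D]) (use that adj_ord_list[OF that(1)] prob_nu in auto)
  have i: "integrable (EM n) (%e. g p (e (fst p)) (e (snd p)))" if "p \<in> adj ?l" for p
    by (rule E.integrable_bounded[of _ B]) (use meas[OF that] b[OF that] in auto)
  have zero: "(\<integral>e. (\<Sum>p\<in>adj ?l. g p (e (fst p)) (e (snd p))) \<partial>EM n) = 0"
    using i pair[OF _ m' b] z by (simp add: Bochner_Integration.integral_sum)
  have "(\<integral>e. (\<Sum>p\<in>adj ?l. g p (e (fst p)) (e (snd p)))\<^sup>2 \<partial>EM n)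
      - (\<integral>e. (\<Sum>p\<in>adj ?l. g p (e (fst p)) (e (snd p))) \<partial>EM n)\<^sup>2
    <= 4 * (\<Sum>p\<in>adj ?l. \<integral>e. (g p (e (fst p)) (e (snd p)))\<^sup>2 \<partial>EM n)"
    by (rule efron_stein_adj[where B=B]) (use meas b prob_nu in auto)
  also have "(\<Sum>p\<in>adj ?l. \<integral>e. (g p (e (fst p)) (e (snd p)))\<^sup>2 \<partial>EM n)
      = (\<Sum>p\<in>adj ?l. \<integral>u. \<integral>v. (g p u v)\<^sup>2 \<partial>\<nu> \<partial>\<nu>)"
  proof (rule sum.cong[OF refl])
    fix p assume p: "p \<in> adj ?l"
    have "(%(u, v). (g p u v)\<^sup>2) \<in> borel_measurable (\<nu> \<Otimes>\<^sub>M \<nu>)"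
      using borel_measurable_power[OF m'[OF p], of 2] by (simp add: case_prod_beta')
    then show "(\<integral>e. (g p (e (fst p)) (e (snd p)))\<^sup>2 \<partial>EM n) = (\<integral>u. \<integral>v. (g p u v)\<^sup>2 \<partial>\<nu> \<partial>\<nu>)"
    proof (rule pair[OF p])
      show "\<bar>(g p u v)\<^sup>2\<bar> <= B\<^sup>2" for u v using abs_square_le[OF b[OF p]] by simp
    qed
  qed
  finally show ?thesis using zero by simp
qed

text \<open>\<open>K\<close> sees one position only, that of the right index, so its noise average
  \<open>q\<close> does too, and the sum of \<open>q\<close> is an i.i.d. sum up to the first
  element of the list. The conditional fluctuation contributes \<open>4 * C * sqrt n\<close>, the
  i.i.d. sum \<open>2 * C * sqrt n\<close>, and the missing element \<open>C\<close>.\<close>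

lemma chain_lln:
  fixes K :: "real => real => real => real"
  assumes K [measurable]: "(%(a, u, v). K a u v) \<in> borel_measurable (borel \<Otimes>\<^sub>M borel \<Otimes>\<^sub>M borel)"
    and b: "!!a u v. \<bar>K a u v\<bar> <= C"
  shows "(%z. \<Sum>p\<in>adj (ord_list n (fst z)). K (fst z (snd p)) (snd z (fst p)) (snd z (snd p))) \<in> borel_measurable (PM n)"
    and "(\<integral>z. \<bar>(\<Sum>p\<in>adj (ord_list n (fst z)). K (fst z (snd p)) (snd z (fst p)) (snd z (snd p)))
      - n * (\<integral>a. \<integral>u. \<integral>v. K a u v \<partial>\<nu> \<partial>\<nu> \<partial>\<mu>)\<bar> \<partial>PM n) <= 6 * C * sqrt n + C"
proof -
  interpret E: prob_space "EM n" by (rule prob_EM)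
  interpret X: prob_space "XM n" by (rule prob_XM)
  interpret P: prob_space "PM n" by (rule prob_PM)
  have C0: "0 <= C" using b abs_ge_zero order_trans by blast
  define q where "q a = (\<integral>u. \<integral>v. K a u v \<partial>\<nu> \<partial>\<nu>)" for a
  define \<kappa> where "\<kappa> = (\<integral>a. q a \<partial>\<mu>)"
  have qm [measurable]: "q \<in> borel_measurable borel"
  proof -
    have "(%x. K (fst (fst x)) (snd (fst x)) (snd x)) \<in> borel_measurable ((borel \<Otimes>\<^sub>M borel) \<Otimes>\<^sub>M borel)"
      by (rule measurable_compose[OF _ K, where f="%x. (fst (fst x), snd (fst x), snd x)", simplified]) measurable
    then show ?thesis unfolding q_def by measurable
  qed
  have qb: "\<bar>q a\<bar> <= C" for a
    unfolding q_def by (intro nu.abs_integral_bounded b C0)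
  have kb: "\<bar>\<kappa>\<bar> <= C" unfolding \<kappa>_def by (intro mu.abs_integral_bounded qb C0)
  define F where "F z = (\<Sum>p\<in>adj (ord_list n (fst z)). K (fst z (snd p)) (snd z (fst p)) (snd z (snd p)))"
    for z :: "(nat => real) \<times> (nat => real)"
  define Q where "Q x = (\<Sum>p\<in>adj (ord_list n x). q (x (snd p)))" for x :: "nat => real"
  show Fm: "(%z. \<Sum>p\<in>adj (ord_list n (fst z)). K (fst z (snd p)) (snd z (fst p)) (snd z (snd p))) \<in> borel_measurable (PM n)"
  proof (rule meas_adj_PM)
    fix i j assume ij: "i \<in> {1..n}" "j \<in> {1..n}"
    have "(%z. (fst z j, snd z i, snd z j)) \<in> measurable (PM n) (borel \<Otimes>\<^sub>M borel \<Otimes>\<^sub>M borel)"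
      using ij by (intro measurable_Pair meas_comp)
    from measurable_compose[OF this K]
    show "(%z. K (fst z (snd (i, j))) (snd z (fst (i, j))) (snd z (snd (i, j)))) \<in> borel_measurable (PM n)"
      by simp
  qed
  note Fm' = Fm[folded F_def]
  have Qm: "Q \<in> borel_measurable (XM n)"
    unfolding Q_def
  proof (rule meas_adj_XM)
    fix i j assume "j \<in> {1..n}"
    then show "(%x. q (x (snd (i, j)))) \<in> borel_measurable (XM n)"
      using measurable_compose[OF meas_comp(1) qm] by simp
  qed
  have Fb: "\<bar>F z\<bar> <= n * C" for z unfolding F_def by (rule abs_sum_adj_le) (use b C0 in auto)
  have Qb: "\<bar>Q x\<bar> <= n * C" for x unfolding Q_def by (rule abs_sum_adj_le) (use qb C0 in auto)
  have QI: "\<bar>Q x - (\<Sum>i\<in>{1..n}. q (x i))\<bar> <= C" for x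
  proof (cases "n = 0")
    case False
    then show ?thesis
      unfolding Q_def using sum_adj_snd[of "ord_list n x" "%i. q (x i)"] qb[of "x (hd (ord_list n x))"] by simp
  qed (use C0 in \<open>simp add: Q_def ord_list_def\<close>)
  have Qm2: "(%z. Q (fst z)) \<in> borel_measurable (PM n)"
    by (rule measurable_compose[OF measurable_fst Qm])
  have d1m: "(%z. \<bar>F z - Q (fst z)\<bar>) \<in> borel_measurable (PM n)"
    using Fm' Qm2 by measurable
  have d1b: "\<bar>\<bar>F z - Q (fst z)\<bar>\<bar> <= 2 * (n * C)" for z using Fb[of z] Qb[of "fst z"] by linarith
  have 1: "(\<integral>z. \<bar>F z - Q (fst z)\<bar> \<partial>PM n) <= (\<integral>x. 4 * C * sqrt n \<partial>XM n)"
  proof (rule PM_integral_mono[OF d1m d1b])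
    fix x assume x: "x \<in> space (XM n)"
    let ?l = "ord_list n x"
    define g where "g p u v = K (x (snd p)) u v - q (x (snd p))" for p :: "nat \<times> nat" and u v
    have gm: "(%(u, v). g p u v) \<in> borel_measurable (borel \<Otimes>\<^sub>M borel)" for p
      unfolding g_def by measurable
    have gb: "\<bar>g p u v\<bar> <= 2 * C" for p u v
      unfolding g_def using b[of "x (snd p)" u v] qb[of "x (snd p)"] by linarith
    have iv: "integrable \<nu> (%v. K a u v)" for a u
      by (rule nu.integrable_bounded[of _ C]) (use b in auto)
    have iu: "integrable \<nu> (%u. \<integral>v. K a u v \<partial>\<nu>)" for a
      by (rule nu.integrable_bounded[of _ C]) (auto intro!: nu.abs_integral_bounded b C0)
    have z0: "(\<integral>u. \<integral>v. g p u v \<partial>\<nu> \<partial>\<nu>) = 0" for p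
      unfolding g_def using iv iu by (simp add: nu.prob_space[simplified] q_def)
    have "(\<integral>e. (\<Sum>p\<in>adj ?l. g p (e (fst p)) (e (snd p)))\<^sup>2 \<partial>EM n)
        <= 4 * (\<Sum>p\<in>adj ?l. \<integral>u. \<integral>v. (g p u v)\<^sup>2 \<partial>\<nu> \<partial>\<nu>)"
      by (rule EM_adj_square[OF gm gb z0])
    also have "(\<Sum>p\<in>adj ?l. \<integral>u. \<integral>v. (g p u v)\<^sup>2 \<partial>\<nu> \<partial>\<nu>) <= n * (2 * C)\<^sup>2"
    proof -
      have "\<bar>\<integral>u. \<integral>v. (g p u v)\<^sup>2 \<partial>\<nu> \<partial>\<nu>\<bar> <= (2 * C)\<^sup>2" for p
        using abs_square_le[OF gb] by (intro nu.abs_integral_bounded) auto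
      then show ?thesis by (intro order_trans[OF abs_ge_self abs_sum_adj_le]) auto
    qed
    finally have sq: "(\<integral>e. (\<Sum>p\<in>adj ?l. g p (e (fst p)) (e (snd p)))\<^sup>2 \<partial>EM n) <= 16 * C\<^sup>2 * n"
      by (simp add: power_mult_distrib mult_ac)
    have eq: "F (x, e) - Q x = (\<Sum>p\<in>adj ?l. g p (e (fst p)) (e (snd p)))" for e
      unfolding F_def Q_def g_def by (simp add: sum_subtractf)
    have "(\<integral>e. \<bar>F (x, e) - Q x\<bar> \<partial>EM n) <= sqrt (16 * C\<^sup>2 * n)"
    proof (rule E.abs_integral_le_sqrt)
      show "(%e. F (x, e) - Q x) \<in> borel_measurable (EM n)"
        using measurable_compose[OF measurable_Pair1'[OF x] Fm'] by measurable
      show "\<bar>F (x, e) - Q x\<bar> <= 2 * (n * C)" for e using Fb[of "(x, e)"] Qb[of x] by linarith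
      show "(\<integral>e. (F (x, e) - Q x)\<^sup>2 \<partial>EM n) <= 16 * C\<^sup>2 * n"
        unfolding eq by (rule sq)
    qed
    also have "\<dots> = 4 * C * sqrt n" using C0 by (simp add: real_sqrt_mult)
    finally show "(\<integral>e. \<bar>F (x, e) - Q (fst (x, e))\<bar> \<partial>EM n) <= 4 * C * sqrt n" by simp
  qed simp
  define S where "S x = \<bar>(\<Sum>i\<in>{1..n}. q (x i)) - n * \<kappa>\<bar>" for x :: "nat => real"
  have Sm: "S \<in> borel_measurable (XM n)"
    unfolding S_def using measurable_compose[OF meas_comp(1) qm]
    by (intro borel_measurable_abs borel_measurable_diff borel_measurable_sum) auto
  have Sb: "\<bar>S x\<bar> <= n * C + C + n * C" for x
  proof -
    have "\<bar>n * \<kappa>\<bar> <= n * C" using kb by (simp add: abs_mult mult_left_mono)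
    then show ?thesis using QI[of x] Qb[of x] unfolding S_def by linarith
  qed
  have S1: "(\<integral>z. S (fst z) \<partial>PM n) <= 2 * C * sqrt n"
    using PM_integral_fst[OF Sm Sb] iid_lln[OF qm qb, of n] by (simp add: S_def \<kappa>_def)
  have Sm2: "(%z. S (fst z)) \<in> borel_measurable (PM n)"
    by (rule measurable_compose[OF measurable_fst Sm])
  have i1: "integrable (PM n) (%z. \<bar>F z - Q (fst z)\<bar>)"
    by (rule P.integrable_bounded[where B="2 * (n * C)"]) (use d1m d1b in auto)
  have i2: "integrable (PM n) (%z. S (fst z))"
    by (rule P.integrable_bounded[where B="n * C + C + n * C"]) (use Sm2 Sb in auto)
  have i0: "integrable (PM n) (%z. \<bar>F z - n * \<kappa>\<bar>)"
  proof (rule P.integrable_bounded[where B="n * C + n * \<bar>\<kappa>\<bar>"])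
    show "(%z. \<bar>F z - n * \<kappa>\<bar>) \<in> borel_measurable (PM n)" using Fm' by measurable
    show "norm \<bar>F z - n * \<kappa>\<bar> <= n * C + n * \<bar>\<kappa>\<bar>" for z
    proof -
      have "\<bar>F z - n * \<kappa>\<bar> <= \<bar>F z\<bar> + \<bar>n * \<kappa>\<bar>" by (rule abs_triangle_ineq4)
      then show ?thesis using Fb[of z] by (simp add: abs_mult)
    qed
  qed
  have "(\<integral>z. \<bar>F z - n * \<kappa>\<bar> \<partial>PM n) <= (\<integral>z. \<bar>F z - Q (fst z)\<bar> + C + S (fst z) \<partial>PM n)"
  proof (rule integral_mono[OF i0])
    show "integrable (PM n) (%z. \<bar>F z - Q (fst z)\<bar> + C + S (fst z))" using i1 i2 by simp
    show "\<bar>F z - n * \<kappa>\<bar> <= \<bar>F z - Q (fst z)\<bar> + C + S (fst z)" for z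
      using QI[of "fst z"] unfolding S_def by linarith
  qed
  also have "\<dots> = (\<integral>z. \<bar>F z - Q (fst z)\<bar> \<partial>PM n) + C + (\<integral>z. S (fst z) \<partial>PM n)"
    using i1 i2 by (simp add: P.prob_space)
  also have "\<dots> <= 4 * C * sqrt n + C + 2 * C * sqrt n"
    using 1 S1 by (simp add: X.prob_space)
  finally show "(\<integral>z. \<bar>(\<Sum>p\<in>adj (ord_list n (fst z)). K (fst z (snd p)) (snd z (fst p)) (snd z (snd p)))
      - n * (\<integral>a. \<integral>u. \<integral>v. K a u v \<partial>\<nu> \<partial>\<nu> \<partial>\<mu>)\<bar> \<partial>PM n) <= 6 * C * sqrt n + C"
    by (simp add: F_def \<kappa>_def q_def)
qed

end

section \<open>The kernel and its projections\<close>

text \<open>The linearization works for arbitrary measurable \<open>w\<close> and \<open>u\<close>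
  with values in [0, 1]. The instance of interest is F_Y(f) and T(f), see \<open>ww\<close> and
  \<open>uu\<close>.\<close>

locale rank_kernel = two_laws +
  fixes w u :: "real \<times> real => real"
  assumes w_meas [measurable]: "w \<in> borel_measurable (borel \<Otimes>\<^sub>M borel)"
    and u_meas [measurable]: "u \<in> borel_measurable (borel \<Otimes>\<^sub>M borel)"
    and w_ge: "!!a. 0 <= w a" and w_le: "!!a. w a <= 1"
    and u_ge: "!!a. 0 <= u a" and u_le: "!!a. u a <= 1"
begin

definition H :: "real => real => real" where "H a b = 1 - max a b"
definition pp :: "real => real => real" where "pp x a = (\<integral>e. H a (w (x, e)) \<partial>\<nu>)"
definition mm :: "real => real => real" where "mm x y = (\<integral>e. pp y (w (x, e)) \<partial>\<nu>)"
definition ub :: "real => real" where "ub x = (\<integral>e. u (x, e) \<partial>\<nu>)"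
definition md :: "real => real => real" where "md x y = (\<integral>e. \<bar>w (x, e) - w (y, e)\<bar> \<partial>\<nu>)"
text \<open>In the model this is the integrated squared distance between the conditional
  distribution functions at \<open>x\<close> and \<open>y\<close>, see \<open>dd_ph\<close>.\<close>

definition dd :: "real => real => real" where "dd x y = mm x x + mm y y - 2 * mm x y"
definition aa :: "real => real" where "aa x = mm x x + ub x"
text \<open>The martingale increment of a pair with old noise \<open>e\<close> and new noise
  \<open>e'\<close>, both placed at the position of the right index. In the Hoeffding decomposition,
  \<open>H\<close> minus its projection on \<open>e\<close> is the projection on \<open>e'\<close>
  plus a degenerate part. The additional \<open>pp x (w (x, e')) - mm x x\<close> stands for the
  projection of the following pair on its left noise, moved to the pair in which this noise is
  new.\<close>

definition kk :: "real => real => real => real" where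
  "kk x e e' = H (w (x, e)) (w (x, e')) - pp x (w (x, e)) + (pp x (w (x, e')) - mm x x) + (u (x, e') - ub x)"

lemma H_meas [measurable (raw)]: "f \<in> borel_measurable M ==> g \<in> borel_measurable M ==> (%x. H (f x) (g x)) \<in> borel_measurable M"
  unfolding H_def by measurable

lemma pp_meas: "(%(x, a). pp x a) \<in> borel_measurable (borel \<Otimes>\<^sub>M borel)"
  unfolding pp_def by measurable

lemma pp_meas' [measurable (raw)]:
  "f \<in> borel_measurable M ==> g \<in> borel_measurable M ==> (%x. pp (f x) (g x)) \<in> borel_measurable M"
  using measurable_compose[OF measurable_Pair pp_meas, of f M g] by simp

lemma mm_meas: "(%(x, y). mm x y) \<in> borel_measurable (borel \<Otimes>\<^sub>M borel)"
  unfolding mm_def by measurable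

lemma mm_meas' [measurable (raw)]:
  "f \<in> borel_measurable M ==> g \<in> borel_measurable M ==> (%x. mm (f x) (g x)) \<in> borel_measurable M"
  using measurable_compose[OF measurable_Pair mm_meas, of f M g] by simp

lemma md_meas: "(%(x, y). md x y) \<in> borel_measurable (borel \<Otimes>\<^sub>M borel)"
  unfolding md_def by measurable

lemma md_meas' [measurable (raw)]:
  "f \<in> borel_measurable M ==> g \<in> borel_measurable M ==> (%x. md (f x) (g x)) \<in> borel_measurable M"
  using measurable_compose[OF measurable_Pair md_meas, of f M g] by simp

lemma dd_meas' [measurable (raw)]:
  assumes [measurable]: "f \<in> borel_measurable M" "g \<in> borel_measurable M"
  shows "(%x. dd (f x) (g x)) \<in> borel_measurable M"
  unfolding dd_def by measurable

lemma ub_meas [measurable]: "ub \<in> borel_measurable borel"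
  unfolding ub_def by measurable

lemma aa_meas [measurable]: "aa \<in> borel_measurable borel"
  unfolding aa_def by measurable

lemma kk_meas [measurable]: "(%(x, e, e'). kk x e e') \<in> borel_measurable (borel \<Otimes>\<^sub>M borel \<Otimes>\<^sub>M borel)"
  unfolding kk_def by measurable

lemma nu_integral_01:
  fixes g :: "real => real"
  assumes "!!e. 0 <= g e" "!!e. g e <= 1"
  shows "0 <= (\<integral>e. g e \<partial>\<nu>)" "(\<integral>e. g e \<partial>\<nu>) <= 1"
proof -
  show "0 <= (\<integral>e. g e \<partial>\<nu>)" by (rule Bochner_Integration.integral_nonneg) (rule assms)
  have "\<bar>\<integral>e. g e \<partial>\<nu>\<bar> <= 1" by (rule nu.abs_integral_bounded) (use assms in auto)
  then show "(\<integral>e. g e \<partial>\<nu>) <= 1" by simp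
qed

lemma H_01: "0 <= a ==> a <= 1 ==> 0 <= b ==> b <= 1 ==> 0 <= H a b \<and> H a b <= 1"
  by (auto simp: H_def)

lemma pp_01: "0 <= a ==> a <= 1 ==> 0 <= pp x a \<and> pp x a <= 1"
  unfolding pp_def using H_01[of a "w (x, _)"] w_ge w_le by (intro conjI nu_integral_01) auto

lemma mm_01: "0 <= mm x y \<and> mm x y <= 1"
  unfolding mm_def using pp_01 w_ge w_le by (intro conjI nu_integral_01) auto

lemma ub_01: "0 <= ub x \<and> ub x <= 1"
  unfolding ub_def using u_ge u_le by (intro conjI nu_integral_01) auto

lemma md_01: "0 <= md x y \<and> md x y <= 1"
proof -
  have "\<bar>w a - w b\<bar> <= 1" for a b using w_ge[of a] w_le[of a] w_ge[of b] w_le[of b] by linarith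
  then show ?thesis unfolding md_def by (intro conjI nu_integral_01) auto
qed

lemma H_lipschitz: "\<bar>H a c - H b c\<bar> <= \<bar>a - b\<bar>"
  by (auto simp: H_def max_def)

lemma H_sym: "H a b = H b a"
  by (simp add: H_def max.commute)

lemma nu_int01: "g \<in> borel_measurable borel ==> (!!e. 0 <= g e \<and> g e <= 1) ==> integrable \<nu> g" for g :: "real => real"
  by (rule nu.integrable_bounded[of _ 1]) auto

lemma int_H: "0 <= a ==> a <= 1 ==> integrable \<nu> (%e. H a (w (x, e)))"
  by (rule nu_int01) (use H_01 w_ge w_le in auto)

lemma int_pp: "integrable \<nu> (%e. pp y (w (x, e)))"
  by (rule nu_int01) (use pp_01 w_ge w_le in auto)

lemma int_u: "integrable \<nu> (%e. u (x, e))"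
  by (rule nu_int01) (use u_ge u_le in auto)

lemma int_w: "integrable \<nu> (%e. w (x, e))"
  by (rule nu_int01) (use w_ge w_le in auto)

lemma pp_lipschitz1: "0 <= a ==> a <= 1 ==> \<bar>pp x a - pp y a\<bar> <= md x y"
proof -
  assume a: "0 <= a" "a <= 1"
  have "pp x a - pp y a = (\<integral>e. H a (w (x, e)) - H a (w (y, e)) \<partial>\<nu>)"
    unfolding pp_def using int_H[OF a] by simp
  also have "\<bar>\<dots>\<bar> <= (\<integral>e. \<bar>H a (w (x, e)) - H a (w (y, e))\<bar> \<partial>\<nu>)" by (rule integral_abs_bound)
  also have "\<dots> <= md x y"
    unfolding md_def
  proof (rule integral_mono)
    show "\<bar>H a (w (x, e)) - H a (w (y, e))\<bar> <= \<bar>w (x, e) - w (y, e)\<bar>" for e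
      using H_lipschitz[of "w (x, e)" a "w (y, e)"] by (simp add: H_sym[of a])
  qed (use int_H[OF a] int_w in auto)
  finally show ?thesis .
qed

lemma pp_lipschitz2: "0 <= a ==> a <= 1 ==> 0 <= b ==> b <= 1 ==> \<bar>pp x a - pp x b\<bar> <= \<bar>a - b\<bar>"
proof -
  assume a: "0 <= a" "a <= 1" and b: "0 <= b" "b <= 1"
  have "pp x a - pp x b = (\<integral>e. H a (w (x, e)) - H b (w (x, e)) \<partial>\<nu>)"
    unfolding pp_def using int_H[OF a] int_H[OF b] by simp
  also have "\<bar>\<dots>\<bar> <= \<bar>a - b\<bar>"
    by (rule nu.abs_integral_bounded) (use H_lipschitz in auto)
  finally show ?thesis .
qed

lemma mm_lipschitz1: "\<bar>mm x y - mm x' y\<bar> <= md x x'"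
proof -
  have "mm x y - mm x' y = (\<integral>e. pp y (w (x, e)) - pp y (w (x', e)) \<partial>\<nu>)"
    unfolding mm_def using int_pp by simp
  also have "\<bar>\<dots>\<bar> <= (\<integral>e. \<bar>pp y (w (x, e)) - pp y (w (x', e))\<bar> \<partial>\<nu>)" by (rule integral_abs_bound)
  also have "\<dots> <= md x x'"
    unfolding md_def by (rule integral_mono) (use int_pp int_w pp_lipschitz2 w_ge w_le in auto)
  finally show ?thesis .
qed

lemma mm_double: "mm x y = (\<integral>e. \<integral>e'. H (w (x, e)) (w (y, e')) \<partial>\<nu> \<partial>\<nu>)"
  by (simp add: mm_def pp_def)

lemma mm_sym: "mm x y = mm y x"
proof -
  interpret pp: pair_prob_space \<nu> \<nu> ..
  have "integrable (\<nu> \<Otimes>\<^sub>M \<nu>) (%(e, e'). H (w (x, e)) (w (y, e')))"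
    by (rule pp.P.integrable_bounded[of _ 1]) (use H_01 w_ge w_le in auto)
  from pp.Fubini_integral[OF this] show ?thesis
    unfolding mm_double by (simp add: H_sym)
qed

lemma md_triangle: "md x z <= md x y + md y z"
proof -
  have "md x z <= (\<integral>e. \<bar>w (x, e) - w (y, e)\<bar> + \<bar>w (y, e) - w (z, e)\<bar> \<partial>\<nu>)"
    unfolding md_def by (rule integral_mono) (use int_w in auto)
  also have "\<dots> = md x y + md y z" unfolding md_def using int_w by simp
  finally show ?thesis .
qed

text \<open>By symmetry \<open>dd\<close> is a second difference of \<open>mm\<close>, that is, a
  difference of two first differences, each bounded by \<open>md\<close>.\<close>

lemma dd_le_md: "\<bar>dd x y\<bar> <= 2 * md x y"
proof -
  have "dd x y = (mm x x - mm y x) - (mm x y - mm y y)" using mm_sym[of x y] by (simp add: dd_def)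
  then show ?thesis using mm_lipschitz1[of x x y] mm_lipschitz1[of x y y] by linarith
qed

lemma kk_bound: "\<bar>kk x e e'\<bar> <= 3"
  unfolding kk_def
  using H_01[of "w (x, e)" "w (x, e')"] pp_01[of "w (x, e)" x] pp_01[of "w (x, e')" x] mm_01[of x x] ub_01[of x]
    u_ge[of "(x, e')"] u_le[of "(x, e')"] w_ge w_le by (simp add: abs_le_iff)

lemma kk_mean_zero: "(\<integral>e'. kk x e e' \<partial>\<nu>) = 0"
  unfolding kk_def using int_H[of "w (x, e)" x] int_pp[of x x] int_u[of x] w_ge w_le
  by (simp add: nu.prob_space[simplified] mm_def[symmetric] ub_def[symmetric] pp_def[symmetric])

lemma aa_bounds: "0 <= aa x" "aa x <= 2"
  unfolding aa_def using mm_01[of x x] ub_01[of x] by auto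

end

section \<open>Linearization of the neighbour sum\<close>

lemma norm_iexp_diff_le: "norm (iexp a - iexp b) <= \<bar>a - b\<bar>"
proof -
  have "iexp a - iexp b = iexp b * (iexp (a - b) - 1)"
  proof -
    have "iexp b * iexp (a - b) = iexp a" by (simp add: exp_add[symmetric] right_diff_distrib)
    then show ?thesis by (simp add: right_diff_distrib)
  qed
  then have "norm (iexp a - iexp b) = norm (iexp (a - b) - 1)"
    by (simp add: norm_mult)
  also have "\<dots> <= \<bar>a - b\<bar>" using iexp_approx1[of "a - b" 0] by simp
  finally show ?thesis .
qed

lemma (in prob_space) char_diff_le:
  fixes f g :: "'a => real"
  assumes [measurable]: "f \<in> borel_measurable M" "g \<in> borel_measurable M"
    and i: "integrable M (%x. \<bar>f x - g x\<bar>)"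
  shows "norm ((\<integral>x. iexp (f x) \<partial>M) - (\<integral>x. iexp (g x) \<partial>M)) <= (\<integral>x. \<bar>f x - g x\<bar> \<partial>M)"
proof -
  have m: "(%x. iexp (h x)) \<in> borel_measurable M" if "h \<in> borel_measurable M" for h :: "'a => real"
    by (rule measurable_compose[OF that, where g="%y. iexp y"])
      (auto intro!: borel_measurable_continuous_onI continuous_intros)
  have ii: "integrable M (%x. iexp (h x))" if "h \<in> borel_measurable M" for h :: "'a => real"
    by (rule integrable_bounded[where B=1]) (use m[OF that] in auto)
  have "(\<integral>x. iexp (f x) \<partial>M) - (\<integral>x. iexp (g x) \<partial>M) = (\<integral>x. iexp (f x) - iexp (g x) \<partial>M)"
    by (rule Bochner_Integration.integral_diff[OF ii[OF assms(1)] ii[OF assms(2)], symmetric])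
  also have "norm \<dots> <= (\<integral>x. norm (iexp (f x) - iexp (g x)) \<partial>M)" by (rule integral_norm_bound)
  also have "\<dots> <= (\<integral>x. \<bar>f x - g x\<bar> \<partial>M)"
    by (rule integral_mono) (use ii assms i norm_iexp_diff_le in auto)
  finally show ?thesis .
qed

context rank_kernel
begin

definition c2 :: real where "c2 = (\<integral>a. aa a \<partial>\<mu>)"
definition SS :: "nat => (nat => real) \<times> (nat => real) => real" where
  "SS n z = (\<Sum>p\<in>adj (ord_list n (fst z)). H (w (fst z (fst p), snd z (fst p))) (w (fst z (snd p), snd z (snd p))))
    + (\<Sum>i\<in>{1..n}. u (fst z i, snd z i))"
definition DD :: "nat => (nat => real) => real" where
  "DD n x = (\<Sum>p\<in>adj (ord_list n x). dd (x (fst p)) (x (snd p)))"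
definition MD :: "nat => (nat => real) => real" where
  "MD n x = (\<Sum>p\<in>adj (ord_list n x). md (x (fst p)) (x (snd p)))"
definition KK :: "nat => (nat => real) \<times> (nat => real) => real" where
  "KK n z = (\<Sum>p\<in>adj (ord_list n (fst z)). kk (fst z (snd p)) (snd z (fst p)) (snd z (snd p)))"
definition AA :: "nat => (nat => real) => real" where "AA n x = (\<Sum>i\<in>{1..n}. aa (x i))"
text \<open>Variance of the contribution of one position plus mean square of one martingale
  increment. \<open>VV_eq\<close> identifies it with the combination of covariances that
  \<open>sigma2_CvM\<close> multiplies by 36.\<close>

definition VV :: real where
  "VV = (\<integral>a. (aa a - c2)\<^sup>2 \<partial>\<mu>) + (\<integral>a. \<integral>e. \<integral>e'. (kk a e e')\<^sup>2 \<partial>\<nu> \<partial>\<nu> \<partial>\<mu>)"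

lemma wz_meas: "i \<in> {1..n} ==> (%z. w (fst z i, snd z i)) \<in> borel_measurable (PM n)"
  "i \<in> {1..n} ==> (%z. u (fst z i, snd z i)) \<in> borel_measurable (PM n)"
  using measurable_compose[OF measurable_Pair[OF meas_comp(3) meas_comp(4)] w_meas]
    measurable_compose[OF measurable_Pair[OF meas_comp(3) meas_comp(4)] u_meas] by auto

lemma SS_meas: "SS n \<in> borel_measurable (PM n)"
  unfolding SS_def
proof (rule borel_measurable_add)
  show "(%z. \<Sum>p\<in>adj (ord_list n (fst z)). H (w (fst z (fst p), snd z (fst p))) (w (fst z (snd p), snd z (snd p))))
    \<in> borel_measurable (PM n)"
    by (rule meas_adj_PM) (auto intro!: H_meas wz_meas)
  show "(%z. \<Sum>i\<in>{1..n}. u (fst z i, snd z i)) \<in> borel_measurable (PM n)"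
    by (rule borel_measurable_sum) (rule wz_meas)
qed

lemma DD_meas: "DD n \<in> borel_measurable (XM n)"
  unfolding DD_def by (rule meas_adj_XM) (auto intro!: dd_meas' meas_comp)

lemma MD_meas: "MD n \<in> borel_measurable (XM n)"
  unfolding MD_def by (rule meas_adj_XM) (auto intro!: md_meas' meas_comp)

lemma KK_meas: "KK n \<in> borel_measurable (PM n)"
  unfolding KK_def by (rule chain_lln(1)[OF kk_meas kk_bound])

lemma AA_meas: "AA n \<in> borel_measurable (XM n)"
  unfolding AA_def by (intro borel_measurable_sum measurable_compose[OF meas_comp(1) aa_meas])

lemma fst_meas: "g \<in> borel_measurable (XM n) ==> (%z. g (fst z)) \<in> borel_measurable (PM n)"
  by (rule measurable_compose[OF measurable_fst])

lemma SS_bound: "\<bar>SS n z\<bar> <= 2 * n"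
proof -
  have "\<bar>\<Sum>p\<in>adj (ord_list n (fst z)). H (w (fst z (fst p), snd z (fst p))) (w (fst z (snd p), snd z (snd p)))\<bar> <= real n * 1"
    by (rule abs_sum_adj_le) (use H_01 w_ge w_le in auto)
  moreover have "\<bar>\<Sum>i\<in>{1..n}. u (fst z i, snd z i)\<bar> <= (\<Sum>i\<in>{1..n}. \<bar>u (fst z i, snd z i)\<bar>)" by (rule sum_abs)
  moreover have "\<dots> <= of_nat (card {1..n}) * 1"
    by (rule sum_bounded_above) (use u_ge u_le in auto)
  ultimately show ?thesis unfolding SS_def by (simp add: abs_le_iff)
qed

lemma DD_bound: "\<bar>DD n x\<bar> <= 2 * n"
proof -
  have "\<bar>DD n x\<bar> <= real n * 2"
    unfolding DD_def
  proof (rule abs_sum_adj_le)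
    fix p show "\<bar>dd (x (fst p)) (x (snd p))\<bar> <= 2"
      using dd_le_md[of "x (fst p)" "x (snd p)"] md_01[of "x (fst p)" "x (snd p)"] by linarith
  qed simp
  then show ?thesis by simp
qed

lemma MD_bound: "0 <= MD n x" "MD n x <= n"
proof -
  show "0 <= MD n x" unfolding MD_def by (rule sum_nonneg) (use md_01 in auto)
  have "\<bar>MD n x\<bar> <= real n * 1" unfolding MD_def by (rule abs_sum_adj_le) (use md_01 in auto)
  then show "MD n x <= n" by simp
qed

lemma KK_bound: "\<bar>KK n z\<bar> <= 3 * n"
  using abs_sum_adj_le[of n "fst z" "%p. kk (fst z (snd p)) (snd z (fst p)) (snd z (snd p))" 3] kk_bound
  by (simp add: KK_def)

lemma AA_bound: "\<bar>AA n x\<bar> <= 2 * n"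
proof -
  have "\<bar>AA n x\<bar> <= (\<Sum>i\<in>{1..n}. \<bar>aa (x i)\<bar>)" unfolding AA_def by (rule sum_abs)
  also have "\<dots> <= of_nat (card {1..n}) * 2"
    by (rule sum_bounded_above) (use aa_bounds in auto)
  finally show ?thesis by simp
qed

text \<open>Given the design \<open>x\<close>, the statistic is its conditional mean plus the martingale \<open>KK\<close>, up to a
  remainder whose variance is controlled by the roughness \<open>MD\<close>: replacing \<open>x\<^sub>a\<close> by its right
  neighbour \<open>x\<^sub>b\<close> in the Hoeffding projections costs \<open>md x\<^sub>a x\<^sub>b\<close>.\<close>

lemma residual_square:
  assumes x: "x \<in> space (XM n)"
  shows "(\<integral>e. (SS n (x, e) - AA n x + DD n x / 2 - KK n (x, e))\<^sup>2 \<partial>EM n) <= 128 * MD n x + 32"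
proof (cases "n = 0")
  case True
  then show ?thesis by (simp add: SS_def AA_def DD_def KK_def MD_def ord_list_def)
next
  case n: False
  interpret E: prob_space "EM n" by (rule prob_EM)
  let ?l = "ord_list n x"
  define wx where "wx i e = w (x i, e)" for i :: nat and e :: real
  define \<psi> where "\<psi> i a = pp (x i) (wx i a) - mm (x i) (x i)" for i a
  define U where "U i a = u (x i, a) - ub (x i)" for i a
  define m where "m i = mm (x i) (x i)" for i
  \<comment> \<open>What is left of a pair after removing its conditional mean, the increment
    computed at the right position, and the projection on the left noise at the left position. It
    vanishes if both indices have the same position.\<close>
  define g where "g p a b = H (wx (fst p) a) (wx (snd p) b) - mm (x (fst p)) (x (snd p)) -
    (H (wx (snd p) a) (wx (snd p) b) - pp (x (snd p)) (wx (snd p) a)) - \<psi> (fst p) a" for p a b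
  have w01: "0 <= wx i a" "wx i a <= 1" for i a using w_ge w_le by (auto simp: wx_def)
  have wxm [measurable]: "wx i \<in> borel_measurable borel" for i unfolding wx_def by measurable
  have psib: "\<bar>\<psi> i a\<bar> <= 1" for i a
    unfolding \<psi>_def using pp_01[OF w01, of "x i" i a] mm_01[of "x i" "x i"] by (simp add: abs_le_iff)
  have Ub: "\<bar>U i a\<bar> <= 1" for i a
    unfolding U_def using u_ge[of "(x i, a)"] u_le[of "(x i, a)"] ub_01[of "x i"] by (simp add: abs_le_iff)
  have mb: "0 <= m i" "m i <= 1" for i unfolding m_def using mm_01 by auto
  define G where "G e = (\<Sum>p\<in>adj ?l. g p (e (fst p)) (e (snd p)))" for e :: "nat => real"
  have ident: "SS n (x, e) - AA n x + DD n x / 2 - KK n (x, e) = G e +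
      (\<psi> (hd ?l) (e (hd ?l)) - \<psi> (last ?l) (e (last ?l)) + U (hd ?l) (e (hd ?l)) - (m (hd ?l) + m (last ?l)) / 2)" for e
  proof -
    have l: "distinct ?l" "?l ~= []" using n by auto
    \<comment> \<open>The bias enters here, through
      \<open>2 * mm x y = mm x x + mm y y - dd x y\<close>. Summed over the list, the
      \<open>\<psi>\<close> terms cancel except at the two ends, and \<open>m\<close> and
      \<open>U\<close> complete to full sums up to terms at the ends.\<close>
    have pw: "H (wx (fst p) (e (fst p))) (wx (snd p) (e (snd p))) - kk (x (snd p)) (e (fst p)) (e (snd p))
        + dd (x (fst p)) (x (snd p)) / 2 =
        g p (e (fst p)) (e (snd p)) + \<psi> (fst p) (e (fst p)) - \<psi> (snd p) (e (snd p)) - U (snd p) (e (snd p))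
        + m (fst p) / 2 + m (snd p) / 2" for p
      unfolding g_def kk_def dd_def \<psi>_def U_def m_def wx_def by (simp add: field_simps)
    have "(\<Sum>p\<in>adj ?l. H (wx (fst p) (e (fst p))) (wx (snd p) (e (snd p)))) - KK n (x, e) + DD n x / 2 =
        (\<Sum>p\<in>adj ?l. H (wx (fst p) (e (fst p))) (wx (snd p) (e (snd p))) - kk (x (snd p)) (e (fst p)) (e (snd p))
        + dd (x (fst p)) (x (snd p)) / 2)"
      by (simp add: KK_def DD_def sum.distrib sum_subtractf sum_divide_distrib)
    also have "\<dots> = G e + (\<Sum>p\<in>adj ?l. \<psi> (fst p) (e (fst p))) - (\<Sum>p\<in>adj ?l. \<psi> (snd p) (e (snd p)))
        - (\<Sum>p\<in>adj ?l. U (snd p) (e (snd p))) + (\<Sum>p\<in>adj ?l. m (fst p) / 2) + (\<Sum>p\<in>adj ?l. m (snd p) / 2)"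
      unfolding pw by (simp add: G_def sum.distrib sum_subtractf)
    also have "(\<Sum>p\<in>adj ?l. \<psi> (fst p) (e (fst p))) = (\<Sum>i\<in>{1..n}. \<psi> i (e i)) - \<psi> (last ?l) (e (last ?l))"
      using sum_adj_fst[OF l, of "%i. \<psi> i (e i)"] by simp
    also have "(\<Sum>p\<in>adj ?l. \<psi> (snd p) (e (snd p))) = (\<Sum>i\<in>{1..n}. \<psi> i (e i)) - \<psi> (hd ?l) (e (hd ?l))"
      using sum_adj_snd[OF l, of "%i. \<psi> i (e i)"] by simp
    also have "(\<Sum>p\<in>adj ?l. U (snd p) (e (snd p))) = (\<Sum>i\<in>{1..n}. U i (e i)) - U (hd ?l) (e (hd ?l))"
      using sum_adj_snd[OF l, of "%i. U i (e i)"] by simp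
    also have "(\<Sum>p\<in>adj ?l. m (fst p) / 2) = (\<Sum>i\<in>{1..n}. m i / 2) - m (last ?l) / 2"
      using sum_adj_fst[OF l, of "%i. m i / 2"] by simp
    also have "(\<Sum>p\<in>adj ?l. m (snd p) / 2) = (\<Sum>i\<in>{1..n}. m i / 2) - m (hd ?l) / 2"
      using sum_adj_snd[OF l, of "%i. m i / 2"] by simp
    moreover have "(\<Sum>i\<in>{1..n}. U i (e i)) = (\<Sum>i\<in>{1..n}. u (x i, e i)) - (\<Sum>i\<in>{1..n}. ub (x i))"
      unfolding U_def by (rule sum_subtractf)
    moreover have "AA n x = (\<Sum>i\<in>{1..n}. m i / 2) + (\<Sum>i\<in>{1..n}. m i / 2) + (\<Sum>i\<in>{1..n}. ub (x i))"
      unfolding AA_def aa_def m_def sum.distrib[symmetric] by simp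
    moreover have "SS n (x, e) = (\<Sum>p\<in>adj ?l. H (wx (fst p) (e (fst p))) (wx (snd p) (e (snd p))))
        + (\<Sum>i\<in>{1..n}. u (x i, e i))"
      unfolding SS_def wx_def by simp
    ultimately show ?thesis by (simp add: add_divide_distrib)
  qed
  \<comment> \<open>The terms at the ends add up to at most 4 in modulus, and
    \<open>2 * 4\<^sup>2 = 32\<close>.\<close>
  have le: "(SS n (x, e) - AA n x + DD n x / 2 - KK n (x, e))\<^sup>2 <= 2 * (G e)\<^sup>2 + 32" for e
  proof -
    define \<beta> where "\<beta> = \<psi> (hd ?l) (e (hd ?l)) - \<psi> (last ?l) (e (last ?l)) + U (hd ?l) (e (hd ?l)) - (m (hd ?l) + m (last ?l)) / 2"
    have "\<bar>\<beta>\<bar> <= 4"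
      unfolding \<beta>_def using psib[of "hd ?l" "e (hd ?l)"] psib[of "last ?l" "e (last ?l)"] Ub[of "hd ?l" "e (hd ?l)"]
        mb[of "hd ?l"] mb[of "last ?l"] by (simp only: abs_le_iff) (simp add: field_simps)
    from abs_square_le[OF this] show ?thesis
      unfolding ident \<beta>_def[symmetric] using square_sum_le[of "G e" \<beta>] by simp
  qed
  have gm: "(%(a, b). g p a b) \<in> borel_measurable (borel \<Otimes>\<^sub>M borel)" for p
    unfolding g_def \<psi>_def by measurable
  have gb4: "\<bar>g p a b\<bar> <= 4" for p a b
  proof -
    have "\<bar>H (wx (fst p) a) (wx (snd p) b) - mm (x (fst p)) (x (snd p))\<bar> <= 1"
      using H_01[OF w01[of "fst p" a] w01[of "snd p" b]] mm_01[of "x (fst p)" "x (snd p)"] by linarith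
    moreover have "\<bar>H (wx (snd p) a) (wx (snd p) b) - pp (x (snd p)) (wx (snd p) a)\<bar> <= 1"
      using H_01[OF w01[of "snd p" a] w01[of "snd p" b]] pp_01[OF w01[of "snd p" a], of "x (snd p)"] by linarith
    ultimately show ?thesis unfolding g_def using psib[of "fst p" a] by linarith
  qed
  define \<delta> where "\<delta> p = md (x (fst p)) (x (snd p))" for p :: "nat \<times> nat"
  define \<kappa> where "\<kappa> p a = \<bar>wx (fst p) a - wx (snd p) a\<bar>" for p :: "nat \<times> nat" and a
  \<comment> \<open>Two replacements of \<open>w\<close> at a fixed noise cost
    \<open>\<kappa>\<close> each, two replacements of a conditional law cost \<open>\<delta>\<close>
    each.\<close>
  have gb: "\<bar>g p a b\<bar> <= 2 * \<kappa> p a + 2 * \<delta> p" for p a b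
  proof -
    have "\<bar>H (wx (fst p) a) (wx (snd p) b) - H (wx (snd p) a) (wx (snd p) b)\<bar> <= \<kappa> p a"
      unfolding \<kappa>_def by (rule H_lipschitz)
    moreover have "\<bar>pp (x (snd p)) (wx (snd p) a) - pp (x (snd p)) (wx (fst p) a)\<bar> <= \<kappa> p a"
      unfolding \<kappa>_def abs_minus_commute[of "wx (fst p) a"] by (rule pp_lipschitz2) (auto simp: w01)
    moreover have "\<bar>pp (x (fst p)) (wx (fst p) a) - pp (x (snd p)) (wx (fst p) a)\<bar> <= \<delta> p"
      unfolding \<delta>_def by (rule pp_lipschitz1[OF w01])
    moreover have "\<bar>mm (x (fst p)) (x (fst p)) - mm (x (fst p)) (x (snd p))\<bar> <= \<delta> p"
      unfolding \<delta>_def using mm_lipschitz1[of "x (fst p)" "x (fst p)" "x (snd p)"] mm_sym[of "x (fst p)" "x (snd p)"] by simp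
    ultimately show ?thesis unfolding g_def \<psi>_def by linarith
  qed
  have ipsi: "integrable \<nu> (\<psi> i)" for i
    unfolding \<psi>_def wx_def using int_pp by simp
  have psi0: "(\<integral>a. \<psi> i a \<partial>\<nu>) = 0" for i
    unfolding \<psi>_def wx_def using int_pp[of "x i" "x i"] by (simp add: mm_def[symmetric] nu.prob_space[simplified])
  have gz: "(\<integral>a. \<integral>b. g p a b \<partial>\<nu> \<partial>\<nu>) = 0" for p
  proof -
    have "(\<integral>b. g p a b \<partial>\<nu>) = pp (x (snd p)) (wx (fst p) a) - mm (x (fst p)) (x (snd p)) - \<psi> (fst p) a" for a
    proof -
      have iH: "integrable \<nu> (%b. H (wx k a) (wx (snd p) b))" for k
        using int_H[OF w01[of k a], of "x (snd p)"] by (simp add: wx_def)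
      have eH: "(\<integral>b. H (wx k a) (wx (snd p) b) \<partial>\<nu>) = pp (x (snd p)) (wx k a)" for k
        by (simp add: pp_def wx_def)
      show ?thesis
        unfolding g_def using iH[of "fst p"] iH[of "snd p"] by (simp add: eH nu.prob_space[simplified])
    qed
    then show ?thesis
      using int_pp ipsi psi0 by (simp add: wx_def mm_def[symmetric] nu.prob_space[simplified])
  qed
  have iK: "integrable \<nu> (%a. 8 * \<kappa> p a + 8 * \<delta> p)" for p
    unfolding \<kappa>_def wx_def using int_w by simp
  have g2: "(\<integral>a. \<integral>b. (g p a b)\<^sup>2 \<partial>\<nu> \<partial>\<nu>) <= 16 * \<delta> p" for p
  proof -
    have k1: "0 <= \<kappa> p a" "\<kappa> p a <= 1" for a
      unfolding \<kappa>_def using w01[of "fst p" a] w01[of "snd p" a] by auto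
    have d1: "0 <= \<delta> p" "\<delta> p <= 1" unfolding \<delta>_def using md_01 by auto
    \<comment> \<open>Both \<open>\<kappa>\<close> and \<open>\<delta>\<close> lie in [0, 1], so
      their squares are bounded by themselves. Since \<open>\<kappa>\<close> integrates to
      \<open>\<delta>\<close>, the variance becomes linear in \<open>md\<close>.\<close>
    have sq: "(g p a b)\<^sup>2 <= 8 * \<kappa> p a + 8 * \<delta> p" for a b
    proof -
      have "(g p a b)\<^sup>2 <= (2 * \<kappa> p a + 2 * \<delta> p)\<^sup>2" by (rule abs_square_le[OF gb])
      also have "\<dots> <= 2 * (2 * \<kappa> p a)\<^sup>2 + 2 * (2 * \<delta> p)\<^sup>2" by (rule square_sum_le)
      also have "\<dots> = 8 * (\<kappa> p a * \<kappa> p a) + 8 * (\<delta> p * \<delta> p)" by (simp add: power2_eq_square)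
      also have "\<dots> <= 8 * (\<kappa> p a * 1) + 8 * (\<delta> p * 1)"
        using k1[of a] d1 by (intro add_mono mult_left_mono) auto
      finally show ?thesis by simp
    qed
    have im: "(%a. \<integral>b. (g p a b)\<^sup>2 \<partial>\<nu>) \<in> borel_measurable borel"
      unfolding g_def \<psi>_def by measurable
    have ig: "integrable \<nu> (%b. (g p a b)\<^sup>2)" for a
    proof (rule nu.integrable_bounded[of _ "4\<^sup>2"])
      show "(%b. (g p a b)\<^sup>2) \<in> borel_measurable \<nu>" unfolding g_def \<psi>_def by measurable
      show "norm ((g p a b)\<^sup>2) <= 4\<^sup>2" for b using abs_square_le[OF gb4[of p a b]] by simp
    qed
    have "(\<integral>a. \<integral>b. (g p a b)\<^sup>2 \<partial>\<nu> \<partial>\<nu>) <= (\<integral>a. 8 * \<kappa> p a + 8 * \<delta> p \<partial>\<nu>)"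
    proof (rule integral_mono)
      show "integrable \<nu> (%a. \<integral>b. (g p a b)\<^sup>2 \<partial>\<nu>)"
      proof (rule nu.integrable_bounded[of _ "4\<^sup>2"])
        show "(%a. \<integral>b. (g p a b)\<^sup>2 \<partial>\<nu>) \<in> borel_measurable \<nu>" using im by simp
        show "norm (\<integral>b. (g p a b)\<^sup>2 \<partial>\<nu>) <= 4\<^sup>2" for a
          by (rule nu.integral_bounded) (use abs_square_le[OF gb4[of p a]] in auto)
      qed
      show "(\<integral>b. (g p a b)\<^sup>2 \<partial>\<nu>) <= 8 * \<kappa> p a + 8 * \<delta> p" for a
      proof -
        have "(\<integral>b. (g p a b)\<^sup>2 \<partial>\<nu>) <= (\<integral>b. 8 * \<kappa> p a + 8 * \<delta> p \<partial>\<nu>)"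
          by (rule integral_mono) (use ig sq in auto)
        then show ?thesis by (simp add: nu.prob_space[simplified])
      qed
    qed (rule iK)
    also have "\<dots> = 8 * (\<integral>a. \<kappa> p a \<partial>\<nu>) + 8 * \<delta> p"
      unfolding \<kappa>_def wx_def using int_w by (simp add: nu.prob_space[simplified])
    also have "(\<integral>a. \<kappa> p a \<partial>\<nu>) = \<delta> p" unfolding \<kappa>_def \<delta>_def md_def wx_def ..
    finally show ?thesis by simp
  qed
  have "(\<integral>e. (G e)\<^sup>2 \<partial>EM n) <= 4 * (\<Sum>p\<in>adj ?l. \<integral>a. \<integral>b. (g p a b)\<^sup>2 \<partial>\<nu> \<partial>\<nu>)"
    unfolding G_def by (rule EM_adj_square[OF gm gb4 gz])
  also have "\<dots> <= 4 * (\<Sum>p\<in>adj ?l. 16 * \<delta> p)" using g2 by (intro mult_left_mono sum_mono) auto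
  also have "\<dots> = 64 * MD n x" unfolding MD_def \<delta>_def by (simp add: sum_distrib_left)
  finally have G2: "(\<integral>e. (G e)\<^sup>2 \<partial>EM n) <= 64 * MD n x" .
  have Gm: "G \<in> borel_measurable (EM n)"
    unfolding G_def
  proof (rule borel_measurable_sum)
    fix p assume p: "p \<in> adj ?l"
    have "(%e. (e (fst p), e (snd p))) \<in> measurable (EM n) (borel \<Otimes>\<^sub>M borel)"
      using adj_ord_list[OF p] by (intro measurable_Pair meas_comp(2)) auto
    from measurable_compose[OF this gm]
    show "(%e. g p (e (fst p)) (e (snd p))) \<in> borel_measurable (EM n)" by simp
  qed
  have Gb: "\<bar>G e\<bar> <= real n * 4" for e unfolding G_def by (rule abs_sum_adj_le) (use gb4 in auto)
  have iG: "integrable (EM n) (%e. (G e)\<^sup>2)"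
    by (rule E.integrable_bounded[where B="(n * 4)\<^sup>2"]) (use Gm abs_square_le[OF Gb] in auto)
  have "(\<integral>e. (SS n (x, e) - AA n x + DD n x / 2 - KK n (x, e))\<^sup>2 \<partial>EM n) <= (\<integral>e. 2 * (G e)\<^sup>2 + 32 \<partial>EM n)"
  proof (rule integral_mono)
    have m1: "(%e. SS n (x, e)) \<in> borel_measurable (EM n)" "(%e. KK n (x, e)) \<in> borel_measurable (EM n)"
      using measurable_compose[OF measurable_Pair1'[OF x] SS_meas] measurable_compose[OF measurable_Pair1'[OF x] KK_meas]
      by auto
    show "integrable (EM n) (%e. (SS n (x, e) - AA n x + DD n x / 2 - KK n (x, e))\<^sup>2)"
    proof (rule E.integrable_bounded[where B="2 * (n * 4)\<^sup>2 + 32"])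
      show "(%e. (SS n (x, e) - AA n x + DD n x / 2 - KK n (x, e))\<^sup>2) \<in> borel_measurable (EM n)"
        using m1 by measurable
      show "norm ((SS n (x, e) - AA n x + DD n x / 2 - KK n (x, e))\<^sup>2) <= 2 * (n * 4)\<^sup>2 + 32" for e
        using le[of e] abs_square_le[OF Gb[of e]] by simp
    qed
  qed (use iG le in auto)
  also have "\<dots> = 2 * (\<integral>e. (G e)\<^sup>2 \<partial>EM n) + 32" using iG by (simp add: E.prob_space)
  finally show ?thesis using G2 by simp
qed

text \<open>Efron-Stein with index \<open>j\<close> deleted from the ordered list. The change is at
  most 4 times the \<open>md\<close>-length \<open>s j\<close> of the pairs at \<open>j\<close>; as
  this length is at most 2, the square is at most \<open>32 * s j\<close>, and summation over
  \<open>j\<close> counts each pair twice.\<close>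

lemma DD_variance:
  "(\<integral>x. (DD n x - (\<integral>x. DD n x \<partial>XM n))\<^sup>2 \<partial>XM n) <= 64 * (\<integral>x. MD n x \<partial>XM n)"
proof -
  interpret X: prob_space "XM n" by (rule prob_XM)
  define W where "W j x = (\<Sum>p\<in>adj (filter (%i. i ~= j) (ord_list n x)). dd (x (fst p)) (x (snd p)))"
    for j and x :: "nat => real"
  define s where "s j x = (\<Sum>p\<in>adj_at j (ord_list n x). md (x (fst p)) (x (snd p)))" for j and x :: "nat => real"
  have filt: "(%x. filter (%i. i ~= j) (ord_list n x)) \<in> measurable (XM n) (count_space UNIV)" for j
    by (rule measurable_compose[OF meas_ord(1)]) simp
  have Wm: "W j \<in> borel_measurable (XM n)" for j
    unfolding W_def
    by (rule measurable_adj_sum[OF filt, where I="{1..n}"]) (auto intro!: dd_meas' meas_comp)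
  have Wb: "\<bar>W j x\<bar> <= 2 * n" for j x
  proof -
    have "\<bar>W j x\<bar> <= (\<Sum>p\<in>adj (filter (%i. i ~= j) (ord_list n x)). \<bar>dd (x (fst p)) (x (snd p))\<bar>)"
      unfolding W_def by (rule sum_abs)
    also have "\<dots> <= real (card (adj (filter (%i. i ~= j) (ord_list n x)))) * 2"
    proof (rule sum_bounded_above)
      fix p show "\<bar>dd (x (fst p)) (x (snd p))\<bar> <= 2"
        using dd_le_md[of "x (fst p)" "x (snd p)"] md_01[of "x (fst p)" "x (snd p)"] by linarith
    qed
    also have "\<dots> <= real n * 2"
      using card_adj_le[of "filter (%i. i ~= j) (ord_list n x)"] length_filter_le[of "%i. i ~= j" "ord_list n x"]
      by (intro mult_right_mono) auto
    finally show ?thesis by simp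
  qed
  have s0: "0 <= s j x" and s2: "s j x <= 2" for j x
  proof -
    show "0 <= s j x" unfolding s_def by (rule sum_nonneg) (use md_01 in auto)
    show "s j x <= 2" unfolding s_def
      using sum_adj_at_le[of "ord_list n x" "%p. md (x (fst p)) (x (snd p))" 1 j] md_01 by simp
  qed
  have diff: "(DD n x - W j x)\<^sup>2 <= 32 * s j x" for j x
  proof -
    have "\<bar>DD n x - W j x\<bar> <= 2 * 2 * s j x"
      unfolding DD_def W_def s_def
    proof (rule sum_adj_remove_le)
      show "md (x (fst (a, b))) (x (snd (a, b))) <= md (x (fst (a, j))) (x (snd (a, j))) + md (x (fst (j, b))) (x (snd (j, b)))" for a b
        using md_triangle by simp
    qed (use dd_le_md in auto)
    then have "(DD n x - W j x)\<^sup>2 <= (4 * s j x)\<^sup>2" by (intro abs_square_le) simp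
    also have "\<dots> = 16 * (s j x * s j x)" by (simp add: power2_eq_square)
    also have "\<dots> <= 16 * (s j x * 2)" using s0[of j x] s2[of j x] by (intro mult_left_mono) auto
    finally show ?thesis by simp
  qed
  have sm: "s j \<in> borel_measurable (XM n)" for j
  proof -
    have eq: "s j x = (\<Sum>p\<in>adj (ord_list n x). if fst p = j \<or> snd p = j then md (x (fst p)) (x (snd p)) else 0)" for x
      unfolding s_def adj_at_def by (rule sum.inter_filter) simp
    show ?thesis unfolding eq
      by (rule meas_adj_XM) (auto intro!: md_meas' meas_comp)
  qed
  have si: "integrable (XM n) (s j)" for j
    by (rule X.integrable_bounded[where B=2]) (use sm s0 s2 in auto)
  have Di: "integrable (XM n) (DD n)"
    by (rule X.integrable_bounded[where B="2 * n"]) (use DD_meas DD_bound in auto)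
  have D2i: "integrable (XM n) (%x. (DD n x)\<^sup>2)"
    by (rule X.integrable_bounded[where B="(2 * n)\<^sup>2"]) (use DD_meas abs_square_le[OF DD_bound] in auto)
  have DWi: "integrable (XM n) (%x. (DD n x - W j x)\<^sup>2)" for j
  proof (rule X.integrable_bounded[where B="64"])
    show "(%x. (DD n x - W j x)\<^sup>2) \<in> borel_measurable (XM n)"
      using DD_meas Wm by measurable
    show "norm ((DD n x - W j x)\<^sup>2) <= 64" for x using diff[of x j] s2[of j x] by simp
  qed
  have "(\<integral>x. (DD n x - (\<integral>x. DD n x \<partial>XM n))\<^sup>2 \<partial>XM n) = (\<integral>x. (DD n x)\<^sup>2 \<partial>XM n) - (\<integral>x. DD n x \<partial>XM n)\<^sup>2"
    by (rule X.variance_eq[OF Di D2i])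
  also have "\<dots> <= (\<Sum>j\<in>{1..n}. \<integral>x. (DD n x - W j x)\<^sup>2 \<partial>XM n)"
  proof (rule efron_stein[where B="2 * n"])
    fix i x v assume "i \<in> {1..n}" "x \<in> space (XM n)"
    show "W i (x(i := v)) = W i x"
      unfolding W_def filter_ord_list_upd
    proof (rule sum.cong[OF refl])
      fix p assume "p \<in> adj (filter (%k. k ~= i) (ord_list n x))"
      then show "dd ((x(i := v)) (fst p)) ((x(i := v)) (snd p)) = dd (x (fst p)) (x (snd p))"
        using adj_in_set(1,3)[of p "filter (%k. k ~= i) (ord_list n x)"] by auto
    qed
  qed (use prob_mu DD_meas DD_bound Wm Wb in auto)
  also have "\<dots> <= (\<Sum>j\<in>{1..n}. \<integral>x. 32 * s j x \<partial>XM n)"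
    by (intro sum_mono integral_mono DWi diff integrable_mult_right si)
  also have "\<dots> = (\<integral>x. (\<Sum>j\<in>{1..n}. 32 * s j x) \<partial>XM n)"
    using si by (intro Bochner_Integration.integral_sum[symmetric]) auto
  also have "\<dots> = (\<integral>x. 64 * MD n x \<partial>XM n)"
  proof (rule Bochner_Integration.integral_cong[OF refl])
    fix x
    have "(\<Sum>j\<in>{1..n}. s j x) = 2 * MD n x"
      unfolding s_def MD_def by (rule sum_sum_adj_at) auto
    then show "(\<Sum>j\<in>{1..n}. 32 * s j x) = 64 * MD n x" by (simp add: sum_distrib_left[symmetric])
  qed
  finally show ?thesis by simp
qed

text \<open>Combines \<open>residual_square\<close> with the concentration of \<open>DD\<close>, so
  that the random bias is replaced by its mean. On both sides \<open>c2\<close> merely centres; it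
  cancels in the difference.\<close>

lemma linearization:
  "(\<integral>z. \<bar>(SS n z - n * c2 + (\<integral>x. DD n x \<partial>XM n) / 2) - (AA n (fst z) - n * c2 + KK n z)\<bar> \<partial>PM n)
    <= sqrt (128 * (\<integral>x. MD n x \<partial>XM n) + 32) + sqrt (64 * (\<integral>x. MD n x \<partial>XM n)) / 2"
  "integrable (PM n) (%z. \<bar>(SS n z - n * c2 + (\<integral>x. DD n x \<partial>XM n) / 2) - (AA n (fst z) - n * c2 + KK n z)\<bar>)"
proof -
  interpret X: prob_space "XM n" by (rule prob_XM)
  interpret P: prob_space "PM n" by (rule prob_PM)
  define R where "R z = SS n z - AA n (fst z) + DD n (fst z) / 2 - KK n z" for z
  define D where "D x = DD n x - (\<integral>x. DD n x \<partial>XM n)" for x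
  note fm = fst_meas[OF AA_meas] fst_meas[OF DD_meas] SS_meas KK_meas
  have Rm: "R \<in> borel_measurable (PM n)" unfolding R_def using fm by measurable
  have Rb: "\<bar>R z\<bar> <= 8 * n" for z
    unfolding R_def using SS_bound[of n z] AA_bound[of n "fst z"] DD_bound[of n "fst z"] KK_bound[of n z] by linarith
  have MDi: "integrable (XM n) (MD n)"
    by (rule X.integrable_bounded[where B=n]) (use MD_meas MD_bound in auto)
  have "(\<integral>z. (R z)\<^sup>2 \<partial>PM n) <= (\<integral>x. 128 * MD n x + 32 \<partial>XM n)"
  proof (rule PM_integral_mono)
    show "(%z. (R z)\<^sup>2) \<in> borel_measurable (PM n)" using Rm by measurable
    show "\<bar>(R z)\<^sup>2\<bar> <= (8 * n)\<^sup>2" for z using abs_square_le[OF Rb] by simp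
    show "(\<integral>e. (R (x, e))\<^sup>2 \<partial>EM n) <= 128 * MD n x + 32" if "x \<in> space (XM n)" for x
      using residual_square[OF that] by (simp add: R_def)
  qed (use MDi in auto)
  also have "\<dots> = 128 * (\<integral>x. MD n x \<partial>XM n) + 32" using MDi by (simp add: X.prob_space)
  finally have 1: "(\<integral>z. \<bar>R z\<bar> \<partial>PM n) <= sqrt (128 * (\<integral>x. MD n x \<partial>XM n) + 32)"
    by (rule P.abs_integral_le_sqrt[OF Rm Rb])
  have Dm: "D \<in> borel_measurable (XM n)" unfolding D_def using DD_meas by measurable
  have Db: "\<bar>D x\<bar> <= 4 * n" for x
  proof -
    have "\<bar>\<integral>x. DD n x \<partial>XM n\<bar> <= 2 * n" by (rule X.abs_integral_bounded) (use DD_bound in auto)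
    then show ?thesis unfolding D_def using DD_bound[of n x] by linarith
  qed
  have "(\<integral>x. \<bar>D x\<bar> \<partial>XM n) <= sqrt (64 * (\<integral>x. MD n x \<partial>XM n))"
    by (rule X.abs_integral_le_sqrt[OF Dm Db]) (use DD_variance in \<open>simp add: D_def\<close>)
  moreover have "(\<integral>z. \<bar>D (fst z)\<bar> \<partial>PM n) = (\<integral>x. \<bar>D x\<bar> \<partial>XM n)"
    by (rule PM_integral_fst[where g="%x. \<bar>D x\<bar>" and B="4 * n"]) (use Dm Db in auto)
  ultimately have 2: "(\<integral>z. \<bar>D (fst z)\<bar> \<partial>PM n) <= sqrt (64 * (\<integral>x. MD n x \<partial>XM n))" by simp
  have iR: "integrable (PM n) (%z. \<bar>R z\<bar>)"
    by (rule P.integrable_bounded[where B="8 * n"]) (use Rm Rb in auto)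
  have iD: "integrable (PM n) (%z. \<bar>D (fst z)\<bar>)"
    by (rule P.integrable_bounded[where B="4 * n"]) (use fst_meas[OF Dm] Db in auto)
  have eq: "(SS n z - n * c2 + (\<integral>x. DD n x \<partial>XM n) / 2) - (AA n (fst z) - n * c2 + KK n z) = R z - D (fst z) / 2" for z
    unfolding R_def D_def by (simp add: field_simps)
  have mm: "(%z. \<bar>R z - D (fst z) / 2\<bar>) \<in> borel_measurable (PM n)"
    using Rm fst_meas[OF Dm] by measurable
  have tri: "\<bar>R z - D (fst z) / 2\<bar> <= \<bar>R z\<bar> + \<bar>D (fst z)\<bar> / 2" for z by linarith
  show i: "integrable (PM n) (%z. \<bar>(SS n z - n * c2 + (\<integral>x. DD n x \<partial>XM n) / 2) - (AA n (fst z) - n * c2 + KK n z)\<bar>)"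
    unfolding eq
  proof (rule P.integrable_bounded[OF mm, where B="10 * n"])
    show "norm \<bar>R z - D (fst z) / 2\<bar> <= 10 * n" for z
      using tri[of z] Rb[of z] Db[of "fst z"] by simp
  qed
  have "(\<integral>z. \<bar>R z - D (fst z) / 2\<bar> \<partial>PM n) <= (\<integral>z. \<bar>R z\<bar> + \<bar>D (fst z)\<bar> / 2 \<partial>PM n)"
    by (rule integral_mono) (use i[unfolded eq] iR iD tri in auto)
  also have "\<dots> = (\<integral>z. \<bar>R z\<bar> \<partial>PM n) + (\<integral>z. \<bar>D (fst z)\<bar> \<partial>PM n) / 2" using iR iD by simp
  finally show "(\<integral>z. \<bar>(SS n z - n * c2 + (\<integral>x. DD n x \<partial>XM n) / 2) - (AA n (fst z) - n * c2 + KK n z)\<bar> \<partial>PM n)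
    <= sqrt (128 * (\<integral>x. MD n x \<partial>XM n) + 32) + sqrt (64 * (\<integral>x. MD n x \<partial>XM n)) / 2"
    unfolding eq using 1 2 by simp
qed

end

section \<open>The Gaussian limit\<close>

context rank_kernel
begin

lemma VV_nonneg: "0 <= VV"
  unfolding VV_def by (intro add_nonneg_nonneg Bochner_Integration.integral_nonneg) auto

lemma c2_bounds: "0 <= c2" "c2 <= 2"
proof -
  show "0 <= c2" unfolding c2_def by (rule Bochner_Integration.integral_nonneg) (rule aa_bounds)
  have "\<bar>c2\<bar> <= 2" unfolding c2_def by (rule mu.abs_integral_bounded) (use aa_bounds in auto)
  then show "c2 <= 2" by simp
qed

lemma aa_c2_bound: "\<bar>aa a - c2\<bar> <= 2"
  using aa_bounds[of a] c2_bounds by linarith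

text \<open>The sum of squared increments is close to \<open>n * VV\<close> in mean, which is the
  input for \<open>char_bound_mcleish\<close>. The squares are bounded by 4 and 9, whence
  \<open>62 = 2 * 4 + 6 * 9\<close> and the constant 9.\<close>

lemma quadratic_lln:
  "(\<integral>z. \<bar>(\<Sum>i\<in>{1..n}. (aa (fst z i) - c2)\<^sup>2) + (\<Sum>p\<in>adj (ord_list n (fst z)). (kk (fst z (snd p)) (snd z (fst p)) (snd z (snd p)))\<^sup>2)
     - n * VV\<bar> \<partial>PM n) <= 62 * sqrt n + 9"
  "(%z. (\<Sum>i\<in>{1..n}. (aa (fst z i) - c2)\<^sup>2) + (\<Sum>p\<in>adj (ord_list n (fst z)). (kk (fst z (snd p)) (snd z (fst p)) (snd z (snd p)))\<^sup>2)) \<in> borel_measurable (PM n)"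
proof -
  interpret X: prob_space "XM n" by (rule prob_XM)
  interpret P: prob_space "PM n" by (rule prob_PM)
  define A where "A x = (\<Sum>i\<in>{1..n}. (aa (x i) - c2)\<^sup>2)" for x :: "nat => real"
  define B where "B z = (\<Sum>p\<in>adj (ord_list n (fst z)). (kk (fst z (snd p)) (snd z (fst p)) (snd z (snd p)))\<^sup>2)"
    for z :: "(nat => real) \<times> (nat => real)"
  define vA where "vA = (\<integral>a. (aa a - c2)\<^sup>2 \<partial>\<mu>)"
  define vB where "vB = (\<integral>a. \<integral>e. \<integral>e'. (kk a e e')\<^sup>2 \<partial>\<nu> \<partial>\<nu> \<partial>\<mu>)"
  have am: "(%a. (aa a - c2)\<^sup>2) \<in> borel_measurable borel" by measurable
  have ab: "\<bar>(aa a - c2)\<^sup>2\<bar> <= 4" for a using abs_square_le[OF aa_c2_bound[of a]] by simp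
  have km: "(%(a, e, e'). (kk a e e')\<^sup>2) \<in> borel_measurable (borel \<Otimes>\<^sub>M borel \<Otimes>\<^sub>M borel)"
    using borel_measurable_power[OF kk_meas, of 2] by (simp add: case_prod_beta')
  have kb: "\<bar>(kk a e e')\<^sup>2\<bar> <= 9" for a e e' using abs_square_le[OF kk_bound[of a e e']] by simp
  have A1: "(\<integral>x. \<bar>A x - n * vA\<bar> \<partial>XM n) <= 2 * 4 * sqrt n"
    unfolding A_def vA_def by (rule iid_lln[OF am ab])
  have B1: "(\<integral>z. \<bar>B z - n * vB\<bar> \<partial>PM n) <= 6 * 9 * sqrt n + 9" and Bm: "B \<in> borel_measurable (PM n)"
    unfolding B_def vB_def by (rule chain_lln(2)[OF km kb], rule chain_lln(1)[OF km kb])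
  have Am: "A \<in> borel_measurable (XM n)"
    unfolding A_def by (intro borel_measurable_sum measurable_compose[OF meas_comp(1) am])
  have Ab: "\<bar>A x\<bar> <= n * 4" for x
  proof -
    have "\<bar>A x\<bar> <= (\<Sum>i\<in>{1..n}. \<bar>(aa (x i) - c2)\<^sup>2\<bar>)" unfolding A_def by (rule sum_abs)
    also have "\<dots> <= of_nat (card {1..n}) * 4" by (rule sum_bounded_above) (rule ab)
    finally show ?thesis by simp
  qed
  have Bb: "\<bar>B z\<bar> <= real n * 9" for z unfolding B_def by (rule abs_sum_adj_le) (use kb in auto)
  have iA: "integrable (PM n) (%z. \<bar>A (fst z) - n * vA\<bar>)"
  proof (rule P.integrable_bounded[where B="n * 4 + \<bar>n * vA\<bar>"])
    show "(%z. \<bar>A (fst z) - n * vA\<bar>) \<in> borel_measurable (PM n)" using fst_meas[OF Am] by measurable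
    show "norm \<bar>A (fst z) - n * vA\<bar> <= n * 4 + \<bar>n * vA\<bar>" for z
      using Ab[of "fst z"] abs_triangle_ineq4[of "A (fst z)" "n * vA"] by simp
  qed
  have iB: "integrable (PM n) (%z. \<bar>B z - n * vB\<bar>)"
  proof (rule P.integrable_bounded[where B="n * 9 + \<bar>n * vB\<bar>"])
    show "(%z. \<bar>B z - n * vB\<bar>) \<in> borel_measurable (PM n)" using Bm by measurable
    show "norm \<bar>B z - n * vB\<bar> <= n * 9 + \<bar>n * vB\<bar>" for z
      using Bb[of z] abs_triangle_ineq4[of "B z" "n * vB"] by simp
  qed
  have A2: "(\<integral>z. \<bar>A (fst z) - n * vA\<bar> \<partial>PM n) = (\<integral>x. \<bar>A x - n * vA\<bar> \<partial>XM n)"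
  proof (rule PM_integral_fst[where g="%x. \<bar>A x - n * vA\<bar>" and B="n * 4 + \<bar>n * vA\<bar>"])
    show "(%x. \<bar>A x - n * vA\<bar>) \<in> borel_measurable (XM n)" using Am by measurable
    show "\<bar>\<bar>A x - n * vA\<bar>\<bar> <= n * 4 + \<bar>n * vA\<bar>" for x
      using Ab[of x] abs_triangle_ineq4[of "A x" "n * vA"] by simp
  qed
  have m: "(%z. A (fst z) + B z) \<in> borel_measurable (PM n)" using fst_meas[OF Am] Bm by measurable
  then show "(%z. (\<Sum>i\<in>{1..n}. (aa (fst z i) - c2)\<^sup>2) + (\<Sum>p\<in>adj (ord_list n (fst z)). (kk (fst z (snd p)) (snd z (fst p)) (snd z (snd p)))\<^sup>2)) \<in> borel_measurable (PM n)"
    by (simp add: A_def B_def)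
  have V: "n * VV = n * vA + n * vB" by (simp add: VV_def vA_def vB_def distrib_left)
  have le: "\<bar>A (fst z) + B z - n * VV\<bar> <= \<bar>A (fst z) - n * vA\<bar> + \<bar>B z - n * vB\<bar>" for z
    unfolding V by linarith
  have "(\<integral>z. \<bar>A (fst z) + B z - n * VV\<bar> \<partial>PM n) <= (\<integral>z. \<bar>A (fst z) - n * vA\<bar> + \<bar>B z - n * vB\<bar> \<partial>PM n)"
  proof (rule integral_mono)
    show "integrable (PM n) (%z. \<bar>A (fst z) + B z - n * VV\<bar>)"
      by (rule Bochner_Integration.integrable_bound[OF Bochner_Integration.integrable_add[OF iA iB]])
        (use m le in \<open>auto intro!: AE_I2 intro: order_trans\<close>)
  qed (use iA iB le in auto)
  also have "\<dots> <= 2 * 4 * sqrt n + (6 * 9 * sqrt n + 9)" using iA iB A1 A2 B1 by simp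
  finally show "(\<integral>z. \<bar>(\<Sum>i\<in>{1..n}. (aa (fst z i) - c2)\<^sup>2) + (\<Sum>p\<in>adj (ord_list n (fst z)). (kk (fst z (snd p)) (snd z (fst p)) (snd z (snd p)))\<^sup>2)
     - n * VV\<bar> \<partial>PM n) <= 62 * sqrt n + 9"
    by (simp add: A_def B_def)
qed

lemma kkz_meas:
  assumes "i \<in> {1..n}" "j \<in> {1..n}"
  shows "(%z. kk (fst z j) (snd z i) (snd z j)) \<in> borel_measurable (PM n)"
proof -
  have "(%z. (fst z j, snd z i, snd z j)) \<in> measurable (PM n) (borel \<Otimes>\<^sub>M borel \<Otimes>\<^sub>M borel)"
    using assms by (intro measurable_Pair meas_comp)
  from measurable_compose[OF this kk_meas] show ?thesis by simp
qed

text \<open>Noises are integrated first: at a fixed design the product over pairs has mean one by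
  \<open>integral_adj_prod\<close>. The other product involves positions only and factorises into
  means equal to one, since \<open>aa - c2\<close> is centred.\<close>

lemma prod_mean_one:
  fixes c :: real
  shows "(\<integral>z. (\<Prod>i\<in>{1..n}. 1 + \<i> * complex_of_real (c * (aa (fst z i) - c2))) *
    (\<Prod>p\<in>adj (ord_list n (fst z)). 1 + \<i> * complex_of_real (c * kk (fst z (snd p)) (snd z (fst p)) (snd z (snd p)))) \<partial>PM n) = 1"
    (is "(\<integral>z. ?F z \<partial>PM n) = 1")
  and "(%z. (\<Prod>p\<in>adj (ord_list n (fst z)). 1 + \<i> * complex_of_real (c * kk (fst z (snd p)) (snd z (fst p)) (snd z (snd p)))))
    \<in> borel_measurable (PM n)" (is "?G \<in> _")
proof -
  interpret X: prob_space "XM n" by (rule prob_XM)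
  interpret E: prob_space "EM n" by (rule prob_EM)
  interpret P: product_sigma_finite "%_. \<mu>" by (rule product_sigma_finite) (rule prob_mu)
  define A where "A x = (\<Prod>i\<in>{1..n}. 1 + \<i> * complex_of_real (c * (aa (x i) - c2)))" for x :: "nat => real"
  have Gm: "?G \<in> borel_measurable (PM n)"
  proof -
    have g: "(%z. ord_list n (fst z)) \<in> measurable (PM n) (count_space (lists {1..n}))"
      by (rule measurable_count_space_extend[OF subset_UNIV _ meas_ord(2)]) (auto simp: in_lists_conv_set)
    show ?thesis
    proof (rule measurable_compose_countable'[OF _ g])
      fix l assume l: "l \<in> lists {1..n::nat}"
      show "(%z. \<Prod>p\<in>adj l. 1 + \<i> * complex_of_real (c * kk (fst z (snd p)) (snd z (fst p)) (snd z (snd p)))) \<in> borel_measurable (PM n)"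
      proof (rule borel_measurable_prod)
        fix p assume p: "p \<in> adj l"
        then have "fst p \<in> {1..n}" "snd p \<in> {1..n}" using adj_in_set[OF p] l by (auto simp: in_lists_conv_set)
        then have [measurable]: "(%z. kk (fst z (snd p)) (snd z (fst p)) (snd z (snd p))) \<in> borel_measurable (PM n)"
          by (rule kkz_meas)
        show "(%z. 1 + \<i> * complex_of_real (c * kk (fst z (snd p)) (snd z (fst p)) (snd z (snd p)))) \<in> borel_measurable (PM n)"
          by measurable
      qed
    qed simp
  qed
  then show "?G \<in> borel_measurable (PM n)" .
  have Am: "A \<in> borel_measurable (XM n)"
    unfolding A_def
  proof (rule borel_measurable_prod)
    fix i assume "i \<in> {1..n}"
    then have "(%x. aa (x i)) \<in> borel_measurable (XM n)"
      using measurable_compose[OF meas_comp(1) aa_meas] by simp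
    then show "(%x. 1 + \<i> * complex_of_real (c * (aa (x i) - c2))) \<in> borel_measurable (XM n)" by measurable
  qed
  have Fm: "?F \<in> borel_measurable (PM n)"
    by (rule borel_measurable_times[OF measurable_compose[OF measurable_fst Am[unfolded A_def]] Gm])
  have n1: "norm (1 + \<i> * complex_of_real (c * t)) <= 1 + \<bar>c\<bar> * 3" if "\<bar>t\<bar> <= 3" for t
  proof -
    have "norm (1 + \<i> * complex_of_real (c * t)) <= 1 + \<bar>c * t\<bar>"
      by (rule order_trans[OF norm_triangle_ineq]) (simp add: norm_mult)
    also have "\<dots> <= 1 + \<bar>c\<bar> * 3" using that by (simp add: abs_mult mult_left_mono)
    finally show ?thesis .
  qed
  have Ab: "norm (A x) <= (1 + \<bar>c\<bar> * 3) ^ n" for x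
  proof -
    have "norm (A x) <= (\<Prod>i\<in>{1..n}. 1 + \<bar>c\<bar> * 3)"
      unfolding A_def prod_norm[symmetric]
    proof (rule prod_mono)
      fix i
      have "\<bar>aa (x i) - c2\<bar> <= 3" using aa_c2_bound[of "x i"] by simp
      then show "0 <= norm (1 + \<i> * complex_of_real (c * (aa (x i) - c2))) \<and>
          norm (1 + \<i> * complex_of_real (c * (aa (x i) - c2))) <= 1 + \<bar>c\<bar> * 3"
        by (intro conjI norm_ge_zero n1)
    qed
    then show ?thesis by simp
  qed
  have Gb: "norm (?G z) <= (1 + \<bar>c\<bar> * 3) ^ n" for z
  proof -
    have "norm (?G z) <= (\<Prod>p\<in>adj (ord_list n (fst z)). 1 + \<bar>c\<bar> * 3)"
      unfolding prod_norm[symmetric] using n1 kk_bound by (intro prod_mono) auto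
    also have "\<dots> = (1 + \<bar>c\<bar> * 3) ^ card (adj (ord_list n (fst z)))" by simp
    also have "\<dots> <= (1 + \<bar>c\<bar> * 3) ^ n" by (rule power_increasing) (use card_adj_ord_list in auto)
    finally show ?thesis .
  qed
  have "(\<integral>z. ?F z \<partial>PM n) = (\<integral>x. \<integral>e. ?F (x, e) \<partial>EM n \<partial>XM n)"
  proof (rule PM_iterate[OF Fm, where B="(1 + \<bar>c\<bar> * 3) ^ n * (1 + \<bar>c\<bar> * 3) ^ n"])
    fix z :: "(nat => real) \<times> (nat => real)"
    show "norm (?F z) <= (1 + \<bar>c\<bar> * 3) ^ n * (1 + \<bar>c\<bar> * 3) ^ n"
      unfolding norm_mult by (rule mult_mono) (use Ab[of "fst z"] Gb[of z] in \<open>auto simp: A_def\<close>)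
  qed
  also have "\<dots> = (\<integral>x. A x \<partial>XM n)"
  proof (rule Bochner_Integration.integral_cong[OF refl])
    fix x assume x: "x \<in> space (XM n)"
    let ?l = "ord_list n x"
    have "(\<integral>e. ?F (x, e) \<partial>EM n) = A x * (\<integral>e. ?G (x, e) \<partial>EM n)"
      unfolding A_def by simp
    also have "(\<integral>e. ?G (x, e) \<partial>EM n) = 1"
      unfolding fst_conv snd_conv
    proof (rule integral_adj_prod[where B="\<bar>c\<bar> * 3"])
      fix p assume p: "p \<in> adj ?l"
      show "(%e. c * kk (x (snd p)) (e (fst p)) (e (snd p))) \<in> borel_measurable (EM n)"
      proof -
        have "(%e. kk (fst (x, e) (snd p)) (snd (x, e) (fst p)) (snd (x, e) (snd p))) \<in> borel_measurable (EM n)"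
          using adj_ord_list[OF p] by (intro measurable_compose[OF measurable_Pair1'[OF x] kkz_meas]) auto
        then show ?thesis unfolding fst_conv snd_conv by (rule borel_measurable_times[OF borel_measurable_const])
      qed
      show "\<bar>c * kk (x (snd p)) (e (fst p)) (e (snd p))\<bar> <= \<bar>c\<bar> * 3" for e
        using kk_bound by (simp add: abs_mult mult_left_mono)
      show "(\<integral>v. c * kk (x (snd p)) ((e(snd p := v)) (fst p)) ((e(snd p := v)) (snd p)) \<partial>\<nu>) = 0" for e
        using adj_ord_list[OF p] by (simp add: kk_mean_zero)
    qed (use prob_nu in auto)
    finally show "(\<integral>e. ?F (x, e) \<partial>EM n) = A x" by simp
  qed
  also have "\<dots> = (\<Prod>i\<in>{1..n}. \<integral>a. 1 + \<i> * complex_of_real (c * (aa a - c2)) \<partial>\<mu>)"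
    unfolding A_def
  proof (rule P.product_integral_prod)
    show "integrable \<mu> (%a. 1 + \<i> * complex_of_real (c * (aa a - c2)))"
    proof (rule mu.integrable_bounded[where B="1 + \<bar>c\<bar> * 3"])
      show "norm (1 + \<i> * complex_of_real (c * (aa a - c2))) <= 1 + \<bar>c\<bar> * 3" for a
        by (rule n1) (use aa_c2_bound[of a] in simp)
    qed measurable
  qed simp
  also have "(\<integral>a. 1 + \<i> * complex_of_real (c * (aa a - c2)) \<partial>\<mu>) = 1"
  proof -
    have ia: "integrable \<mu> aa" by (rule mu.integrable_bounded[where B=2]) (use aa_bounds in auto)
    then have z: "(\<integral>a. c * (aa a - c2) \<partial>\<mu>) = 0" by (simp add: c2_def mu.prob_space[simplified])
    have "(\<integral>a. 1 + \<i> * complex_of_real (c * (aa a - c2)) \<partial>\<mu>) = 1 + \<i> * complex_of_real (\<integral>a. c * (aa a - c2) \<partial>\<mu>)"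
      unfolding integral_complex_of_real[symmetric] using ia
      by (subst Bochner_Integration.integral_add) (auto simp: mu.prob_space[simplified])
    then show ?thesis by (simp only: z) simp
  qed
  finally show "(\<integral>z. ?F z \<partial>PM n) = 1" by simp
qed

text \<open>The increments are bounded by 3 times the modulus of \<open>s / sqrt n\<close>; the
  hypothesis on \<open>s\<close> makes this at most one.\<close>

lemma char_WW_bound:
  assumes n: "n \<ge> 1" and s: "9 * s\<^sup>2 <= real n"
  shows "norm ((\<integral>z. iexp (s / sqrt n * (AA n (fst z) - n * c2 + KK n z)) \<partial>PM n) - complex_of_real (exp (-(s\<^sup>2 * VV / 2))))
    <= 2 * (2 * real n) * (3 * \<bar>s\<bar> / sqrt n) ^ 3 + exp (2 * real n * (3 * \<bar>s\<bar> / sqrt n)\<^sup>2 / 2) / 2 * (s\<^sup>2 / real n * (62 * sqrt n + 9))"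
proof -
  interpret P: prob_space "PM n" by (rule prob_PM)
  define c where "c = s / sqrt n"
  define J where "J = {1..n} <+> {1..n} \<times> {1..n}"
  define \<zeta> where "\<zeta> j z = (case j of Inl i => c * (aa (fst z i) - c2)
      | Inr p => if p \<in> adj (ord_list n (fst z)) then c * kk (fst z (snd p)) (snd z (fst p)) (snd z (snd p)) else 0)"
    for j :: "nat + nat \<times> nat" and z :: "(nat => real) \<times> (nat => real)"
  have J: "finite J" by (simp add: J_def)
  have adjI: "adj (ord_list n x) \<subseteq> {1..n} \<times> {1..n}" for x
    using adj_ord_list by fastforce
  have rest: "(\<Sum>p\<in>{1..n} \<times> {1..n}. if p \<in> adj (ord_list n x) then h p else 0) = (\<Sum>p\<in>adj (ord_list n x). h p)"
    for x and h :: "nat \<times> nat => real"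
    using adjI[of x] by (intro sum.mono_neutral_cong_right) auto
  have restp: "(\<Prod>p\<in>{1..n} \<times> {1..n}. if p \<in> adj (ord_list n x) then h p else 1) = (\<Prod>p\<in>adj (ord_list n x). h p)"
    for x and h :: "nat \<times> nat => complex"
    using adjI[of x] by (intro prod.mono_neutral_cong_right) auto
  have sum\<zeta>: "(\<Sum>j\<in>J. \<zeta> j z) = c * (AA n (fst z) - n * c2 + KK n z)" for z
  proof -
    have "(\<Sum>j\<in>J. \<zeta> j z) = (\<Sum>i\<in>{1..n}. c * (aa (fst z i) - c2)) +
        (\<Sum>p\<in>adj (ord_list n (fst z)). c * kk (fst z (snd p)) (snd z (fst p)) (snd z (snd p)))"
      unfolding J_def by (subst sum.Plus) (auto simp: \<zeta>_def rest)
    then show ?thesis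
      by (simp add: AA_def KK_def sum_distrib_left[symmetric] sum_subtractf distrib_left)
  qed
  have sq\<zeta>: "(\<Sum>j\<in>J. (\<zeta> j z)\<^sup>2) = c\<^sup>2 * ((\<Sum>i\<in>{1..n}. (aa (fst z i) - c2)\<^sup>2) +
        (\<Sum>p\<in>adj (ord_list n (fst z)). (kk (fst z (snd p)) (snd z (fst p)) (snd z (snd p)))\<^sup>2))" for z
  proof -
    have "(\<Sum>j\<in>J. (\<zeta> j z)\<^sup>2) = (\<Sum>i\<in>{1..n}. (c * (aa (fst z i) - c2))\<^sup>2) +
        (\<Sum>p\<in>{1..n} \<times> {1..n}. if p \<in> adj (ord_list n (fst z)) then (c * kk (fst z (snd p)) (snd z (fst p)) (snd z (snd p)))\<^sup>2 else 0)"
      unfolding J_def by (subst sum.Plus) (auto simp: \<zeta>_def intro!: sum.cong)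
    then show ?thesis
      unfolding rest by (simp add: power_mult_distrib sum_distrib_left[symmetric] distrib_left)
  qed
  have prod\<zeta>: "(\<Prod>j\<in>J. 1 + \<i> * complex_of_real (\<zeta> j z)) = (\<Prod>i\<in>{1..n}. 1 + \<i> * complex_of_real (c * (aa (fst z i) - c2))) *
    (\<Prod>p\<in>adj (ord_list n (fst z)). 1 + \<i> * complex_of_real (c * kk (fst z (snd p)) (snd z (fst p)) (snd z (snd p))))" for z
  proof -
    have "(\<Prod>j\<in>J. 1 + \<i> * complex_of_real (\<zeta> j z)) = (\<Prod>i\<in>{1..n}. 1 + \<i> * complex_of_real (c * (aa (fst z i) - c2))) *
      (\<Prod>p\<in>{1..n} \<times> {1..n}. if p \<in> adj (ord_list n (fst z)) then 1 + \<i> * complex_of_real (c * kk (fst z (snd p)) (snd z (fst p)) (snd z (snd p))) else 1)"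
      unfolding J_def by (subst prod.Plus) (auto simp: \<zeta>_def intro!: prod.cong)
    then show ?thesis unfolding restp .
  qed
  have \<zeta>m: "\<zeta> j \<in> borel_measurable (PM n)" if "j \<in> J" for j
  proof (cases j)
    case (Inl i)
    then have "(%z. aa (fst z i)) \<in> borel_measurable (PM n)"
      using measurable_compose[OF meas_comp(3) aa_meas] that by (auto simp: J_def)
    then show ?thesis unfolding \<zeta>_def Inl by simp
  next
    case (Inr p)
    then have [measurable]: "(%z. kk (fst z (snd p)) (snd z (fst p)) (snd z (snd p))) \<in> borel_measurable (PM n)"
      using kkz_meas[of "fst p" n "snd p"] that by (auto simp: J_def)
    have [measurable]: "Measurable.pred (PM n) (%z. p \<in> adj (ord_list n (fst z)))"
      by (rule measurable_compose[OF meas_ord(2)]) simp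
    show ?thesis unfolding \<zeta>_def Inr sum.case by measurable
  qed
  have sn: "0 < sqrt (real n)" using n by simp
  have cb: "\<bar>c\<bar> = \<bar>s\<bar> / sqrt n" using sn by (simp add: c_def abs_divide)
  have c2n: "c\<^sup>2 = s\<^sup>2 / n" using n by (simp add: c_def power_divide)
  have "norm ((\<integral>z. iexp (\<Sum>j\<in>J. \<zeta> j z) \<partial>PM n) - complex_of_real (exp (-((s\<^sup>2 * VV) / 2)))) <=
      2 * (2 * real n) * (3 * \<bar>s\<bar> / sqrt n) ^ 3 + exp (2 * real n * (3 * \<bar>s\<bar> / sqrt n)\<^sup>2 / 2) / 2 * (\<integral>z. \<bar>(\<Sum>j\<in>J. (\<zeta> j z)\<^sup>2) - s\<^sup>2 * VV\<bar> \<partial>PM n)"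
  proof (rule P.char_bound_mcleish[OF J \<zeta>m])
    fix j z
    have "\<bar>\<zeta> j z\<bar> <= \<bar>c\<bar> * 3"
    proof (cases j)
      case (Inl i)
      have "\<bar>aa (fst z i) - c2\<bar> <= 3" using aa_c2_bound[of "fst z i"] by simp
      then show ?thesis by (simp add: \<zeta>_def Inl abs_mult mult_left_mono)
    next
      case (Inr p)
      show ?thesis using kk_bound by (simp add: \<zeta>_def Inr abs_mult mult_left_mono)
    qed
    then show "\<bar>\<zeta> j z\<bar> <= 3 * \<bar>s\<bar> / sqrt n" by (simp add: cb mult.commute)
  next
    have "(3 * \<bar>s\<bar>)\<^sup>2 <= (sqrt n)\<^sup>2" using s by (simp add: power_mult_distrib)
    then have "3 * \<bar>s\<bar> <= sqrt n" by (rule power2_le_imp_le) simp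
    then show "3 * \<bar>s\<bar> / sqrt n <= 1" using sn by simp
  next
    fix z
    have "{j \<in> J. \<zeta> j z ~= 0} \<subseteq> Inl ` {1..n} \<union> Inr ` adj (ord_list n (fst z))"
      by (auto simp: J_def \<zeta>_def split: if_splits)
    then have "card {j \<in> J. \<zeta> j z ~= 0} <= card (Inl ` {1..n} \<union> Inr ` adj (ord_list n (fst z)) :: (nat + nat \<times> nat) set)"
      by (intro card_mono) auto
    also have "\<dots> <= card (Inl ` {1..n} :: (nat + nat \<times> nat) set) + card (Inr ` adj (ord_list n (fst z)) :: (nat + nat \<times> nat) set)"
      by (rule card_Un_le)
    also have "\<dots> <= n + n"
      using card_adj_ord_list[of n "fst z"] by (intro add_mono order_trans[OF card_image_le]) auto
    finally show "real (card {j \<in> J. \<zeta> j z ~= 0}) <= 2 * real n" by simp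
  next
    show "(\<integral>z. (\<Prod>j\<in>J. 1 + \<i> * complex_of_real (\<zeta> j z)) \<partial>PM n) = 1"
      unfolding prod\<zeta> by (rule prod_mean_one)
  qed (use VV_nonneg in auto)
  moreover have "(\<integral>z. \<bar>(\<Sum>j\<in>J. (\<zeta> j z)\<^sup>2) - s\<^sup>2 * VV\<bar> \<partial>PM n) <= s\<^sup>2 / real n * (62 * sqrt n + 9)"
  proof -
    have eqz: "\<bar>(\<Sum>j\<in>J. (\<zeta> j z)\<^sup>2) - s\<^sup>2 * VV\<bar> = s\<^sup>2 / real n * \<bar>(\<Sum>i\<in>{1..n}. (aa (fst z i) - c2)\<^sup>2) +
        (\<Sum>p\<in>adj (ord_list n (fst z)). (kk (fst z (snd p)) (snd z (fst p)) (snd z (snd p)))\<^sup>2) - n * VV\<bar>" for z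
    proof -
      have "(\<Sum>j\<in>J. (\<zeta> j z)\<^sup>2) - s\<^sup>2 * VV = s\<^sup>2 / n * ((\<Sum>i\<in>{1..n}. (aa (fst z i) - c2)\<^sup>2) +
        (\<Sum>p\<in>adj (ord_list n (fst z)). (kk (fst z (snd p)) (snd z (fst p)) (snd z (snd p)))\<^sup>2) - n * VV)"
        unfolding sq\<zeta> c2n using n by (simp add: field_simps)
      then show ?thesis by (simp add: abs_mult)
    qed
    show ?thesis
      unfolding eqz integral_mult_right_zero by (intro mult_left_mono quadratic_lln(1)) auto
  qed
  ultimately show ?thesis
    unfolding sum\<zeta> c_def by (rule order_trans[OF _ add_left_mono[OF mult_left_mono]]) simp_all
qed

lemma char_WW_tendsto:
  "(%n. \<integral>z. iexp (s / sqrt (real n) * (AA n (fst z) - n * c2 + KK n z)) \<partial>PM n)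
    \<longlonglongrightarrow> complex_of_real (exp (-(s\<^sup>2 * VV / 2)))"
proof (rule LIM_zero_cancel, rule Lim_null_comparison)
  show "\<forall>\<^sub>F n in sequentially. norm ((\<integral>z. iexp (s / sqrt (real n) * (AA n (fst z) - n * c2 + KK n z)) \<partial>PM n)
      - complex_of_real (exp (-(s\<^sup>2 * VV / 2)))) <=
    2 * (2 * real n) * (3 * \<bar>s\<bar> / sqrt n) ^ 3 + exp (2 * real n * (3 * \<bar>s\<bar> / sqrt n)\<^sup>2 / 2) / 2 * (s\<^sup>2 / real n * (62 * sqrt n + 9))"
    using eventually_ge_at_top[of "max 1 (nat \<lceil>9 * s\<^sup>2\<rceil>)"]
  proof eventually_elim
    case (elim n)
    then have "9 * s\<^sup>2 <= real n" by linarith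
    with elim show ?case by (intro char_WW_bound) auto
  qed
  have e1: "2 * (2 * real n) * (3 * \<bar>s\<bar> / sqrt n) ^ 3 = 108 * \<bar>s\<bar> ^ 3 * (1 / sqrt n)" for n :: nat
    by (cases "n = 0") (simp_all add: power3_eq_cube field_simps)
  \<comment> \<open>The exponent does not depend on \<open>n\<close>: it is
    \<open>9 * s\<^sup>2\<close>. Hence both error terms are of order 1 / sqrt n.\<close>
  have e2: "exp (2 * real n * (3 * \<bar>s\<bar> / sqrt n)\<^sup>2 / 2) / 2 * (s\<^sup>2 / real n * (62 * sqrt n + 9)) =
      exp (9 * s\<^sup>2) / 2 * (s\<^sup>2 * (62 * (1 / sqrt n) + 9 * (1 / n)))" if "n \<ge> 1" for n :: nat
  proof -
    have "2 * real n * (3 * \<bar>s\<bar> / sqrt n)\<^sup>2 / 2 = 9 * s\<^sup>2"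
      using that by (simp add: power_divide power_mult_distrib)
    moreover have "s\<^sup>2 / real n * (62 * sqrt n + 9) = s\<^sup>2 * (62 * (sqrt n / n) + 9 * (1 / n))"
      by (simp add: algebra_simps add_divide_distrib)
    moreover have "sqrt n / n = 1 / sqrt n" using that by (simp add: field_simps)
    ultimately show ?thesis by simp
  qed
  have z: "(%n. 1 / sqrt (real n)) \<longlonglongrightarrow> 0"
    by (intro tendsto_divide_0[OF tendsto_const] filterlim_at_top_imp_at_infinity
        filterlim_compose[OF sqrt_at_top filterlim_real_sequentially])
  have "(%n. 108 * \<bar>s\<bar> ^ 3 * (1 / sqrt (real n)) + exp (9 * s\<^sup>2) / 2 * (s\<^sup>2 * (62 * (1 / sqrt (real n)) + 9 * (1 / real n))))
      \<longlonglongrightarrow> 108 * \<bar>s\<bar> ^ 3 * 0 + exp (9 * s\<^sup>2) / 2 * (s\<^sup>2 * (62 * 0 + 9 * 0))"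
    by (intro tendsto_intros z lim_1_over_n)
  then have "(%n. 108 * \<bar>s\<bar> ^ 3 * (1 / sqrt (real n)) + exp (9 * s\<^sup>2) / 2 * (s\<^sup>2 * (62 * (1 / sqrt (real n)) + 9 * (1 / real n))))
      \<longlonglongrightarrow> 0" by simp
  then show "(%n. 2 * (2 * real n) * (3 * \<bar>s\<bar> / sqrt n) ^ 3 + exp (2 * real n * (3 * \<bar>s\<bar> / sqrt n)\<^sup>2 / 2) / 2 * (s\<^sup>2 / real n * (62 * sqrt n + 9)))
      \<longlonglongrightarrow> 0"
    by (rule Lim_transform_eventually)
      (use e1 e2 in \<open>auto intro!: eventually_mono[OF eventually_ge_at_top[of 1]]\<close>)
qed

end

section \<open>The regression model\<close>

context two_laws
begin

lemma abs_mu_nu [simp]: "prob_space (\<mu> \<Otimes>\<^sub>M \<nu>)"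
proof -
  interpret pair_prob_space \<mu> \<nu> ..
  show ?thesis by (rule P.prob_space_axioms)
qed

text \<open>If the integrand ignores coordinate \<open>i\<close> of positions and noises, the
  response with index \<open>i\<close> is independent of it and may be integrated against its own
  law. The noise is resampled at a fixed design, then the position, and Fubini joins the two
  integrals.\<close>

lemma integral_resample_point:
  fixes \<Phi> :: "((nat => real) \<times> (nat => real)) => real => real" and f :: "real \<times> real => real"
  assumes i: "i \<in> {1..n}" and f [measurable]: "f \<in> borel_measurable (borel \<Otimes>\<^sub>M borel)"
    and m: "(%(z, t). \<Phi> z t) \<in> borel_measurable (PM n \<Otimes>\<^sub>M borel)"
    and b: "!!z t. \<bar>\<Phi> z t\<bar> <= B"
    and inv: "!!x e a v t. \<Phi> (x(i := a), e(i := v)) t = \<Phi> (x, e) t"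
  shows "(\<integral>z. \<Phi> z (f (fst z i, snd z i)) \<partial>PM n) = (\<integral>z. \<integral>t. \<Phi> z t \<partial>distr (\<mu> \<Otimes>\<^sub>M \<nu>) borel f \<partial>PM n)"
proof -
  interpret X: prob_space "XM n" by (rule prob_XM)
  interpret E: prob_space "EM n" by (rule prob_EM)
  interpret mn: pair_prob_space \<mu> \<nu> ..
  interpret me: pair_prob_space \<mu> "EM n" ..
  have B0: "0 <= B" using b abs_ge_zero order_trans by blast
  have fm: "f \<in> borel_measurable (\<mu> \<Otimes>\<^sub>M \<nu>)"
    using f by (simp cong: measurable_cong_sets sets_pair_measure_cong)
  have inve: "\<Phi> (x, e(i := v)) t = \<Phi> (x, e) t" for x e v t
    using inv[of x "x i" e v t] by simp
  have invx: "\<Phi> (x(i := a), e) t = \<Phi> (x, e) t" for x e a t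
    using inv[of x a e "e i" t] by simp
  have yi: "(%z. f (fst z i, snd z i)) \<in> borel_measurable (PM n)"
    by (rule measurable_compose[OF measurable_Pair[OF meas_comp(3)[OF i] meas_comp(4)[OF i]] f])
  have mz: "(%z. \<Phi> z (f (fst z i, snd z i))) \<in> borel_measurable (PM n)"
    using measurable_compose[OF measurable_Pair[OF measurable_ident yi] m] by simp
  have mza: "(%(z, a, v). \<Phi> z (f (a, v))) \<in> borel_measurable (PM n \<Otimes>\<^sub>M borel \<Otimes>\<^sub>M borel)"
  proof -
    have "(%q. (fst q, f (fst (snd q), snd (snd q)))) \<in> measurable (PM n \<Otimes>\<^sub>M borel \<Otimes>\<^sub>M borel) (PM n \<Otimes>\<^sub>M borel)"
      by measurable
    from measurable_compose[OF this m] show ?thesis by (simp add: case_prod_beta')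
  qed
  define \<Psi> where "\<Psi> z a = (\<integral>v. \<Phi> z (f (a, v)) \<partial>\<nu>)" for z a
  have Psim: "(%(z, a). \<Psi> z a) \<in> borel_measurable (PM n \<Otimes>\<^sub>M borel)"
  proof -
    have "(%q. (fst (fst q), snd (fst q), snd q)) \<in> measurable ((PM n \<Otimes>\<^sub>M borel) \<Otimes>\<^sub>M \<nu>) (PM n \<Otimes>\<^sub>M borel \<Otimes>\<^sub>M borel)"
      by measurable
    from measurable_compose[OF this mza]
    have "(%(q, v). \<Phi> (fst q) (f (snd q, v))) \<in> borel_measurable ((PM n \<Otimes>\<^sub>M borel) \<Otimes>\<^sub>M \<nu>)"
      by (simp add: case_prod_beta')
    from nu.borel_measurable_lebesgue_integral[OF this]
    show ?thesis by (simp add: \<Psi>_def case_prod_beta')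
  qed
  have Psib: "\<bar>\<Psi> z a\<bar> <= B" for z a unfolding \<Psi>_def by (rule nu.abs_integral_bounded) (use b B0 in auto)
  have Psiinv: "\<Psi> (x(i := a'), e) a = \<Psi> (x, e) a" for x e a a' unfolding \<Psi>_def invx ..
  have step1: "(\<integral>e. \<Phi> (x, e) (f (x i, e i)) \<partial>EM n) = (\<integral>e. \<Psi> (x, e) (x i) \<partial>EM n)" if x: "x \<in> space (XM n)" for x
  proof -
    have "(\<integral>e. \<Phi> (x, e) (f (x i, e i)) \<partial>EM n) = (\<integral>e. \<integral>v. \<Phi> (x, e(i := v)) (f (x i, (e(i := v)) i)) \<partial>\<nu> \<partial>EM n)"
      by (rule integral_resample[where B=B])
        (use i b prob_nu measurable_compose[OF measurable_Pair1'[OF x] mz] in auto)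
    then show ?thesis by (simp add: inve \<Psi>_def)
  qed
  have xi: "(%z. fst z i) \<in> borel_measurable (PM n)" by (rule meas_comp(3)[OF i])
  have mP: "(%z. \<Psi> z (fst z i)) \<in> borel_measurable (PM n)"
    using measurable_compose[OF measurable_Pair[OF measurable_ident xi] Psim] by simp
  define \<Xi> where "\<Xi> x = (\<integral>e. \<Psi> (x, e) (x i) \<partial>EM n)" for x
  have Xim: "\<Xi> \<in> borel_measurable (XM n)"
    unfolding \<Xi>_def using mP by (intro E.borel_measurable_lebesgue_integral) (simp add: case_prod_beta')
  have Xib: "\<bar>\<Xi> x\<bar> <= B" for x unfolding \<Xi>_def by (rule E.abs_integral_bounded) (use Psib B0 in auto)
  have inner: "(\<integral>a. \<integral>e. \<Psi> (x, e) a \<partial>EM n \<partial>\<mu>) = (\<integral>e. \<integral>t. \<Phi> (x, e) t \<partial>distr (\<mu> \<Otimes>\<^sub>M \<nu>) borel f \<partial>EM n)"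
    if x: "x \<in> space (XM n)" for x
  proof -
    have "(%q. ((x, snd q), fst q)) \<in> measurable (\<mu> \<Otimes>\<^sub>M EM n) (PM n \<Otimes>\<^sub>M borel)"
    proof (rule measurable_Pair)
      show "(%q. (x, snd q)) \<in> measurable (\<mu> \<Otimes>\<^sub>M EM n) (PM n)"
        by (rule measurable_compose[OF measurable_snd measurable_Pair1'[OF x]])
    qed measurable
    from measurable_compose[OF this Psim]
    have "(%(a, e). \<Psi> (x, e) a) \<in> borel_measurable (\<mu> \<Otimes>\<^sub>M EM n)" by (simp add: case_prod_beta')
    then have "integrable (\<mu> \<Otimes>\<^sub>M EM n) (%(a, e). \<Psi> (x, e) a)"
      by (rule me.P.integrable_bounded[where B=B]) (use Psib in auto)
    from me.Fubini_integral[OF this]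
    have "(\<integral>a. \<integral>e. \<Psi> (x, e) a \<partial>EM n \<partial>\<mu>) = (\<integral>e. \<integral>a. \<Psi> (x, e) a \<partial>\<mu> \<partial>EM n)" by simp
    also have "\<dots> = (\<integral>e. \<integral>t. \<Phi> (x, e) t \<partial>distr (\<mu> \<Otimes>\<^sub>M \<nu>) borel f \<partial>EM n)"
    proof (rule Bochner_Integration.integral_cong[OF refl])
      fix e assume e: "e \<in> space (EM n)"
      have z: "(x, e) \<in> space (PM n)" using x e by (simp add: space_pair_measure)
      have tm: "\<Phi> (x, e) \<in> borel_measurable borel"
        using measurable_compose[OF measurable_Pair1'[OF z] m] by simp
      have "(\<integral>t. \<Phi> (x, e) t \<partial>distr (\<mu> \<Otimes>\<^sub>M \<nu>) borel f) = (\<integral>q. \<Phi> (x, e) (f q) \<partial>(\<mu> \<Otimes>\<^sub>M \<nu>))"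
        by (rule integral_distr[OF fm tm])
      also have "\<dots> = (\<integral>a. \<integral>v. \<Phi> (x, e) (f (a, v)) \<partial>\<nu> \<partial>\<mu>)"
        by (rule mn.integral_fst'[symmetric], rule mn.P.integrable_bounded[where B=B])
          (use measurable_compose[OF fm tm] b in auto)
      finally show "(\<integral>a. \<Psi> (x, e) a \<partial>\<mu>) = (\<integral>t. \<Phi> (x, e) t \<partial>distr (\<mu> \<Otimes>\<^sub>M \<nu>) borel f)"
        by (simp add: \<Psi>_def)
    qed
    finally show ?thesis .
  qed
  interpret L: prob_space "distr (\<mu> \<Otimes>\<^sub>M \<nu>) borel f" by (rule mn.P.prob_space_distr[OF fm])
  have "(\<integral>z. \<Phi> z (f (fst z i, snd z i)) \<partial>PM n) = (\<integral>x. \<integral>e. \<Phi> (x, e) (f (x i, e i)) \<partial>EM n \<partial>XM n)"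
    using PM_iterate[OF mz, of B] b by simp
  also have "\<dots> = (\<integral>x. \<Xi> x \<partial>XM n)"
    unfolding \<Xi>_def by (rule Bochner_Integration.integral_cong[OF refl]) (rule step1)
  also have "\<dots> = (\<integral>x. \<integral>a. \<Xi> (x(i := a)) \<partial>\<mu> \<partial>XM n)"
    by (rule integral_resample[where B=B]) (use i prob_mu Xim Xib in auto)
  also have "\<dots> = (\<integral>x. \<integral>a. \<integral>e. \<Psi> (x, e) a \<partial>EM n \<partial>\<mu> \<partial>XM n)"
    unfolding \<Xi>_def Psiinv by simp
  also have "\<dots> = (\<integral>x. \<integral>e. \<integral>t. \<Phi> (x, e) t \<partial>distr (\<mu> \<Otimes>\<^sub>M \<nu>) borel f \<partial>EM n \<partial>XM n)"
    by (rule Bochner_Integration.integral_cong[OF refl]) (rule inner)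
  also have "\<dots> = (\<integral>z. \<integral>t. \<Phi> z t \<partial>distr (\<mu> \<Otimes>\<^sub>M \<nu>) borel f \<partial>PM n)"
  proof (rule PM_iterate[where B=B, symmetric])
    have "(%(z, t). \<Phi> z t) \<in> borel_measurable (PM n \<Otimes>\<^sub>M distr (\<mu> \<Otimes>\<^sub>M \<nu>) borel f)"
      using m by (simp cong: measurable_cong_sets sets_pair_measure_cong)
    then show "(%z. \<integral>t. \<Phi> z t \<partial>distr (\<mu> \<Otimes>\<^sub>M \<nu>) borel f) \<in> borel_measurable (PM n)"
      by (rule L.borel_measurable_lebesgue_integral)
    show "norm (\<integral>t. \<Phi> z t \<partial>distr (\<mu> \<Otimes>\<^sub>M \<nu>) borel f) <= B" for z
      by (rule L.integral_bounded) (use b B0 in auto)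
  qed
  finally show ?thesis .
qed

text \<open>The inequality is applied twice, to the noises at a fixed design and to the conditional
  mean as a function of the design; each stage contributes \<open>n * d\<^sup>2\<close>.\<close>

lemma efron_stein_PM:
  fixes Z :: "(nat => real) \<times> (nat => real) => real" and W :: "nat => (nat => real) \<times> (nat => real) => real"
  assumes Z: "Z \<in> borel_measurable (PM n)" "!!z. \<bar>Z z\<bar> <= B"
    and W: "!!i. i \<in> {1..n} ==> W i \<in> borel_measurable (PM n)" "!!i z. \<bar>W i z\<bar> <= B"
    and inv: "!!i x e a v. i \<in> {1..n} ==> W i (x(i := a), e(i := v)) = W i (x, e)"
    and d: "!!i z. i \<in> {1..n} ==> \<bar>Z z - W i z\<bar> <= d"
  shows "(\<integral>z. (Z z - (\<integral>z. Z z \<partial>PM n))\<^sup>2 \<partial>PM n) <= 2 * real n * d\<^sup>2"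
proof -
  interpret X: prob_space "XM n" by (rule prob_XM)
  interpret E: prob_space "EM n" by (rule prob_EM)
  interpret P: prob_space "PM n" by (rule prob_PM)
  have B0: "0 <= B" using Z(2) abs_ge_zero order_trans by blast
  define zb where "zb x = (\<integral>e. Z (x, e) \<partial>EM n)" for x
  define wb where "wb i x = (\<integral>e. W i (x, e) \<partial>EM n)" for i x
  have sec: "(%e. F (x, e)) \<in> borel_measurable (EM n)" if "F \<in> borel_measurable (PM n)" "x \<in> space (XM n)"
    for F :: "_ => real" and x
    using measurable_compose[OF measurable_Pair1'[OF that(2)] that(1)] .
  have seci: "integrable (EM n) (%e. F (x, e))" if "F \<in> borel_measurable (PM n)" "x \<in> space (XM n)" "!!z. \<bar>F z\<bar> <= C"
    for F :: "_ => real" and x C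
    by (rule E.integrable_bounded[where B=C]) (use sec[OF that(1,2)] that(3) in auto)
  have fub: "(%x. \<integral>e. F (x, e) \<partial>EM n) \<in> borel_measurable (XM n)" if "F \<in> borel_measurable (PM n)" for F :: "_ => real"
    using that by (intro E.borel_measurable_lebesgue_integral) (simp add: case_prod_beta')
  have zbm: "zb \<in> borel_measurable (XM n)" unfolding zb_def by (rule fub[OF Z(1)])
  have wbm: "i \<in> {1..n} ==> wb i \<in> borel_measurable (XM n)" for i unfolding wb_def by (rule fub[OF W(1)])
  have zbb: "\<bar>zb x\<bar> <= B" for x unfolding zb_def by (rule E.abs_integral_bounded) (use Z B0 in auto)
  have wbb: "\<bar>wb i x\<bar> <= B" for i x unfolding wb_def by (rule E.abs_integral_bounded) (use W B0 in auto)
  \<comment> \<open>Changing one of the two coordinates is a joint update that reinserts the old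
    value of the other.\<close>
  have inve: "W i (x, e(i := v)) = W i (x, e)" if "i \<in> {1..n}" for i x e v
    using inv[OF that, of x "x i" e v] by simp
  have invx: "W i (x(i := a), e) = W i (x, e)" if "i \<in> {1..n}" for i x e a
    using inv[OF that, of x a e "e i"] by simp
  have wbinv: "wb i (x(i := a)) = wb i x" if "i \<in> {1..n}" for i x a
    unfolding wb_def invx[OF that] ..
  have d2: "(Z z - W i z)\<^sup>2 <= d\<^sup>2" if "i \<in> {1..n}" for i z by (rule abs_square_le[OF d[OF that]])
  have avg: "(\<integral>x. (F x)\<^sup>2 \<partial>M) <= d\<^sup>2" if "prob_space M" "!!x. x \<in> space M ==> (F x)\<^sup>2 <= d\<^sup>2"
    for M :: "'z measure" and F :: "'z => real"
  proof -
    interpret M: prob_space M by fact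
    have "\<bar>\<integral>x. (F x)\<^sup>2 \<partial>M\<bar> <= d\<^sup>2" by (rule M.abs_integral_bounded) (use that(2) in auto)
    then show ?thesis by simp
  qed
  have inner: "(\<integral>e. (Z (x, e))\<^sup>2 \<partial>EM n) <= (zb x)\<^sup>2 + n * d\<^sup>2" if x: "x \<in> space (XM n)" for x
  proof -
    have "(\<integral>e. (Z (x, e))\<^sup>2 \<partial>EM n) - (\<integral>e. Z (x, e) \<partial>EM n)\<^sup>2 <= (\<Sum>i\<in>{1..n}. \<integral>e. (Z (x, e) - W i (x, e))\<^sup>2 \<partial>EM n)"
      by (rule efron_stein[where B=B]) (use prob_nu sec[OF Z(1) x] sec[OF W(1) x] Z(2) W(2) inve in auto)
    also have "\<dots> <= (\<Sum>i\<in>{1..n}. d\<^sup>2)"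
      by (intro sum_mono avg prob_EM d2)
    finally show ?thesis by (simp add: zb_def)
  qed
  have outer: "(\<integral>x. (zb x)\<^sup>2 \<partial>XM n) - (\<integral>x. zb x \<partial>XM n)\<^sup>2 <= n * d\<^sup>2"
  proof -
    have "(\<integral>x. (zb x)\<^sup>2 \<partial>XM n) - (\<integral>x. zb x \<partial>XM n)\<^sup>2 <= (\<Sum>i\<in>{1..n}. \<integral>x. (zb x - wb i x)\<^sup>2 \<partial>XM n)"
      by (rule efron_stein[where B=B]) (use prob_mu zbm wbm zbb wbb wbinv in auto)
    also have "\<dots> <= (\<Sum>i\<in>{1..n}. d\<^sup>2)"
    proof (intro sum_mono avg prob_XM)
      fix i x assume i: "i \<in> {1..n}" and x: "x \<in> space (XM n)"
      have "zb x - wb i x = (\<integral>e. Z (x, e) - W i (x, e) \<partial>EM n)"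
        unfolding zb_def wb_def
        by (rule Bochner_Integration.integral_diff[symmetric]) (rule seci[OF Z(1) x Z(2)], rule seci[OF W(1)[OF i] x W(2)])
      moreover have "\<bar>\<integral>e. Z (x, e) - W i (x, e) \<partial>EM n\<bar> <= d"
        by (rule E.abs_integral_bounded) (use d[OF i] abs_ge_zero order_trans in \<open>auto, blast\<close>)
      ultimately show "(zb x - wb i x)\<^sup>2 <= d\<^sup>2" using abs_square_le by metis
    qed
    finally show ?thesis by simp
  qed
  have Zi: "integrable (PM n) Z" by (rule P.integrable_bounded[where B=B]) (use Z in auto)
  have Z2b: "\<bar>(Z z)\<^sup>2\<bar> <= B\<^sup>2" for z using abs_square_le[OF Z(2)[of z]] by simp
  have Z2m: "(%z. (Z z)\<^sup>2) \<in> borel_measurable (PM n)" using Z(1) by measurable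
  have Z2i: "integrable (PM n) (%z. (Z z)\<^sup>2)"
    by (rule P.integrable_bounded[where B="B\<^sup>2"]) (use Z2m Z2b in auto)
  have zb2: "integrable (XM n) (%x. (zb x)\<^sup>2)"
    by (rule X.integrable_bounded[where B="B\<^sup>2"]) (use zbm abs_square_le[OF zbb] in auto)
  have "(\<integral>z. (Z z)\<^sup>2 \<partial>PM n) <= (\<integral>x. (zb x)\<^sup>2 + n * d\<^sup>2 \<partial>XM n)"
    by (rule PM_integral_mono[OF Z2m Z2b]) (use zb2 inner in auto)
  also have "\<dots> = (\<integral>x. (zb x)\<^sup>2 \<partial>XM n) + n * d\<^sup>2" using zb2 by (simp add: X.prob_space)
  finally have "(\<integral>z. (Z z)\<^sup>2 \<partial>PM n) <= (\<integral>x. (zb x)\<^sup>2 \<partial>XM n) + n * d\<^sup>2" .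
  moreover have "(\<integral>z. Z z \<partial>PM n) = (\<integral>x. zb x \<partial>XM n)"
    unfolding zb_def using PM_iterate[OF Z(1), of B] Z(2) by simp
  ultimately show ?thesis
    using outer P.variance_eq[OF Zi Z2i] by simp
qed

end

section \<open>The model with response function \<open>f\<close>\<close>

locale rank_model = two_laws +
  fixes f :: "real \<times> real => real"
  assumes f_meas [measurable]: "f \<in> borel_measurable (borel \<Otimes>\<^sub>M borel)"
    and no_atoms: "!!t. measure (distr (\<mu> \<Otimes>\<^sub>M \<nu>) borel f) {t} = 0"
begin

text \<open>\<open>lam\<close> is the law of the response, so integrals against it are integrals in
  dF_Y and \<open>GG\<close> is F_Y. Further, \<open>ph\<close> is the conditional distribution
  function and \<open>TT\<close> the function T.\<close>

definition lam :: "real measure" where "lam = distr (\<mu> \<Otimes>\<^sub>M \<nu>) borel f"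
definition ph :: "real => real => real" where "ph t x = (\<integral>e. indicator {..t} (f (x, e)) \<partial>\<nu>)"
definition GG :: "real => real" where "GG y = measure lam {..y}"
definition TT :: "real => real" where "TT t = (\<integral>x. (ph t x)\<^sup>2 \<partial>\<mu>)"
definition ww :: "real \<times> real => real" where "ww q = GG (f q)"
definition uu :: "real \<times> real => real" where "uu q = TT (f q)"

lemma f_meas_mn: "f \<in> borel_measurable (\<mu> \<Otimes>\<^sub>M \<nu>)"
  using f_meas by (simp cong: measurable_cong_sets sets_pair_measure_cong)

lemma sets_lam [simp, measurable_cong]: "sets lam = sets borel" and space_lam [simp]: "space lam = UNIV"
  by (simp_all add: lam_def)

sublocale L: prob_space lam
proof -
  interpret mn: prob_space "\<mu> \<Otimes>\<^sub>M \<nu>" by simp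
  show "prob_space lam" unfolding lam_def by (rule mn.prob_space_distr[OF f_meas_mn])
qed

lemma lam_single [simp]: "measure lam {t} = 0"
  using no_atoms by (simp add: lam_def)

lemma ph_meas: "(%(t, x). ph t x) \<in> borel_measurable (borel \<Otimes>\<^sub>M borel)"
proof -
  have eq: "ph t x = (\<integral>e. (if f (x, e) <= t then 1 else 0) \<partial>\<nu>)" for t x
    unfolding ph_def by (rule Bochner_Integration.integral_cong) (auto simp: indicator_def)
  show ?thesis unfolding eq by measurable
qed

lemma ph_meas' [measurable (raw)]:
  "h \<in> borel_measurable M ==> g \<in> borel_measurable M ==> (%x. ph (h x) (g x)) \<in> borel_measurable M"
  using measurable_compose[OF measurable_Pair ph_meas, of h M g] by simp

lemma ph_01: "0 <= ph t x \<and> ph t x <= 1"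
proof -
  have "\<bar>ph t x\<bar> <= 1" unfolding ph_def by (rule nu.abs_integral_bounded) (auto simp: indicator_def)
  moreover have "0 <= ph t x" unfolding ph_def by (rule Bochner_Integration.integral_nonneg) simp
  ultimately show ?thesis by simp
qed

lemma TT_meas [measurable]: "TT \<in> borel_measurable borel"
  unfolding TT_def by measurable

lemma ph_sq: "0 <= (ph t x)\<^sup>2 \<and> (ph t x)\<^sup>2 <= 1"
  using ph_01[of t x] power_le_one[of "ph t x" 2] by auto

lemma TT_01: "0 <= TT t \<and> TT t <= 1"
proof -
  have "\<bar>TT t\<bar> <= 1" unfolding TT_def by (rule mu.abs_integral_bounded) (use ph_sq in auto)
  moreover have "0 <= TT t" unfolding TT_def by (rule Bochner_Integration.integral_nonneg) simp
  ultimately show ?thesis by simp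
qed

lemma GG_mono: "x <= y ==> GG x <= GG y"
  unfolding GG_def by (rule L.finite_measure_mono) auto

lemma GG_meas [measurable]: "GG \<in> borel_measurable borel"
  by (rule borel_measurable_mono) (auto intro: monoI GG_mono)

lemma GG_01: "0 <= GG y \<and> GG y <= 1"
  by (auto simp: GG_def)

sublocale rank_kernel \<mu> \<nu> ww uu
proof
  show "ww \<in> borel_measurable (borel \<Otimes>\<^sub>M borel)" "uu \<in> borel_measurable (borel \<Otimes>\<^sub>M borel)"
    unfolding ww_def uu_def
    by (rule measurable_compose[OF f_meas GG_meas], rule measurable_compose[OF f_meas TT_meas])
qed (simp_all add: ww_def uu_def GG_01 TT_01)

lemma lam_atLeast: "measure lam {y..} = 1 - GG y"
proof -
  have "measure lam {y..} = measure lam ({y} \<union> {y<..})" by (rule arg_cong[where f="measure lam"]) auto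
  also have "\<dots> = measure lam {y} + measure lam {y<..}"
    by (rule L.finite_measure_Union) auto
  also have "measure lam {y<..} = 1 - GG y"
  proof -
    have "measure lam (space lam - {..y}) = 1 - GG y" unfolding GG_def by (rule L.prob_compl) simp
    moreover have "space lam - {..y} = {y<..}" by auto
    ultimately show ?thesis by simp
  qed
  finally show ?thesis by simp
qed

text \<open>The origin of \<open>H\<close>: the product of indicators is the indicator of a closed
  upper half-line in \<open>t\<close>, whose mass is one minus F_Y at the maximum because
  \<open>lam\<close> has no atoms.\<close>

lemma integral_max_le: "(\<integral>t. indicator {..t} y * indicator {..t} y' \<partial>lam) = H (GG y) (GG y')"
proof -
  have "(\<integral>t. indicator {..t} y * indicator {..t} y' \<partial>lam) = (\<integral>t. (indicator {max y y'..} t :: real) \<partial>lam)"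
    by (rule Bochner_Integration.integral_cong) (auto simp: indicator_def)
  also have "\<dots> = 1 - GG (max y y')" by (simp add: lam_atLeast)
  also have "\<dots> = H (GG y) (GG y')"
    unfolding H_def using max_of_mono[OF monoI[of GG, OF GG_mono], of y y'] by simp
  finally show ?thesis .
qed

lemma ind_meas: "h \<in> borel_measurable M ==> g \<in> borel_measurable M ==> (%x. indicator {..h x} (g x) :: real) \<in> borel_measurable M"
  for h g :: "'z => real"
proof -
  assume [measurable]: "h \<in> borel_measurable M" "g \<in> borel_measurable M"
  have "(%x. if g x <= h x then 1 else 0 :: real) \<in> borel_measurable M" by measurable
  moreover have "(%x. indicator {..h x} (g x) :: real) = (%x. if g x <= h x then 1 else 0)"
    by (auto simp: indicator_def)
  ultimately show ?thesis by simp
qed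

text \<open>By Fubini, \<open>mm\<close> is the inner product in L2(\<open>lam\<close>) of two
  conditional distribution functions. Hence \<open>dd\<close> is a squared norm and the bias has a
  sign.\<close>

lemma mm_ph: "mm x y = (\<integral>t. ph t x * ph t y \<partial>lam)"
proof -
  interpret nl: pair_prob_space \<nu> lam ..
  define h where "h t x e = (indicator {..t} (f (x, e)) :: real)" for t x e
  have hb: "\<bar>h t x e\<bar> <= 1" for t x e by (simp add: h_def indicator_def)
  have hb2: "\<bar>h t x e * c\<bar> <= 1" if "\<bar>c\<bar> <= 1" for t x e c using that by (simp add: h_def indicator_def)
  have hm [measurable (raw)]: "(%q. h (a q) (b q) (c q)) \<in> borel_measurable M"
    if "a \<in> borel_measurable M" "b \<in> borel_measurable M" "c \<in> borel_measurable M" for a b c and M :: "'z measure"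
    unfolding h_def by (rule ind_meas[OF that(1) measurable_compose[OF measurable_Pair[OF that(2,3)] f_meas]])
  have phh: "ph t x = (\<integral>e. h t x e \<partial>\<nu>)" for t x by (simp add: ph_def h_def)
  have in1: "(\<integral>e'. H (ww (x, e)) (ww (y, e')) \<partial>\<nu>) = (\<integral>t. h t x e * ph t y \<partial>lam)" for e
  proof -
    have "(\<integral>e'. H (ww (x, e)) (ww (y, e')) \<partial>\<nu>) = (\<integral>e'. \<integral>t. h t x e * h t y e' \<partial>lam \<partial>\<nu>)"
      by (simp add: ww_def integral_max_le[symmetric] h_def)
    also have "\<dots> = (\<integral>t. \<integral>e'. h t x e * h t y e' \<partial>\<nu> \<partial>lam)"
    proof (rule nl.Fubini_integral[symmetric], rule nl.P.integrable_bounded[where B=1])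
      show "(%(e', t). h t x e * h t y e') \<in> borel_measurable (\<nu> \<Otimes>\<^sub>M lam)" by measurable
    qed (use hb2[OF hb] in auto)
    finally show ?thesis by (simp add: phh)
  qed
  have "mm x y = (\<integral>e. \<integral>t. h t x e * ph t y \<partial>lam \<partial>\<nu>)" unfolding mm_double in1 ..
  also have "\<dots> = (\<integral>t. \<integral>e. h t x e * ph t y \<partial>\<nu> \<partial>lam)"
  proof (rule nl.Fubini_integral[symmetric], rule nl.P.integrable_bounded[where B=1])
    show "(%(e, t). h t x e * ph t y) \<in> borel_measurable (\<nu> \<Otimes>\<^sub>M lam)" by measurable
  qed (use hb2 ph_01 in auto)
  finally show ?thesis by (simp add: phh)
qed

lemma int_ph2: "integrable lam (%t. ph t x * ph t y)"
proof (rule L.integrable_bounded[where B=1])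
  show "norm (ph t x * ph t y) <= 1" for t using ph_01[of t x] ph_01[of t y] by (simp add: mult_le_one)
qed measurable

lemma dd_ph: "dd x y = (\<integral>t. (ph t x - ph t y)\<^sup>2 \<partial>lam)"
proof -
  have "(\<integral>t. (ph t x - ph t y)\<^sup>2 \<partial>lam) = (\<integral>t. ph t x * ph t x + ph t y * ph t y - 2 * (ph t x * ph t y) \<partial>lam)"
    by (rule Bochner_Integration.integral_cong) (auto simp: power2_eq_square algebra_simps)
  also have "\<dots> = dd x y" unfolding dd_def mm_ph using int_ph2 by simp
  finally show ?thesis by simp
qed

lemma integral_lam: "g \<in> borel_measurable borel ==> (!!t. \<bar>g t\<bar> <= B) ==> (\<integral>t. g t \<partial>lam) = (\<integral>a. \<integral>v. g (f (a, v)) \<partial>\<nu> \<partial>\<mu>)"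
  for g :: "real => real"
proof -
  assume g: "g \<in> borel_measurable borel" and b: "!!t. \<bar>g t\<bar> <= B"
  interpret mn: pair_prob_space \<mu> \<nu> ..
  have "(\<integral>t. g t \<partial>lam) = (\<integral>q. g (f q) \<partial>(\<mu> \<Otimes>\<^sub>M \<nu>))"
    unfolding lam_def by (rule integral_distr[OF f_meas_mn g])
  also have "\<dots> = (\<integral>a. \<integral>v. g (f (a, v)) \<partial>\<nu> \<partial>\<mu>)"
    by (rule mn.integral_fst'[symmetric], rule mn.P.integrable_bounded[where B=B])
      (use measurable_compose[OF f_meas_mn g] b in auto)
  finally show ?thesis .
qed

lemma integral_mm_diag: "(\<integral>x. mm x x \<partial>\<mu>) = (\<integral>t. TT t \<partial>lam)"
proof -
  interpret ml: pair_prob_space \<mu> lam ..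
  have "(\<integral>x. mm x x \<partial>\<mu>) = (\<integral>x. \<integral>t. (ph t x)\<^sup>2 \<partial>lam \<partial>\<mu>)" by (simp add: mm_ph power2_eq_square)
  also have "\<dots> = (\<integral>t. \<integral>x. (ph t x)\<^sup>2 \<partial>\<mu> \<partial>lam)"
  proof (rule ml.Fubini_integral[symmetric], rule ml.P.integrable_bounded[where B=1])
    show "(%(x, t). (ph t x)\<^sup>2) \<in> borel_measurable (\<mu> \<Otimes>\<^sub>M lam)" by measurable
  qed (use ph_sq in auto)
  finally show ?thesis by (simp add: TT_def)
qed

text \<open>The mean of T under F_Y enters twice: from integrating T_n against F_Y, and from
  evaluating T at the observations.\<close>

lemma c2_eq: "c2 = 2 * (\<integral>t. TT t \<partial>lam)"
proof -
  have i1: "integrable \<mu> (%x. mm x x)" by (rule mu.integrable_bounded[where B=1]) (use mm_01 in auto)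
  have i2: "integrable \<mu> ub" by (rule mu.integrable_bounded[where B=1]) (use ub_01 in auto)
  have "(\<integral>x. ub x \<partial>\<mu>) = (\<integral>t. TT t \<partial>lam)"
    unfolding ub_def uu_def using integral_lam[of TT 1] TT_01 by simp
  then show ?thesis unfolding c2_def aa_def using i1 i2 integral_mm_diag by simp
qed

text \<open>The distance of F_Y(a) and F_Y(b) is at most the mass of the levels separating a and b.
  So \<open>md\<close> is bounded by the mean jump of the sections of \<open>A\<close>, with a noise
  and an independent level as parameter, and \<open>indicator_section_jump\<close> applies.\<close>

lemma MD_tendsto: "(%n. (\<integral>x. MD n x \<partial>XM n) / n) \<longlonglongrightarrow> 0"
proof -
  interpret nl: pair_prob_space \<nu> lam ..
  define A where "A = {q :: real \<times> real \<times> real. snd (snd q) <= f (fst q, fst (snd q))}"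
  have A: "A \<in> sets (borel \<Otimes>\<^sub>M (\<nu> \<Otimes>\<^sub>M lam))"
  proof -
    have "{q \<in> space (borel \<Otimes>\<^sub>M (\<nu> \<Otimes>\<^sub>M lam)). snd (snd q) <= f (fst q, fst (snd q))} \<in> sets (borel \<Otimes>\<^sub>M (\<nu> \<Otimes>\<^sub>M lam))"
      by measurable
    then show ?thesis by (simp add: A_def space_pair_measure)
  qed
  define \<delta> :: "real => real => real" where "\<delta> x y = (\<integral>r. \<bar>indicator A (x, r) - indicator A (y, r)\<bar> \<partial>(\<nu> \<Otimes>\<^sub>M lam))" for x y :: real
  have Am [measurable]: "(indicator A :: _ => real) \<in> borel_measurable (borel \<Otimes>\<^sub>M (\<nu> \<Otimes>\<^sub>M lam))" using A by simp
  have md: "md x y <= \<delta> x y" for x y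
  proof -
    have m: "(%r. \<bar>indicator A (x, r) - indicator A (y, r)\<bar> :: real) \<in> borel_measurable (\<nu> \<Otimes>\<^sub>M lam)" by measurable
    have i: "integrable (\<nu> \<Otimes>\<^sub>M lam) (%r. \<bar>indicator A (x, r) - indicator A (y, r)\<bar> :: real)"
      by (rule nl.P.integrable_bounded[OF m, where B=1]) (auto simp: indicator_def)
    have eq: "\<delta> x y = (\<integral>e. \<integral>t. \<bar>indicator A (x, e, t) - indicator A (y, e, t)\<bar> \<partial>lam \<partial>\<nu>)"
      unfolding \<delta>_def by (rule nl.integral_fst'[OF i, symmetric])
    show ?thesis
      unfolding md_def eq
    proof (rule integral_mono)
      show "integrable \<nu> (%e. \<bar>ww (x, e) - ww (y, e)\<bar>)" using int_w by simp
      show "integrable \<nu> (%e. \<integral>t. \<bar>indicator A (x, e, t) - indicator A (y, e, t) :: real\<bar> \<partial>lam)"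
        by (rule nl.integrable_fst'[OF i])
      fix e
      have g: "GG c = (\<integral>t. indicator {..c} t \<partial>lam)" for c by (simp add: GG_def)
      have ii: "integrable lam (%t. indicator {..c} t :: real)" for c
        by (rule L.integrable_bounded[where B=1]) (auto simp: indicator_def)
      have "ww (x, e) - ww (y, e) = (\<integral>t. indicator {..f (x, e)} t - indicator {..f (y, e)} t \<partial>lam)"
        unfolding ww_def g using ii by simp
      also have "\<bar>\<dots>\<bar> <= (\<integral>t. \<bar>indicator {..f (x, e)} t - indicator {..f (y, e)} t\<bar> \<partial>lam)"
        by (rule integral_abs_bound)
      also have "\<dots> = (\<integral>t. \<bar>indicator A (x, e, t) - indicator A (y, e, t)\<bar> \<partial>lam)"
        by (rule Bochner_Integration.integral_cong) (auto simp: A_def indicator_def)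
      finally show "\<bar>ww (x, e) - ww (y, e)\<bar> <= (\<integral>t. \<bar>indicator A (x, e, t) - indicator A (y, e, t)\<bar> \<partial>lam)" .
    qed
  qed
  have dm: "(%(x, y). \<delta> x y) \<in> borel_measurable (borel \<Otimes>\<^sub>M borel)"
    unfolding \<delta>_def by measurable
  have db: "0 <= \<delta> x y \<and> \<delta> x y <= 1" for x y
  proof -
    have "\<bar>\<delta> x y\<bar> <= 1" unfolding \<delta>_def by (rule nl.P.abs_integral_bounded) (auto simp: indicator_def)
    moreover have "0 <= \<delta> x y" unfolding \<delta>_def by (rule Bochner_Integration.integral_nonneg) simp
    ultimately show ?thesis by simp
  qed
  have le: "(\<integral>x. MD n x \<partial>XM n) <= (\<integral>x. (\<Sum>p\<in>adj (ord_list n x). \<delta> (x (fst p)) (x (snd p))) \<partial>XM n)" for n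
  proof -
    interpret X: prob_space "XM n" by (rule prob_XM)
    show ?thesis
    proof (rule integral_mono)
      show "integrable (XM n) (MD n)"
        by (rule X.integrable_bounded[where B=n]) (use MD_meas MD_bound in auto)
      show "integrable (XM n) (%x. \<Sum>p\<in>adj (ord_list n x). \<delta> (x (fst p)) (x (snd p)))"
      proof (rule X.integrable_bounded[where B="real n * 1"])
        show "(%x. \<Sum>p\<in>adj (ord_list n x). \<delta> (x (fst p)) (x (snd p))) \<in> borel_measurable (XM n)"
          by (rule meas_adj_XM)
            (use measurable_compose[OF measurable_Pair[OF meas_comp(1) meas_comp(1)] dm] in auto)
        show "norm (\<Sum>p\<in>adj (ord_list n x). \<delta> (x (fst p)) (x (snd p))) <= real n * 1" for x
          unfolding real_norm_def by (rule abs_sum_adj_le) (use db in auto)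
      qed
      show "MD n x <= (\<Sum>p\<in>adj (ord_list n x). \<delta> (x (fst p)) (x (snd p)))" for x
        unfolding MD_def by (intro sum_mono md)
    qed
  qed
  have lim: "(%n. (\<integral>x. (\<Sum>p\<in>adj (ord_list n x). \<delta> (x (fst p)) (x (snd p))) \<partial>XM n) / n) \<longlonglongrightarrow> 0"
    unfolding \<delta>_def by (rule indicator_section_jump[OF nl.P.prob_space_axioms A])
  show ?thesis
  proof (rule tendsto_sandwich[OF _ _ tendsto_const lim])
    show "\<forall>\<^sub>F n in sequentially. 0 <= (\<integral>x. MD n x \<partial>XM n) / n"
      using MD_bound by (intro always_eventually allI divide_nonneg_nonneg Bochner_Integration.integral_nonneg) auto
    show "\<forall>\<^sub>F n in sequentially. (\<integral>x. MD n x \<partial>XM n) / n <= (\<integral>x. (\<Sum>p\<in>adj (ord_list n x). \<delta> (x (fst p)) (x (snd p))) \<partial>XM n) / n"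
      using le by (intro always_eventually allI divide_right_mono) auto
  qed
qed

end

section \<open>Integrating against the empirical law\<close>

lemma sqrt_over_n_tendsto: "(%n. sqrt (real n) / real n) \<longlonglongrightarrow> 0"
proof -
  have "(%n. 1 / sqrt (real n)) \<longlonglongrightarrow> 0"
    by (intro tendsto_divide_0[OF tendsto_const] filterlim_at_top_imp_at_infinity
        filterlim_compose[OF sqrt_at_top filterlim_real_sequentially])
  moreover have "sqrt (real n) / real n = 1 / sqrt (real n)" for n
    by (cases "n = 0") (simp_all add: field_simps)
  ultimately show ?thesis by simp
qed

lemma filter_ord_list_upd_gen:
  "\<not> P i ==> filter P (ord_list n (x(i := a))) = filter P (ord_list n x)"
  unfolding ord_list_def filter_sort by (rule sort_key_cong) auto

lemma (in prob_space) abs_integral_diff_le: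
  fixes F G :: "'a => real"
  assumes "integrable M F" "integrable M G" "!!x. x \<in> space M ==> \<bar>F x - G x\<bar> <= d" "0 <= d"
  shows "\<bar>(\<integral>x. F x \<partial>M) - (\<integral>x. G x \<partial>M)\<bar> <= d"
proof -
  have "(\<integral>x. F x \<partial>M) - (\<integral>x. G x \<partial>M) = (\<integral>x. F x - G x \<partial>M)"
    using assms by simp
  then show ?thesis using abs_integral_bounded[of "%x. F x - G x" d] assms(3,4) by simp
qed

context rank_model
begin

definition yy :: "nat => (nat => real) \<times> (nat => real) => real" where
  "yy i z = f (fst z i, snd z i)"

text \<open>T_n without the observations in \<open>J\<close> and without the cyclic pair, still
  divided by \<open>n\<close>. Deleting the indices decouples it from their positions and noises,
  see \<open>TR_inv\<close>.\<close>

definition TR :: "nat => nat set => (nat => real) \<times> (nat => real) => real => real" where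
  "TR n J z t = (\<Sum>p\<in>adj (filter (%i. i \<notin> J) (ord_list n (fst z))).
     indicator {..t} (yy (fst p) z) * indicator {..t} (yy (snd p) z)) / n"

definition cc :: real where "cc = (\<integral>t. TT t \<partial>lam)"

definition ZZ :: "nat => (nat => real) \<times> (nat => real) => real" where
  "ZZ n z = (\<Sum>j\<in>{1..n}. TR n {} z (yy j z)) / n"

definition ED :: "nat => real" where "ED n = (\<integral>x. DD n x \<partial>XM n)"

lemma yy_meas: "i \<in> {1..n} ==> yy i \<in> borel_measurable (PM n)"
  unfolding yy_def by (rule measurable_compose[OF measurable_Pair[OF meas_comp(3) meas_comp(4)] f_meas])

lemma ind_prod_01: "0 <= (indicator A x * indicator A y :: real)" "(indicator A x * indicator A y :: real) <= 1"
  by (auto simp: indicator_def)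

lemma TR_01: "0 <= TR n J z t \<and> TR n J z t <= 1"
proof -
  let ?l = "filter (%i. i \<notin> J) (ord_list n (fst z))"
  let ?K = "%p. indicator {..t} (yy (fst p) z) * indicator {..t} (yy (snd p) z) :: real"
  have "0 <= sum ?K (adj ?l)" by (rule sum_nonneg) (rule ind_prod_01)
  moreover have "sum ?K (adj ?l) <= of_nat (card (adj ?l)) * 1"
    by (rule sum_bounded_above) (rule ind_prod_01)
  moreover have "card (adj ?l) <= n"
    using card_adj_le[of ?l] length_filter_le[of "%i. i \<notin> J" "ord_list n (fst z)"] by simp
  ultimately show ?thesis
    unfolding TR_def by (cases "n = 0") (auto simp: divide_simps)
qed

lemma TR_meas: "(%(z, t). TR n J z t) \<in> borel_measurable (PM n \<Otimes>\<^sub>M borel)"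
proof -
  have g: "(%q. filter (%i. i \<notin> J) (ord_list n (fst (fst q)))) \<in> measurable (PM n \<Otimes>\<^sub>M borel) (count_space UNIV)"
    by (rule measurable_compose[OF measurable_compose[OF measurable_fst meas_ord(2)]]) simp
  have "(%q. \<Sum>p\<in>adj (filter (%i. i \<notin> J) (ord_list n (fst (fst q)))).
     indicator {..snd q} (yy (fst p) (fst q)) * indicator {..snd q} (yy (snd p) (fst q)) :: real) \<in> borel_measurable (PM n \<Otimes>\<^sub>M borel)"
  proof (rule measurable_adj_sum[OF g, where I="{1..n}"])
    fix p assume p: "p \<in> {1..n} \<times> {1..n}"
    have y: "(%q. yy i (fst q)) \<in> borel_measurable (PM n \<Otimes>\<^sub>M borel)" if "i \<in> {1..n}" for i
      by (rule measurable_compose[OF measurable_fst yy_meas[OF that]])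
    show "(%q. indicator {..snd q} (yy (fst p) (fst q)) * indicator {..snd q} (yy (snd p) (fst q)) :: real) \<in> borel_measurable (PM n \<Otimes>\<^sub>M borel)"
      by (rule borel_measurable_times[OF ind_meas[OF measurable_snd y] ind_meas[OF measurable_snd y]])
        (use p in auto)
  qed auto
  then have "(%q. TR n J (fst q) (snd q)) \<in> borel_measurable (PM n \<Otimes>\<^sub>M borel)"
    unfolding TR_def by (rule borel_measurable_divide) simp
  then show ?thesis by (simp add: case_prod_beta')
qed

lemma TR_meas_z: "h \<in> borel_measurable (PM n) ==> (%z. TR n J z (h z)) \<in> borel_measurable (PM n)"
  using measurable_compose[OF measurable_Pair[OF measurable_ident] TR_meas] by simp

lemma TR_meas_t: "TR n J z \<in> borel_measurable borel"
  unfolding TR_def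
  by (intro borel_measurable_divide borel_measurable_sum borel_measurable_times ind_meas) auto

lemma TR_insert: "\<bar>TR n J z t - TR n (insert i J) z t\<bar> <= 2 / n"
proof -
  let ?l = "filter (%k. k \<notin> J) (ord_list n (fst z))"
  let ?K = "%p. indicator {..t} (yy (fst p) z) * indicator {..t} (yy (snd p) z) :: real"
  have eq: "filter (%k. k \<notin> insert i J) (ord_list n (fst z)) = filter (%k. k ~= i) ?l"
    by (simp add: conj_commute)
  have "\<bar>sum ?K (adj ?l) - sum ?K (adj (filter (%k. k ~= i) ?l))\<bar> <= 2"
    by (rule sum_adj_remove_le_2) (simp_all only: distinct_filter ord_list_simps(1) ind_prod_01)
  then have "\<bar>sum ?K (adj ?l) - sum ?K (adj (filter (%k. k ~= i) ?l))\<bar> / n <= 2 / n"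
    by (rule divide_right_mono) simp
  then show ?thesis
    unfolding TR_def eq by (simp add: diff_divide_distrib[symmetric])
qed

lemma TR_inv: "i \<in> J ==> TR n J (x(i := a), e(i := v)) t = TR n J (x, e) t"
proof -
  assume i: "i \<in> J"
  have l: "filter (%k. k \<notin> J) (ord_list n (x(i := a))) = filter (%k. k \<notin> J) (ord_list n x)"
    by (rule filter_ord_list_upd_gen) (use i in simp)
  have y: "yy k (x(i := a), e(i := v)) = yy k (x, e)" if "k \<notin> J" for k
    using that i by (auto simp: yy_def)
  show ?thesis
    unfolding TR_def fst_conv l
  proof (intro arg_cong[where f="%s. s / real n"] sum.cong refl)
    fix p assume p: "p \<in> adj (filter (%k. k \<notin> J) (ord_list n x))"
    show "indicator {..t} (yy (fst p) (x(i := a), e(i := v))) * indicator {..t} (yy (snd p) (x(i := a), e(i := v))) =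
        (indicator {..t} (yy (fst p) (x, e)) * indicator {..t} (yy (snd p) (x, e)) :: real)"
      using adj_in_set(1,3)[OF p] y by simp
  qed
qed

text \<open>Moving the left noise of each pair to the right position gives a kernel covered by
  \<open>chain_lln\<close>, whose mean is T(t). The error of the move is the jump of the indicator
  of \<open>{q. f q <= t}\<close> between neighbouring positions, which is o(n) in mean.\<close>

lemma TR_lln: "(%n. \<integral>z. \<bar>TR n {} z t - TT t\<bar> \<partial>PM n) \<longlonglongrightarrow> 0"
proof -
  define I where "I a e = (indicator {..t} (f (a, e)) :: real)" for a e
  have Ib: "0 <= I a e \<and> I a e <= 1" for a e by (simp add: I_def indicator_def)
  have Im [measurable (raw)]: "(%q. I (a q) (b q)) \<in> borel_measurable M"
    if "a \<in> borel_measurable M" "b \<in> borel_measurable M" for a b and M :: "'z measure"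
    unfolding I_def by (rule ind_meas[OF _ measurable_compose[OF measurable_Pair[OF that] f_meas]]) simp
  define A where "A = {q. f q <= t}"
  have A: "A \<in> sets (borel \<Otimes>\<^sub>M \<nu>)"
  proof -
    have "f \<in> borel_measurable (borel \<Otimes>\<^sub>M \<nu>)" using f_meas by (simp cong: measurable_cong_sets sets_pair_measure_cong)
    then have "{q \<in> space (borel \<Otimes>\<^sub>M \<nu>). f q <= t} \<in> sets (borel \<Otimes>\<^sub>M \<nu>)" by measurable
    then show ?thesis by (simp add: A_def space_pair_measure)
  qed
  have IA: "indicator A (a, e) = I a e" for a e by (auto simp: A_def I_def indicator_def)
  define \<delta> where "\<delta> a b = (\<integral>e. \<bar>I a e - I b e\<bar> \<partial>\<nu>)" for a b
  have \<delta>m: "(%x. \<delta> (g x) (h x)) \<in> borel_measurable M" if [measurable]: "g \<in> borel_measurable M" "h \<in> borel_measurable M"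
    for g h and M :: "'z measure"
    unfolding \<delta>_def by measurable
  have Id: "\<bar>I a e - I b e\<bar> <= 1" for a b e using Ib[of a e] Ib[of b e] by linarith
  have \<delta>b: "\<bar>\<delta> a b\<bar> <= 1" for a b unfolding \<delta>_def by (rule nu.abs_integral_bounded) (use Id in auto)
  define r where "r n = (\<integral>x. (\<Sum>p\<in>adj (ord_list n x). \<delta> (x (fst p)) (x (snd p))) \<partial>XM n)" for n
  have r0: "(%n. r n / n) \<longlonglongrightarrow> 0"
    using indicator_section_jump[OF prob_nu A] by (simp add: IA r_def \<delta>_def)
  define K where "K a e e' = I a e * I a e'" for a e e'
  have Km: "(%(a, e, e'). K a e e') \<in> borel_measurable (borel \<Otimes>\<^sub>M borel \<Otimes>\<^sub>M borel)"
    unfolding K_def by measurable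
  have Kb: "\<bar>K a e e'\<bar> <= 1" for a e e' using Ib[of a e] Ib[of a e'] by (simp add: K_def abs_mult mult_le_one)
  have Kint: "(\<integral>a. \<integral>e. \<integral>e'. K a e e' \<partial>\<nu> \<partial>\<nu> \<partial>\<mu>) = TT t"
    unfolding TT_def by (simp add: K_def ph_def I_def power2_eq_square)
  define F where "F n z = (\<Sum>p\<in>adj (ord_list n (fst z)). K (fst z (snd p)) (snd z (fst p)) (snd z (snd p)))"
    for n and z :: "(nat => real) \<times> (nat => real)"
  define D where "D n z = (\<Sum>p\<in>adj (ord_list n (fst z)). \<bar>I (fst z (fst p)) (snd z (fst p)) - I (fst z (snd p)) (snd z (fst p))\<bar>)"
    for n and z :: "(nat => real) \<times> (nat => real)"
  have Fm: "F n \<in> borel_measurable (PM n)" and F1: "(\<integral>z. \<bar>F n z - n * TT t\<bar> \<partial>PM n) <= 6 * 1 * sqrt n + 1" for n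
    unfolding F_def Kint[symmetric] by (rule chain_lln(1)[OF Km Kb], rule chain_lln(2)[OF Km Kb])
  have Dm: "D n \<in> borel_measurable (PM n)" for n
    unfolding D_def
  proof (rule meas_adj_PM)
    fix i j assume ij: "i \<in> {1..n}" "j \<in> {1..n}"
    show "(%z. \<bar>I (fst z (fst (i, j))) (snd z (fst (i, j))) - I (fst z (snd (i, j))) (snd z (fst (i, j)))\<bar>) \<in> borel_measurable (PM n)"
      unfolding fst_conv snd_conv
      by (intro borel_measurable_abs borel_measurable_diff Im meas_comp ij)
  qed
  have Db: "\<bar>D n z\<bar> <= real n * 1" for n z
    unfolding D_def by (rule abs_sum_adj_le) (use Id in auto)
  have D1: "(\<integral>z. D n z \<partial>PM n) <= r n" for n
    unfolding r_def
  proof (rule PM_integral_mono[OF Dm Db])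
    interpret X: prob_space "XM n" by (rule prob_XM)
    show "integrable (XM n) (%x. \<Sum>p\<in>adj (ord_list n x). \<delta> (x (fst p)) (x (snd p)))"
    proof (rule X.integrable_bounded[where B="real n * 1"])
      show "(%x. \<Sum>p\<in>adj (ord_list n x). \<delta> (x (fst p)) (x (snd p))) \<in> borel_measurable (XM n)"
        by (rule meas_adj_XM) (auto intro!: \<delta>m meas_comp)
      show "norm (\<Sum>p\<in>adj (ord_list n x). \<delta> (x (fst p)) (x (snd p))) <= real n * 1" for x
        unfolding real_norm_def by (rule abs_sum_adj_le) (use \<delta>b in auto)
    qed
    fix x assume x: "x \<in> space (XM n)"
    interpret E: prob_space "EM n" by (rule prob_EM)
    have hm: "(%v. \<bar>I (x (fst p)) v - I (x (snd p)) v\<bar>) \<in> borel_measurable \<nu>" for p :: "nat \<times> nat" by measurable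
    have comp: "(\<integral>e. \<bar>I (x (fst p)) (e (fst p)) - I (x (snd p)) (e (fst p))\<bar> \<partial>EM n) = \<delta> (x (fst p)) (x (snd p))"
      and i: "integrable (EM n) (%e. \<bar>I (x (fst p)) (e (fst p)) - I (x (snd p)) (e (fst p))\<bar>)"
      if "p \<in> adj (ord_list n x)" for p
    proof -
      have k: "fst p \<in> {1..n}" using adj_ord_list[OF that] by simp
      show "(\<integral>e. \<bar>I (x (fst p)) (e (fst p)) - I (x (snd p)) (e (fst p))\<bar> \<partial>EM n) = \<delta> (x (fst p)) (x (snd p))"
        unfolding \<delta>_def
        by (rule integral_PiM_component[where g="%v. \<bar>I (x (fst p)) v - I (x (snd p)) v\<bar>"]) (use k hm prob_nu in auto)
      show "integrable (EM n) (%e. \<bar>I (x (fst p)) (e (fst p)) - I (x (snd p)) (e (fst p))\<bar>)"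
      proof (rule E.integrable_bounded[where B=1])
        show "(%e. \<bar>I (x (fst p)) (e (fst p)) - I (x (snd p)) (e (fst p))\<bar>) \<in> borel_measurable (EM n)"
          by (intro borel_measurable_abs borel_measurable_diff Im meas_comp(2) k borel_measurable_const)
      qed (use Id in auto)
    qed
    show "(\<integral>e. D n (x, e) \<partial>EM n) <= (\<Sum>p\<in>adj (ord_list n x). \<delta> (x (fst p)) (x (snd p)))"
      unfolding D_def fst_conv snd_conv using i comp by (subst Bochner_Integration.integral_sum) auto
  qed
  have bound: "(\<integral>z. \<bar>TR n {} z t - TT t\<bar> \<partial>PM n) <= r n / n + 6 * (sqrt n / n) + 1 / n" if n: "n \<ge> 1" for n
  proof -
    interpret P: prob_space "PM n" by (rule prob_PM)
    have pw: "\<bar>TR n {} z t - TT t\<bar> <= (D n z + \<bar>F n z - n * TT t\<bar>) / n" for z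
    proof -
      have TRn: "n * TR n {} z t = (\<Sum>p\<in>adj (ord_list n (fst z)). I (fst z (fst p)) (snd z (fst p)) * I (fst z (snd p)) (snd z (snd p)))"
        using n by (simp add: TR_def I_def yy_def)
      have "\<bar>n * TR n {} z t - F n z\<bar> <= (\<Sum>p\<in>adj (ord_list n (fst z)).
         \<bar>I (fst z (fst p)) (snd z (fst p)) * I (fst z (snd p)) (snd z (snd p)) - K (fst z (snd p)) (snd z (fst p)) (snd z (snd p))\<bar>)"
        unfolding TRn F_def sum_subtractf[symmetric] by (rule sum_abs)
      also have "\<dots> <= D n z"
        unfolding D_def
      proof (rule sum_mono)
        fix p :: "nat \<times> nat"
        let ?c = "I (fst z (snd p)) (snd z (snd p))"
        have "I (fst z (fst p)) (snd z (fst p)) * ?c - K (fst z (snd p)) (snd z (fst p)) (snd z (snd p))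
            = (I (fst z (fst p)) (snd z (fst p)) - I (fst z (snd p)) (snd z (fst p))) * ?c"
          by (simp add: K_def left_diff_distrib)
        then show "\<bar>I (fst z (fst p)) (snd z (fst p)) * ?c - K (fst z (snd p)) (snd z (fst p)) (snd z (snd p))\<bar>
            <= \<bar>I (fst z (fst p)) (snd z (fst p)) - I (fst z (snd p)) (snd z (fst p))\<bar>"
          using Ib[of "fst z (snd p)" "snd z (snd p)"] by (simp add: abs_mult mult_left_le)
      qed
      finally have "\<bar>n * TR n {} z t - n * TT t\<bar> <= D n z + \<bar>F n z - n * TT t\<bar>" by linarith
      moreover have "\<bar>n * TR n {} z t - n * TT t\<bar> = n * \<bar>TR n {} z t - TT t\<bar>"
        by (simp add: abs_mult right_diff_distrib[symmetric])
      ultimately show ?thesis using n by (simp add: pos_le_divide_eq mult.commute)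
    qed
    have iD: "integrable (PM n) (D n)" by (rule P.integrable_bounded[where B="real n * 1"]) (use Dm Db in auto)
    have iF: "integrable (PM n) (%z. \<bar>F n z - n * TT t\<bar>)"
    proof (rule P.integrable_bounded[where B="real n * 1 + \<bar>n * TT t\<bar>"])
      show "(%z. \<bar>F n z - n * TT t\<bar>) \<in> borel_measurable (PM n)" using Fm[of n] by measurable
      show "norm \<bar>F n z - n * TT t\<bar> <= real n * 1 + \<bar>n * TT t\<bar>" for z
      proof -
        have "\<bar>F n z\<bar> <= real n * 1" unfolding F_def by (rule abs_sum_adj_le) (use Kb in auto)
        then show ?thesis using abs_triangle_ineq4[of "F n z" "n * TT t"] by simp
      qed
    qed
    have iT: "integrable (PM n) (%z. \<bar>TR n {} z t - TT t\<bar>)"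
    proof (rule P.integrable_bounded[where B=1])
      show "(%z. \<bar>TR n {} z t - TT t\<bar>) \<in> borel_measurable (PM n)"
        using TR_meas_z[of "%_. t" n "{}"] by simp
      show "norm \<bar>TR n {} z t - TT t\<bar> <= 1" for z
        unfolding real_norm_def abs_idempotent using TR_01[of n "{}" z t] TT_01[of t] by linarith
    qed
    have "(\<integral>z. \<bar>TR n {} z t - TT t\<bar> \<partial>PM n) <= (\<integral>z. (D n z + \<bar>F n z - n * TT t\<bar>) / n \<partial>PM n)"
      by (rule integral_mono) (use iT iD iF pw in auto)
    also have "\<dots> = ((\<integral>z. D n z \<partial>PM n) + (\<integral>z. \<bar>F n z - n * TT t\<bar> \<partial>PM n)) / n" using iD iF by simp
    also have "\<dots> <= (r n + (6 * sqrt n + 1)) / n" using D1[of n] F1[of n] by (intro divide_right_mono) auto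
    finally show ?thesis by (simp add: add_divide_distrib)
  qed
  note z = sqrt_over_n_tendsto
  have lim: "(%n. r n / n + 6 * (sqrt (real n) / n) + 1 / n) \<longlonglongrightarrow> 0 + 6 * 0 + 0"
    by (intro tendsto_intros r0 z lim_1_over_n)
  show ?thesis
  proof (rule tendsto_sandwich[OF _ _ tendsto_const])
    show "\<forall>\<^sub>F n in sequentially. 0 <= (\<integral>z. \<bar>TR n {} z t - TT t\<bar> \<partial>PM n)"
      by (intro always_eventually allI Bochner_Integration.integral_nonneg) auto
    show "\<forall>\<^sub>F n in sequentially. (\<integral>z. \<bar>TR n {} z t - TT t\<bar> \<partial>PM n) <= r n / n + 6 * (sqrt (real n) / n) + 1 / n"
      using bound by (intro eventually_mono[OF eventually_ge_at_top[of 1]]) auto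
  qed (use lim in simp)
qed

text \<open>The mean L1 distance of T_n and T with respect to F_Y. It tends to zero, without a rate,
  and governs the size of the empirical remainder.\<close>

definition al :: "nat => real" where "al n = (\<integral>z. \<integral>t. \<bar>TR n {} z t - TT t\<bar> \<partial>lam \<partial>PM n)"

lemma TRT_bound: "\<bar>TR n J z t - TT t\<bar> <= 1"
  using TR_01[of n J z t] TT_01[of t] by linarith

lemma TRT_meas: "(%(z, t). \<bar>TR n J z t - TT t\<bar>) \<in> borel_measurable (PM n \<Otimes>\<^sub>M lam)"
proof -
  have [measurable]: "(%q. TR n J (fst q) (snd q)) \<in> borel_measurable (PM n \<Otimes>\<^sub>M lam)"
    using TR_meas by (simp add: case_prod_beta' cong: measurable_cong_sets sets_pair_measure_cong)
  have "(%q. \<bar>TR n J (fst q) (snd q) - TT (snd q)\<bar>) \<in> borel_measurable (PM n \<Otimes>\<^sub>M lam)" by measurable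
  then show ?thesis by (simp add: case_prod_beta')
qed

lemma al_tendsto: "al \<longlonglongrightarrow> 0"
proof -
  have eq: "al n = (\<integral>t. \<integral>z. \<bar>TR n {} z t - TT t\<bar> \<partial>PM n \<partial>lam)" for n
  proof -
    interpret P: prob_space "PM n" by (rule prob_PM)
    interpret pl: pair_prob_space "PM n" lam ..
    show ?thesis
      unfolding al_def
      by (rule pl.Fubini_integral[symmetric], rule pl.P.integrable_bounded[where B=1])
        (use TRT_meas TRT_bound in auto)
  qed
  have "(%n. \<integral>t. \<integral>z. \<bar>TR n {} z t - TT t\<bar> \<partial>PM n \<partial>lam) \<longlonglongrightarrow> (\<integral>t. 0 \<partial>lam)"
  proof (rule integral_dominated_convergence[where w="%_. 1"])
    fix n
    interpret P: prob_space "PM n" by (rule prob_PM)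
    have "(%(t, z). \<bar>TR n {} z t - TT t\<bar>) \<in> borel_measurable (lam \<Otimes>\<^sub>M PM n)"
      using measurable_compose[OF measurable_pair_swap' TRT_meas] by (simp add: case_prod_beta')
    then show "(%t. \<integral>z. \<bar>TR n {} z t - TT t\<bar> \<partial>PM n) \<in> borel_measurable lam"
      by (rule P.borel_measurable_lebesgue_integral)
    show "AE t in lam. norm (\<integral>z. \<bar>TR n {} z t - TT t\<bar> \<partial>PM n) <= 1"
      by (intro AE_I2 P.integral_bounded) (use TRT_bound in auto)
  qed (use TR_lln in auto)
  then show ?thesis unfolding eq by simp
qed

section \<open>The remainder caused by the empirical law\<close>

text \<open>Centred under \<open>lam\<close>, so that its mean vanishes at a response that is
  independent of the observations it is built from.\<close>

definition gg :: "nat => nat set => (nat => real) \<times> (nat => real) => real => real" where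
  "gg n J z t = TR n J z t - TT t - (\<integral>s. TR n J z s - TT s \<partial>lam)"

text \<open>Equals n times the integral of \<open>TR n {} z - TT\<close> against F_n - F_Y, the
  product of two errors that remains after linearising in both.\<close>

definition QQ :: "nat => (nat => real) \<times> (nat => real) => real" where
  "QQ n z = (\<Sum>j\<in>{1..n}. gg n {} z (yy j z))"

lemma int_TR: "integrable lam (TR n J z)"
  by (rule L.integrable_bounded[where B=1]) (use TR_meas_t TR_01 in auto)

lemma int_TT: "integrable lam TT"
  by (rule L.integrable_bounded[where B=1]) (use TT_01 in auto)

lemma int_TRT: "integrable lam (%s. TR n J z s - TT s)"
  using int_TR int_TT by simp

lemma gg_bound: "\<bar>gg n J z t\<bar> <= 2"
proof -
  have "\<bar>\<integral>s. TR n J z s - TT s \<partial>lam\<bar> <= 1" by (rule L.abs_integral_bounded) (use TRT_bound in auto)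
  then show ?thesis unfolding gg_def using TRT_bound[of n J z t] by linarith
qed

lemma gg_mean: "(\<integral>t. gg n J z t \<partial>lam) = 0"
  unfolding gg_def using int_TRT by (simp add: L.prob_space[simplified])

lemma gg_meas: "(%(z, t). gg n J z t) \<in> borel_measurable (PM n \<Otimes>\<^sub>M borel)"
proof -
  have m: "(%q. TR n J (fst q) (snd q)) \<in> borel_measurable (PM n \<Otimes>\<^sub>M lam)"
    using TR_meas by (simp add: case_prod_beta' cong: measurable_cong_sets sets_pair_measure_cong)
  have "(%(z, s). TR n J z s - TT s) \<in> borel_measurable (PM n \<Otimes>\<^sub>M lam)"
    using borel_measurable_diff[OF m, of "%q. TT (snd q)"] by (simp add: case_prod_beta')
  then have "(%z. \<integral>s. TR n J z s - TT s \<partial>lam) \<in> borel_measurable (PM n)"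
    by (rule L.borel_measurable_lebesgue_integral)
  then have [measurable]: "(%q. \<integral>s. TR n J (fst q) s - TT s \<partial>lam) \<in> borel_measurable (PM n \<Otimes>\<^sub>M borel)"
    by (rule measurable_compose[OF measurable_fst])
  have [measurable]: "(%q. TR n J (fst q) (snd q)) \<in> borel_measurable (PM n \<Otimes>\<^sub>M borel)"
    using TR_meas by (simp add: case_prod_beta')
  have "(%q. gg n J (fst q) (snd q)) \<in> borel_measurable (PM n \<Otimes>\<^sub>M borel)"
    unfolding gg_def by measurable
  then show ?thesis by (simp add: case_prod_beta')
qed

lemma gg_meas_z: "h \<in> borel_measurable (PM n) ==> (%z. gg n J z (h z)) \<in> borel_measurable (PM n)"
  using measurable_compose[OF measurable_Pair[OF measurable_ident] gg_meas] by simp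

lemma gg_inv: "i \<in> J ==> gg n J (x(i := a), e(i := v)) t = gg n J (x, e) t"
  unfolding gg_def by (simp add: TR_inv)

lemma gg_insert: "\<bar>gg n J z t - gg n (insert i J) z t\<bar> <= 4 / n"
proof -
  have "\<bar>(\<integral>s. TR n J z s - TT s \<partial>lam) - (\<integral>s. TR n (insert i J) z s - TT s \<partial>lam)\<bar> <= 2 / n"
    by (rule L.abs_integral_diff_le) (use int_TRT TR_insert[of n J z _ i] in auto)
  then show ?thesis unfolding gg_def using TR_insert[of n J z t i] by linarith
qed

lemma gg_remove2: "\<bar>gg n {} z t - gg n {i, j} z t\<bar> <= 8 / n"
  using gg_insert[of n "{}" z t j] gg_insert[of n "{j}" z t i] by linarith

lemma int_al: "integrable (PM n) (%z. \<integral>t. \<bar>TR n J z t - TT t\<bar> \<partial>lam)"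
proof -
  interpret P: prob_space "PM n" by (rule prob_PM)
  show ?thesis
  proof (rule P.integrable_bounded[where B=1])
    show "(%z. \<integral>t. \<bar>TR n J z t - TT t\<bar> \<partial>lam) \<in> borel_measurable (PM n)"
      by (rule L.borel_measurable_lebesgue_integral[OF TRT_meas])
    show "norm (\<integral>t. \<bar>TR n J z t - TT t\<bar> \<partial>lam) <= 1" for z
      by (rule L.integral_bounded) (use TRT_bound in auto)
  qed
qed

text \<open>With \<open>i\<close> deleted, the response \<open>yy i\<close> is a fresh draw from
  \<open>lam\<close>. Centring at most doubles the L1 error, and reinstating two indices costs
  \<open>4 / n\<close>.\<close>

lemma gg_abs_mean: "(\<integral>z. \<bar>gg n {i, j} z (yy i z)\<bar> \<partial>PM n) <= 2 * (al n + 4 / n)" if i: "i \<in> {1..n}"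
proof -
  interpret P: prob_space "PM n" by (rule prob_PM)
  interpret pl: pair_prob_space "PM n" lam ..
  let ?J = "{i, j}"
  have m: "(%(z, t). \<bar>gg n ?J z t\<bar>) \<in> borel_measurable (PM n \<Otimes>\<^sub>M borel)"
    using borel_measurable_abs[OF gg_meas[of n ?J]] by (simp add: case_prod_beta')
  have "(\<integral>z. \<bar>gg n ?J z (yy i z)\<bar> \<partial>PM n) = (\<integral>z. \<integral>t. \<bar>gg n ?J z t\<bar> \<partial>lam \<partial>PM n)"
    unfolding yy_def lam_def
    by (rule integral_resample_point[OF i f_meas m, where B=2]) (use gg_bound gg_inv in auto)
  also have "\<dots> <= (\<integral>z. 2 * ((\<integral>t. \<bar>TR n {} z t - TT t\<bar> \<partial>lam) + 4 / n) \<partial>PM n)"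
  proof (rule integral_mono)
    have m': "(%(z, t). \<bar>gg n ?J z t\<bar>) \<in> borel_measurable (PM n \<Otimes>\<^sub>M lam)"
      using m by (simp cong: measurable_cong_sets sets_pair_measure_cong)
    show "integrable (PM n) (%z. \<integral>t. \<bar>gg n ?J z t\<bar> \<partial>lam)"
    proof (rule P.integrable_bounded[where B=2])
      show "(%z. \<integral>t. \<bar>gg n ?J z t\<bar> \<partial>lam) \<in> borel_measurable (PM n)"
        by (rule L.borel_measurable_lebesgue_integral[OF m'])
      show "norm (\<integral>t. \<bar>gg n ?J z t\<bar> \<partial>lam) <= 2" for z
        by (rule L.integral_bounded) (use gg_bound in auto)
    qed
    from int_al show "integrable (PM n) (%z. 2 * ((\<integral>t. \<bar>TR n {} z t - TT t\<bar> \<partial>lam) + 4 / n))" by simp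
    fix z
    have it: "integrable lam (%t. \<bar>TR n K z t - TT t\<bar>)" for K using int_TRT by simp
    have a: "\<bar>TR n ?J z t - TT t\<bar> <= \<bar>TR n {} z t - TT t\<bar> + 4 / n" for t
      using TR_insert[of n "{}" z t j] TR_insert[of n "{j}" z t i] by linarith
    define b where "b = (\<integral>t. \<bar>TR n ?J z t - TT t\<bar> \<partial>lam)"
    have "b <= (\<integral>t. \<bar>TR n {} z t - TT t\<bar> + 4 / n \<partial>lam)"
      unfolding b_def by (rule integral_mono) (use it a in auto)
    also have "\<dots> = (\<integral>t. \<bar>TR n {} z t - TT t\<bar> \<partial>lam) + 4 / n" using it by (simp add: L.prob_space[simplified])
    finally have bb: "b <= (\<integral>t. \<bar>TR n {} z t - TT t\<bar> \<partial>lam) + 4 / n" .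
    have sb: "\<bar>\<integral>s. TR n ?J z s - TT s \<partial>lam\<bar> <= b" unfolding b_def by (rule integral_abs_bound)
    have "(\<integral>t. \<bar>gg n ?J z t\<bar> \<partial>lam) <= (\<integral>t. \<bar>TR n ?J z t - TT t\<bar> + b \<partial>lam)"
    proof (rule integral_mono)
      show "integrable lam (%t. \<bar>gg n ?J z t\<bar>)" unfolding gg_def using int_TRT int_TR int_TT by simp
      show "integrable lam (%t. \<bar>TR n ?J z t - TT t\<bar> + b)" using it by simp
      show "\<bar>gg n ?J z t\<bar> <= \<bar>TR n ?J z t - TT t\<bar> + b" for t unfolding gg_def using sb by linarith
    qed
    also have "\<dots> = b + b" using it by (simp add: b_def[symmetric] L.prob_space[simplified])
    also have "\<dots> = 2 * b" by simp
    also have "\<dots> <= 2 * ((\<integral>t. \<bar>TR n {} z t - TT t\<bar> \<partial>lam) + 4 / n)"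
      by (rule mult_left_mono[OF bb]) simp
    finally show "(\<integral>t. \<bar>gg n ?J z t\<bar> \<partial>lam) <= 2 * ((\<integral>t. \<bar>TR n {} z t - TT t\<bar> \<partial>lam) + 4 / n)" .
  qed
  also have "\<dots> = 2 * (al n + 4 / n)"
    using int_al[of n "{}"] by (simp add: al_def P.prob_space)
  finally show ?thesis .
qed

text \<open>Leaving out the observations \<open>i\<close> and \<open>j\<close> changes \<open>gg\<close> by \<open>O(1/n)\<close> and makes the product of
  its values at \<open>Y\<^sub>i\<close> and \<open>Y\<^sub>j\<close> exactly centred.\<close>

lemma gg_cross:
  assumes i: "i \<in> {1..n}" and j: "j \<in> {1..n}" and ij: "i ~= j"
  shows "(\<integral>z. gg n {} z (yy i z) * gg n {} z (yy j z) \<partial>PM n) <= 32 * al n / n + 192 / (real n * real n)"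
proof -
  interpret P: prob_space "PM n" by (rule prob_PM)
  let ?J = "{i, j}"
  have n: "n \<ge> 1" using i by auto
  define a where "a k z = gg n ?J z (yy k z)" for k z
  define b where "b k z = gg n {} z (yy k z)" for k z
  have am: "a k \<in> borel_measurable (PM n)" "b k \<in> borel_measurable (PM n)" if "k \<in> {1..n}" for k
    unfolding a_def b_def using gg_meas_z[OF yy_meas[OF that]] by auto
  have ab: "\<bar>a k z\<bar> <= 2" "\<bar>b k z\<bar> <= 2" for k z unfolding a_def b_def using gg_bound by auto
  have d: "\<bar>b k z - a k z\<bar> <= 8 / n" for k z unfolding a_def b_def by (rule gg_remove2)
  have zero: "(\<integral>z. a i z * a j z \<partial>PM n) = 0"
  proof -
    define \<Phi> where "\<Phi> z t = gg n ?J z t * a j z" for z t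
    have m: "(%(z, t). \<Phi> z t) \<in> borel_measurable (PM n \<Otimes>\<^sub>M borel)"
      unfolding \<Phi>_def using borel_measurable_times[OF gg_meas[of n ?J] measurable_compose[OF measurable_fst am(1)[OF j]]]
      by (simp add: case_prod_beta')
    have bd: "\<bar>\<Phi> z t\<bar> <= 4" for z t
      unfolding \<Phi>_def abs_mult using mult_mono[OF gg_bound[of n ?J z t] ab(1)[of j z]] by simp
    have "(\<integral>z. \<Phi> z (f (fst z i, snd z i)) \<partial>PM n) = (\<integral>z. \<integral>t. \<Phi> z t \<partial>distr (\<mu> \<Otimes>\<^sub>M \<nu>) borel f \<partial>PM n)"
    proof (rule integral_resample_point[OF i f_meas m bd])
      fix x e c v t
      have "a j (x(i := c), e(i := v)) = a j (x, e)"
        using ij by (simp add: a_def yy_def gg_inv)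
      then show "\<Phi> (x(i := c), e(i := v)) t = \<Phi> (x, e) t" by (simp add: \<Phi>_def gg_inv)
    qed
    also have "\<dots> = 0" unfolding \<Phi>_def lam_def[symmetric] by (simp add: gg_mean)
    finally show ?thesis by (simp add: \<Phi>_def a_def yy_def)
  qed
  have int: "integrable (PM n) (%z. h z * k z)" if "h \<in> borel_measurable (PM n)" "k \<in> borel_measurable (PM n)"
    "!!z. \<bar>h z\<bar> <= 2" "!!z. \<bar>k z\<bar> <= 2" for h k :: "_ => real"
  proof (rule P.integrable_bounded[where B=4])
    show "(%z. h z * k z) \<in> borel_measurable (PM n)" by (rule borel_measurable_times[OF that(1,2)])
    show "norm (h z * k z) <= 4" for z using mult_mono[OF that(3)[of z] that(4)[of z]] by (simp add: abs_mult)
  qed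
  have ia: "integrable (PM n) (%z. \<bar>a k z\<bar>)" if "k \<in> {1..n}" for k
    by (rule P.integrable_bounded[where B=2]) (use am(1)[OF that] ab in auto)
  have mean: "(\<integral>z. \<bar>a i z\<bar> \<partial>PM n) <= 2 * (al n + 4 / n)" "(\<integral>z. \<bar>a j z\<bar> \<partial>PM n) <= 2 * (al n + 4 / n)"
    unfolding a_def using gg_abs_mean[OF i, of j] gg_abs_mean[OF j, of i] by (simp_all add: insert_commute)
  have "(\<integral>z. b i z * b j z \<partial>PM n) = (\<integral>z. b i z * b j z \<partial>PM n) - (\<integral>z. a i z * a j z \<partial>PM n)" using zero by simp
  also have "\<dots> = (\<integral>z. b i z * b j z - a i z * a j z \<partial>PM n)"
    by (rule Bochner_Integration.integral_diff[symmetric]) (use int am i j ab in auto)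
  also have "\<dots> <= (\<integral>z. 8 / n * \<bar>a i z\<bar> + 8 / n * \<bar>a j z\<bar> + 64 / (real n * real n) \<partial>PM n)"
  proof (rule integral_mono)
    show "integrable (PM n) (%z. b i z * b j z - a i z * a j z)"
      by (rule Bochner_Integration.integrable_diff) (use int am i j ab in auto)
    show "integrable (PM n) (%z. 8 / n * \<bar>a i z\<bar> + 8 / n * \<bar>a j z\<bar> + 64 / (real n * real n))"
      using ia[OF i] ia[OF j] by simp
    fix z
    \<comment> \<open>Every term on the right contains a deletion error of size
      \<open>8 / n\<close>; in the first two terms it multiplies a quantity whose mean is small by
      \<open>gg_abs_mean\<close>, the third has two such errors.\<close>
    have "b i z * b j z - a i z * a j z = a i z * (b j z - a j z) + a j z * (b i z - a i z) + (b i z - a i z) * (b j z - a j z)"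
      by (simp add: algebra_simps)
    also have "\<dots> <= \<bar>a i z * (b j z - a j z)\<bar> + \<bar>a j z * (b i z - a i z)\<bar> + \<bar>(b i z - a i z) * (b j z - a j z)\<bar>" by linarith
    also have "\<dots> <= \<bar>a i z\<bar> * (8 / n) + \<bar>a j z\<bar> * (8 / n) + 8 / n * (8 / n)"
      unfolding abs_mult using d by (intro add_mono mult_left_mono mult_mono) auto
    finally show "b i z * b j z - a i z * a j z <= 8 / n * \<bar>a i z\<bar> + 8 / n * \<bar>a j z\<bar> + 64 / (real n * real n)"
      by (simp add: mult.commute)
  qed
  also have "\<dots> = 8 / n * (\<integral>z. \<bar>a i z\<bar> \<partial>PM n) + 8 / n * (\<integral>z. \<bar>a j z\<bar> \<partial>PM n) + 64 / (real n * real n)"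
    using ia[OF i] ia[OF j] by (simp add: P.prob_space)
  also have "\<dots> <= 8 / n * (2 * (al n + 4 / n)) + 8 / n * (2 * (al n + 4 / n)) + 64 / (real n * real n)"
    using mean by (intro add_mono mult_left_mono) auto
  also have "\<dots> = 32 * al n / n + 192 / (real n * real n)"
    using n by (simp add: field_simps)
  finally show ?thesis unfolding b_def .
qed

text \<open>For a function bounded by 2 the square is at most twice the modulus, so the L1 bound
  suffices.\<close>

lemma gg_diag:
  assumes i: "i \<in> {1..n}"
  shows "(\<integral>z. gg n {} z (yy i z) * gg n {} z (yy i z) \<partial>PM n) <= 4 * al n + 32 / n"
proof -
  interpret P: prob_space "PM n" by (rule prob_PM)
  define a where "a z = gg n {i, i} z (yy i z)" for z
  define b where "b z = gg n {} z (yy i z)" for z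
  have am: "a \<in> borel_measurable (PM n)" "b \<in> borel_measurable (PM n)"
    unfolding a_def b_def using gg_meas_z[OF yy_meas[OF i]] by auto
  have ab: "\<bar>a z\<bar> <= 2" "\<bar>b z\<bar> <= 2" for z unfolding a_def b_def using gg_bound by auto
  have d: "\<bar>b z - a z\<bar> <= 8 / n" for z unfolding a_def b_def by (rule gg_remove2)
  have ia: "integrable (PM n) (%z. \<bar>a z\<bar>)"
    by (rule P.integrable_bounded[where B=2]) (use am ab in auto)
  have "(\<integral>z. b z * b z \<partial>PM n) <= (\<integral>z. 2 * (\<bar>a z\<bar> + 8 / n) \<partial>PM n)"
  proof (rule integral_mono)
    show "integrable (PM n) (%z. b z * b z)"
    proof (rule P.integrable_bounded[where B=4])
      show "(%z. b z * b z) \<in> borel_measurable (PM n)" using am by measurable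
      show "norm (b z * b z) <= 4" for z using mult_mono[OF ab(2)[of z] ab(2)[of z]] by (simp add: abs_mult)
    qed
    show "integrable (PM n) (%z. 2 * (\<bar>a z\<bar> + 8 / n))" using ia by simp
    fix z
    have "b z * b z = \<bar>b z\<bar> * \<bar>b z\<bar>" by simp
    also have "\<dots> <= 2 * (\<bar>a z\<bar> + 8 / n)"
      by (rule mult_mono) (use ab[of z] d[of z] in auto)
    finally show "b z * b z <= 2 * (\<bar>a z\<bar> + 8 / n)" .
  qed
  also have "\<dots> = 2 * (\<integral>z. \<bar>a z\<bar> \<partial>PM n) + 16 / n" using ia by (simp add: P.prob_space)
  finally have "(\<integral>z. b z * b z \<partial>PM n) <= 2 * (\<integral>z. \<bar>a z\<bar> \<partial>PM n) + 16 / n" .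
  moreover have "(\<integral>z. \<bar>a z\<bar> \<partial>PM n) <= 2 * (al n + 4 / n)"
    unfolding a_def by (rule gg_abs_mean[OF i])
  ultimately have "(\<integral>z. b z * b z \<partial>PM n) <= 4 * al n + 32 / n" by (simp add: field_simps)
  then show ?thesis unfolding b_def .
qed

lemma QQ_meas: "QQ n \<in> borel_measurable (PM n)"
  unfolding QQ_def by (intro borel_measurable_sum gg_meas_z yy_meas)

lemma QQ_bound: "\<bar>QQ n z\<bar> <= 2 * n"
proof -
  have "\<bar>QQ n z\<bar> <= (\<Sum>j\<in>{1..n}. \<bar>gg n {} z (yy j z)\<bar>)" unfolding QQ_def by (rule sum_abs)
  also have "\<dots> <= of_nat (card {1..n}) * 2" by (rule sum_bounded_above) (rule gg_bound)
  finally show ?thesis by simp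
qed

lemma al_nonneg: "0 <= al n"
  unfolding al_def by (intro Bochner_Integration.integral_nonneg) auto

text \<open>About n^2 cross terms of size \<open>al n / n\<close> and n diagonal terms of size
  \<open>al n\<close> give o(n), hence \<open>QQ\<close> is negligible on the scale sqrt n. The
  constants are 36 = 32 + 4 and 224 = 192 + 32.\<close>

lemma QQ_square: "(\<integral>z. (QQ n z)\<^sup>2 \<partial>PM n) <= 36 * real n * al n + 224"
proof (cases "n = 0")
  case True
  then show ?thesis by (simp add: QQ_def)
next
  case False
  interpret P: prob_space "PM n" by (rule prob_PM)
  define b where "b k z = gg n {} z (yy k z)" for k z
  have bm: "b k \<in> borel_measurable (PM n)" if "k \<in> {1..n}" for k
    unfolding b_def by (rule gg_meas_z[OF yy_meas[OF that]])
  have bb: "\<bar>b k z\<bar> <= 2" for k z unfolding b_def by (rule gg_bound)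
  have ib: "integrable (PM n) (%z. b k z * b l z)" if "k \<in> {1..n}" "l \<in> {1..n}" for k l
  proof (rule P.integrable_bounded[where B=4])
    show "(%z. b k z * b l z) \<in> borel_measurable (PM n)" using bm that by (intro borel_measurable_times) auto
    show "norm (b k z * b l z) <= 4" for z using mult_mono[OF bb[of k z] bb[of l z]] by (simp add: abs_mult)
  qed
  have "(\<integral>z. (QQ n z)\<^sup>2 \<partial>PM n) = (\<integral>z. (\<Sum>k\<in>{1..n}. \<Sum>l\<in>{1..n}. b k z * b l z) \<partial>PM n)"
    by (simp add: QQ_def b_def power2_eq_square sum_product)
  also have "\<dots> = (\<Sum>k\<in>{1..n}. \<integral>z. (\<Sum>l\<in>{1..n}. b k z * b l z) \<partial>PM n)"
    by (rule Bochner_Integration.integral_sum) (rule Bochner_Integration.integrable_sum, rule ib)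
  also have "\<dots> = (\<Sum>k\<in>{1..n}. \<Sum>l\<in>{1..n}. \<integral>z. b k z * b l z \<partial>PM n)"
    by (rule sum.cong[OF refl], rule Bochner_Integration.integral_sum) (rule ib)
  also have "\<dots> <= (\<Sum>k\<in>{1..n}. \<Sum>l\<in>{1..n}. (32 * al n / n + 192 / (real n * real n)) + (if k = l then 4 * al n + 32 / n else 0))"
  proof (intro sum_mono)
    fix k l assume kl: "k \<in> {1..n}" "l \<in> {1..n}"
    show "(\<integral>z. b k z * b l z \<partial>PM n) <= (32 * al n / n + 192 / (real n * real n)) + (if k = l then 4 * al n + 32 / n else 0)"
    proof (cases "k = l")
      case True
      have "0 <= 32 * al n / n + 192 / (real n * real n)" using al_nonneg[of n] by simp
      then show ?thesis unfolding b_def using True gg_diag[OF kl(1)] by simp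
    next
      case False
      then show ?thesis unfolding b_def using gg_cross[OF kl] by simp
    qed
  qed
  also have "\<dots> = n * (n * (32 * al n / n + 192 / (real n * real n)) + (4 * al n + 32 / n))"
    by (simp add: sum.distrib)
  also have "\<dots> = 36 * real n * al n + 224" using False by (simp add: field_simps)
  finally show ?thesis .
qed

text \<open>Exact bilinear expansion of the integral of T_n against F_n around T and F_Y: the two
  linear terms make up \<open>SS\<close>, the constant is \<open>cc\<close>, and the product of the
  errors is \<open>QQ\<close>.\<close>

lemma n_ZZ: "n * ZZ n z = SS n z - n * cc + QQ n z" if n: "n \<ge> 1"
proof -
  have H: "n * (\<integral>t. TR n {} z t \<partial>lam) =
      (\<Sum>p\<in>adj (ord_list n (fst z)). H (ww (fst z (fst p), snd z (fst p))) (ww (fst z (snd p), snd z (snd p))))"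
  proof -
    have ii: "integrable lam (%t. indicator {..t} y * indicator {..t} y' :: real)" for y y'
    proof (rule L.integrable_bounded[where B=1])
      show "(%t. indicator {..t} y * indicator {..t} y' :: real) \<in> borel_measurable lam"
        by (intro borel_measurable_times ind_meas) auto
      show "norm (indicator {..t} y * indicator {..t} y' :: real) <= 1" for t by (simp add: indicator_def)
    qed
    have "n * (\<integral>t. TR n {} z t \<partial>lam) = (\<integral>t. n * TR n {} z t \<partial>lam)" by simp
    also have "\<dots> = (\<integral>t. (\<Sum>p\<in>adj (ord_list n (fst z)). indicator {..t} (yy (fst p) z) * indicator {..t} (yy (snd p) z)) \<partial>lam)"
      by (rule Bochner_Integration.integral_cong) (use n in \<open>auto simp: TR_def simp del: indicator_simps sum_mult_indicator\<close>)
    also have "\<dots> = (\<Sum>p\<in>adj (ord_list n (fst z)). \<integral>t. indicator {..t} (yy (fst p) z) * indicator {..t} (yy (snd p) z) \<partial>lam)"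
      by (rule Bochner_Integration.integral_sum) (rule ii)
    finally have "n * (\<integral>t. TR n {} z t \<partial>lam) = (\<Sum>p\<in>adj (ord_list n (fst z)). \<integral>t. indicator {..t} (yy (fst p) z) * indicator {..t} (yy (snd p) z) \<partial>lam)" .
    then show ?thesis by (simp add: integral_max_le yy_def ww_def)
  qed
  have U: "(\<Sum>j\<in>{1..n}. TT (yy j z)) = (\<Sum>i\<in>{1..n}. uu (fst z i, snd z i))" by (simp add: uu_def yy_def)
  have I: "(\<integral>s. TR n {} z s - TT s \<partial>lam) = (\<integral>t. TR n {} z t \<partial>lam) - cc"
    unfolding cc_def using int_TR int_TT by simp
  have "QQ n z = n * ZZ n z - (\<Sum>j\<in>{1..n}. TT (yy j z)) - n * (\<integral>s. TR n {} z s - TT s \<partial>lam)"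
    using n by (simp add: QQ_def gg_def ZZ_def sum_subtractf)
  then show ?thesis unfolding SS_def H[symmetric] U I by (simp add: algebra_simps)
qed

section \<open>Asymptotics of the statistic without the cyclic pair\<close>

lemma ZZ_meas: "ZZ n \<in> borel_measurable (PM n)"
  unfolding ZZ_def by (intro borel_measurable_divide borel_measurable_sum TR_meas_z yy_meas) auto

lemma ZZ_01: "0 <= ZZ n z \<and> ZZ n z <= 1"
proof -
  have "0 <= (\<Sum>j\<in>{1..n}. TR n {} z (yy j z))" by (rule sum_nonneg) (use TR_01 in auto)
  moreover have "(\<Sum>j\<in>{1..n}. TR n {} z (yy j z)) <= of_nat (card {1..n}) * 1"
    by (rule sum_bounded_above) (use TR_01 in auto)
  ultimately show ?thesis unfolding ZZ_def by (cases "n = 0") (auto simp: divide_simps)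
qed

text \<open>Observation \<open>i\<close> is deleted both from the ordered list and from the
  empirical average. The lost evaluation costs \<open>1 / n\<close>, the altered pairs
  \<open>2 / n\<close>, and \<open>2 * n * (3 / n)\<^sup>2 = 18 / n\<close>.\<close>

lemma ZZ_variance: "(\<integral>z. (ZZ n z - (\<integral>z. ZZ n z \<partial>PM n))\<^sup>2 \<partial>PM n) <= 18 / n"
proof (cases "n = 0")
  case True
  then show ?thesis by (simp add: ZZ_def)
next
  case n: False
  define W where "W i z = (\<Sum>j\<in>{1..n} - {i}. TR n {i} z (yy j z)) / n" for i z
  have "(\<integral>z. (ZZ n z - (\<integral>z. ZZ n z \<partial>PM n))\<^sup>2 \<partial>PM n) <= 2 * real n * (3 / n)\<^sup>2"
  proof (rule efron_stein_PM[where B=1 and W=W])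
    show "\<bar>ZZ n z\<bar> <= 1" for z using ZZ_01[of n z] by simp
    show "W i \<in> borel_measurable (PM n)" if "i \<in> {1..n}" for i
      unfolding W_def by (intro borel_measurable_divide borel_measurable_sum TR_meas_z yy_meas) auto
    show "\<bar>W i z\<bar> <= 1" for i z
    proof -
      have "0 <= (\<Sum>j\<in>{1..n} - {i}. TR n {i} z (yy j z))" by (rule sum_nonneg) (use TR_01 in auto)
      moreover have "(\<Sum>j\<in>{1..n} - {i}. TR n {i} z (yy j z)) <= of_nat (card ({1..n} - {i})) * 1"
        by (rule sum_bounded_above) (use TR_01 in auto)
      moreover have "card ({1..n} - {i}) <= n" using card_mono[of "{1..n}" "{1..n} - {i}"] by auto
      ultimately show ?thesis unfolding W_def using n by (auto simp: divide_simps)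
    qed
    show "W i (x(i := a), e(i := v)) = W i (x, e)" if "i \<in> {1..n}" for i x e a v
    proof -
      have "TR n {i} (x(i := a), e(i := v)) (yy j (x(i := a), e(i := v))) = TR n {i} (x, e) (yy j (x, e))" if "j ~= i" for j
        using that by (simp add: TR_inv yy_def)
      then show ?thesis unfolding W_def by simp
    qed
    show "\<bar>ZZ n z - W i z\<bar> <= 3 / n" if i: "i \<in> {1..n}" for i z
    proof -
      have "(\<Sum>j\<in>{1..n}. TR n {} z (yy j z)) = TR n {} z (yy i z) + (\<Sum>j\<in>{1..n} - {i}. TR n {} z (yy j z))"
        by (rule sum.remove) (use i in auto)
      then have 1: "\<bar>(\<Sum>j\<in>{1..n}. TR n {} z (yy j z)) - (\<Sum>j\<in>{1..n} - {i}. TR n {i} z (yy j z))\<bar>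
          <= \<bar>TR n {} z (yy i z)\<bar> + \<bar>\<Sum>j\<in>{1..n} - {i}. TR n {} z (yy j z) - TR n {i} z (yy j z)\<bar>"
        by (simp add: sum_subtractf)
      have "\<bar>\<Sum>j\<in>{1..n} - {i}. TR n {} z (yy j z) - TR n {i} z (yy j z)\<bar> <= (\<Sum>j\<in>{1..n} - {i}. \<bar>TR n {} z (yy j z) - TR n {i} z (yy j z)\<bar>)"
        by (rule sum_abs)
      also have "\<dots> <= of_nat (card ({1..n} - {i})) * (2 / n)"
        by (rule sum_bounded_above) (rule TR_insert)
      also have "\<dots> <= real n * (2 / n)"
        using card_mono[of "{1..n}" "{1..n} - {i}"] by (intro mult_right_mono) auto
      also have "\<dots> = 2" using n by simp
      finally have 2: "\<bar>\<Sum>j\<in>{1..n} - {i}. TR n {} z (yy j z) - TR n {i} z (yy j z)\<bar> <= 2" .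
      have 3: "\<bar>TR n {} z (yy i z)\<bar> <= 1" using TR_01[of n "{}" z "yy i z"] by simp
      from 1 2 3 have "\<bar>(\<Sum>j\<in>{1..n}. TR n {} z (yy j z)) - (\<Sum>j\<in>{1..n} - {i}. TR n {i} z (yy j z))\<bar> <= 3" by linarith
      then have "\<bar>(\<Sum>j\<in>{1..n}. TR n {} z (yy j z)) - (\<Sum>j\<in>{1..n} - {i}. TR n {i} z (yy j z))\<bar> / n <= 3 / n"
        by (rule divide_right_mono) simp
      then show ?thesis unfolding ZZ_def W_def by (simp add: diff_divide_distrib[symmetric])
    qed
  qed (rule ZZ_meas)
  then show ?thesis using n by (simp add: power2_eq_square)
qed

text \<open>Total L1 error on the scale of sums: conditional residual, fluctuation of the bias,
  empirical remainder. By \<open>er_tendsto\<close> it is o(sqrt n).\<close>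

definition er :: "nat => real" where
  "er n = sqrt (128 * (\<integral>x. MD n x \<partial>XM n) + 32) + sqrt (64 * (\<integral>x. MD n x \<partial>XM n)) / 2 + sqrt (36 * real n * al n + 224)"

lemma ZZ_approx:
  assumes n: "n \<ge> 1"
  shows "(\<integral>z. \<bar>(n * ZZ n z - n * cc + ED n / 2) - (AA n (fst z) - n * c2 + KK n z)\<bar> \<partial>PM n) <= er n"
    and "integrable (PM n) (%z. \<bar>(n * ZZ n z - n * cc + ED n / 2) - (AA n (fst z) - n * c2 + KK n z)\<bar>)"
proof -
  interpret P: prob_space "PM n" by (rule prob_PM)
  define L1 where "L1 z = (SS n z - n * c2 + ED n / 2) - (AA n (fst z) - n * c2 + KK n z)" for z
  have eq: "(n * ZZ n z - n * cc + ED n / 2) - (AA n (fst z) - n * c2 + KK n z) = L1 z + QQ n z" for z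
    unfolding n_ZZ[OF n] L1_def using c2_eq by (simp add: cc_def)
  have l1: "(\<integral>z. \<bar>L1 z\<bar> \<partial>PM n) <= sqrt (128 * (\<integral>x. MD n x \<partial>XM n) + 32) + sqrt (64 * (\<integral>x. MD n x \<partial>XM n)) / 2"
    and l2: "integrable (PM n) (%z. \<bar>L1 z\<bar>)"
    unfolding L1_def ED_def by (rule linearization(1), rule linearization(2))
  have L1m: "L1 \<in> borel_measurable (PM n)"
    unfolding L1_def using SS_meas KK_meas fst_meas[OF AA_meas] by measurable
  have q1: "(\<integral>z. \<bar>QQ n z\<bar> \<partial>PM n) <= sqrt (36 * real n * al n + 224)"
    by (rule P.abs_integral_le_sqrt[OF QQ_meas QQ_bound QQ_square])
  have q2: "integrable (PM n) (%z. \<bar>QQ n z\<bar>)"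
    by (rule P.integrable_bounded[where B="2 * n"]) (use QQ_meas QQ_bound in auto)
  show i: "integrable (PM n) (%z. \<bar>(n * ZZ n z - n * cc + ED n / 2) - (AA n (fst z) - n * c2 + KK n z)\<bar>)"
    unfolding eq
  proof (rule Bochner_Integration.integrable_bound[OF Bochner_Integration.integrable_add[OF l2 q2]])
    show "(%z. \<bar>L1 z + QQ n z\<bar>) \<in> borel_measurable (PM n)" using L1m QQ_meas by measurable
  qed auto
  have "(\<integral>z. \<bar>L1 z + QQ n z\<bar> \<partial>PM n) <= (\<integral>z. \<bar>L1 z\<bar> + \<bar>QQ n z\<bar> \<partial>PM n)"
    by (rule integral_mono) (use i[unfolded eq] l2 q2 in auto)
  also have "\<dots> = (\<integral>z. \<bar>L1 z\<bar> \<partial>PM n) + (\<integral>z. \<bar>QQ n z\<bar> \<partial>PM n)" using l2 q2 by simp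
  finally show "(\<integral>z. \<bar>(n * ZZ n z - n * cc + ED n / 2) - (AA n (fst z) - n * c2 + KK n z)\<bar> \<partial>PM n) <= er n"
    unfolding eq er_def using add_mono[OF l1 q1] by (rule order_trans)
qed

lemma er_tendsto: "(%n. er n / sqrt n) \<longlonglongrightarrow> 0"
proof -
  define m where "m n = (\<integral>x. MD n x \<partial>XM n)" for n
  have "er n / sqrt n = sqrt (128 * (m n / n) + 32 * (1 / n)) + sqrt (64 * (m n / n)) / 2 + sqrt (36 * al n + 224 * (1 / n))" if "n \<ge> 1" for n
  proof -
    have q: "sqrt a / sqrt n = sqrt (a / n)" for a by (rule real_sqrt_divide[symmetric])
    have "er n / sqrt n = sqrt (128 * m n + 32) / sqrt n + sqrt (64 * m n) / sqrt n / 2 + sqrt (36 * real n * al n + 224) / sqrt n"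
      unfolding er_def m_def by (simp only: add_divide_distrib divide_divide_eq_left mult.commute)
    moreover have "(128 * m n + 32) / n = 128 * (m n / n) + 32 * (1 / n)" "64 * m n / n = 64 * (m n / n)"
      "(36 * real n * al n + 224) / n = 36 * al n + 224 * (1 / n)"
      using that by (simp_all add: add_divide_distrib)
    ultimately show ?thesis unfolding q by (simp only:)
  qed
  then have ev: "\<forall>\<^sub>F n in sequentially. sqrt (128 * (m n / n) + 32 * (1 / n)) + sqrt (64 * (m n / n)) / 2 + sqrt (36 * al n + 224 * (1 / n)) = er n / sqrt n"
    by (intro eventually_mono[OF eventually_ge_at_top[of 1]]) auto
  have m0: "(%n. m n / n) \<longlonglongrightarrow> 0" unfolding m_def by (rule MD_tendsto)
  have "(%n. sqrt (128 * (m n / n) + 32 * (1 / n)) + sqrt (64 * (m n / n)) / 2 + sqrt (36 * al n + 224 * (1 / n)))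
      \<longlonglongrightarrow> sqrt (128 * 0 + 32 * 0) + sqrt (64 * 0) / 2 + sqrt (36 * 0 + 224 * 0)"
    by (intro tendsto_intros m0 al_tendsto lim_1_over_n) auto
  then have "(%n. sqrt (128 * (m n / n) + 32 * (1 / n)) + sqrt (64 * (m n / n)) / 2 + sqrt (36 * al n + 224 * (1 / n))) \<longlonglongrightarrow> 0"
    by simp
  then show ?thesis using ev by (rule Lim_transform_eventually)
qed

lemma ED_bound: "0 <= ED n" "ED n <= 2 * (\<integral>x. MD n x \<partial>XM n)"
proof -
  interpret X: prob_space "XM n" by (rule prob_XM)
  show "0 <= ED n" unfolding ED_def DD_def dd_ph
    by (intro Bochner_Integration.integral_nonneg sum_nonneg) auto
  have "ED n <= (\<integral>x. 2 * MD n x \<partial>XM n)"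
    unfolding ED_def
  proof (rule integral_mono)
    show "integrable (XM n) (DD n)" by (rule X.integrable_bounded[where B="2 * n"]) (use DD_meas DD_bound in auto)
    show "integrable (XM n) (%x. 2 * MD n x)"
      by (rule integrable_mult_right, rule X.integrable_bounded[where B=n]) (use MD_meas MD_bound in auto)
    show "DD n x <= 2 * MD n x" for x
      unfolding DD_def MD_def sum_distrib_left by (rule sum_mono) (rule order_trans[OF abs_ge_self dd_le_md])
  qed
  then show "ED n <= 2 * (\<integral>x. MD n x \<partial>XM n)" by simp
qed

lemma ED_tendsto: "(%n. ED n / n) \<longlonglongrightarrow> 0"
proof (rule Lim_null_comparison)
  have "norm (ED n / n) <= 2 * ((\<integral>x. MD n x \<partial>XM n) / n)" for n
  proof -
    define b where "b = (\<integral>x. MD n x \<partial>XM n)"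
    have "0 <= ED n" "ED n <= 2 * b" using ED_bound[of n] unfolding b_def by blast+
    then have "norm (ED n / n) <= 2 * (b / n)" by (simp add: divide_right_mono)
    then show ?thesis unfolding b_def .
  qed
  then show "\<forall>\<^sub>F n in sequentially. norm (ED n / real n) <= 2 * ((\<integral>x. MD n x \<partial>XM n) / n)" by (rule always_eventually[OF allI])
  show "(%n. 2 * ((\<integral>x. MD n x \<partial>XM n) / real n)) \<longlonglongrightarrow> 0"
    by (rule tendsto_mult_right_zero[OF MD_tendsto])
qed

lemma rescale_identity:
  fixes s r m a b c d :: real
  assumes "0 < r" "m = r * r"
  shows "\<bar>s / r * d - s * (r * (a - b + c / (2 * m)))\<bar> = \<bar>s\<bar> / r * \<bar>(m * a - m * b + c / 2) - d\<bar>"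
proof -
  have "m * a - m * b + c / 2 = r * (r * (a - b + c / (2 * m)))"
    using assms by (simp add: field_simps)
  then have "s / r * d - s * (r * (a - b + c / (2 * m))) = - (s / r * ((m * a - m * b + c / 2) - d))"
    using assms(1) by (simp add: right_diff_distrib)
  then show ?thesis using assms(1) by (simp add: abs_mult abs_divide)
qed

text \<open>The difference of characteristic functions is bounded by the L1 distance, which after
  rescaling is the modulus of \<open>s\<close> times \<open>er n / sqrt n\<close>.\<close>

lemma char_ZZ:
  "(%n. \<integral>z. iexp (s * (sqrt (real n) * (ZZ n z - cc + ED n / (2 * real n)))) \<partial>PM n) \<longlonglongrightarrow> complex_of_real (exp (-(s\<^sup>2 * VV / 2)))"
proof (rule Lim_transform2[OF char_WW_tendsto[of s]])
  have "(%n. \<bar>s\<bar> * (er n / sqrt n)) \<longlonglongrightarrow> \<bar>s\<bar> * 0" by (intro tendsto_intros er_tendsto)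
  then have lim: "(%n. \<bar>s\<bar> * (er n / sqrt n)) \<longlonglongrightarrow> 0" by simp
  show "(%n. (\<integral>z. iexp (s / sqrt (real n) * (AA n (fst z) - n * c2 + KK n z)) \<partial>PM n)
      - (\<integral>z. iexp (s * (sqrt (real n) * (ZZ n z - cc + ED n / (2 * real n)))) \<partial>PM n)) \<longlonglongrightarrow> 0"
  proof (rule Lim_null_comparison[OF _ lim], rule eventually_mono[OF eventually_ge_at_top[of 1]])
    fix n :: nat assume n: "1 <= n"
    interpret P: prob_space "PM n" by (rule prob_PM)
    have sn: "sqrt (real n) > 0" using n by simp
    have eq: "\<bar>s / sqrt (real n) * (AA n (fst z) - n * c2 + KK n z) - s * (sqrt (real n) * (ZZ n z - cc + ED n / (2 * real n)))\<bar> =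
        \<bar>s\<bar> / sqrt n * \<bar>(n * ZZ n z - n * cc + ED n / 2) - (AA n (fst z) - n * c2 + KK n z)\<bar>" for z
      by (rule rescale_identity) (use n in auto)
    define F where "F z = s / sqrt (real n) * (AA n (fst z) - n * c2 + KK n z)" for z
    define G where "G z = s * (sqrt (real n) * (ZZ n z - cc + ED n / (2 * real n)))" for z
    define e1 where "e1 z = \<bar>(n * ZZ n z - n * cc + ED n / 2) - (AA n (fst z) - n * c2 + KK n z)\<bar>" for z
    have ie: "integrable (PM n) e1" "(\<integral>z. e1 z \<partial>PM n) <= er n"
      unfolding e1_def by (rule ZZ_approx(2)[OF n], rule ZZ_approx(1)[OF n])
    have eq': "\<bar>F z - G z\<bar> = \<bar>s\<bar> / sqrt n * e1 z" for z
      unfolding F_def G_def e1_def by (rule eq)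
    have FG: "F \<in> borel_measurable (PM n)" "G \<in> borel_measurable (PM n)"
      unfolding F_def G_def using KK_meas fst_meas[OF AA_meas] ZZ_meas by measurable
    have "norm ((\<integral>z. iexp (F z) \<partial>PM n) - (\<integral>z. iexp (G z) \<partial>PM n)) <= (\<integral>z. \<bar>F z - G z\<bar> \<partial>PM n)"
      by (rule P.char_diff_le[OF FG]) (use ie(1) in \<open>simp add: eq'\<close>)
    also have "\<dots> = \<bar>s\<bar> / sqrt n * (\<integral>z. e1 z \<partial>PM n)"
      unfolding eq' by simp
    also have "\<dots> <= \<bar>s\<bar> / sqrt n * er n"
      by (rule mult_left_mono[OF ie(2)]) (use sn in simp)
    finally have "norm ((\<integral>z. iexp (F z) \<partial>PM n) - (\<integral>z. iexp (G z) \<partial>PM n)) <= \<bar>s\<bar> * (er n / sqrt n)" by simp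
    then show "norm ((\<integral>z. iexp (s / sqrt (real n) * (AA n (fst z) - n * c2 + KK n z)) \<partial>PM n)
      - (\<integral>z. iexp (s * (sqrt (real n) * (ZZ n z - cc + ED n / (2 * real n)))) \<partial>PM n)) <= \<bar>s\<bar> * (er n / sqrt n)"
      unfolding F_def G_def .
  qed
qed

text \<open>On the scale of sums everything is o(n): the error \<open>er\<close>, the centred parts
  \<open>AA - n * c2\<close> and \<open>KK\<close> with \<open>4 + 18 = 22\<close> times sqrt n, and
  the bias.\<close>

lemma ZZ_mean: "(%n. \<integral>z. ZZ n z \<partial>PM n) \<longlonglongrightarrow> cc"
proof (rule LIM_zero_cancel)
  have "(%n. er n / sqrt n * (sqrt n / n) + ED n / n * (1/2) + 22 * (sqrt (real n) / n) + 3 * (1 / real n)) \<longlonglongrightarrow> 0 * 0 + 0 * (1/2) + 22 * 0 + 3 * 0"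
    by (intro tendsto_intros er_tendsto ED_tendsto lim_1_over_n sqrt_over_n_tendsto)
  then have lim: "(%n. er n / sqrt n * (sqrt n / n) + ED n / n * (1/2) + 22 * (sqrt (real n) / n) + 3 * (1 / real n)) \<longlonglongrightarrow> 0" by simp
  show "(%n. (\<integral>z. ZZ n z \<partial>PM n) - cc) \<longlonglongrightarrow> 0"
  proof (rule Lim_null_comparison[OF _ lim], rule eventually_mono[OF eventually_ge_at_top[of 1]])
    fix n :: nat assume n: "1 <= n"
    interpret P: prob_space "PM n" by (rule prob_PM)
    have Zi: "integrable (PM n) (ZZ n)" by (rule P.integrable_bounded[where B=1]) (use ZZ_meas ZZ_01 in auto)
    have A1: "(\<integral>z. \<bar>AA n (fst z) - n * c2\<bar> \<partial>PM n) <= 2 * 2 * sqrt n" and A2: "integrable (PM n) (%z. \<bar>AA n (fst z) - n * c2\<bar>)"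
    proof -
      have m: "(%x. \<bar>AA n x - n * c2\<bar>) \<in> borel_measurable (XM n)" using AA_meas by measurable
      have b: "\<bar>\<bar>AA n x - n * c2\<bar>\<bar> <= 2 * n + \<bar>n * c2\<bar>" for x using AA_bound[of n x] by linarith
      have "(\<integral>z. \<bar>AA n (fst z) - n * c2\<bar> \<partial>PM n) = (\<integral>x. \<bar>AA n x - n * c2\<bar> \<partial>XM n)"
        by (rule PM_integral_fst[OF m b])
      also have "\<dots> <= 2 * 2 * sqrt n"
        unfolding AA_def c2_def by (rule iid_lln) (use aa_bounds in auto)
      finally show "(\<integral>z. \<bar>AA n (fst z) - n * c2\<bar> \<partial>PM n) <= 2 * 2 * sqrt n" .
      show "integrable (PM n) (%z. \<bar>AA n (fst z) - n * c2\<bar>)"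
        by (rule P.integrable_bounded[OF fst_meas[OF m], where B="2 * n + \<bar>n * c2\<bar>"]) (use b in auto)
    qed
    have K1: "(\<integral>z. \<bar>KK n z\<bar> \<partial>PM n) <= 6 * 3 * sqrt n + 3"
      using chain_lln(2)[OF kk_meas kk_bound, of n] by (simp add: KK_def kk_mean_zero)
    have K2: "integrable (PM n) (%z. \<bar>KK n z\<bar>)"
      by (rule P.integrable_bounded[where B="3 * n"]) (use KK_meas KK_bound in auto)
    define e1 where "e1 z = \<bar>(n * ZZ n z - n * cc + ED n / 2) - (AA n (fst z) - n * c2 + KK n z)\<bar>" for z
    define a1 where "a1 z = \<bar>AA n (fst z) - n * c2\<bar>" for z :: "(nat => real) \<times> (nat => real)"
    define k1 where "k1 z = \<bar>KK n z\<bar>" for z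
    have ie: "integrable (PM n) e1" "(\<integral>z. e1 z \<partial>PM n) <= er n"
      unfolding e1_def by (rule ZZ_approx(2)[OF n], rule ZZ_approx(1)[OF n])
    have ia: "integrable (PM n) a1" "(\<integral>z. a1 z \<partial>PM n) <= 4 * sqrt n"
      unfolding a1_def using A1 A2 by simp_all
    have ik: "integrable (PM n) k1" "(\<integral>z. k1 z \<partial>PM n) <= 18 * sqrt n + 3"
      unfolding k1_def using K1 K2 by simp_all
    have pw: "\<bar>n * ZZ n z - n * cc\<bar> <= e1 z + a1 z + k1 z + ED n / 2" for z
      unfolding e1_def a1_def k1_def using ED_bound(1)[of n] by linarith
    have "n * \<bar>(\<integral>z. ZZ n z \<partial>PM n) - cc\<bar> = \<bar>n * ((\<integral>z. ZZ n z \<partial>PM n) - cc)\<bar>" by (simp add: abs_mult)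
    also have "n * ((\<integral>z. ZZ n z \<partial>PM n) - cc) = (\<integral>z. n * ZZ n z - n * cc \<partial>PM n)"
      using Zi by (simp add: P.prob_space right_diff_distrib)
    also have "\<bar>\<dots>\<bar> <= (\<integral>z. \<bar>n * ZZ n z - n * cc\<bar> \<partial>PM n)" by (rule integral_abs_bound)
    also have "\<dots> <= (\<integral>z. e1 z + a1 z + k1 z + ED n / 2 \<partial>PM n)"
    proof (rule integral_mono)
      show "integrable (PM n) (%z. \<bar>n * ZZ n z - n * cc\<bar>)"
        by (rule integrable_abs, rule Bochner_Integration.integrable_diff, rule integrable_mult_right, rule Zi, rule P.integrable_const)
      show "integrable (PM n) (%z. e1 z + a1 z + k1 z + ED n / 2)"
        by (rule Bochner_Integration.integrable_add, rule Bochner_Integration.integrable_add,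
            rule Bochner_Integration.integrable_add, rule ie(1), rule ia(1), rule ik(1), rule P.integrable_const)
    qed (rule pw)
    also have "\<dots> = (\<integral>z. e1 z \<partial>PM n) + (\<integral>z. a1 z \<partial>PM n) + (\<integral>z. k1 z \<partial>PM n) + ED n / 2"
      using ie(1) ia(1) ik(1) by (simp add: P.prob_space)
    also have "\<dots> <= er n + (4 * sqrt n + (18 * sqrt n + 3)) + ED n / 2"
      using ie(2) ia(2) ik(2) by linarith
    finally have "\<bar>(\<integral>z. ZZ n z \<partial>PM n) - cc\<bar> <= (er n + (4 * sqrt n + (18 * sqrt n + 3)) + ED n / 2) / n"
      using n by (subst pos_le_divide_eq) (simp_all add: mult.commute)
    also have "\<dots> = er n / sqrt n * (sqrt n / n) + ED n / n * (1/2) + 22 * (sqrt (real n) / n) + 3 * (1 / real n)"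
    proof -
      have "er n / sqrt n * (sqrt n / n) = er n / n" using n by simp
      then show ?thesis by (simp add: add_divide_distrib)
    qed
    finally show "norm ((\<integral>z. ZZ n z \<partial>PM n) - cc) <= er n / sqrt n * (sqrt n / n) + ED n / n * (1/2) + 22 * (sqrt (real n) / n) + 3 * (1 / real n)"
      by simp
  qed
qed

end

section \<open>The limiting variance\<close>

text \<open>The shape needed for covariances: an expectation is moved inside a double integral over
  two levels.\<close>

lemma triple_swap:
  fixes F :: "'c => real => real => real"
  assumes \<alpha>: "prob_space \<alpha>" "sets \<alpha> = sets borel" and \<beta>: "prob_space \<beta>" "sets \<beta> = sets borel"
    and \<gamma>: "prob_space \<gamma>"
    and m: "(%(c, s, t). F c s t) \<in> borel_measurable (\<gamma> \<Otimes>\<^sub>M borel \<Otimes>\<^sub>M borel)" and b: "!!c s t. \<bar>F c s t\<bar> <= B"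
  shows "(\<integral>c. \<integral>s. \<integral>t. F c s t \<partial>\<alpha> \<partial>\<beta> \<partial>\<gamma>) = (\<integral>s. \<integral>t. \<integral>c. F c s t \<partial>\<gamma> \<partial>\<alpha> \<partial>\<beta>)"
proof -
  interpret A: prob_space \<alpha> by fact
  interpret B: prob_space \<beta> by fact
  interpret C: prob_space \<gamma> by fact
  interpret ba: pair_prob_space \<beta> \<alpha> ..
  interpret cba: pair_prob_space \<gamma> "\<beta> \<Otimes>\<^sub>M \<alpha>" ..
  have m': "(%(c, q). F c (fst q) (snd q)) \<in> borel_measurable (\<gamma> \<Otimes>\<^sub>M (\<beta> \<Otimes>\<^sub>M \<alpha>))"
    using m by (simp add: case_prod_beta' \<alpha>(2) \<beta>(2) cong: measurable_cong_sets sets_pair_measure_cong)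
  have i: "integrable (\<gamma> \<Otimes>\<^sub>M (\<beta> \<Otimes>\<^sub>M \<alpha>)) (%(c, q). F c (fst q) (snd q))"
    by (rule cba.P.integrable_bounded[OF m', where B=B]) (use b in auto)
  have "(\<integral>s. \<integral>t. F c s t \<partial>\<alpha> \<partial>\<beta>) = (\<integral>q. F c (fst q) (snd q) \<partial>(\<beta> \<Otimes>\<^sub>M \<alpha>))" if c: "c \<in> space \<gamma>" for c
  proof -
    have "integrable (\<beta> \<Otimes>\<^sub>M \<alpha>) (%q. F c (fst q) (snd q))"
      by (rule ba.P.integrable_bounded[where B=B]) (use measurable_compose[OF measurable_Pair1'[OF c] m'] b in auto)
    from ba.integral_fst'[OF this] show ?thesis by simp
  qed
  then have "(\<integral>c. \<integral>s. \<integral>t. F c s t \<partial>\<alpha> \<partial>\<beta> \<partial>\<gamma>) = (\<integral>c. \<integral>q. F c (fst q) (snd q) \<partial>(\<beta> \<Otimes>\<^sub>M \<alpha>) \<partial>\<gamma>)"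
    by (intro Bochner_Integration.integral_cong refl) auto
  also have "\<dots> = (\<integral>q. \<integral>c. F c (fst q) (snd q) \<partial>\<gamma> \<partial>(\<beta> \<Otimes>\<^sub>M \<alpha>))"
    by (rule cba.Fubini_integral[OF i, symmetric])
  also have "\<dots> = (\<integral>s. \<integral>t. \<integral>c. F c s t \<partial>\<gamma> \<partial>\<alpha> \<partial>\<beta>)"
  proof -
    have "(%(q, c). F c (fst q) (snd q)) \<in> borel_measurable ((\<beta> \<Otimes>\<^sub>M \<alpha>) \<Otimes>\<^sub>M \<gamma>)"
      using measurable_compose[OF measurable_pair_swap' m'] by (simp add: case_prod_beta')
    then have "(%q. \<integral>c. F c (fst q) (snd q) \<partial>\<gamma>) \<in> borel_measurable (\<beta> \<Otimes>\<^sub>M \<alpha>)"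
      by (rule C.borel_measurable_lebesgue_integral)
    then have "integrable (\<beta> \<Otimes>\<^sub>M \<alpha>) (%q. \<integral>c. F c (fst q) (snd q) \<partial>\<gamma>)"
    proof (rule ba.P.integrable_bounded[where B="\<bar>B\<bar>"])
      show "norm (\<integral>c. F c (fst q) (snd q) \<partial>\<gamma>) <= \<bar>B\<bar>" for q
        by (rule C.integral_bounded) (use b order_trans[OF b abs_ge_self] in auto)
    qed
    from ba.integral_fst'[OF this] show ?thesis by simp
  qed
  finally show ?thesis .
qed

context rank_model
begin

section \<open>The Stieltjes measure dT\<close>

definition tau :: "real measure" where "tau = interval_measure TT"

lemma ph_mono: "s <= t ==> ph s x <= ph t x"
  unfolding ph_def
proof (rule integral_mono)
  assume st: "s <= t"
  have "(%e. indicator {..c} (f (x, e)) :: real) \<in> borel_measurable \<nu>" for c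
    by (rule ind_meas) (use measurable_compose[OF measurable_Pair1' f_meas, of x] in auto)
  then have int: "integrable \<nu> (%e. indicator {..c} (f (x, e)) :: real)" for c
    by (rule nu.integrable_bounded[where B=1]) (simp add: indicator_def)
  show "integrable \<nu> (%e. indicator {..s} (f (x, e)) :: real)" "integrable \<nu> (%e. indicator {..t} (f (x, e)) :: real)"
    by (rule int)+
  show "indicator {..s} (f (x, e)) <= (indicator {..t} (f (x, e)) :: real)" for e
    using st by (auto simp: indicator_def)
qed

lemma integral_ph: "(\<integral>x. ph t x \<partial>\<mu>) = GG t"
proof -
  have "(\<integral>y. (indicator {..t} y :: real) \<partial>lam) = (\<integral>a. \<integral>v. (indicator {..t} (f (a, v)) :: real) \<partial>\<nu> \<partial>\<mu>)"
    by (rule integral_lam[where B=1]) (auto simp: indicator_def)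
  then show ?thesis by (simp add: ph_def GG_def)
qed

lemma int_ph: "integrable \<mu> (ph t)"
  by (rule mu.integrable_bounded[where B=1]) (use ph_01 in auto)

lemma int_phsq: "integrable \<mu> (%x. (ph t x)\<^sup>2)"
  by (rule mu.integrable_bounded[where B=1]) (use ph_sq in auto)

text \<open>The difference of squares factors with a sum between 0 and 2, so increments of T are
  dominated by those of 2 F_Y. Thus T is nondecreasing and inherits continuity, and dT has no
  atoms.\<close>

lemma TT_diff: "s <= t ==> 0 <= TT t - TT s \<and> TT t - TT s <= 2 * (GG t - GG s)"
proof -
  assume st: "s <= t"
  have eq: "TT t - TT s = (\<integral>x. (ph t x)\<^sup>2 - (ph s x)\<^sup>2 \<partial>\<mu>)" unfolding TT_def using int_phsq by simp
  have fac: "(ph t x)\<^sup>2 - (ph s x)\<^sup>2 = (ph t x - ph s x) * (ph t x + ph s x)" for x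
    by (simp add: power2_eq_square algebra_simps)
  have "0 <= (\<integral>x. (ph t x)\<^sup>2 - (ph s x)\<^sup>2 \<partial>\<mu>)"
    unfolding fac using ph_mono[OF st] ph_01 by (intro Bochner_Integration.integral_nonneg mult_nonneg_nonneg add_nonneg_nonneg) auto
  moreover have "(\<integral>x. (ph t x)\<^sup>2 - (ph s x)\<^sup>2 \<partial>\<mu>) <= (\<integral>x. (ph t x - ph s x) * 2 \<partial>\<mu>)"
  proof (rule integral_mono)
    show "(ph t x)\<^sup>2 - (ph s x)\<^sup>2 <= (ph t x - ph s x) * 2" for x
      unfolding fac using ph_mono[OF st, of x] ph_01[of t x] ph_01[of s x] by (intro mult_left_mono) auto
  qed (use int_ph int_phsq in auto)
  moreover have "(\<integral>x. (ph t x - ph s x) * 2 \<partial>\<mu>) = 2 * (GG t - GG s)"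
    using int_ph by (simp add: integral_ph)
  ultimately show ?thesis unfolding eq by simp
qed

lemma real_distr_lam: "real_distribution lam"
  by (simp add: real_distribution_def real_distribution_axioms_def L.prob_space_axioms)

lemma GG_cdf: "GG = cdf lam"
  by (auto simp: GG_def cdf_def)

lemma isCont_GG: "isCont GG t"
proof -
  interpret RL: real_distribution lam by (rule real_distr_lam)
  show ?thesis unfolding GG_cdf by (simp add: RL.isCont_cdf)
qed

lemma isCont_TT: "isCont TT t"
proof -
  have *: "\<bar>TT s - TT t\<bar> <= 2 * \<bar>GG s - GG t\<bar>" for s
    using TT_diff[of s t] TT_diff[of t s] by (cases "s <= t") auto
  have "(%s. 2 * \<bar>GG s - GG t\<bar>) \<midarrow>t\<rightarrow> 2 * \<bar>GG t - GG t\<bar>"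
    by (intro tendsto_intros isCont_GG[unfolded isCont_def])
  then have lim: "(%s. 2 * \<bar>GG s - GG t\<bar>) \<midarrow>t\<rightarrow> 0" by simp
  show ?thesis
    unfolding isCont_def
    by (rule LIM_zero_cancel, rule Lim_null_comparison[OF _ lim]) (use * in auto)
qed

text \<open>The inequalities T <= F_Y and 1 - T <= 2 (1 - F_Y) transfer the limits from F_Y, which
  makes dT a probability measure.\<close>

lemma TT_at_top: "(TT \<longlongrightarrow> 1) at_top" and TT_at_bot: "(TT \<longlongrightarrow> 0) at_bot"
proof -
  interpret RL: real_distribution lam by (rule real_distr_lam)
  have top: "(GG \<longlongrightarrow> 1) at_top" unfolding GG_cdf by (rule RL.cdf_lim_at_top_prob)
  have bot: "(GG \<longlongrightarrow> 0) at_bot" unfolding GG_cdf by (rule RL.cdf_lim_at_bot)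
  have le: "TT t <= GG t" for t
    unfolding integral_ph[symmetric] TT_def
  proof (rule integral_mono[OF int_phsq int_ph])
    show "(ph t x)\<^sup>2 <= ph t x" for x
      using ph_01[of t x] mult_left_mono[of "ph t x" 1 "ph t x"] by (simp add: power2_eq_square)
  qed
  have ge: "1 - TT t <= 2 * (1 - GG t)" for t
  proof -
    have "1 - TT t = (\<integral>x. 1 - (ph t x)\<^sup>2 \<partial>\<mu>)" unfolding TT_def using int_phsq by (simp add: mu.prob_space[simplified])
    also have "\<dots> <= (\<integral>x. 2 * (1 - ph t x) \<partial>\<mu>)"
    proof (rule integral_mono)
      show "1 - (ph t x)\<^sup>2 <= 2 * (1 - ph t x)" for x
        using zero_le_power2[of "1 - ph t x"] by (simp add: power2_eq_square algebra_simps)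
    qed (use int_ph int_phsq in auto)
    also have "\<dots> = 2 * (1 - GG t)" using int_ph by (simp add: integral_ph mu.prob_space[simplified])
    finally show ?thesis .
  qed
  show "(TT \<longlongrightarrow> 0) at_bot"
    by (rule tendsto_sandwich[OF _ _ tendsto_const bot]) (use TT_01 le in auto)
  have "((%t. 1 - 2 * (1 - GG t)) \<longlongrightarrow> 1 - 2 * (1 - 1)) at_top" by (intro tendsto_intros top)
  then have low: "((%t. 1 - 2 * (1 - GG t)) \<longlongrightarrow> 1) at_top" by simp
  show "(TT \<longlongrightarrow> 1) at_top"
  proof (rule tendsto_sandwich[OF _ _ low tendsto_const])
    show "\<forall>\<^sub>F t in at_top. 1 - 2 * (1 - GG t) <= TT t" using ge by (intro always_eventually allI) (simp add: algebra_simps)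
  qed (use TT_01 in auto)
qed

lemma real_distr_tau: "real_distribution tau" and cdf_tau: "cdf tau = TT"
proof -
  have mono: "!!x y. x <= y ==> TT x <= TT y" using TT_diff by force
  have rc: "!!a. continuous (at_right a) TT" using isCont_TT continuous_at_imp_continuous_at_within by blast
  show "real_distribution tau" unfolding tau_def
    by (rule real_distribution_interval_measure[OF mono rc TT_at_bot TT_at_top])
  show "cdf tau = TT" unfolding tau_def
    by (rule cdf_interval_measure[OF mono rc TT_at_bot])
qed

sublocale tau: prob_space tau
  using real_distr_tau by (simp add: real_distribution_def)

lemma sets_tau [simp, measurable_cong]: "sets tau = sets borel"
  by (simp add: tau_def)

lemma space_tau [simp]: "space tau = UNIV"
  by (simp add: tau_def)

lemma tau_atLeast: "measure tau {y..} = 1 - TT y"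
proof -
  interpret R: real_distribution tau by (rule real_distr_tau)
  have "measure tau {y} = 0" using R.isCont_cdf[of y] isCont_TT by (simp add: cdf_tau)
  have "measure tau {y..} = measure tau ({y} \<union> {y<..})" by (rule arg_cong[where f="measure tau"]) auto
  also have "\<dots> = measure tau {y} + measure tau {y<..}"
    by (rule tau.finite_measure_Union) auto
  also have "measure tau {y<..} = 1 - TT y"
  proof -
    have "measure tau (space tau - {..y}) = 1 - measure tau {..y}" by (rule tau.prob_compl) simp
    moreover have "space tau - {..y} = {y<..}" by auto
    ultimately show ?thesis using cdf_tau by (simp add: cdf_def fun_eq_iff)
  qed
  finally show ?thesis using \<open>measure tau {y} = 0\<close> by simp
qed

section \<open>Moments of the increments as double integrals over levels\<close>

definition hh :: "real => real => real => real" where "hh t x e = indicator {..t} (f (x, e))"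

lemma hh_meas [measurable (raw)]:
  "a \<in> borel_measurable M ==> b \<in> borel_measurable M ==> c \<in> borel_measurable M ==> (%q. hh (a q) (b q) (c q)) \<in> borel_measurable M"
  unfolding hh_def by (rule ind_meas[OF _ measurable_compose[OF measurable_Pair f_meas]])

lemma hh_01: "0 <= hh t x e" "hh t x e <= 1" by (auto simp: hh_def indicator_def)

text \<open>The source of the minimum of two levels in the covariances: both indicators concern the
  same response.\<close>

lemma hh_mult: "hh t x e * hh s x e = hh (min t s) x e" by (auto simp: hh_def indicator_def)

lemma ph_hh: "ph t x = (\<integral>e. hh t x e \<partial>\<nu>)" by (simp add: ph_def hh_def)

text \<open>As dT has no atoms, 1 - T(y) is the dT-mass of the levels from y on. Working with
  \<open>1 - uu\<close> makes each factor an integral of indicators, over dF_Y or over dT.\<close>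

lemma uu_tau: "1 - uu (x, e) = (\<integral>s. hh s x e \<partial>tau)"
proof -
  have "(\<integral>s. hh s x e \<partial>tau) = (\<integral>s. indicator {f (x, e)..} s \<partial>tau)"
    by (rule Bochner_Integration.integral_cong) (auto simp: hh_def indicator_def)
  then show ?thesis by (simp add: uu_def tau_atLeast)
qed

lemma H_lam: "H (ww (x, e)) (ww (x, e')) = (\<integral>t. hh t x e * hh t x e' \<partial>lam)"
  by (simp add: ww_def integral_max_le[symmetric] hh_def)

lemma pp_lam: "pp x (ww (x, e)) = (\<integral>t. hh t x e * ph t x \<partial>lam)"
proof -
  interpret nl: pair_prob_space \<nu> lam ..
  have "pp x (ww (x, e)) = (\<integral>e'. \<integral>t. hh t x e * hh t x e' \<partial>lam \<partial>\<nu>)" unfolding pp_def H_lam ..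
  also have "\<dots> = (\<integral>t. \<integral>e'. hh t x e * hh t x e' \<partial>\<nu> \<partial>lam)"
  proof (rule nl.Fubini_integral[symmetric], rule nl.P.integrable_bounded[where B=1])
    show "(%(e', t). hh t x e * hh t x e') \<in> borel_measurable (\<nu> \<Otimes>\<^sub>M lam)" by measurable
  qed (use hh_01 in \<open>auto simp: mult_le_one\<close>)
  finally show ?thesis by (simp add: ph_hh)
qed

lemma int_product:
  fixes F G :: "real => real"
  shows "(\<integral>t. F t \<partial>lam) * (\<integral>s. G s \<partial>\<beta>) = (\<integral>s. \<integral>t. F t * G s \<partial>lam \<partial>\<beta>)"
  by simp

lemma prodb: "\<bar>a\<bar> <= 1 ==> \<bar>b\<bar> <= 1 ==> \<bar>a * b\<bar> <= (1::real)"
  by (simp add: abs_mult mult_le_one)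

lemma abs01: "\<bar>hh t x e\<bar> <= 1" "\<bar>ph t x\<bar> <= 1"
  using hh_01[of t x e] ph_01[of t x] by auto

lemma nu_lam_lam_swap:
  fixes \<beta> :: "real measure" and k :: "real => real => real"
  assumes \<beta>: "prob_space \<beta>" "sets \<beta> = sets borel"
    and k: "(%(s, t). k s t) \<in> borel_measurable (borel \<Otimes>\<^sub>M borel)" "!!s t. \<bar>k s t\<bar> <= 1"
  shows "(\<integral>e. \<integral>s. \<integral>t. hh (min t s) x e * k s t \<partial>lam \<partial>\<beta> \<partial>\<nu>) = (\<integral>s. \<integral>t. ph (min t s) x * k s t \<partial>lam \<partial>\<beta>)"
proof -
  have [measurable]: "(%q. k (fst (snd q)) (snd (snd q))) \<in> borel_measurable (\<nu> \<Otimes>\<^sub>M borel \<Otimes>\<^sub>M borel)"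
  proof -
    have "(%q. (case snd q of (s, t) => k s t)) \<in> borel_measurable (\<nu> \<Otimes>\<^sub>M borel \<Otimes>\<^sub>M borel)"
      by (rule measurable_compose[OF measurable_snd k(1)])
    then show ?thesis by (simp add: case_prod_beta')
  qed
  have "(\<integral>e. \<integral>s. \<integral>t. hh (min t s) x e * k s t \<partial>lam \<partial>\<beta> \<partial>\<nu>) = (\<integral>s. \<integral>t. \<integral>e. hh (min t s) x e * k s t \<partial>\<nu> \<partial>lam \<partial>\<beta>)"
  proof (rule triple_swap[where B=1])
    have "(%q. hh (min (snd (snd q)) (fst (snd q))) x (fst q) * k (fst (snd q)) (snd (snd q))) \<in> borel_measurable (\<nu> \<Otimes>\<^sub>M borel \<Otimes>\<^sub>M borel)"
      by measurable
    then show "(%(e, s, t). hh (min t s) x e * k s t) \<in> borel_measurable (\<nu> \<Otimes>\<^sub>M borel \<Otimes>\<^sub>M borel)"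
      by (simp add: case_prod_beta')
  qed (use \<beta> k(2) abs01 in \<open>auto intro!: prodb L.prob_space_axioms prob_nu\<close>)
  then show ?thesis by (simp add: ph_hh)
qed

lemma P2_eq: "(\<integral>e. (pp x (ww (x, e)))\<^sup>2 \<partial>\<nu>) = (\<integral>s. \<integral>t. ph (min t s) x * (ph t x * ph s x) \<partial>lam \<partial>lam)"
proof -
  have "(pp x (ww (x, e)))\<^sup>2 = (\<integral>s. \<integral>t. hh (min t s) x e * (ph t x * ph s x) \<partial>lam \<partial>lam)" for e
    unfolding pp_lam power2_eq_square int_product
    by (intro Bochner_Integration.integral_cong refl) (simp add: hh_mult[symmetric] mult_ac)
  then have "(\<integral>e. (pp x (ww (x, e)))\<^sup>2 \<partial>\<nu>) = (\<integral>e. \<integral>s. \<integral>t. hh (min t s) x e * (ph t x * ph s x) \<partial>lam \<partial>lam \<partial>\<nu>)" by simp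
  also have "\<dots> = (\<integral>s. \<integral>t. ph (min t s) x * (ph t x * ph s x) \<partial>lam \<partial>lam)"
    by (rule nu_lam_lam_swap) (use abs01 in \<open>auto intro!: prodb L.prob_space_axioms\<close>)
  finally show ?thesis .
qed

text \<open>Squaring produces an indicator at the smaller level for each of the two noises; they are
  independent given \<open>x\<close>, so each contributes a factor
  \<open>ph (min t s) x\<close>.\<close>

lemma H2_eq: "(\<integral>e. \<integral>e'. (H (ww (x, e)) (ww (x, e')))\<^sup>2 \<partial>\<nu> \<partial>\<nu>) = (\<integral>s. \<integral>t. ph (min t s) x * ph (min t s) x \<partial>lam \<partial>lam)"
proof -
  have "(H (ww (x, e)) (ww (x, e')))\<^sup>2 = (\<integral>s. \<integral>t. hh (min t s) x e' * hh (min t s) x e \<partial>lam \<partial>lam)" for e e'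
    unfolding H_lam power2_eq_square int_product
    by (intro Bochner_Integration.integral_cong refl) (simp add: hh_mult[symmetric] mult_ac)
  then have "(\<integral>e'. (H (ww (x, e)) (ww (x, e')))\<^sup>2 \<partial>\<nu>) = (\<integral>e'. \<integral>s. \<integral>t. hh (min t s) x e' * hh (min t s) x e \<partial>lam \<partial>lam \<partial>\<nu>)" for e
    by simp
  also have "\<dots> e = (\<integral>s. \<integral>t. ph (min t s) x * hh (min t s) x e \<partial>lam \<partial>lam)" for e
    by (rule nu_lam_lam_swap) (use abs01 in \<open>auto intro!: prodb L.prob_space_axioms\<close>)
  finally have "(\<integral>e'. (H (ww (x, e)) (ww (x, e')))\<^sup>2 \<partial>\<nu>) = (\<integral>s. \<integral>t. hh (min t s) x e * ph (min t s) x \<partial>lam \<partial>lam)" for e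
    by (simp add: mult.commute)
  then have "(\<integral>e. \<integral>e'. (H (ww (x, e)) (ww (x, e')))\<^sup>2 \<partial>\<nu> \<partial>\<nu>) = (\<integral>e. \<integral>s. \<integral>t. hh (min t s) x e * ph (min t s) x \<partial>lam \<partial>lam \<partial>\<nu>)"
    by simp
  also have "\<dots> = (\<integral>s. \<integral>t. ph (min t s) x * ph (min t s) x \<partial>lam \<partial>lam)"
    by (rule nu_lam_lam_swap) (use abs01 in \<open>auto intro!: prodb L.prob_space_axioms\<close>)
  finally show ?thesis .
qed

lemma PV_eq: "(\<integral>e. pp x (ww (x, e)) * (1 - uu (x, e)) \<partial>\<nu>) = (\<integral>s. \<integral>t. ph (min t s) x * ph t x \<partial>lam \<partial>tau)"
proof -
  have "pp x (ww (x, e)) * (1 - uu (x, e)) = (\<integral>s. \<integral>t. hh (min t s) x e * ph t x \<partial>lam \<partial>tau)" for e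
    unfolding pp_lam uu_tau int_product
    by (intro Bochner_Integration.integral_cong refl) (simp add: hh_mult[symmetric] mult_ac)
  then have "(\<integral>e. pp x (ww (x, e)) * (1 - uu (x, e)) \<partial>\<nu>) = (\<integral>e. \<integral>s. \<integral>t. hh (min t s) x e * ph t x \<partial>lam \<partial>tau \<partial>\<nu>)" by simp
  also have "\<dots> = (\<integral>s. \<integral>t. ph (min t s) x * ph t x \<partial>lam \<partial>tau)"
    by (rule nu_lam_lam_swap) (use abs01 in \<open>auto intro!: prodb tau.prob_space_axioms\<close>)
  finally show ?thesis .
qed

lemma M2_eq: "(mm x x)\<^sup>2 = (\<integral>s. \<integral>t. (ph t x)\<^sup>2 * (ph s x)\<^sup>2 \<partial>lam \<partial>lam)"
  unfolding mm_ph power2_eq_square int_product ..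

lemma ub_tau: "1 - ub x = (\<integral>s. ph s x \<partial>tau)"
proof -
  interpret nt: pair_prob_space \<nu> tau ..
  have "1 - ub x = (\<integral>e. 1 - uu (x, e) \<partial>\<nu>)" unfolding ub_def using int_u by (simp add: nu.prob_space[simplified])
  also have "\<dots> = (\<integral>e. \<integral>s. hh s x e \<partial>tau \<partial>\<nu>)" unfolding uu_tau ..
  also have "\<dots> = (\<integral>s. \<integral>e. hh s x e \<partial>\<nu> \<partial>tau)"
  proof (rule nt.Fubini_integral[symmetric], rule nt.P.integrable_bounded[where B=1])
    show "(%(e, s). hh s x e) \<in> borel_measurable (\<nu> \<Otimes>\<^sub>M tau)" by measurable
  qed (use hh_01 in auto)
  finally show ?thesis by (simp add: ph_hh)
qed

lemma MV_eq: "mm x x * (1 - ub x) = (\<integral>s. \<integral>t. (ph t x)\<^sup>2 * ph s x \<partial>lam \<partial>tau)"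
  unfolding mm_ph ub_tau int_product power2_eq_square ..

lemma mu_swap:
  fixes \<beta> :: "real measure" and k :: "real => real => real => real"
  assumes \<beta>: "prob_space \<beta>" "sets \<beta> = sets borel"
    and k: "(%(x, s, t). k x s t) \<in> borel_measurable (borel \<Otimes>\<^sub>M borel \<Otimes>\<^sub>M borel)" "!!x s t. \<bar>k x s t\<bar> <= (1::real)"
  shows "(\<integral>x. \<integral>s. \<integral>t. k x s t \<partial>lam \<partial>\<beta> \<partial>\<mu>) = (\<integral>s. \<integral>t. \<integral>x. k x s t \<partial>\<mu> \<partial>lam \<partial>\<beta>)"
proof (rule triple_swap[where B=1])
  show "(%(x, s, t). k x s t) \<in> borel_measurable (\<mu> \<Otimes>\<^sub>M borel \<Otimes>\<^sub>M borel)"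
    using k(1) by (simp cong: measurable_cong_sets sets_pair_measure_cong)
qed (use \<beta> k(2) prob_mu L.prob_space_axioms in auto)

text \<open>Only the response enters here, so position and noise merge into its law
  \<open>lam\<close> and the conditional distribution function averages to F_Y.\<close>

lemma V2_eq: "(\<integral>x. \<integral>e. (1 - uu (x, e))\<^sup>2 \<partial>\<nu> \<partial>\<mu>) = (\<integral>s. \<integral>t. GG (min t s) \<partial>tau \<partial>tau)"
proof -
  interpret mn: pair_prob_space \<mu> \<nu> ..
  define j where "j t y = (indicator {..t} y :: real)" for t y :: real
  have jm [measurable (raw)]: "a \<in> borel_measurable M ==> b \<in> borel_measurable M ==> (%q. j (a q) (b q)) \<in> borel_measurable M"
    for a b and M :: "'z measure" unfolding j_def by (rule ind_meas)
  have jj: "(1 - TT y)\<^sup>2 = (\<integral>s. \<integral>t. j (min t s) y \<partial>tau \<partial>tau)" for y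
  proof -
    have "1 - TT y = (\<integral>s. j s y \<partial>tau)"
    proof -
      have "(\<integral>s. j s y \<partial>tau) = (\<integral>s. indicator {y..} s \<partial>tau)"
        by (rule Bochner_Integration.integral_cong) (auto simp: j_def indicator_def)
      then show ?thesis by (simp add: tau_atLeast)
    qed
    then have "(1 - TT y)\<^sup>2 = (\<integral>s. \<integral>t. j t y * j s y \<partial>tau \<partial>tau)" by (simp add: power2_eq_square)
    also have "\<dots> = (\<integral>s. \<integral>t. j (min t s) y \<partial>tau \<partial>tau)"
      by (intro Bochner_Integration.integral_cong refl) (auto simp: j_def indicator_def)
    finally show ?thesis .
  qed
  have "(\<integral>x. \<integral>e. (1 - uu (x, e))\<^sup>2 \<partial>\<nu> \<partial>\<mu>) = (\<integral>y. (1 - TT y)\<^sup>2 \<partial>lam)"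
  proof (subst integral_lam[where B=1])
    show "\<bar>(1 - TT t)\<^sup>2\<bar> <= 1" for t using TT_01[of t] power_le_one[of "1 - TT t" 2] by simp
  qed (auto simp: uu_def)
  also have "\<dots> = (\<integral>y. \<integral>s. \<integral>t. j (min t s) y \<partial>tau \<partial>tau \<partial>lam)" unfolding jj ..
  also have "\<dots> = (\<integral>s. \<integral>t. \<integral>y. j (min t s) y \<partial>lam \<partial>tau \<partial>tau)"
  proof (rule triple_swap[where B=1])
    have "(%q. j (min (snd (snd q)) (fst (snd q))) (fst q)) \<in> borel_measurable (lam \<Otimes>\<^sub>M borel \<Otimes>\<^sub>M borel)" by measurable
    then show "(%(y, s, t). j (min t s) y) \<in> borel_measurable (lam \<Otimes>\<^sub>M borel \<Otimes>\<^sub>M borel)" by (simp add: case_prod_beta')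
  qed (auto intro: tau.prob_space_axioms L.prob_space_axioms simp: j_def indicator_def)
  finally show ?thesis by (simp add: j_def GG_def)
qed

definition "CXX t s = (\<integral>x. (ph t x)\<^sup>2 * (ph s x)\<^sup>2 \<partial>\<mu>) - (\<integral>x. (ph t x)\<^sup>2 \<partial>\<mu>) * (\<integral>x. (ph s x)\<^sup>2 \<partial>\<mu>)
  + (\<integral>x. (ph (min t s) x + 3 * ph t x * ph s x) * (ph (min t s) x - ph t x * ph s x) \<partial>\<mu>)"
definition "CXY t s = (\<integral>x. (ph t x)\<^sup>2 * ph s x \<partial>\<mu>) - (\<integral>x. (ph t x)\<^sup>2 \<partial>\<mu>) * (\<integral>x. ph s x \<partial>\<mu>)
  + (\<integral>x. 2 * ph t x * (ph (min t s) x - ph t x * ph s x) \<partial>\<mu>)"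
definition "CYY t s = GG (min t s) - GG t * GG s"

text \<open>With \<open>v = 1 - uu\<close> the increment reads
  \<open>h e e' - p e + p e' - m - v e' + vb\<close>. Since \<open>p\<close> is the conditional mean
  of the symmetric \<open>h\<close> in either argument, every mixed term with a function of one
  noise reduces to a single integral.\<close>

lemma kk_square:
  "(\<integral>e. \<integral>e'. (kk x e e')\<^sup>2 \<partial>\<nu> \<partial>\<nu>) = (\<integral>e. \<integral>e'. (H (ww (x, e)) (ww (x, e')))\<^sup>2 \<partial>\<nu> \<partial>\<nu>)
    + 2 * (\<integral>e. (pp x (ww (x, e)))\<^sup>2 \<partial>\<nu>) - 3 * (mm x x)\<^sup>2
    + 4 * ((1 - ub x) * mm x x - (\<integral>e. pp x (ww (x, e)) * (1 - uu (x, e)) \<partial>\<nu>))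
    + (\<integral>e. (1 - uu (x, e))\<^sup>2 \<partial>\<nu>) - (1 - ub x)\<^sup>2"
proof -
  define h where "h e e' = H (ww (x, e)) (ww (x, e'))" for e e'
  define p where "p e = pp x (ww (x, e))" for e
  define v where "v e = 1 - uu (x, e)" for e
  define m where "m = mm x x"
  define vb where "vb = 1 - ub x"
  have h01: "\<bar>h e e'\<bar> <= 1" for e e' unfolding h_def using H_01[of "ww (x, e)" "ww (x, e')"] w_ge w_le by auto
  have p01: "\<bar>p e\<bar> <= 1" for e unfolding p_def using pp_01[of "ww (x, e)" x] w_ge w_le by auto
  have v01: "\<bar>v e\<bar> <= 1" for e unfolding v_def using u_ge[of "(x, e)"] u_le[of "(x, e)"] by auto
  have hm [measurable (raw)]: "a \<in> borel_measurable M ==> b \<in> borel_measurable M ==> (%q. h (a q) (b q)) \<in> borel_measurable M"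
    for a b and M :: "'z measure" unfolding h_def by (intro H_meas measurable_compose[OF measurable_Pair w_meas]) auto
  have pm [measurable]: "p \<in> borel_measurable borel" unfolding p_def by measurable
  have vm [measurable]: "v \<in> borel_measurable borel" unfolding v_def by measurable
  have b1: "integrable \<nu> g" if "g \<in> borel_measurable borel" "!!e. \<bar>g e\<bar> <= 1" for g :: "real => real"
    by (rule nu.integrable_bounded[where B=1]) (use that in auto)
  have ih: "integrable \<nu> (h e)" "integrable \<nu> (%e'. h e' e)" for e by (rule b1, measurable, use h01 in simp)+
  have ip: "integrable \<nu> p" and iv: "integrable \<nu> v" by (rule b1, measurable, use p01 v01 in simp)+
  have ihh: "integrable \<nu> (%e'. h e e' * h e e')" "integrable \<nu> (%e'. h e e' * p e')" "integrable \<nu> (%e'. h e e' * v e')"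
    "integrable \<nu> (%e. p e * p e)" "integrable \<nu> (%e. p e * v e)" "integrable \<nu> (%e. v e * v e)" for e
    by (rule b1, measurable, intro prodb h01 p01 v01)+
  have I2: "integrable \<nu> (%e. \<integral>e'. h e e' * h e e' \<partial>\<nu>)" "integrable \<nu> (%e. \<integral>e'. h e e' * p e' \<partial>\<nu>)"
    "integrable \<nu> (%e. \<integral>e'. h e e' * v e' \<partial>\<nu>)"
    by (rule b1, measurable, rule nu.abs_integral_bounded, intro prodb h01 p01 v01, simp)+
  have hp: "(\<integral>e'. h e e' \<partial>\<nu>) = p e" "(\<integral>e'. h e' e \<partial>\<nu>) = p e" for e
    unfolding h_def p_def pp_def by (simp_all add: H_sym)
  have pmean: "(\<integral>e. p e \<partial>\<nu>) = m" unfolding p_def m_def mm_def ..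
  have vmean: "(\<integral>e. v e \<partial>\<nu>) = vb" unfolding v_def vb_def ub_def using int_u by (simp add: nu.prob_space[simplified])
  interpret nn: pair_prob_space \<nu> \<nu> ..
  have sw: "(\<integral>e. \<integral>e'. h e e' * g e' \<partial>\<nu> \<partial>\<nu>) = (\<integral>e. p e * g e \<partial>\<nu>)"
    if g: "g \<in> borel_measurable borel" "!!e. \<bar>g e\<bar> <= 1" for g
  proof -
    have "integrable (\<nu> \<Otimes>\<^sub>M \<nu>) (%(e, e'). h e e' * g e')"
    proof (rule nn.P.integrable_bounded[where B=1])
      show "(%(e, e'). h e e' * g e') \<in> borel_measurable (\<nu> \<Otimes>\<^sub>M \<nu>)" using g(1) by measurable
    qed (use g(2) h01 prodb in auto)
    from nn.Fubini_integral[OF this] have "(\<integral>e. \<integral>e'. h e e' * g e' \<partial>\<nu> \<partial>\<nu>) = (\<integral>e'. \<integral>e. h e e' * g e' \<partial>\<nu> \<partial>\<nu>)" by simp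
    also have "\<dots> = (\<integral>e. p e * g e \<partial>\<nu>)" by (simp add: hp)
    finally show ?thesis .
  qed
  have kk: "(kk x e e')\<^sup>2 = h e e' * h e e' + 2 * (h e e' * p e') - 2 * (h e e' * v e') + p e' * p e' - 2 * (p e' * v e') + v e' * v e'
      + (2 * (vb - m - p e)) * h e e' + (2 * (vb - m - p e)) * p e' - (2 * (vb - m - p e)) * v e' + (vb - m - p e)\<^sup>2" for e e'
    unfolding kk_def h_def p_def v_def m_def vb_def by (simp add: power2_eq_square algebra_simps)
  have inner: "(\<integral>e'. (kk x e e')\<^sup>2 \<partial>\<nu>) = (\<integral>e'. h e e' * h e e' \<partial>\<nu>) + 2 * (\<integral>e'. h e e' * p e' \<partial>\<nu>) - 2 * (\<integral>e'. h e e' * v e' \<partial>\<nu>)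
      + (\<integral>e'. p e' * p e' \<partial>\<nu>) - 2 * (\<integral>e'. p e' * v e' \<partial>\<nu>) + (\<integral>e'. v e' * v e' \<partial>\<nu>)
      - p e * p e - 2 * (m - vb) * p e - (m - vb)\<^sup>2" for e
  proof -
    have "(\<integral>e'. (kk x e e')\<^sup>2 \<partial>\<nu>) = (\<integral>e'. h e e' * h e e' \<partial>\<nu>) + 2 * (\<integral>e'. h e e' * p e' \<partial>\<nu>) - 2 * (\<integral>e'. h e e' * v e' \<partial>\<nu>)
      + (\<integral>e'. p e' * p e' \<partial>\<nu>) - 2 * (\<integral>e'. p e' * v e' \<partial>\<nu>) + (\<integral>e'. v e' * v e' \<partial>\<nu>)
      + 2 * (vb - m - p e) * p e + 2 * (vb - m - p e) * m - 2 * (vb - m - p e) * vb + (vb - m - p e)\<^sup>2"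
      unfolding kk using ihh ih ip iv by (simp add: hp pmean vmean nu.prob_space[simplified])
    then show ?thesis by (simp add: power2_eq_square algebra_simps)
  qed
  have "(\<integral>e. \<integral>e'. (kk x e e')\<^sup>2 \<partial>\<nu> \<partial>\<nu>) = (\<integral>e. \<integral>e'. h e e' * h e e' \<partial>\<nu> \<partial>\<nu>) + 2 * (\<integral>e. p e * p e \<partial>\<nu>) - 2 * (\<integral>e. p e * v e \<partial>\<nu>)
      + (\<integral>e'. p e' * p e' \<partial>\<nu>) - 2 * (\<integral>e'. p e' * v e' \<partial>\<nu>) + (\<integral>e'. v e' * v e' \<partial>\<nu>) - (\<integral>e. p e * p e \<partial>\<nu>) - 2 * (m - vb) * m - (m - vb)\<^sup>2"
    unfolding inner using I2 ihh ip pmean by (simp add: sw[OF pm p01] sw[OF vm v01] nu.prob_space[simplified])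
  also have "\<dots> = (\<integral>e. \<integral>e'. h e e' * h e e' \<partial>\<nu> \<partial>\<nu>) + 2 * (\<integral>e. p e * p e \<partial>\<nu>) - 3 * (m * m)
      + 4 * (vb * m - (\<integral>e. p e * v e \<partial>\<nu>)) + (\<integral>e'. v e' * v e' \<partial>\<nu>) - vb * vb"
    by (simp add: power2_eq_square algebra_simps)
  finally show ?thesis by (simp add: power2_eq_square h_def p_def v_def m_def vb_def)
qed

text \<open>Turns the iterated integral into one integral over a product, where linear combinations
  split in a single step by linearity.\<close>

lemma trip_iter:
  fixes \<beta> :: "real measure" and k :: "real => real => real => real"
  assumes \<beta>: "prob_space \<beta>" "sets \<beta> = sets borel"
    and k: "(%q. k (snd (snd q)) (fst q) (fst (snd q))) \<in> borel_measurable (borel \<Otimes>\<^sub>M borel \<Otimes>\<^sub>M borel)" "!!x s t. \<bar>k x s t\<bar> <= B"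
  shows "integrable (\<beta> \<Otimes>\<^sub>M lam \<Otimes>\<^sub>M \<mu>) (%q. k (snd (snd q)) (fst q) (fst (snd q)))"
    and "(\<integral>s. \<integral>t. \<integral>x. k x s t \<partial>\<mu> \<partial>lam \<partial>\<beta>) = (\<integral>q. k (snd (snd q)) (fst q) (fst (snd q)) \<partial>(\<beta> \<Otimes>\<^sub>M lam \<Otimes>\<^sub>M \<mu>))"
proof -
  interpret B: prob_space \<beta> by fact
  interpret lm: pair_prob_space lam \<mu> ..
  interpret b: pair_prob_space \<beta> "lam \<Otimes>\<^sub>M \<mu>" ..
  have m: "(%q. k (snd (snd q)) (fst q) (fst (snd q))) \<in> borel_measurable (\<beta> \<Otimes>\<^sub>M lam \<Otimes>\<^sub>M \<mu>)"
    using k(1) unfolding measurable_cong_sets[OF sets_pair_measure_cong[OF \<beta>(2) sets_pair_measure_cong[OF sets_lam sets_mu]] refl] .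
  show i: "integrable (\<beta> \<Otimes>\<^sub>M lam \<Otimes>\<^sub>M \<mu>) (%q. k (snd (snd q)) (fst q) (fst (snd q)))"
    by (rule b.P.integrable_bounded[OF m, where B=B]) (use k(2) in auto)
  have sp: "space \<beta> = UNIV" using sets_eq_imp_space_eq[OF \<beta>(2)] by simp
  have "(\<integral>t. \<integral>x. k x s t \<partial>\<mu> \<partial>lam) = (\<integral>r. k (snd r) s (fst r) \<partial>(lam \<Otimes>\<^sub>M \<mu>))" for s
  proof -
    have s: "s \<in> space \<beta>" using sp by simp
    have "integrable (lam \<Otimes>\<^sub>M \<mu>) (%r. k (snd r) s (fst r))"
      by (rule lm.P.integrable_bounded[where B=B]) (use measurable_compose[OF measurable_Pair1'[OF s] m] k(2) in auto)
    from lm.integral_fst'[OF this] show ?thesis by simp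
  qed
  then show "(\<integral>s. \<integral>t. \<integral>x. k x s t \<partial>\<mu> \<partial>lam \<partial>\<beta>) = (\<integral>q. k (snd (snd q)) (fst q) (fst (snd q)) \<partial>(\<beta> \<Otimes>\<^sub>M lam \<Otimes>\<^sub>M \<mu>))"
    using b.integral_fst'[OF i] by simp
qed

lemma mu_swap':
  fixes \<beta> :: "real measure" and k :: "real => real => real => real"
  assumes \<beta>: "prob_space \<beta>" "sets \<beta> = sets borel"
    and k: "(%q. k (fst q) (fst (snd q)) (snd (snd q))) \<in> borel_measurable (borel \<Otimes>\<^sub>M borel \<Otimes>\<^sub>M borel)"
      "(%q. k (snd (snd q)) (fst q) (fst (snd q))) \<in> borel_measurable (borel \<Otimes>\<^sub>M borel \<Otimes>\<^sub>M borel)" "!!x s t. \<bar>k x s t\<bar> <= 1"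
  shows "(\<integral>q. k (snd (snd q)) (fst q) (fst (snd q)) \<partial>(\<beta> \<Otimes>\<^sub>M lam \<Otimes>\<^sub>M \<mu>)) = (\<integral>x. \<integral>s. \<integral>t. k x s t \<partial>lam \<partial>\<beta> \<partial>\<mu>)"
proof -
  have "(\<integral>x. \<integral>s. \<integral>t. k x s t \<partial>lam \<partial>\<beta> \<partial>\<mu>) = (\<integral>s. \<integral>t. \<integral>x. k x s t \<partial>\<mu> \<partial>lam \<partial>\<beta>)"
    by (rule mu_swap[OF \<beta> _ k(3)]) (use k(1) in \<open>simp add: case_prod_beta'\<close>)
  then show ?thesis using trip_iter(2)[OF \<beta> k(2,3)] by simp
qed

text \<open>Both sides are expanded in the integrals \<open>I\<close> of the monomials
  \<open>k1\<close> to \<open>k7\<close>. The second moment \<open>W\<close> of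
  \<open>1 - ub\<close> occurs with opposite signs in the position variance and in the martingale
  part and cancels; \<open>UU\<close> becomes the dT dT term.\<close>

lemma VV_eq: "VV = (\<integral>s. \<integral>t. CXX t s \<partial>lam \<partial>lam) + (\<integral>s. \<integral>t. CYY t s \<partial>tau \<partial>tau) - 2 * (\<integral>s. \<integral>t. CXY t s \<partial>lam \<partial>tau)"
proof -
  note Lp = L.prob_space_axioms and tp = tau.prob_space_axioms
  define k1 where "k1 x s t = ph (min t s) x * ph (min t s) x" for x s t
  define k2 where "k2 x s t = ph (min t s) x * (ph t x * ph s x)" for x s t
  define k3 where "k3 x s t = (ph t x)\<^sup>2 * (ph s x)\<^sup>2" for x s t
  define k4 where "k4 x s t = ph (min t s) x * ph t x" for x s t
  define k5 where "k5 x s t = (ph t x)\<^sup>2 * ph s x" for x s t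
  define k6 where "k6 x s t = (ph t x)\<^sup>2 * TT s" for x s t
  define k7 where "k7 x s t = (ph t x)\<^sup>2 * GG s" for x s t
  have sq1: "\<bar>(ph t x)\<^sup>2\<bar> <= 1" for t x using ph_sq[of t x] by simp
  have g1: "\<bar>GG s\<bar> <= 1" "\<bar>TT s\<bar> <= 1" for s using GG_01[of s] TT_01[of s] by auto
  have b: "\<bar>k1 x s t\<bar> <= 1" "\<bar>k2 x s t\<bar> <= 1" "\<bar>k3 x s t\<bar> <= 1" "\<bar>k4 x s t\<bar> <= 1" "\<bar>k5 x s t\<bar> <= 1" "\<bar>k6 x s t\<bar> <= 1" "\<bar>k7 x s t\<bar> <= 1" for x s t
    unfolding k1_def k2_def k3_def k4_def k5_def k6_def k7_def by (intro prodb abs01 sq1 g1)+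
  have km1: "(%q. k1 (a q) (b q) (c q)) \<in> borel_measurable N"
    if [measurable]: "a \<in> borel_measurable N" "b \<in> borel_measurable N" "c \<in> borel_measurable N"
    for a b c and N :: "'z measure"
    unfolding k1_def by measurable
  have km2: "(%q. k2 (a q) (b q) (c q)) \<in> borel_measurable N"
    if [measurable]: "a \<in> borel_measurable N" "b \<in> borel_measurable N" "c \<in> borel_measurable N"
    for a b c and N :: "'z measure"
    unfolding k2_def by measurable
  have km3: "(%q. k3 (a q) (b q) (c q)) \<in> borel_measurable N"
    if [measurable]: "a \<in> borel_measurable N" "b \<in> borel_measurable N" "c \<in> borel_measurable N"
    for a b c and N :: "'z measure"
    unfolding k3_def by measurable
  have km4: "(%q. k4 (a q) (b q) (c q)) \<in> borel_measurable N"
    if [measurable]: "a \<in> borel_measurable N" "b \<in> borel_measurable N" "c \<in> borel_measurable N"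
    for a b c and N :: "'z measure"
    unfolding k4_def by measurable
  have km5: "(%q. k5 (a q) (b q) (c q)) \<in> borel_measurable N"
    if [measurable]: "a \<in> borel_measurable N" "b \<in> borel_measurable N" "c \<in> borel_measurable N"
    for a b c and N :: "'z measure"
    unfolding k5_def by measurable
  have km6: "(%q. k6 (a q) (b q) (c q)) \<in> borel_measurable N"
    if [measurable]: "a \<in> borel_measurable N" "b \<in> borel_measurable N" "c \<in> borel_measurable N"
    for a b c and N :: "'z measure"
    unfolding k6_def by measurable
  have km7: "(%q. k7 (a q) (b q) (c q)) \<in> borel_measurable N"
    if [measurable]: "a \<in> borel_measurable N" "b \<in> borel_measurable N" "c \<in> borel_measurable N"
    for a b c and N :: "'z measure"
    unfolding k7_def by measurable
  note [measurable (raw)] = km1 km2 km3 km4 km5 km6 km7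
  define I where "I \<beta> k = (\<integral>q. k (snd (snd q)) (fst q) (fst (snd q)) \<partial>(\<beta> \<Otimes>\<^sub>M lam \<Otimes>\<^sub>M \<mu>))" for \<beta> and k :: "real => real => real => real"
  have m3: "(%q. k (snd (snd q)) (fst q) (fst (snd q))) \<in> borel_measurable (borel \<Otimes>\<^sub>M borel \<Otimes>\<^sub>M borel)"
      "(%q. k (fst q) (fst (snd q)) (snd (snd q))) \<in> borel_measurable (borel \<Otimes>\<^sub>M borel \<Otimes>\<^sub>M borel)"
    if "k \<in> {k1, k2, k3, k4, k5, k6, k7}" for k
    using that by (auto simp del: fst_conv snd_conv)
  have kb: "\<bar>k x s t\<bar> <= 1" if "k \<in> {k1, k2, k3, k4, k5, k6, k7}" for k x s t
    using that b[of x s t] by auto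
  have int3: "integrable (\<beta> \<Otimes>\<^sub>M lam \<Otimes>\<^sub>M \<mu>) (%q. k (snd (snd q)) (fst q) (fst (snd q)))"
    and it3: "I \<beta> k = (\<integral>s. \<integral>t. \<integral>x. k x s t \<partial>\<mu> \<partial>lam \<partial>\<beta>)" and sw3: "I \<beta> k = (\<integral>x. \<integral>s. \<integral>t. k x s t \<partial>lam \<partial>\<beta> \<partial>\<mu>)"
    if \<beta>: "prob_space \<beta>" "sets \<beta> = sets borel" and k: "k \<in> {k1, k2, k3, k4, k5, k6, k7}" for \<beta> k
    using trip_iter[OF \<beta> m3(1)[OF k] kb[OF k]] mu_swap'[OF \<beta> m3(2)[OF k] m3(1)[OF k] kb[OF k]] unfolding I_def by simp_all
  have intx: "integrable \<mu> (%x. k x s t)" if k: "k \<in> {k1, k2, k3, k4, k5, k6, k7}" for k s t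
  proof (rule mu.integrable_bounded[where B=1])
    show "(%x. k x s t) \<in> borel_measurable \<mu>" using k by auto
  qed (use kb[OF k] in auto)
  have intr: "integrable \<mu> (%x. \<integral>s. \<integral>t. k x s t \<partial>lam \<partial>\<beta>)" if \<beta>: "\<beta> \<in> {lam, tau}" and k: "k \<in> {k1, k2, k3, k4, k5, k6, k7}" for \<beta> k
  proof (rule mu.integrable_bounded[where B=1])
    show "(%x. \<integral>s. \<integral>t. k x s t \<partial>lam \<partial>\<beta>) \<in> borel_measurable \<mu>" using \<beta> k by (elim insertE) (simp_all, measurable)
    interpret B: prob_space \<beta> using \<beta> Lp tp by auto
    have "\<bar>\<integral>s. \<integral>t. k x s t \<partial>lam \<partial>\<beta>\<bar> <= 1" for x
      by (intro B.abs_integral_bounded L.abs_integral_bounded kb[OF k]) simp_all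
    then show "norm (\<integral>s. \<integral>t. k x s t \<partial>lam \<partial>\<beta>) <= 1" for x by simp
  qed
  have CXXk: "CXX t s = (\<integral>x. k1 x s t + 2 * k2 x s t - 2 * k3 x s t - k6 x s t \<partial>\<mu>)" for t s
  proof -
    have 1: "(ph (min t s) x + 3 * ph t x * ph s x) * (ph (min t s) x - ph t x * ph s x) = k1 x s t + 2 * k2 x s t - 3 * k3 x s t" for x
      unfolding k1_def k2_def k3_def by (simp add: power2_eq_square algebra_simps)
    have 2: "(ph t x)\<^sup>2 * (ph s x)\<^sup>2 = k3 x s t" for x unfolding k3_def ..
    have 3: "(\<integral>x. (ph t x)\<^sup>2 \<partial>\<mu>) * (\<integral>x. (ph s x)\<^sup>2 \<partial>\<mu>) = (\<integral>x. k6 x s t \<partial>\<mu>)" unfolding k6_def TT_def by simp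
    show ?thesis unfolding CXX_def 1 2 3 using intx by simp
  qed
  have CXYk: "CXY t s = (\<integral>x. 2 * k4 x s t - k5 x s t - k7 x s t \<partial>\<mu>)" for t s
  proof -
    have 1: "2 * ph t x * (ph (min t s) x - ph t x * ph s x) = 2 * k4 x s t - 2 * k5 x s t" for x
      unfolding k4_def k5_def by (simp add: power2_eq_square algebra_simps)
    have 2: "(ph t x)\<^sup>2 * ph s x = k5 x s t" for x unfolding k5_def ..
    have 3: "(\<integral>x. (ph t x)\<^sup>2 \<partial>\<mu>) * (\<integral>x. ph s x \<partial>\<mu>) = (\<integral>x. k7 x s t \<partial>\<mu>)" unfolding k7_def integral_ph by simp
    show ?thesis unfolding CXY_def 1 2 3 using intx by simp
  qed
  have XX: "(\<integral>s. \<integral>t. CXX t s \<partial>lam \<partial>lam) = I lam k1 + 2 * I lam k2 - 2 * I lam k3 - I lam k6"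
  proof -
    have "(\<integral>s. \<integral>t. CXX t s \<partial>lam \<partial>lam) = (\<integral>q. (%x s t. k1 x s t + 2 * k2 x s t - 2 * k3 x s t - k6 x s t) (snd (snd q)) (fst q) (fst (snd q)) \<partial>(lam \<Otimes>\<^sub>M lam \<Otimes>\<^sub>M \<mu>))"
      unfolding CXXk
    proof (rule trip_iter(2)[OF Lp sets_lam, where B=6])
      show "\<bar>k1 x s t + 2 * k2 x s t - 2 * k3 x s t - k6 x s t\<bar> <= 6" for x s t
        using b[of x s t] by (simp add: abs_le_iff)
    qed measurable
    then show ?thesis unfolding I_def using int3[OF Lp sets_lam] by simp
  qed
  have XY: "(\<integral>s. \<integral>t. CXY t s \<partial>lam \<partial>tau) = 2 * I tau k4 - I tau k5 - I tau k7"
  proof -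
    have "(\<integral>s. \<integral>t. CXY t s \<partial>lam \<partial>tau) = (\<integral>q. (%x s t. 2 * k4 x s t - k5 x s t - k7 x s t) (snd (snd q)) (fst q) (fst (snd q)) \<partial>(tau \<Otimes>\<^sub>M lam \<Otimes>\<^sub>M \<mu>))"
      unfolding CXYk
    proof (rule trip_iter(2)[OF tp sets_tau, where B=4])
      show "\<bar>2 * k4 x s t - k5 x s t - k7 x s t\<bar> <= 4" for x s t
        using b[of x s t] by (simp add: abs_le_iff)
    qed measurable
    then show ?thesis unfolding I_def using int3[OF tp sets_tau] by simp
  qed
  have ubmean: "(\<integral>x. ub x \<partial>\<mu>) = cc"
  proof -
    have "(\<integral>t. TT t \<partial>lam) = (\<integral>a. \<integral>v. TT (f (a, v)) \<partial>\<nu> \<partial>\<mu>)"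
      by (rule integral_lam[where B=1]) (use TT_01 in auto)
    then show ?thesis by (simp add: cc_def ub_def uu_def)
  qed
  have ubb: "0 <= ub x \<and> ub x <= 1" for x
    unfolding ub_def using u_ge u_le nu.abs_integral_bounded[of "%e. uu (x, e)" 1]
    by (auto intro!: Bochner_Integration.integral_nonneg simp: abs_le_iff)
  have [measurable]: "ub \<in> borel_measurable borel"
  proof -
    have "(%x. \<integral>e. uu (x, e) \<partial>\<nu>) \<in> borel_measurable borel"
      using u_meas by (intro nu.borel_measurable_lebesgue_integral) (simp add: case_prod_beta' cong: measurable_cong_sets sets_pair_measure_cong)
    then show ?thesis unfolding ub_def[abs_def] .
  qed
  have int_ub: "integrable \<mu> ub" by (rule mu.integrable_bounded[where B=1]) (use ubb in auto)
  \<comment> \<open>Integration by parts: the integrals of F_Y in dT and of T in dF_Y add up to one.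
    Fubini gives it through the mean of \<open>1 - ub\<close>.\<close>
  have GGtau: "(\<integral>t. GG t \<partial>tau) = 1 - cc"
  proof -
    interpret mt: pair_prob_space \<mu> tau ..
    have "(\<integral>t. GG t \<partial>tau) = (\<integral>t. \<integral>x. ph t x \<partial>\<mu> \<partial>tau)" unfolding integral_ph ..
    also have "\<dots> = (\<integral>x. \<integral>t. ph t x \<partial>tau \<partial>\<mu>)"
    proof (rule mt.Fubini_integral, rule mt.P.integrable_bounded[where B=1])
      show "(%(x, t). ph t x) \<in> borel_measurable (\<mu> \<Otimes>\<^sub>M tau)" by measurable
    qed (use abs01 in auto)
    also have "\<dots> = 1 - cc" unfolding ub_tau[symmetric] using int_ub ubmean by (simp add: mu.prob_space[simplified])
    finally show ?thesis .
  qed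
  have YY: "(\<integral>s. \<integral>t. CYY t s \<partial>tau \<partial>tau) = (\<integral>x. \<integral>e. (1 - uu (x, e))\<^sup>2 \<partial>\<nu> \<partial>\<mu>) - (1 - cc) * (1 - cc)"
  proof -
    have i1: "integrable tau g" if "g \<in> borel_measurable borel" "!!t. \<bar>g t\<bar> <= 1" for g :: "real => real"
      by (rule tau.integrable_bounded[where B=1]) (use that in auto)
    have "(\<integral>t. CYY t s \<partial>tau) = (\<integral>t. GG (min t s) \<partial>tau) - (1 - cc) * GG s" for s
    proof -
      have "integrable tau (%t. GG (min t s))" "integrable tau GG" by (rule i1, measurable, rule g1)+
      then show ?thesis unfolding CYY_def by (simp add: GGtau)
    qed
    moreover have "integrable tau (%s. \<integral>t. GG (min t s) \<partial>tau)" "integrable tau GG"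
      by (rule i1, measurable, rule tau.abs_integral_bounded, rule g1, simp) (rule i1, measurable, rule g1)
    ultimately show ?thesis unfolding V2_eq by (simp add: GGtau)
  qed
  have k6: "I lam k6 = cc * cc"
    unfolding it3[OF Lp sets_lam, of k6, simplified] by (simp add: k6_def TT_def[symmetric] cc_def)
  have k7: "I tau k7 = cc * (1 - cc)"
    unfolding it3[OF tp sets_tau, of k7, simplified] by (simp add: k7_def TT_def[symmetric] cc_def[symmetric] GGtau)
  define UU where "UU = (\<integral>x. \<integral>e. (1 - uu (x, e))\<^sup>2 \<partial>\<nu> \<partial>\<mu>)"
  define W where "W = (\<integral>x. (1 - ub x) * (1 - ub x) \<partial>\<mu>)"
  have iW: "integrable \<mu> (%x. (1 - ub x) * (1 - ub x))"
    by (rule mu.integrable_bounded[where B=1]) (use ubb in \<open>auto intro!: mult_le_one simp: abs_mult\<close>)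
  have iU: "integrable \<mu> (%x. \<integral>e. (1 - uu (x, e))\<^sup>2 \<partial>\<nu>)"
  proof (rule mu.integrable_bounded[where B=1])
    have "(%q. (1 - uu q)\<^sup>2) \<in> borel_measurable (\<mu> \<Otimes>\<^sub>M \<nu>)" using u_meas by (simp cong: measurable_cong_sets sets_pair_measure_cong)
    then show "(%x. \<integral>e. (1 - uu (x, e))\<^sup>2 \<partial>\<nu>) \<in> borel_measurable \<mu>"
      by (intro nu.borel_measurable_lebesgue_integral) (simp add: case_prod_beta')
    have "(1 - uu q)\<^sup>2 <= 1" for q using u_ge[of q] u_le[of q] power_le_one[of "1 - uu q" 2] by simp
    then show "norm (\<integral>e. (1 - uu (x, e))\<^sup>2 \<partial>\<nu>) <= 1" for x
      using nu.abs_integral_bounded[of "%e. (1 - uu (x, e))\<^sup>2" 1] by simp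
  qed
  have mm2: "mm x x * mm x x = (\<integral>s. \<integral>t. k3 x s t \<partial>lam \<partial>lam)" for x
    using M2_eq[of x] by (simp add: k3_def power2_eq_square)
  have mv: "mm x x * (1 - ub x) = (\<integral>s. \<integral>t. k5 x s t \<partial>lam \<partial>tau)" for x
    using MV_eq[of x] by (simp add: k5_def)
  have int_mm: "integrable \<mu> (%x. mm x x)"
  proof (rule mu.integrable_bounded[where B=1])
    show "(%x. mm x x) \<in> borel_measurable \<mu>" unfolding mm_ph by measurable
    show "norm (mm x x) <= 1" for x unfolding mm_ph real_norm_def by (rule L.abs_integral_bounded, intro prodb abs01(2), simp)
  qed
  have mmean: "(\<integral>x. mm x x \<partial>\<mu>) = cc" using integral_mm_diag by (simp add: cc_def)
  have A: "(\<integral>x. (aa x - c2)\<^sup>2 \<partial>\<mu>) = I lam k3 - 2 * I tau k5 + W - (2 * cc - 1) * (2 * cc - 1)"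
  proof -
    \<comment> \<open>Then \<open>aa x - c2 = mm x x - (1 - ub x) + d\<close>, which brings in the
      quantity \<open>1 - ub\<close> that is an integral over dT.\<close>
    define d where "d = 1 - 2 * cc"
    have c2d: "c2 = 1 - d" using c2_eq by (simp add: d_def cc_def)
    have "(aa x - c2)\<^sup>2 = mm x x * mm x x - 2 * (mm x x * (1 - ub x)) + (1 - ub x) * (1 - ub x) + 2 * d * (mm x x) - 2 * d * (1 - ub x) + d * d" for x
      unfolding aa_def c2d by (simp add: power2_eq_square algebra_simps)
    then have "(\<integral>x. (aa x - c2)\<^sup>2 \<partial>\<mu>) = (\<integral>x. (\<integral>s. \<integral>t. k3 x s t \<partial>lam \<partial>lam) - 2 * (\<integral>s. \<integral>t. k5 x s t \<partial>lam \<partial>tau) + (1 - ub x) * (1 - ub x) + 2 * d * (mm x x) - 2 * d * (1 - ub x) + d * d \<partial>\<mu>)"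
      by (simp only: mm2 mv)
    also have "\<dots> = I lam k3 - 2 * I tau k5 + W + 2 * d * cc - 2 * d * (1 - cc) + d * d"
    proof -
      have "(\<integral>x. 1 - ub x \<partial>\<mu>) = 1 - cc" using int_ub ubmean by (simp add: mu.prob_space[simplified])
      moreover have "integrable \<mu> (%x. 1 - ub x)" using int_ub by simp
      ultimately show ?thesis
        using intr[of lam k3] intr[of tau k5] iW int_mm sw3[OF Lp sets_lam, of k3] sw3[OF tp sets_tau, of k5]
        by (simp add: W_def[symmetric] mmean mu.prob_space[simplified] del: Bochner_Integration.integral_diff[where f="%_. 1"])
    qed
    also have "\<dots> = I lam k3 - 2 * I tau k5 + W - (2 * cc - 1) * (2 * cc - 1)" by (simp add: d_def algebra_simps)
    finally show ?thesis .
  qed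
  have Kx: "(\<integral>e. \<integral>e'. (kk x e e')\<^sup>2 \<partial>\<nu> \<partial>\<nu>) = (\<integral>s. \<integral>t. k1 x s t \<partial>lam \<partial>lam) + 2 * (\<integral>s. \<integral>t. k2 x s t \<partial>lam \<partial>lam)
      - 3 * (\<integral>s. \<integral>t. k3 x s t \<partial>lam \<partial>lam) + 4 * (\<integral>s. \<integral>t. k5 x s t \<partial>lam \<partial>tau) - 4 * (\<integral>s. \<integral>t. k4 x s t \<partial>lam \<partial>tau)
      + (\<integral>e. (1 - uu (x, e))\<^sup>2 \<partial>\<nu>) - (1 - ub x) * (1 - ub x)" for x
  proof -
    have "(\<integral>e. \<integral>e'. (H (ww (x, e)) (ww (x, e')))\<^sup>2 \<partial>\<nu> \<partial>\<nu>) = (\<integral>s. \<integral>t. k1 x s t \<partial>lam \<partial>lam)" unfolding k1_def by (rule H2_eq)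
    moreover have "(\<integral>e. (pp x (ww (x, e)))\<^sup>2 \<partial>\<nu>) = (\<integral>s. \<integral>t. k2 x s t \<partial>lam \<partial>lam)" unfolding k2_def by (rule P2_eq)
    moreover have "(mm x x)\<^sup>2 = (\<integral>s. \<integral>t. k3 x s t \<partial>lam \<partial>lam)" unfolding k3_def by (rule M2_eq)
    moreover have "(1 - ub x) * mm x x = (\<integral>s. \<integral>t. k5 x s t \<partial>lam \<partial>tau)" unfolding mv[symmetric] by (rule mult.commute)
    moreover have "(\<integral>e. pp x (ww (x, e)) * (1 - uu (x, e)) \<partial>\<nu>) = (\<integral>s. \<integral>t. k4 x s t \<partial>lam \<partial>tau)" unfolding k4_def by (rule PV_eq)
    ultimately show ?thesis unfolding kk_square[of x] by (simp only: power2_eq_square[of "1 - ub x"] right_diff_distrib)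
  qed
  have K: "(\<integral>x. \<integral>e. \<integral>e'. (kk x e e')\<^sup>2 \<partial>\<nu> \<partial>\<nu> \<partial>\<mu>) = I lam k1 + 2 * I lam k2 - 3 * I lam k3 + 4 * I tau k5 - 4 * I tau k4 + UU - W"
  proof -
    define j1 where "j1 x = (\<integral>s. \<integral>t. k1 x s t \<partial>lam \<partial>lam)" for x
    define j2 where "j2 x = (\<integral>s. \<integral>t. k2 x s t \<partial>lam \<partial>lam)" for x
    define j3 where "j3 x = (\<integral>s. \<integral>t. k3 x s t \<partial>lam \<partial>lam)" for x
    define j4 where "j4 x = (\<integral>s. \<integral>t. k4 x s t \<partial>lam \<partial>tau)" for x
    define j5 where "j5 x = (\<integral>s. \<integral>t. k5 x s t \<partial>lam \<partial>tau)" for x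
    define j6 where "j6 x = (\<integral>e. (1 - uu (x, e))\<^sup>2 \<partial>\<nu>)" for x
    define j7 where "j7 x = (1 - ub x) * (1 - ub x)" for x
    have ji: "integrable \<mu> j1" "integrable \<mu> j2" "integrable \<mu> j3" "integrable \<mu> j4" "integrable \<mu> j5" "integrable \<mu> j6" "integrable \<mu> j7"
      unfolding j1_def j2_def j3_def j4_def j5_def j6_def j7_def by ((rule intr, simp, simp) | rule iU | rule iW)+
    have jv: "integral\<^sup>L \<mu> j1 = I lam k1" "integral\<^sup>L \<mu> j2 = I lam k2" "integral\<^sup>L \<mu> j3 = I lam k3" "integral\<^sup>L \<mu> j4 = I tau k4" "integral\<^sup>L \<mu> j5 = I tau k5"
       "integral\<^sup>L \<mu> j6 = UU" "integral\<^sup>L \<mu> j7 = W"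
      unfolding j1_def j2_def j3_def j4_def j5_def j6_def j7_def UU_def W_def
      using sw3[OF Lp sets_lam] sw3[OF tp sets_tau] by simp_all
    have "(\<integral>x. \<integral>e. \<integral>e'. (kk x e e')\<^sup>2 \<partial>\<nu> \<partial>\<nu> \<partial>\<mu>) = (\<integral>x. j1 x + 2 * j2 x - 3 * j3 x + 4 * j5 x - 4 * j4 x + j6 x - j7 x \<partial>\<mu>)"
      unfolding Kx j1_def j2_def j3_def j4_def j5_def j6_def j7_def ..
    then show ?thesis using ji by (simp add: jv)
  qed
  show ?thesis
    unfolding VV_def A K XX XY YY UU_def[symmetric] k6 k7 by (simp add: algebra_simps)
qed

text \<open>These are the moments of a uniform variable, obtained by symmetry alone:
  \<open>i s t\<close> indicates \<open>t <= s\<close>, and integrating it over \<open>t\<close>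
  gives F_Y(s), over \<open>s\<close> it gives 1 - F_Y(t). Fubini then yields one linear equation
  for each moment.\<close>

lemma GG_moments: "(\<integral>t. GG t \<partial>lam) = 1 / 2" "(\<integral>t. GG t * GG t \<partial>lam) = 1 / 3"
proof -
  define i where "i s t = (indicator {..s} t :: real)" for s t :: real
  have im [measurable (raw)]: "a \<in> borel_measurable N ==> b \<in> borel_measurable N ==> (%q. i (a q) (b q)) \<in> borel_measurable N"
    for a b and N :: "'z measure" unfolding i_def by (rule ind_meas)
  have i1: "\<bar>i s t\<bar> <= 1" for s t by (simp add: i_def indicator_def)
  interpret ll: pair_prob_space lam lam ..
  have iL: "integrable lam g" if "g \<in> borel_measurable borel" "!!t. \<bar>g t\<bar> <= 1" for g :: "real => real"
    by (rule L.integrable_bounded[where B=1]) (use that in auto)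
  have g1: "\<bar>GG s\<bar> <= 1" for s using GG_01[of s] by auto
  have intG: "integrable lam GG" "integrable lam (%t. GG t * GG t)" by (rule iL, measurable, intro prodb g1)+
  have up: "(\<integral>t. i s t \<partial>lam) = GG s" for s by (simp add: i_def GG_def)
  have dn: "(\<integral>s. i s t \<partial>lam) = 1 - GG t" for t
  proof -
    have "(\<integral>s. i s t \<partial>lam) = (\<integral>s. indicator {t..} s \<partial>lam)"
      by (rule Bochner_Integration.integral_cong) (auto simp: i_def indicator_def)
    then show ?thesis by (simp add: lam_atLeast)
  qed
  have fub: "(\<integral>s. \<integral>t. i s t * g t \<partial>lam \<partial>lam) = (\<integral>t. (1 - GG t) * g t \<partial>lam)" if "g \<in> borel_measurable borel" "!!t. \<bar>g t\<bar> <= 1" for g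
  proof -
    have "integrable (lam \<Otimes>\<^sub>M lam) (%(s, t). i s t * g t)"
    proof (rule ll.P.integrable_bounded[where B=1])
      show "(%(s, t). i s t * g t) \<in> borel_measurable (lam \<Otimes>\<^sub>M lam)" using that(1) by measurable
    qed (use that(2) i1 prodb in auto)
    from ll.Fubini_integral[OF this] show ?thesis by (simp add: dn)
  qed
  show half: "(\<integral>t. GG t \<partial>lam) = 1 / 2"
    using fub[of "%_. 1"] intG by (simp add: up L.prob_space[simplified])
  define q where "q = (\<integral>t. GG t * GG t \<partial>lam)"
  \<comment> \<open>The maximum of \<open>GG s\<close> and \<open>GG t\<close> is selected with the
    indicator of \<open>t <= s\<close>, so that it can be integrated term by term.\<close>
  have HG: "(\<integral>u. i u s * i u t \<partial>lam) = 1 - (i s t * GG s + GG t - i s t * GG t)" for s t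
  proof -
    have "(\<integral>u. i u s * i u t \<partial>lam) = H (GG s) (GG t)" unfolding i_def by (rule integral_max_le)
    also have "\<dots> = 1 - (i s t * GG s + GG t - i s t * GG t)"
    proof (cases "t <= s")
      case True
      then show ?thesis using GG_mono[OF True] by (simp add: H_def i_def max_absorb1)
    next
      case False
      then have "GG s <= GG t" by (intro GG_mono) simp
      with False show ?thesis by (simp add: H_def i_def max_absorb2)
    qed
    finally show ?thesis .
  qed
  have "q = (\<integral>u. \<integral>s. \<integral>t. i u s * i u t \<partial>lam \<partial>lam \<partial>lam)"
    unfolding q_def by (simp add: up)
  also have "\<dots> = (\<integral>s. \<integral>t. \<integral>u. i u s * i u t \<partial>lam \<partial>lam \<partial>lam)"
  proof (rule triple_swap[where B=1])
    have "(%q. i (fst q) (fst (snd q)) * i (fst q) (snd (snd q))) \<in> borel_measurable (lam \<Otimes>\<^sub>M borel \<Otimes>\<^sub>M borel)" by measurable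
    then show "(%(u, s, t). i u s * i u t) \<in> borel_measurable (lam \<Otimes>\<^sub>M borel \<Otimes>\<^sub>M borel)" by (simp add: case_prod_beta')
  qed (use L.prob_space_axioms i1 prodb in auto)
  also have "\<dots> = (\<integral>s. 1 / 2 - GG s * GG s + (\<integral>t. i s t * GG t \<partial>lam) \<partial>lam)"
  proof (rule Bochner_Integration.integral_cong[OF refl])
    fix s
    have "integrable lam (%t. i s t)" "integrable lam (%t. i s t * GG t)" by (rule iL, measurable, intro prodb i1 g1)+
    then show "(\<integral>t. \<integral>u. i u s * i u t \<partial>lam \<partial>lam) = 1 / 2 - GG s * GG s + (\<integral>t. i s t * GG t \<partial>lam)"
      unfolding HG using intG by (simp add: up half L.prob_space[simplified])
  qed
  also have "\<dots> = 1 / 2 - q + (\<integral>t. (1 - GG t) * GG t \<partial>lam)"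
  proof -
    have "integrable lam (%s. \<integral>t. i s t * GG t \<partial>lam)"
    proof (rule iL)
      show "\<bar>\<integral>t. i s t * GG t \<partial>lam\<bar> <= 1" for s by (rule L.abs_integral_bounded) (use i1 g1 prodb in auto)
    qed measurable
    then show ?thesis using intG fub[OF GG_meas g1] by (simp add: q_def L.prob_space[simplified])
  qed
  also have "(\<integral>t. (1 - GG t) * GG t \<partial>lam) = 1 / 2 - q"
    using intG by (simp add: q_def left_diff_distrib half)
  finally show "(\<integral>t. GG t * GG t \<partial>lam) = 1 / 3" by (simp add: q_def)
qed

text \<open>By the uniform moments the denominator is 1/6 and the numerator
  \<open>cc - 1 / 3\<close>; this is where the 6 and the 2 of the estimator come from.\<close>

lemma rho_eq: "(\<integral>t. (\<integral>x. (ph t x - GG t)\<^sup>2 \<partial>\<mu>) \<partial>lam) / (\<integral>t. GG t * (1 - GG t) \<partial>lam) = 6 * cc - 2"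
proof -
  have g1: "\<bar>GG s\<bar> <= 1" for s using GG_01[of s] by auto
  have intG: "integrable lam GG" "integrable lam (%t. GG t * GG t)"
    by (rule L.integrable_bounded[where B=1], measurable, unfold real_norm_def, intro prodb g1)+
  have d: "(\<integral>t. GG t * (1 - GG t) \<partial>lam) = 1 / 6"
    using intG by (simp add: right_diff_distrib GG_moments)
  have "(\<integral>x. (ph t x - GG t)\<^sup>2 \<partial>\<mu>) = TT t - GG t * GG t" for t
  proof -
    have "(ph t x - GG t)\<^sup>2 = (ph t x)\<^sup>2 - 2 * GG t * ph t x + GG t * GG t" for x
      by (simp add: power2_eq_square algebra_simps)
    then show ?thesis using int_ph[of t] int_phsq[of t] by (simp add: integral_ph TT_def mu.prob_space[simplified])
  qed
  then have "(\<integral>t. (\<integral>x. (ph t x - GG t)\<^sup>2 \<partial>\<mu>) \<partial>lam) = cc - 1 / 3"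
    using intG int_TT by (simp add: cc_def GG_moments)
  then show ?thesis unfolding d by simp
qed

end

section \<open>Ranks, right neighbours and transfer to the sample\<close>

text \<open>A strictly increasing arrangement excludes ties, and sorted distinct lists of values
  with the same elements coincide; injectivity of \<open>x\<close> carries this equality back to the
  indices.\<close>

lemma rank_perm_list:
  assumes "is_rank_perm n x p"
  shows "map p [1..<Suc n] = ord_list n x" "inj_on x {1..n}"
proof -
  have p: "p permutes {1..n}" and m: "strict_mono_on {1..n} (%i. x (p i))"
    using assms by (auto simp: is_rank_perm_def)
  have img: "p ` {1..n} = {1..n}" by (rule permutes_image[OF p])
  have "inj_on (x \<circ> p) {1..n}"
    using strict_mono_on_imp_inj_on[OF m] by (simp add: comp_def)
  then have "inj_on x (p ` {1..n})" by (rule inj_on_imageI)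
  then show inj: "inj_on x {1..n}" by (simp only: img)
  have seteq: "set (map p [1..<Suc n]) = {1..n}"
    using img by (simp only: set_map set_upt atLeastLessThanSuc_atLeastAtMost)
  have "sorted (map x (map p [1..<Suc n]))"
    unfolding map_map
  proof (subst sorted_iff_nth_mono, intro allI impI)
    fix i j assume ij: "i <= j" "j < length (map (x \<circ> p) [1..<Suc n])"
    then have jn: "j < n" "i < n" by (simp_all del: upt_Suc)
    then have mem: "1 + i \<in> {1..n}" "1 + j \<in> {1..n}" by simp_all
    have le: "x (p (1 + i)) <= x (p (1 + j))"
    proof (cases "i = j")
      case False
      then have "1 + i < 1 + j" using ij(1) by simp
      from strict_mono_onD[OF m mem this] show ?thesis by simp
    qed simp
    have nth: "map (x \<circ> p) [1..<Suc n] ! k = x (p (1 + k))" if "k < n" for k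
      using that by (simp del: upt_Suc)
    show "map (x \<circ> p) [1..<Suc n] ! i <= map (x \<circ> p) [1..<Suc n] ! j"
      unfolding nth[OF jn(1)] nth[OF jn(2)] by (rule le)
  qed
  moreover have d: "distinct (map p [1..<Suc n])"
    using permutes_inj_on[OF p] by (simp add: distinct_map)
  have "distinct (map x (map p [1..<Suc n]))"
    unfolding distinct_map[of x] seteq using d inj by blast
  moreover have "distinct (map x (ord_list n x))"
    using inj by (simp add: distinct_map)
  moreover have "set (map x (map p [1..<Suc n])) = set (map x (ord_list n x))"
    by (simp only: set_map[of x] seteq ord_list_simps)
  ultimately have "map x (map p [1..<Suc n]) = map x (ord_list n x)"
    using ord_list_simps(4) by (intro sorted_distinct_set_unique) auto
  then show "map p [1..<Suc n] = ord_list n x"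
    by (rule map_inj_on) (simp only: seteq ord_list_simps inj Un_absorb)
qed

lemma rank_perm_unique:
  assumes "is_rank_perm n x p" "is_rank_perm n x q"
  shows "p = q"
proof
  fix i
  show "p i = q i"
  proof (cases "i \<in> {1..n}")
    case True
    have "map p [1..<Suc n] = map q [1..<Suc n]"
      using rank_perm_list(1)[OF assms(1)] rank_perm_list(1)[OF assms(2)] by (rule trans[OF _ sym])
    then have "\<forall>i\<in>set [1..<Suc n]. p i = q i" by (simp only: map_eq_conv)
    with True show ?thesis by auto
  next
    case False
    with assms show ?thesis by (metis is_rank_perm_def permutes_not_in)
  qed
qed

lemma rank_perm_eqI: "is_rank_perm n x p ==> rank_perm n x = p"
  using rank_perm_unique unfolding rank_perm_def by (metis the_equality)

lemma ex_rank_perm: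
  assumes inj: "inj_on x {1..n}"
  shows "is_rank_perm n x (rank_perm n x)"
proof -
  define l where "l = ord_list n x"
  \<comment> \<open>List positions start at 0, ranks at 1.\<close>
  define p where "p i = (if i \<in> {1..n} then l ! (i - 1) else i)" for i
  have l: "distinct l" "set l = {1..n}" "length l = n" "sorted (map x l)" by (simp_all add: l_def)
  have "bij_betw (%i. i - 1) {1..n} {..<n}"
    by (rule bij_betw_byWitness[where f'="%i. i + 1"]) auto
  moreover have "bij_betw ((!) l) {..<n} {1..n}"
    by (rule bij_betw_nth) (use l in auto)
  ultimately have "bij_betw ((!) l \<circ> (%i. i - 1)) {1..n} {1..n}" by (rule bij_betw_trans)
  then have "bij_betw p {1..n} {1..n}"
    by (rule bij_betw_cong[THEN iffD1, rotated]) (simp add: p_def)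
  then have perm: "p permutes {1..n}" by (rule bij_imp_permutes) (auto simp: p_def)
  have "strict_mono_on {1..n} (%i. x (p i))"
  proof (rule strict_mono_onI)
    fix i j assume ij: "i \<in> {1..n}" "j \<in> {1..n}" "i < j"
    then have lt: "i - 1 < j - 1" "i - 1 < n" "j - 1 < n" by auto
    have "map x l ! (i - 1) <= map x l ! (j - 1)"
      using lt l by (intro sorted_nth_mono) auto
    then have le: "x (p i) <= x (p j)" using lt ij l by (simp add: p_def)
    have "l ! (i - 1) ~= l ! (j - 1)" using lt l by (simp add: nth_eq_iff_index_eq)
    then have "p i ~= p j" using ij by (simp add: p_def)
    moreover have "p i \<in> {1..n}" "p j \<in> {1..n}" using perm ij by (simp_all only: permutes_in_image)
    ultimately have "x (p i) ~= x (p j)" using inj by (auto dest: inj_onD)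
    with le show "x (p i) < x (p j)" by simp
  qed
  with perm have "is_rank_perm n x p" by (simp add: is_rank_perm_def)
  then show ?thesis using rank_perm_eqI by metis
qed

lemma rank_perm_ties: "\<not> inj_on x {1..n} ==> rank_perm n x = id"
  using rank_perm_list(2) unfolding rank_perm_def by metis

lemma rank_perm_permutes: "rank_perm n x permutes {1..n}"
  using ex_rank_perm[of x n] rank_perm_ties[of x n] permutes_id by (metis is_rank_perm_def)

lemma rank_perm_map: "inj_on x {1..n} ==> map (rank_perm n x) [1..<Suc n] = ord_list n x"
  by (rule rank_perm_list[OF ex_rank_perm])

lemma is_rank_perm_cong: "(!!i. i \<in> {1..n} ==> x i = y i) ==> is_rank_perm n x p \<longleftrightarrow> is_rank_perm n y p"
  unfolding is_rank_perm_def monotone_on_def using permutes_in_image[of p "{1..n}"] by auto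

lemma rank_perm_cong: "(!!i. i \<in> {1..n} ==> x i = y i) ==> rank_perm n x = rank_perm n y"
  unfolding rank_perm_def using is_rank_perm_cong[of n x y] by presburger

lemma rank_perm_ext_cong: "(!!i. i \<in> {1..n} ==> x i = y i) ==> rank_perm_ext n x = rank_perm_ext n y"
  unfolding rank_perm_ext_def using rank_perm_cong[of n x y] by presburger

lemma right_neighbour_cong: "(!!i. i \<in> {1..n} ==> x i = y i) ==> right_neighbour n x = right_neighbour n y"
  unfolding right_neighbour_def using rank_perm_cong[of n x y] rank_perm_ext_cong[of n x y] by presburger

lemma rank_perm_in: "i \<in> {1..n} ==> rank_perm n x i \<in> {1..n}"
  using rank_perm_permutes by (simp only: permutes_in_image)

lemma rank_perm_ext_in: "n \<ge> 1 ==> rank_perm_ext n x i \<in> {1..n}"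
proof -
  assume "n \<ge> 1"
  then have "(i + n - 1) mod n < n" by (intro mod_less_divisor) simp
  then have "1 + (i + n - 1) mod n \<in> {1..n}" by simp
  then show ?thesis unfolding rank_perm_ext_def by (rule rank_perm_in)
qed

lemma rank_perm_ext_self: "i \<in> {1..n} ==> rank_perm_ext n x i = rank_perm n x i"
proof -
  assume i: "i \<in> {1..n}"
  define k where "k = i - 1"
  have k: "i = k + 1" "k < n" using i by (auto simp: k_def)
  have "i + n - 1 = k + n" unfolding k(1) by simp
  then have "1 + (i + n - 1) mod n = i" using k by simp
  then show ?thesis by (simp add: rank_perm_ext_def)
qed

lemma rank_perm_ext_period: "n \<ge> 1 ==> rank_perm_ext n x (i + n) = rank_perm_ext n x i"
proof -
  assume n: "n \<ge> 1"
  then have "i + n + n - 1 = (i + n - 1) + n" by simp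
  then have "(i + n + n - 1) mod n = (i + n - 1) mod n" by (metis mod_add_self2)
  then show ?thesis by (simp add: rank_perm_ext_def)
qed

lemma right_neighbour_in: "n \<ge> 1 ==> right_neighbour n x j \<in> {1..n}"
  unfolding right_neighbour_def by (rule rank_perm_ext_in)

lemma sum_adj_nth:
  fixes K :: "nat \<times> nat => real"
  assumes "distinct l"
  shows "(\<Sum>p\<in>adj l. K p) = (\<Sum>k<length l - 1. K (l ! k, l ! (k + 1)))"
proof -
  have "(\<Sum>p\<in>adj l. K p) = sum_list (map K (zip l (tl l)))"
    unfolding adj_def by (rule sum.distinct_set_conv_list[OF distinct_zipI1[OF assms]])
  also have "\<dots> = (\<Sum>k = 0..<length l - 1. K (l ! k, l ! (k + 1)))"
    unfolding sum_list_sum_nth by (rule sum.cong) (auto simp: nth_tl Suc_eq_plus1 simp del: One_nat_def)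
  finally show ?thesis by (simp add: atLeast0LessThan)
qed

text \<open>Stated with the list of values of \<open>rank_perm\<close> itself, so that it holds
  under ties as well. The one cyclic term joins the last entry to the first.\<close>

lemma sum_rank_perm_ext:
  fixes K :: "nat \<times> nat => real" and x :: "nat => real"
  assumes n: "n \<ge> 1"
  defines "l \<equiv> map (rank_perm n x) [1..<Suc n]"
  shows "(\<Sum>i=1..n. K (rank_perm_ext n x i, rank_perm_ext n x (i + 1))) = (\<Sum>p\<in>adj l. K p) + K (last l, hd l)"
proof -
  obtain m where m: "n = Suc m" using n by (cases n) auto
  have dl: "distinct l" unfolding l_def using permutes_inj_on[OF rank_perm_permutes] by (simp add: distinct_map)
  have len: "length l = n" by (simp add: l_def)
  have ln: "l ! k = rank_perm n x (k + 1)" if "k < n" for k using that by (simp add: l_def add.commute del: upt_Suc)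
  have ne: "l ~= []" using len n by auto
  have "(\<Sum>i=1..n. K (rank_perm_ext n x i, rank_perm_ext n x (i + 1))) =
      (\<Sum>k<n. K (rank_perm_ext n x (k + 1), rank_perm_ext n x (k + 1 + 1)))"
    by (rule sum.reindex_bij_witness[of _ "%k. k + 1" "%i. i - 1"]) auto
  also have "\<dots> = (\<Sum>k<m. K (rank_perm_ext n x (k + 1), rank_perm_ext n x (k + 1 + 1))) +
      K (rank_perm_ext n x (m + 1), rank_perm_ext n x (m + 1 + 1))"
    by (simp add: m)
  also have "(\<Sum>k<m. K (rank_perm_ext n x (k + 1), rank_perm_ext n x (k + 1 + 1))) = (\<Sum>k<m. K (l ! k, l ! (k + 1)))"
  proof (rule sum.cong[OF refl])
    fix k assume "k \<in> {..<m}"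
    then have k: "k + 1 \<in> {1..n}" "k + 1 + 1 \<in> {1..n}" "k < n" "k + 1 < n" using m by auto
    show "K (rank_perm_ext n x (k + 1), rank_perm_ext n x (k + 1 + 1)) = K (l ! k, l ! (k + 1))"
      unfolding rank_perm_ext_self[OF k(1)] rank_perm_ext_self[OF k(2)] ln[OF k(3)] ln[OF k(4)] ..
  qed
  also have "\<dots> = (\<Sum>p\<in>adj l. K p)" unfolding sum_adj_nth[OF dl] len using m by simp
  also have "rank_perm_ext n x (m + 1) = last l"
  proof -
    have "m + 1 \<in> {1..n}" "m < n" using m by auto
    then show ?thesis using ln[of m] len m last_conv_nth[OF ne] by (simp add: rank_perm_ext_self)
  qed
  also have "rank_perm_ext n x (m + 1 + 1) = hd l"
  proof -
    have "rank_perm_ext n x (m + 1 + 1) = rank_perm_ext n x 1"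
    proof -
      have "m + 1 + 1 = 1 + n" using m by simp
      then show ?thesis using rank_perm_ext_period[OF n, of x 1] by (simp only:)
    qed
    also have "\<dots> = rank_perm n x 1" using n by (intro rank_perm_ext_self) auto
    finally show ?thesis using ln[of 0] n hd_conv_nth[OF ne] by simp
  qed
  finally show ?thesis .
qed

lemma sum_rank_perm_ext_shift:
  fixes K :: "nat => nat => real"
  assumes n: "n \<ge> 1"
  shows "(\<Sum>i=1..n. K (rank_perm_ext n x (i - 1)) (rank_perm_ext n x i)) =
    (\<Sum>i=1..n. K (rank_perm_ext n x i) (rank_perm_ext n x (i + 1)))"
proof -
  define F where "F i = K (rank_perm_ext n x i) (rank_perm_ext n x (i + 1))" for i
  have F: "F n = F 0"
    unfolding F_def using rank_perm_ext_period[OF n, of x 0] rank_perm_ext_period[OF n, of x 1] by (simp add: add.commute)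
  have "(\<Sum>i=1..n. K (rank_perm_ext n x (i - 1)) (rank_perm_ext n x i)) = (\<Sum>k<n. F k)"
    unfolding F_def by (rule sum.reindex_bij_witness[of _ "%k. k + 1" "%i. i - 1"]) auto
  also have "\<dots> = (\<Sum>k<n. F (k + 1))"
    using sum.lessThan_Suc_shift[of F n] sum.lessThan_Suc[of F n] F unfolding Suc_eq_plus1 by linarith
  also have "\<dots> = (\<Sum>i=1..n. F i)"
    by (rule sum.reindex_bij_witness[of _ "%i. i - 1" "%k. k + 1"]) auto
  finally show ?thesis by (simp add: F_def)
qed

lemma sum_right_neighbour:
  fixes K :: "nat => nat => real"
  assumes n: "n \<ge> 1"
  shows "(\<Sum>j=1..n. K j (right_neighbour n x j)) = (\<Sum>i=1..n. K (rank_perm_ext n x i) (rank_perm_ext n x (i + 1)))"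
proof -
  have p: "rank_perm n x permutes {1..n}" by (rule rank_perm_permutes)
  have "(\<Sum>j=1..n. K j (right_neighbour n x j)) = (\<Sum>i=1..n. K (rank_perm n x i) (right_neighbour n x (rank_perm n x i)))"
    using sum.permute[OF p, of "%j. K j (right_neighbour n x j)"] by (simp add: comp_def)
  also have "\<dots> = (\<Sum>i=1..n. K (rank_perm_ext n x i) (rank_perm_ext n x (i + 1)))"
    by (rule sum.cong[OF refl]) (simp add: right_neighbour_def permutes_inverses(2)[OF p] rank_perm_ext_self)
  finally show ?thesis .
qed

text \<open>Neighbourhood depends on the values only, so relabelling the data by an involution
  relabels the neighbours. With \<open>p\<close> a transposition this gives the exchangeability
  behind the second form of Delta.\<close>

lemma right_neighbour_transpose:
  assumes n: "n \<ge> 1" and inj: "inj_on x {1..n}" and p: "p permutes {1..n}" and pp: "p \<circ> p = id"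
  shows "right_neighbour n (x \<circ> p) j = p (right_neighbour n x (p j))"
proof -
  let ?r = "rank_perm n x"
  have r: "?r permutes {1..n}" and rm: "strict_mono_on {1..n} (%i. x (?r i))"
    using ex_rank_perm[OF inj] by (auto simp: is_rank_perm_def)
  have ppi: "p (p i) = i" for i using pp by (metis comp_apply id_apply)
  have "is_rank_perm n (x \<circ> p) (p \<circ> ?r)"
    unfolding is_rank_perm_def using permutes_compose[OF r p] rm by (simp add: ppi)
  then have eq: "rank_perm n (x \<circ> p) = p \<circ> ?r" by (rule rank_perm_eqI)
  have "inv (p \<circ> ?r) j = inv ?r (p j)"
    by (rule inv_equality[THEN fun_cong[where x=j], of "%j. inv ?r (p j)"]) (simp_all add: ppi permutes_inverses[OF r])
  then show ?thesis
    by (simp add: right_neighbour_def rank_perm_ext_def eq)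
qed

text \<open>The rank permutation is a function of a measurable list with countably many values, so
  all indices derived from it are measurable, and evaluation at a random index is a finite case
  distinction.\<close>

lemma measurable_rank_perm_ext:
  fixes x y :: "'a => nat => real"
  assumes n: "n \<ge> 1" and x: "!!i. i \<in> {1..n} ==> (%\<omega>. x \<omega> i) \<in> borel_measurable M"
    and y: "!!i. i \<in> {1..n} ==> (%\<omega>. y \<omega> i) \<in> borel_measurable M"
  shows "(%\<omega>. y \<omega> (rank_perm_ext n (x \<omega>) i)) \<in> borel_measurable M"
    and "(%\<omega>. inv (rank_perm n (x \<omega>)) j) \<in> measurable M (count_space UNIV)"
    and "j \<in> {1..n} ==> (%\<omega>. y \<omega> (right_neighbour n (x \<omega>) j)) \<in> borel_measurable M"
proof -
  \<comment> \<open>The list of values of \<open>rank_perm\<close> in both cases: the sorted list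
    without ties, the identity list otherwise.\<close>
  define l where "l \<omega> = (if inj_on (x \<omega>) {1..n} then ord_list n (x \<omega>) else [1..<Suc n])" for \<omega>
  have rp: "map (rank_perm n (x \<omega>)) [1..<Suc n] = l \<omega>" for \<omega>
    using rank_perm_map[of "x \<omega>" n] rank_perm_ties[of "x \<omega>" n] by (cases "inj_on (x \<omega>) {1..n}") (simp_all add: l_def del: upt_Suc)
  have inj: "Measurable.pred M (%\<omega>. inj_on (x \<omega>) {1..n})"
  proof -
    have "Measurable.pred M (%\<omega>. x \<omega> i = x \<omega> j --> i = j)" if "i \<in> {1..n}" "j \<in> {1..n}" for i j
      using x[OF that(1)] x[OF that(2)] by measurable
    then have "Measurable.pred M (%\<omega>. \<forall>i\<in>{1..n}. \<forall>j\<in>{1..n}. x \<omega> i = x \<omega> j --> i = j)"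
      by (intro pred_intros_finite) auto
    then show ?thesis by (simp only: inj_on_def)
  qed
  have lm: "l \<in> measurable M (count_space UNIV)"
    unfolding l_def
    by (rule measurable_If[OF measurable_ord_list[OF x] _ predE[OF inj]]) auto
  have "rank_perm n (x \<omega>) k = (if k \<in> {1..n} then l \<omega> ! (k - 1) else k)" for \<omega> k
  proof (cases "k \<in> {1..n}")
    case True
    then have "l \<omega> ! (k - 1) = rank_perm n (x \<omega>) k"
      unfolding rp[symmetric] by (subst nth_map) (auto simp del: upt_Suc)
    then show ?thesis using True by simp
  next
    case False
    then show ?thesis by (simp only: if_False permutes_not_in[OF rank_perm_permutes False])
  qed
  then have rpeq: "rank_perm n (x \<omega>) = (%k. if k \<in> {1..n} then l \<omega> ! (k - 1) else k)" for \<omega> by auto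
  have cm: "(%\<omega>. G (l \<omega>)) \<in> measurable M (count_space UNIV)" for G :: "nat list => nat"
    by (rule measurable_compose[OF lm]) simp
  show "(%\<omega>. inv (rank_perm n (x \<omega>)) j) \<in> measurable M (count_space UNIV)"
    unfolding rpeq by (rule cm)
  have comp: "(%\<omega>. y \<omega> (g \<omega>)) \<in> borel_measurable M"
    if g: "g \<in> measurable M (count_space UNIV)" and gi: "!!\<omega>. g \<omega> \<in> {1..n}" for g
  proof (rule measurable_compose_countable'[where I="{1..n}"])
    have gf: "g -` {k} \<inter> space M \<in> sets M" for k using measurable_sets[OF g, of "{k}"] by simp
    have "g -` A \<inter> space M \<in> sets M" for A using measurable_sets[OF g, of A] by simp
    then show "g \<in> measurable M (count_space {1..n})"
      using gi by (intro measurableI) auto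
  qed (use y in auto)
  show "(%\<omega>. y \<omega> (rank_perm_ext n (x \<omega>) i)) \<in> borel_measurable M"
  proof (rule comp)
    show "(%\<omega>. rank_perm_ext n (x \<omega>) i) \<in> measurable M (count_space UNIV)"
      unfolding rank_perm_ext_def rpeq by (rule cm)
  qed (rule rank_perm_ext_in[OF n])
  show "(%\<omega>. y \<omega> (right_neighbour n (x \<omega>) j)) \<in> borel_measurable M"
  proof (rule comp)
    show "(%\<omega>. right_neighbour n (x \<omega>) j) \<in> measurable M (count_space UNIV)"
      unfolding right_neighbour_def rank_perm_ext_def rpeq by (rule cm)
  qed (rule right_neighbour_in[OF n])
qed

lemma interval_measure_cdf:
  assumes "real_distribution N"
  shows "interval_measure (cdf N) = N"
proof -
  interpret N: real_distribution N by fact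
  have *: "!!x y. x <= y ==> cdf N x <= cdf N y" "!!a. continuous (at_right a) (cdf N)"
    "(cdf N \<longlongrightarrow> 0) at_bot" "(cdf N \<longlongrightarrow> 1) at_top"
    by (rule N.cdf_nondecreasing, assumption, rule N.cdf_is_right_cont, rule N.cdf_lim_at_bot, rule N.cdf_lim_at_top_prob)
  show ?thesis
    by (rule cdf_unique[OF real_distribution_interval_measure[OF *] assms cdf_interval_measure[OF *(1-3)]])
qed

text \<open>The empirical distribution function is the distribution function of the image under
  \<open>y\<close> of the uniform law on the indices, so its Stieltjes measure is that
  image.\<close>

lemma integral_empirical_cdf:
  fixes g :: "real => real"
  assumes n: "n \<ge> 1" and g: "g \<in> borel_measurable borel"
  shows "(\<integral>t. g t \<partial>interval_measure (empirical_cdf n y)) = (\<Sum>j=1..n. g (y j)) / real n"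
proof -
  define P where "P = measure_pmf (pmf_of_set {1..n})"
  have ne: "{1..n} ~= {}" "finite {1..n}" using n by auto
  have int: "(\<integral>j. h j \<partial>P) = (\<Sum>j=1..n. h j) / real n" for h :: "nat => real"
    unfolding P_def by (subst integral_pmf_of_set[OF ne]) simp
  have ym: "y \<in> borel_measurable P" by (simp add: P_def)
  have pP: "prob_space P" by (simp add: P_def measure_pmf.prob_space_axioms)
  interpret P: prob_space P by (rule pP)
  have rd: "real_distribution (distr P borel y)" using ym by (rule P.real_distribution_distr)
  have "cdf (distr P borel y) t = empirical_cdf n y t" for t
  proof -
    have "cdf (distr P borel y) t = (\<integral>s. indicator {..t} s \<partial>distr P borel y)" by (simp add: cdf_def)
    also have "\<dots> = (\<integral>j. indicator {..t} (y j) \<partial>P)" by (rule integral_distr[OF ym]) simp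
    also have "\<dots> = empirical_cdf n y t" unfolding int by (simp add: empirical_cdf_def)
    finally show ?thesis .
  qed
  then have "empirical_cdf n y = cdf (distr P borel y)" by auto
  then have "interval_measure (empirical_cdf n y) = distr P borel y" using interval_measure_cdf[OF rd] by simp
  then show ?thesis using integral_distr[OF ym g] int by simp
qed

lemma rank_T_measurable: "rank_T n x y \<in> borel_measurable borel"
proof -
  have "(%t. indicator {..t} a :: real) = indicator {a..}" for a :: real by (auto simp: fun_eq_iff indicator_def)
  then have [measurable]: "(%t. indicator {..t} a :: real) \<in> borel_measurable borel" for a :: real by simp
  show ?thesis unfolding rank_T_def[abs_def] by measurable
qed

lemma rank_T_CvM_eq:
  assumes n: "n \<ge> 1"
  shows "rank_T_CvM n x y = (\<Sum>j=1..n. rank_T n x y (y j)) / real n"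
  unfolding rank_T_CvM_def by (rule integral_empirical_cdf[OF n rank_T_measurable])

lemma rank_T_adj:
  assumes n: "n \<ge> 1" and inj: "inj_on x {1..n}"
  shows "\<bar>rank_T n x y t - (\<Sum>p\<in>adj (ord_list n x). indicator {..t} (y (fst p)) * indicator {..t} (y (snd p))) / n\<bar> <= 1 / real n"
proof -
  define K where "K p = (indicator {..t} (y (fst p)) * indicator {..t} (y (snd p)) :: real)" for p
  have K: "0 <= K p" "K p <= 1" for p by (auto simp: K_def indicator_def)
  have "rank_T n x y t = (1 / real n) * (\<Sum>i=1..n. K (rank_perm_ext n x i, rank_perm_ext n x (i + 1)))"
    by (simp add: rank_T_def K_def)
  also have "\<dots> = (1 / real n) * ((\<Sum>p\<in>adj (ord_list n x). K p) + K (last (ord_list n x), hd (ord_list n x)))"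
    unfolding sum_rank_perm_ext[OF n] rank_perm_map[OF inj] ..
  finally have "rank_T n x y t - (\<Sum>p\<in>adj (ord_list n x). K p) / n = K (last (ord_list n x), hd (ord_list n x)) / n"
    by (simp add: add_divide_distrib)
  moreover have "\<bar>K (last (ord_list n x), hd (ord_list n x)) / n\<bar> <= 1 / n"
    using K by (simp add: divide_right_mono)
  ultimately show ?thesis unfolding K_def by simp
qed

text \<open>Interpolation between squares: n^2 s(n) changes by O(n) per step, and there are at most
  2k steps from k^2 to n if k is the integer part of sqrt n. The relative change is thus
  O(1/k).\<close>

lemma tendsto_from_squares:
  fixes s :: "nat => real"
  assumes s: "!!n. n \<ge> 1 ==> 0 <= s n \<and> s n <= 1"
    and step: "!!n. n \<ge> 1 ==> \<bar>(real n + 1)\<^sup>2 * s (n + 1) - (real n)\<^sup>2 * s n\<bar> <= 3 * (real n + 1)"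
    and sq: "(%k. s (k * k)) \<longlonglongrightarrow> c"
  shows "s \<longlonglongrightarrow> c"
proof -
  define S where "S n = (real n)\<^sup>2 * s n" for n
  have tele: "\<bar>S (m + d) - S m\<bar> <= 3 * real d * real (m + d)" if m: "m \<ge> 1" for m d
  proof (induction d)
    case (Suc d)
    have "\<bar>S (m + d + 1) - S (m + d)\<bar> <= 3 * (real (m + d) + 1)"
      using step[of "m + d"] m by (simp add: S_def add.commute add.left_commute)
    moreover have "m + Suc d = m + d + 1" by simp
    ultimately have "\<bar>S (m + Suc d) - S m\<bar> <= 3 * real d * real (m + d) + 3 * (real (m + d) + 1)"
      using Suc by (simp only:)
    also have "\<dots> <= 3 * real (Suc d) * real (m + Suc d)" by (simp add: algebra_simps)
    finally show ?case .
  qed simp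
  \<comment> \<open>The 5 is 3 from the accumulated steps plus 2 from the change of the
    normalisation from \<open>(real m)\<^sup>2\<close> to \<open>N\<^sup>2\<close>.\<close>
  have close: "\<bar>s (m + d) - s m\<bar> <= 5 * real d / real m" if m: "m \<ge> 1" for m d
  proof -
    define N where "N = real (m + d)"
    define D where "D = real d"
    have n: "0 < N" "real m > 0" "real m <= N" "0 <= D" "N = real m + D" using m by (auto simp: N_def D_def)
    have sq: "S (m + d) = N\<^sup>2 * s (m + d)" "S m = (real m)\<^sup>2 * s m" by (simp_all only: S_def N_def)
    have h1: "N\<^sup>2 * (s (m + d) - s m) = (S (m + d) - S m) + ((real m)\<^sup>2 - N\<^sup>2) * s m"
      unfolding sq by (simp add: algebra_simps)
    have h2: "\<bar>((real m)\<^sup>2 - N\<^sup>2) * s m\<bar> <= \<bar>(real m)\<^sup>2 - N\<^sup>2\<bar> * 1"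
      unfolding abs_mult by (rule mult_left_mono) (use s[OF m] in auto)
    have "(real m)\<^sup>2 - N\<^sup>2 = - (D * (real m + N))" unfolding n(5) by (simp add: power2_eq_square algebra_simps)
    then have h3: "\<bar>(real m)\<^sup>2 - N\<^sup>2\<bar> = D * (real m + N)" using n by (simp add: abs_mult)
    have h4: "D * (real m + N) <= D * (2 * N)" using n by (intro mult_left_mono) auto
    have h5: "\<bar>S (m + d) - S m\<bar> <= 3 * D * N" using tele[OF m, of d] by (simp only: N_def D_def)
    have "N * (N * \<bar>s (m + d) - s m\<bar>) = \<bar>N\<^sup>2 * (s (m + d) - s m)\<bar>" using n by (simp add: abs_mult power2_eq_square)
    also have "\<dots> <= \<bar>S (m + d) - S m\<bar> + \<bar>((real m)\<^sup>2 - N\<^sup>2) * s m\<bar>" unfolding h1 by (rule abs_triangle_ineq)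
    also have "\<dots> <= 3 * D * N + D * (2 * N)" by (rule add_mono[OF h5 order_trans[OF h2[unfolded mult_1_right h3] h4]])
    also have "\<dots> = N * (5 * D)" by simp
    finally have "N * \<bar>s (m + d) - s m\<bar> <= 5 * D" by (rule mult_left_le_imp_le) (rule n(1))
    then have "\<bar>s (m + d) - s m\<bar> <= 5 * D / N" using n by (simp add: pos_le_divide_eq mult.commute)
    also have "\<dots> <= 5 * D / real m" using n by (intro divide_left_mono mult_pos_pos mult_nonneg_nonneg) auto
    finally show ?thesis unfolding D_def .
  qed
  define k where "k n = nat \<lfloor>sqrt (real n)\<rfloor>" for n
  have kn: "k n * k n <= n" "n <= k n * k n + 2 * k n" for n
  proof -
    have "real (k n) = real_of_int \<lfloor>sqrt n\<rfloor>" unfolding k_def by (rule of_nat_nat) simp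
    then have a: "real (k n) <= sqrt n" "sqrt n < real (k n) + 1" using floor_correct[of "sqrt n"] by simp_all
    have "real (k n) * real (k n) <= sqrt n * sqrt n" using a by (intro mult_mono) auto
    then show "k n * k n <= n" by (simp flip: of_nat_mult)
    have "sqrt n * sqrt n < (real (k n) + 1) * (real (k n) + 1)" using a by (intro mult_strict_mono) auto
    then have "real n < real ((k n + 1) * (k n + 1))" by (simp add: algebra_simps)
    then show "n <= k n * k n + 2 * k n" by (simp only: of_nat_less_iff) (simp add: algebra_simps)
  qed
  have klim: "filterlim k at_top sequentially"
    unfolding k_def by (intro filterlim_compose[OF filterlim_nat_sequentially] filterlim_compose[OF filterlim_floor_sequentially]
      filterlim_compose[OF sqrt_at_top] filterlim_real_sequentially)
  have "\<bar>s n - s (k n * k n)\<bar> <= 10 / real (k n)" if "k n \<ge> 1" for n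
  proof -
    have m: "k n * k n \<ge> 1" using that by (simp add: Suc_leI One_nat_def)
    have "\<bar>s n - s (k n * k n)\<bar> <= 5 * real (n - k n * k n) / real (k n * k n)"
      using close[OF m, of "n - k n * k n"] kn(1)[of n] by simp
    also have "\<dots> <= 5 * (2 * real (k n)) / real (k n * k n)"
      using kn(2)[of n] by (intro divide_right_mono mult_left_mono) auto
    also have "\<dots> = 10 / real (k n)" using that by simp
    finally show ?thesis .
  qed
  moreover have "\<forall>\<^sub>F n in sequentially. k n \<ge> 1" using klim by (simp add: filterlim_at_top)
  ultimately have ev: "\<forall>\<^sub>F n in sequentially. norm (s n - s (k n * k n)) <= 10 / real (k n)"
    by (auto elim!: eventually_mono)
  have "(%n. 10 / real (k n)) \<longlonglongrightarrow> 0"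
    by (rule tendsto_divide_0[OF tendsto_const filterlim_at_top_imp_at_infinity[OF filterlim_compose[OF filterlim_real_sequentially klim]]])
  from Lim_null_comparison[OF ev this] have "(%n. s n - s (k n * k n)) \<longlonglongrightarrow> 0" .
  moreover have "(%n. s (k n * k n)) \<longlonglongrightarrow> c" by (rule filterlim_compose[OF sq klim])
  ultimately show ?thesis using tendsto_add[of "%n. s n - s (k n * k n)" 0 sequentially "%n. s (k n * k n)" c] by simp
qed

lemma normal_law_char:
  assumes v: "0 <= v"
  shows "real_distribution (normal_law 0 v)" and "char (normal_law 0 v) s = complex_of_real (exp (- (s\<^sup>2 * v / 2)))"
proof -
  have "real_distribution (normal_law 0 v) \<and> char (normal_law 0 v) s = complex_of_real (exp (- (s\<^sup>2 * v / 2)))"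
  proof (cases "v = 0")
    case True
    have "char (return borel 0) s = 1"
      unfolding char_def by (subst integral_return) auto
    moreover have "prob_space (return borel (0::real))" by (rule prob_space_return) simp
    ultimately show ?thesis using True
      by (simp add: normal_law_def real_distribution_def real_distribution_axioms_def)
  next
    case False
    with v have v0: "0 < sqrt v" by simp
    interpret N: prob_space std_normal_distribution by (rule prob_space_normal_density) simp
    have "distributed std_normal_distribution lborel (%x. x) std_normal_density"
      unfolding distributed_def by (auto intro!: distr_id2)
    from N.normal_density_affine[OF this, of "sqrt v" 0]
    have "distributed std_normal_distribution lborel (%x. sqrt v * x) (normal_density 0 (sqrt v))"
      using v0 by simp
    then have eq: "normal_law 0 v = distr std_normal_distribution lborel (%x. sqrt v * x)"
      using False unfolding normal_law_def by (simp add: distributed_distr_eq_density)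
    have m: "(%x. sqrt v * x) \<in> measurable std_normal_distribution lborel" by simp
    have "char (normal_law 0 v) s = (CLINT x|std_normal_distribution. iexp (s * (sqrt v * x)))"
      unfolding eq char_def by (rule integral_distr[OF m]) simp
    also have "\<dots> = char std_normal_distribution (s * sqrt v)" by (simp add: char_def mult.assoc)
    also have "\<dots> = complex_of_real (exp (- ((s * sqrt v)\<^sup>2) / 2))" unfolding char_std_normal_distribution ..
    also have "(s * sqrt v)\<^sup>2 = s\<^sup>2 * v" using v by (simp add: power_mult_distrib)
    finally have "char (normal_law 0 v) s = complex_of_real (exp (- (s\<^sup>2 * v / 2)))" by simp
    moreover have "prob_space (normal_law 0 v)" unfolding eq by (rule N.prob_space_distr[OF m])
    ultimately show ?thesis
      by (simp add: real_distribution_def real_distribution_axioms_def eq)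
  qed
  then show "real_distribution (normal_law 0 v)" "char (normal_law 0 v) s = complex_of_real (exp (- (s\<^sup>2 * v / 2)))"
    by blast+
qed

section \<open>Transport from the product spaces to the sample\<close>

text \<open>The sample enters through the joint laws of its first n positions and noises. Every
  statistic of size n becomes a function of \<open>zz n\<close>, whose law is \<open>PM n\<close>,
  while almost sure statements refer to the common space \<open>M\<close>.\<close>

locale rank_sample = rank_model \<mu> \<nu> f + M: prob_space M
  for \<mu> \<nu> :: "real measure" and f :: "real \<times> real => real" and M :: "'a measure" +
  fixes Xs \<epsilon>s :: "nat => 'a => real"
  assumes mu_single: "!!t. measure \<mu> {t} = 0"
    and Xs_meas: "!!i. i \<ge> 1 ==> Xs i \<in> borel_measurable M"
    and es_meas: "!!i. i \<ge> 1 ==> \<epsilon>s i \<in> borel_measurable M"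
    and law: "!!n. n \<ge> 1 ==>
      distr M (PM n) (%\<omega>. (restrict (%i. Xs i \<omega>) {1..n}, restrict (%i. \<epsilon>s i \<omega>) {1..n})) = PM n"
begin

definition zz :: "nat => 'a => (nat => real) \<times> (nat => real)" where
  "zz n \<omega> = (restrict (%i. Xs i \<omega>) {1..n}, restrict (%i. \<epsilon>s i \<omega>) {1..n})"

definition ys :: "nat => 'a => real" where "ys i \<omega> = f (Xs i \<omega>, \<epsilon>s i \<omega>)"

definition RT :: "nat => 'a => real" where "RT n \<omega> = rank_T_CvM n (%i. Xs i \<omega>) (%i. ys i \<omega>)"

definition DC :: "nat => real" where
  "DC n = (1 / real n) * (\<Sum>i=1..n.
     \<integral>t. (\<integral>\<omega>. (ph t (Xs (rank_perm_ext n (%k. Xs k \<omega>) (i - 1)) \<omega>) - ph t (Xs (rank_perm_ext n (%k. Xs k \<omega>) i) \<omega>))\<^sup>2 \<partial>M) \<partial>lam)"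

lemma zz_meas: "zz n \<in> measurable M (PM n)"
proof -
  have X: "Xs i \<in> measurable M \<mu>" if "i \<in> {1..n}" for i
    unfolding measurable_cong_sets[OF refl sets_mu] using that by (intro Xs_meas) simp
  have E: "\<epsilon>s i \<in> measurable M \<nu>" if "i \<in> {1..n}" for i
    unfolding measurable_cong_sets[OF refl sets_nu] using that by (intro es_meas) simp
  show ?thesis unfolding zz_def[abs_def]
    by (intro measurable_Pair measurable_restrict X E)
qed

lemma zz_law: "n \<ge> 1 ==> distr M (PM n) (zz n) = PM n"
  unfolding zz_def[abs_def] by (rule law)

lemma transfer:
  fixes g :: "_ => 'b::{banach,second_countable_topology}"
  assumes n: "n \<ge> 1" and g: "g \<in> borel_measurable (PM n)"
  shows "(\<integral>\<omega>. g (zz n \<omega>) \<partial>M) = (\<integral>z. g z \<partial>PM n)"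
  using integral_distr[OF zz_meas g] unfolding zz_law[OF n] by (rule sym)

lemma transferX:
  fixes g :: "_ => real"
  assumes n: "n \<ge> 1" and g: "g \<in> borel_measurable (XM n)" "!!x. \<bar>g x\<bar> <= B"
  shows "(\<integral>\<omega>. g (fst (zz n \<omega>)) \<partial>M) = (\<integral>x. g x \<partial>XM n)"
  using transfer[OF n measurable_compose[OF measurable_fst g(1)]] PM_integral_fst[OF g(1), of B] g(2) by simp

lemma fst_zz_meas: "(%\<omega>. fst (zz n \<omega>)) \<in> measurable M (XM n)"
  by (rule measurable_compose[OF zz_meas measurable_fst])

lemma zz_nth: "i \<in> {1..n} ==> fst (zz n \<omega>) i = Xs i \<omega>" "i \<in> {1..n} ==> snd (zz n \<omega>) i = \<epsilon>s i \<omega>"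
  by (simp_all add: zz_def)

text \<open>Given one position, an independent one meets it with probability zero, since
  \<open>\<mu>\<close> has no atoms.\<close>

lemma no_ties_pair:
  assumes ij: "i \<in> {1..n}" "j \<in> {1..n}" "i ~= j"
  shows "AE \<omega> in M. Xs i \<omega> ~= Xs j \<omega>"
proof -
  have n: "n \<ge> 1" using ij by auto
  define g where "g x = (indicator {0} (x i - x j) :: real)" for x :: "nat => real"
  have gm: "g \<in> borel_measurable (XM n)"
    unfolding g_def using meas_comp(1)[OF ij(1)] meas_comp(1)[OF ij(2)] by measurable
  have gb: "\<bar>g x\<bar> <= 1" for x by (simp add: g_def indicator_def)
  have "(\<integral>x. g x \<partial>XM n) = (\<integral>u. \<integral>v. (indicator {0} (u - v) :: real) \<partial>\<mu> \<partial>\<mu>)"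
    unfolding g_def
  proof (rule integral_PiM_pair[where B=1])
    have d: "(%q. fst q - snd q :: real) \<in> borel_measurable (borel \<Otimes>\<^sub>M borel)" by measurable
    have i0: "(indicator {0} :: real => real) \<in> borel_measurable borel" by (intro borel_measurable_indicator) simp
    have "(%q. indicator {0} (fst q - snd q :: real) :: real) \<in> borel_measurable (borel \<Otimes>\<^sub>M borel)"
      by (rule measurable_compose[OF d i0])
    then show "(%(u, v). indicator {0} (u - v) :: real) \<in> borel_measurable (\<mu> \<Otimes>\<^sub>M \<mu>)"
      by (simp add: case_prod_beta' cong: measurable_cong_sets sets_pair_measure_cong)
  qed (use ij prob_mu in \<open>auto simp: indicator_def\<close>)
  also have "\<dots> = 0"
  proof -
    have "(%v. indicator {0} (u - v) :: real) = indicator {u}" for u :: real by (auto simp: indicator_def fun_eq_iff)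
    then have "(\<integral>v. (indicator {0} (u - v) :: real) \<partial>\<mu>) = 0" for u by (simp add: mu_single)
    then show ?thesis by simp
  qed
  finally have zero: "(\<integral>\<omega>. g (fst (zz n \<omega>)) \<partial>M) = 0" using transferX[OF n gm gb] by simp
  have "integrable M (%\<omega>. g (fst (zz n \<omega>)))"
    by (rule M.integrable_bounded[where B=1]) (use measurable_compose[OF fst_zz_meas gm] gb in auto)
  then have "AE \<omega> in M. g (fst (zz n \<omega>)) = 0"
    using zero by (subst (asm) integral_nonneg_eq_0_iff_AE) (auto simp: g_def)
  then show ?thesis
    by (rule eventually_mono) (simp add: g_def zz_nth[OF ij(1)] zz_nth[OF ij(2)] indicator_eq_0_iff)
qed

lemma no_ties: "AE \<omega> in M. \<forall>n. inj_on (%i. Xs i \<omega>) {1..n}"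
proof -
  have "AE \<omega> in M. 1 <= i --> 1 <= j --> i ~= j --> Xs i \<omega> ~= Xs j \<omega>" for i j
  proof (cases "1 <= i \<and> 1 <= j \<and> i ~= j")
    case True
    then have "AE \<omega> in M. Xs i \<omega> ~= Xs j \<omega>" by (intro no_ties_pair[of i "max i j" j]) auto
    then show ?thesis by (rule eventually_mono) simp
  next
    case False
    then show ?thesis by (intro AE_I2) blast
  qed
  then have "AE \<omega> in M. \<forall>i j. 1 <= i --> 1 <= j --> i ~= j --> Xs i \<omega> ~= Xs j \<omega>"
    unfolding AE_all_countable by blast
  then show ?thesis
  proof (rule eventually_mono)
    fix \<omega> assume h: "\<forall>i j. 1 <= i --> 1 <= j --> i ~= j --> Xs i \<omega> ~= Xs j \<omega>"
    show "\<forall>n. inj_on (%i. Xs i \<omega>) {1..n}"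
    proof (intro allI inj_onI)
      fix n i j assume ij: "i \<in> {1..n}" "j \<in> {1..n}" "Xs i \<omega> = Xs j \<omega>"
      then have "1 <= i" "1 <= j" by simp_all
      with h ij(3) show "i = j" by blast
    qed
  qed
qed

lemma ys_meas: "i \<ge> 1 ==> ys i \<in> borel_measurable M"
  unfolding ys_def[abs_def] by (rule measurable_compose[OF measurable_Pair[OF Xs_meas es_meas] f_meas])

lemma Xs_ext_meas: "n \<ge> 1 ==> (%\<omega>. Xs (rank_perm_ext n (%k. Xs k \<omega>) i) \<omega>) \<in> borel_measurable M"
  by (rule measurable_rank_perm_ext(1)[of n "%\<omega> k. Xs k \<omega>" M "%\<omega> k. Xs k \<omega>"]) (auto intro: Xs_meas)

lemma ys_ext_meas: "n \<ge> 1 ==> (%\<omega>. ys (rank_perm_ext n (%k. Xs k \<omega>) i) \<omega>) \<in> borel_measurable M"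
  by (rule measurable_rank_perm_ext(1)[of n "%\<omega> k. Xs k \<omega>" M "%\<omega> k. ys k \<omega>"]) (auto intro: Xs_meas ys_meas)

lemma Xs_right_meas: "n \<ge> 1 ==> j \<in> {1..n} ==> (%\<omega>. Xs (right_neighbour n (%k. Xs k \<omega>) j) \<omega>) \<in> borel_measurable M"
  by (rule measurable_rank_perm_ext(3)[of n "%\<omega> k. Xs k \<omega>" M "%\<omega> k. Xs k \<omega>"]) (auto intro: Xs_meas)

lemma RT_meas: "n \<ge> 1 ==> RT n \<in> borel_measurable M"
proof -
  assume n: "n \<ge> 1"
  have "(%\<omega>. (\<Sum>j=1..n. (1 / real n) * (\<Sum>i=1..n. indicator {..ys j \<omega>} (ys (rank_perm_ext n (%k. Xs k \<omega>) i) \<omega>) *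
      indicator {..ys j \<omega>} (ys (rank_perm_ext n (%k. Xs k \<omega>) (i + 1)) \<omega>))) / real n) \<in> borel_measurable M"
    by (intro borel_measurable_divide borel_measurable_sum borel_measurable_times borel_measurable_const ind_meas ys_meas ys_ext_meas[OF n]) auto
  then show ?thesis unfolding RT_def[abs_def] rank_T_CvM_eq[OF n] rank_T_def .
qed

lemma TR_zz:
  "TR n {} (zz n \<omega>) t = (\<Sum>p\<in>adj (ord_list n (%i. Xs i \<omega>)). indicator {..t} (ys (fst p) \<omega>) * indicator {..t} (ys (snd p) \<omega>)) / n"
proof -
  have o: "ord_list n (fst (zz n \<omega>)) = ord_list n (%i. Xs i \<omega>)" by (rule ord_list_cong) (rule zz_nth(1))
  have y: "yy i (zz n \<omega>) = ys i \<omega>" if "i \<in> {1..n}" for i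
    unfolding yy_def ys_def zz_nth(1)[OF that] zz_nth(2)[OF that] ..
  have f: "filter (%i. i \<notin> {}) l = l" for l :: "nat list" by simp
  have "(\<Sum>p\<in>adj (ord_list n (%i. Xs i \<omega>)). indicator {..t} (yy (fst p) (zz n \<omega>)) * indicator {..t} (yy (snd p) (zz n \<omega>)) :: real) =
      (\<Sum>p\<in>adj (ord_list n (%i. Xs i \<omega>)). indicator {..t} (ys (fst p) \<omega>) * indicator {..t} (ys (snd p) \<omega>))"
    by (rule sum.cong[OF refl]) (use adj_ord_list y in metis)
  then show ?thesis unfolding TR_def f o by simp
qed

lemma ZZ_zz: "ZZ n (zz n \<omega>) = (\<Sum>j=1..n. TR n {} (zz n \<omega>) (ys j \<omega>)) / n"
proof -
  have "yy i (zz n \<omega>) = ys i \<omega>" if "i \<in> {1..n}" for i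
    unfolding yy_def ys_def zz_nth(1)[OF that] zz_nth(2)[OF that] ..
  then show ?thesis unfolding ZZ_def by (intro arg_cong[where f="%a. a / real n"] sum.cong refl) simp
qed

text \<open>At each level the cyclic pair contributes at most \<open>1 / n\<close> to T_n, and
  averaging over the empirical law keeps this bound.\<close>

lemma RT_ZZ:
  assumes n: "n \<ge> 1" and inj: "inj_on (%i. Xs i \<omega>) {1..n}"
  shows "\<bar>RT n \<omega> - ZZ n (zz n \<omega>)\<bar> <= 1 / n"
proof -
  let ?x = "%i. Xs i \<omega>" and ?y = "%i. ys i \<omega>"
  have "RT n \<omega> - ZZ n (zz n \<omega>) = (\<Sum>j=1..n. rank_T n ?x ?y (ys j \<omega>) - TR n {} (zz n \<omega>) (ys j \<omega>)) / n"
    unfolding RT_def rank_T_CvM_eq[OF n] ZZ_zz by (simp add: sum_subtractf diff_divide_distrib)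
  also have "\<bar>\<dots>\<bar> <= (\<Sum>j=1..n. 1 / real n) / n"
  proof -
    have "\<bar>\<Sum>j=1..n. rank_T n ?x ?y (ys j \<omega>) - TR n {} (zz n \<omega>) (ys j \<omega>)\<bar> <= (\<Sum>j=1..n. \<bar>rank_T n ?x ?y (ys j \<omega>) - TR n {} (zz n \<omega>) (ys j \<omega>)\<bar>)"
      by (rule sum_abs)
    also have "\<dots> <= (\<Sum>j=1..n. 1 / real n)"
      unfolding TR_zz by (rule sum_mono) (rule rank_T_adj[OF n inj])
    finally show ?thesis by (simp add: divide_right_mono)
  qed
  also have "(\<Sum>j=1..n. 1 / real n) / n = 1 / n" using n by simp
  finally show ?thesis .
qed

text \<open>Observation n + 1 changes each of the n inner sums by at most 2, because deleting it
  from the longer list restores the shorter one, and it adds one inner sum of size at most n +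
  1.\<close>

lemma ZZ_step:
  assumes n: "n \<ge> 1"
  shows "\<bar>(real n + 1)\<^sup>2 * ZZ (n + 1) (zz (n + 1) \<omega>) - (real n)\<^sup>2 * ZZ n (zz n \<omega>)\<bar> <= 3 * (real n + 1)"
proof -
  define K where "K j p = (indicator {..ys j \<omega>} (ys (fst p) \<omega>) * indicator {..ys j \<omega>} (ys (snd p) \<omega>) :: real)" for j p
  have K: "0 <= K j p" "K j p <= 1" for j p by (auto simp: K_def indicator_def)
  define A where "A m j = (\<Sum>p\<in>adj (ord_list m (%i. Xs i \<omega>)). K j p)" for m j
  have sq: "(real m)\<^sup>2 * ZZ m (zz m \<omega>) = (\<Sum>j=1..m. A m j)" if "m \<ge> 1" for m
  proof -
    have "ZZ m (zz m \<omega>) = (\<Sum>j=1..m. A m j) / m / m"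
      unfolding ZZ_zz TR_zz A_def K_def by (simp add: sum_divide_distrib)
    then show ?thesis using that by (simp add: power2_eq_square)
  qed
  have d: "\<bar>A (n + 1) j - A n j\<bar> <= 2" for j
    using sum_adj_remove_le_2[of "ord_list (Suc n) (%i. Xs i \<omega>)" "K j" "Suc n"] K
    unfolding filter_ord_list_Suc A_def by (simp add: Suc_eq_plus1 del: One_nat_def)
  have l: "\<bar>A (n + 1) j\<bar> <= real (n + 1)" for j
  proof -
    have "A (n + 1) j <= of_nat (card (adj (ord_list (n + 1) (%i. Xs i \<omega>)))) * 1"
      unfolding A_def by (rule sum_bounded_above) (rule K)
    moreover have "0 <= A (n + 1) j" unfolding A_def by (rule sum_nonneg) (rule K)
    ultimately show ?thesis using card_adj_ord_list[of "n + 1" "%i. Xs i \<omega>"] by simp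
  qed
  have "(\<Sum>j=1..n + 1. A (n + 1) j) - (\<Sum>j=1..n. A n j) = (\<Sum>j=1..n. A (n + 1) j - A n j) + A (n + 1) (n + 1)"
  proof -
    have "{1..n + 1} = insert (n + 1) {1..n}" by auto
    then have "(\<Sum>j=1..n + 1. A (n + 1) j) = A (n + 1) (n + 1) + (\<Sum>j=1..n. A (n + 1) j)" by simp
    then show ?thesis by (simp only: sum_subtractf)
  qed
  then have "\<bar>(\<Sum>j=1..n + 1. A (n + 1) j) - (\<Sum>j=1..n. A n j)\<bar> <= \<bar>\<Sum>j=1..n. A (n + 1) j - A n j\<bar> + real (n + 1)"
    using l[of "n + 1"] by linarith
  also have "\<bar>\<Sum>j=1..n. A (n + 1) j - A n j\<bar> <= (\<Sum>j=1..n. 2)"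
    by (rule order_trans[OF sum_abs sum_mono]) (rule d)
  also have "(\<Sum>j=1..n. 2) + real (n + 1) <= 3 * (real n + 1)" by simp
  finally show ?thesis using sq[OF n] sq[of "n + 1"] by (simp add: add.commute)
qed

section \<open>Almost sure convergence\<close>

text \<open>The variance bound 18/n is not summable over n but is so over the squares, and
  \<open>ZZ_step\<close> bridges the gaps.\<close>

lemma ZZ_as: "AE \<omega> in M. (%n. ZZ n (zz n \<omega>)) \<longlonglongrightarrow> cc"
proof -
  define m where "m n = (\<integral>z. ZZ n z \<partial>PM n)" for n
  \<comment> \<open>Shifted by one, so that all sample sizes are positive.\<close>
  define N where "N k = Suc k * Suc k" for k
  have N1: "N k \<ge> 1" for k by (simp add: N_def One_nat_def)
  define q where "q k \<omega> = (ZZ (N k) (zz (N k) \<omega>) - m (N k))\<^sup>2" for k \<omega>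
  have m01: "\<bar>m n\<bar> <= 1" for n
  proof -
    interpret P: prob_space "PM n" by (rule prob_PM)
    show ?thesis unfolding m_def by (rule P.abs_integral_bounded) (use ZZ_01 in auto)
  qed
  have qm: "q k \<in> borel_measurable M" for k
    unfolding q_def using measurable_compose[OF zz_meas ZZ_meas] by measurable
  have qb: "0 <= q k \<omega>" "q k \<omega> <= 4" for k \<omega>
  proof -
    have "\<bar>ZZ (N k) (zz (N k) \<omega>) - m (N k)\<bar> <= 2" using ZZ_01[of "N k" "zz (N k) \<omega>"] m01[of "N k"] by linarith
    then show "q k \<omega> <= 4" using abs_square_le[of "ZZ (N k) (zz (N k) \<omega>) - m (N k)" 2] by (simp add: q_def)
  qed (simp add: q_def)
  have qi: "integrable M (q k)" for k by (rule M.integrable_bounded[where B=4]) (use qm qb in auto)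
  have qe: "(\<integral>\<omega>. q k \<omega> \<partial>M) <= 18 * inverse (real (Suc k) ^ 2)" for k
  proof -
    have "(\<integral>\<omega>. q k \<omega> \<partial>M) = (\<integral>z. (ZZ (N k) z - m (N k))\<^sup>2 \<partial>PM (N k))"
      unfolding q_def by (rule transfer[OF N1]) (use ZZ_meas in measurable)
    also have "\<dots> <= 18 / N k" unfolding m_def by (rule ZZ_variance)
    also have "18 / real (N k) = 18 * inverse (real (Suc k) ^ 2)"
      by (simp only: N_def of_nat_mult power2_eq_square divide_inverse)
    finally show ?thesis .
  qed
  have "summable (%k. 18 * inverse (real (Suc k) ^ 2))"
    by (intro summable_mult) (subst summable_Suc_iff, rule inverse_power_summable, simp)
  then have sum: "summable (%k. \<integral>\<omega>. q k \<omega> \<partial>M)"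
  proof (rule summable_comparison_test'[where N=0])
    show "norm (\<integral>\<omega>. q k \<omega> \<partial>M) <= 18 * inverse (real (Suc k) ^ 2)" for k
      using qe[of k] qb by (simp add: Bochner_Integration.integral_nonneg)
  qed
  \<comment> \<open>The sum of squared deviations has finite expectation, hence is almost surely
    finite, hence its terms tend to zero.\<close>
  have "(\<integral>\<^sup>+\<omega>. (\<Sum>k. ennreal (q k \<omega>)) \<partial>M) = (\<Sum>k. \<integral>\<^sup>+\<omega>. ennreal (q k \<omega>) \<partial>M)"
    by (rule nn_integral_suminf) (use qm in measurable)
  also have "\<dots> = (\<Sum>k. ennreal (\<integral>\<omega>. q k \<omega> \<partial>M))"
    using qi qb by (intro suminf_cong nn_integral_eq_integral) auto
  also have "\<dots> = ennreal (\<Sum>k. \<integral>\<omega>. q k \<omega> \<partial>M)"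
    by (rule suminf_ennreal2[OF _ sum]) (use qb in \<open>auto intro: Bochner_Integration.integral_nonneg\<close>)
  finally have "(\<integral>\<^sup>+\<omega>. (\<Sum>k. ennreal (q k \<omega>)) \<partial>M) ~= \<infinity>" by simp
  then have "AE \<omega> in M. (\<Sum>k. ennreal (q k \<omega>)) ~= \<infinity>"
    by (rule nn_integral_noteq_infinite[rotated]) (use qm in measurable)
  then show ?thesis
  proof (rule eventually_mono)
    fix \<omega> assume "(\<Sum>k. ennreal (q k \<omega>)) ~= \<infinity>"
    then have "summable (%k. q k \<omega>)" using qb by (intro summable_suminf_not_top) auto
    then have "(%k. q k \<omega>) \<longlonglongrightarrow> 0" by (rule summable_LIMSEQ_zero)
    then have "(%k. sqrt (q k \<omega>)) \<longlonglongrightarrow> sqrt 0" by (rule tendsto_real_sqrt)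
    then have "(%k. \<bar>ZZ (N k) (zz (N k) \<omega>) - m (N k)\<bar>) \<longlonglongrightarrow> 0" by (simp add: q_def)
    then have 1: "(%k. ZZ (N k) (zz (N k) \<omega>) - m (N k)) \<longlonglongrightarrow> 0" by (rule tendsto_rabs_zero_cancel)
    have "filterlim N at_top sequentially"
      by (rule filterlim_at_top_mono[OF filterlim_Suc]) (simp add: N_def)
    then have 2: "(%k. m (N k)) \<longlonglongrightarrow> cc" unfolding m_def by (rule filterlim_compose[OF ZZ_mean])
    have "(%k. ZZ (N k) (zz (N k) \<omega>)) \<longlonglongrightarrow> cc" using tendsto_add[OF 1 2] by simp
    then have sq: "(%k. ZZ (k * k) (zz (k * k) \<omega>)) \<longlonglongrightarrow> cc"
      unfolding N_def by (subst filterlim_sequentially_Suc[symmetric]) simp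
    show "(%n. ZZ n (zz n \<omega>)) \<longlonglongrightarrow> cc"
      by (rule tendsto_from_squares[OF ZZ_01 ZZ_step sq])
  qed
qed

lemma RT_as: "AE \<omega> in M. (%n. RT n \<omega>) \<longlonglongrightarrow> cc"
  using ZZ_as no_ties
proof eventually_elim
  case (elim \<omega>)
  have "(%n. RT n \<omega> - ZZ n (zz n \<omega>)) \<longlonglongrightarrow> 0"
  proof (rule Lim_null_comparison[OF _ lim_1_over_n])
    show "\<forall>\<^sub>F n in sequentially. norm (RT n \<omega> - ZZ n (zz n \<omega>)) <= 1 / real n"
      using elim(2) by (intro eventually_mono[OF eventually_ge_at_top[of 1]]) (simp add: RT_ZZ)
  qed
  from tendsto_add[OF this elim(1)] show ?case by simp
qed

section \<open>The bias along the sample\<close>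

lemma ph_diff_sq: "(ph t x - ph t y)\<^sup>2 <= 1"
proof -
  have "\<bar>ph t x - ph t y\<bar> <= 1" using ph_01[of t x] ph_01[of t y] by auto
  from abs_square_le[OF this] show ?thesis by simp
qed

lemma dd_01: "0 <= dd x y" "dd x y <= 1"
proof -
  show "0 <= dd x y" unfolding dd_ph by (rule Bochner_Integration.integral_nonneg) simp
  show "dd x y <= 1" unfolding dd_ph using L.abs_integral_bounded[of "%t. (ph t x - ph t y)\<^sup>2" 1] ph_diff_sq by simp
qed

lemma int_ph_diff: "integrable lam (%t. (ph t x - ph t y)\<^sup>2)"
proof (rule L.integrable_bounded[where B=1])
  show "(%t. (ph t x - ph t y)\<^sup>2) \<in> borel_measurable lam" by measurable
qed (use ph_diff_sq in simp)

lemma dd_comp_meas: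
  fixes a b :: "'z => real"
  assumes [measurable]: "a \<in> borel_measurable N" "b \<in> borel_measurable N"
  shows "(%q. dd (a q) (b q)) \<in> borel_measurable N"
  unfolding dd_ph by measurable

text \<open>Moves the level integral inside the expectation, after which Delta is an expected
  neighbour sum of \<open>dd\<close>.\<close>

lemma integral_dd:
  assumes [measurable]: "a \<in> borel_measurable M" "b \<in> borel_measurable M"
  shows "(\<integral>t. \<integral>\<omega>. (ph t (a \<omega>) - ph t (b \<omega>))\<^sup>2 \<partial>M \<partial>lam) = (\<integral>\<omega>. dd (a \<omega>) (b \<omega>) \<partial>M)"
proof -
  interpret Ml: pair_prob_space M lam ..
  have "integrable (M \<Otimes>\<^sub>M lam) (%(\<omega>, t). (ph t (a \<omega>) - ph t (b \<omega>))\<^sup>2)"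
  proof (rule Ml.P.integrable_bounded[where B=1])
    show "(%(\<omega>, t). (ph t (a \<omega>) - ph t (b \<omega>))\<^sup>2) \<in> borel_measurable (M \<Otimes>\<^sub>M lam)" by measurable
    show "norm (case q of (\<omega>, t) => (ph t (a \<omega>) - ph t (b \<omega>))\<^sup>2) <= 1" for q
      using ph_diff_sq by (cases q) simp
  qed
  from Ml.Fubini_integral[OF this] show ?thesis by (simp add: dd_ph)
qed

lemma dd_int: "a \<in> borel_measurable M ==> b \<in> borel_measurable M ==> integrable M (%\<omega>. dd (a \<omega>) (b \<omega>))"
proof (rule M.integrable_bounded[where B=1])
  show "norm (dd (a \<omega>) (b \<omega>)) <= 1" for \<omega> using dd_01[of "a \<omega>" "b \<omega>"] by simp
qed (rule dd_comp_meas)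

lemma n_DC:
  assumes n: "n \<ge> 1"
  shows "n * DC n = (\<integral>\<omega>. (\<Sum>i=1..n. dd (Xs (rank_perm_ext n (%k. Xs k \<omega>) i) \<omega>) (Xs (rank_perm_ext n (%k. Xs k \<omega>) (i + 1)) \<omega>)) \<partial>M)"
proof -
  have "n * DC n = (\<Sum>i=1..n. \<integral>\<omega>. dd (Xs (rank_perm_ext n (%k. Xs k \<omega>) (i - 1)) \<omega>) (Xs (rank_perm_ext n (%k. Xs k \<omega>) i) \<omega>) \<partial>M)"
    unfolding DC_def integral_dd[OF Xs_ext_meas[OF n] Xs_ext_meas[OF n]] using n by simp
  also have "\<dots> = (\<integral>\<omega>. (\<Sum>i=1..n. dd (Xs (rank_perm_ext n (%k. Xs k \<omega>) (i - 1)) \<omega>) (Xs (rank_perm_ext n (%k. Xs k \<omega>) i) \<omega>)) \<partial>M)"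
    by (rule Bochner_Integration.integral_sum[symmetric]) (rule dd_int[OF Xs_ext_meas[OF n] Xs_ext_meas[OF n]])
  also have "\<dots> = (\<integral>\<omega>. (\<Sum>i=1..n. dd (Xs (rank_perm_ext n (%k. Xs k \<omega>) i) \<omega>) (Xs (rank_perm_ext n (%k. Xs k \<omega>) (i + 1)) \<omega>)) \<partial>M)"
  proof (rule Bochner_Integration.integral_cong[OF refl])
    fix \<omega>
    show "(\<Sum>i=1..n. dd (Xs (rank_perm_ext n (%k. Xs k \<omega>) (i - 1)) \<omega>) (Xs (rank_perm_ext n (%k. Xs k \<omega>) i) \<omega>)) =
        (\<Sum>i=1..n. dd (Xs (rank_perm_ext n (%k. Xs k \<omega>) i) \<omega>) (Xs (rank_perm_ext n (%k. Xs k \<omega>) (i + 1)) \<omega>))"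
      by (rule sum_rank_perm_ext_shift[OF n, of "%a b. dd (Xs a \<omega>) (Xs b \<omega>)"])
  qed
  finally show ?thesis .
qed

lemma DD_zz: "DD n (fst (zz n \<omega>)) = (\<Sum>p\<in>adj (ord_list n (%i. Xs i \<omega>)). dd (Xs (fst p) \<omega>) (Xs (snd p) \<omega>))"
proof -
  have o: "ord_list n (fst (zz n \<omega>)) = ord_list n (%i. Xs i \<omega>)" by (rule ord_list_cong) (rule zz_nth(1))
  show ?thesis unfolding DD_def o
    by (rule sum.cong[OF refl]) (use adj_ord_list zz_nth(1) in metis)
qed

lemma ED_zz: "n \<ge> 1 ==> ED n = (\<integral>\<omega>. DD n (fst (zz n \<omega>)) \<partial>M)"
  unfolding ED_def by (rule transferX[OF _ DD_meas DD_bound, symmetric])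

lemma DD_zz_int: "integrable M (%\<omega>. DD n (fst (zz n \<omega>)))"
  by (rule M.integrable_bounded[where B="2 * n"]) (use measurable_compose[OF fst_zz_meas DD_meas] DD_bound in auto)

text \<open>Outside a null set the two sums differ by the cyclic pair alone, and \<open>dd\<close>
  has values in [0, 1].\<close>

lemma DC_ED:
  assumes n: "n \<ge> 1"
  shows "\<bar>n * DC n - ED n\<bar> <= 1"
proof -
  define S where "S \<omega> = (\<Sum>i=1..n. dd (Xs (rank_perm_ext n (%k. Xs k \<omega>) i) \<omega>) (Xs (rank_perm_ext n (%k. Xs k \<omega>) (i + 1)) \<omega>))" for \<omega>
  have Si: "integrable M S"
    unfolding S_def by (rule Bochner_Integration.integrable_sum) (rule dd_int[OF Xs_ext_meas[OF n] Xs_ext_meas[OF n]])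
  have ae: "AE \<omega> in M. DD n (fst (zz n \<omega>)) <= S \<omega> \<and> S \<omega> <= DD n (fst (zz n \<omega>)) + 1"
    using no_ties
  proof (rule eventually_mono)
    fix \<omega> assume inj: "\<forall>n. inj_on (%i. Xs i \<omega>) {1..n}"
    let ?l = "ord_list n (%i. Xs i \<omega>)"
    have "S \<omega> = (\<Sum>p\<in>adj ?l. dd (Xs (fst p) \<omega>) (Xs (snd p) \<omega>)) + dd (Xs (last ?l) \<omega>) (Xs (hd ?l) \<omega>)"
      using sum_rank_perm_ext[OF n, of "%p. dd (Xs (fst p) \<omega>) (Xs (snd p) \<omega>)" "%i. Xs i \<omega>"]
      unfolding rank_perm_map[OF inj[rule_format]] S_def by simp
    then show "DD n (fst (zz n \<omega>)) <= S \<omega> \<and> S \<omega> <= DD n (fst (zz n \<omega>)) + 1"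
      unfolding DD_zz using dd_01[of "Xs (last ?l) \<omega>" "Xs (hd ?l) \<omega>"] by simp
  qed
  have "(\<integral>\<omega>. DD n (fst (zz n \<omega>)) \<partial>M) <= (\<integral>\<omega>. S \<omega> \<partial>M)"
    by (rule integral_mono_AE[OF DD_zz_int Si]) (use ae in \<open>auto elim: eventually_mono\<close>)
  moreover have "(\<integral>\<omega>. S \<omega> \<partial>M) <= (\<integral>\<omega>. DD n (fst (zz n \<omega>)) + 1 \<partial>M)"
    by (rule integral_mono_AE[OF Si]) (use ae DD_zz_int in \<open>auto elim: eventually_mono\<close>)
  moreover have "(\<integral>\<omega>. DD n (fst (zz n \<omega>)) + 1 \<partial>M) = (\<integral>\<omega>. DD n (fst (zz n \<omega>)) \<partial>M) + 1"
    using DD_zz_int by (simp add: M.prob_space)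
  ultimately show ?thesis unfolding n_DC[OF n] ED_zz[OF n] S_def[symmetric] by simp
qed

lemma DC_tendsto: "DC \<longlonglongrightarrow> 0"
proof (rule Lim_null_comparison)
  show "\<forall>\<^sub>F n in sequentially. norm (DC n) <= ED n / n + 1 / n"
  proof (rule eventually_mono[OF eventually_ge_at_top[of 1]])
    fix n :: nat assume n: "1 <= n"
    have "\<bar>n * DC n\<bar> <= ED n + 1" using DC_ED[OF n] ED_bound(1)[of n] by linarith
    then have "\<bar>DC n\<bar> * n <= ED n + 1" by (simp add: abs_mult mult.commute)
    then have "\<bar>DC n\<bar> <= (ED n + 1) / n" using n by (subst pos_le_divide_eq) auto
    then show "norm (DC n) <= ED n / n + 1 / n" by (simp add: add_divide_distrib)
  qed
  show "(%n. ED n / real n + 1 / real n) \<longlonglongrightarrow> 0" using tendsto_add[OF ED_tendsto lim_1_over_n] by simp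
qed

text \<open>Delta is the average over j of the mean distance from X_j to its right neighbour.
  Exchanging the labels 1 and j preserves the law of the positions and carries right neighbours to
  right neighbours, so all these means agree.\<close>

lemma DC_right_neighbour:
  assumes n: "n \<ge> 1"
  shows "DC n = (\<integral>t. (\<integral>\<omega>. (ph t (Xs 1 \<omega>) - ph t (Xs (right_neighbour n (%k. Xs k \<omega>) 1) \<omega>))\<^sup>2 \<partial>M) \<partial>lam)"
proof -
  define R where "R j = (\<integral>\<omega>. dd (Xs j \<omega>) (Xs (right_neighbour n (%k. Xs k \<omega>) j) \<omega>) \<partial>M)" for j
  define F where "F j x = dd (x j) (x (right_neighbour n x j))" for j and x :: "nat => real"
  have one: "1 \<in> {1..n}" using n by simp
  have Fb: "\<bar>F j x\<bar> <= 1" for j x unfolding F_def using dd_01[of "x j" "x (right_neighbour n x j)"] by simp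
  have Fm: "F j \<in> borel_measurable (XM n)" if j: "j \<in> {1..n}" for j
    unfolding F_def
    by (rule dd_comp_meas[OF meas_comp(1)[OF j] measurable_rank_perm_ext(3)[where x="%\<omega>. \<omega>" and y="%\<omega>. \<omega>" and M="XM n", OF n meas_comp(1) meas_comp(1) j]])
  have Fz: "F j (fst (zz n \<omega>)) = dd (Xs j \<omega>) (Xs (right_neighbour n (%k. Xs k \<omega>) j) \<omega>)" if j: "j \<in> {1..n}" for j \<omega>
  proof -
    have "right_neighbour n (fst (zz n \<omega>)) = right_neighbour n (%k. Xs k \<omega>)" by (rule right_neighbour_cong) (rule zz_nth(1))
    then show ?thesis unfolding F_def using zz_nth(1)[OF j] zz_nth(1)[OF right_neighbour_in[OF n]] by simp
  qed
  have RF: "R j = (\<integral>x. F j x \<partial>XM n)" if j: "j \<in> {1..n}" for j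
    unfolding R_def Fz[OF j, symmetric] by (rule transferX[OF n Fm[OF j] Fb])
  have Rj: "R j = R 1" if j: "j \<in> {1..n}" for j
  proof -
    define p where "p = Transposition.transpose 1 j"
    have pp: "p permutes {1..n}" unfolding p_def by (rule permutes_swap_id[OF one j])
    have inv: "p \<circ> p = id" "p 1 = j" "p (p a) = a" for a unfolding p_def by (simp_all add: fun_eq_iff)
    have pin: "p i \<in> {1..n}" if "i \<in> {1..n}" for i using that permutes_in_image[OF pp] by blast
    define sh where "sh x = restrict (%i. x (p i)) {1..n}" for x :: "nat => real"
    have shm: "sh \<in> measurable (XM n) (XM n)"
      unfolding sh_def[abs_def]
      by (rule measurable_restrict) (use pin in \<open>auto intro!: measurable_component_singleton\<close>)
    have "distr (XM n) (XM n) sh = XM n"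
      unfolding sh_def[abs_def]
      by (rule distr_PiM_reindex[where M="%_. \<mu>"]) (use prob_mu pin permutes_inj_on[OF pp] in auto)
    then have "(\<integral>x. F 1 x \<partial>XM n) = (\<integral>x. F 1 (sh x) \<partial>XM n)"
      \<comment> \<open>Permuting the coordinates preserves the product law; afterwards one passes
        to \<open>M\<close>, where ties can be discarded almost surely.\<close>
      using integral_distr[OF shm Fm[OF one]] by simp
    also have "\<dots> = (\<integral>\<omega>. F 1 (sh (fst (zz n \<omega>))) \<partial>M)"
      by (rule transferX[OF n measurable_compose[OF shm Fm[OF one]] Fb, symmetric])
    also have "\<dots> = (\<integral>\<omega>. F j (fst (zz n \<omega>)) \<partial>M)"
    proof (rule integral_cong_AE)
      show "(%\<omega>. F 1 (sh (fst (zz n \<omega>)))) \<in> borel_measurable M"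
        by (rule measurable_compose[OF measurable_compose[OF fst_zz_meas shm] Fm[OF one]])
      show "(%\<omega>. F j (fst (zz n \<omega>))) \<in> borel_measurable M" by (rule measurable_compose[OF fst_zz_meas Fm[OF j]])
      show "AE \<omega> in M. F 1 (sh (fst (zz n \<omega>))) = F j (fst (zz n \<omega>))"
        using no_ties
      proof (rule eventually_mono)
        fix \<omega> assume "\<forall>n. inj_on (%i. Xs i \<omega>) {1..n}"
        then have "inj_on (%i. Xs i \<omega>) {1..n}" by blast
        define x where "x = fst (zz n \<omega>)"
        have inj: "inj_on x {1..n}" unfolding x_def
          by (rule iffD2[OF inj_on_cong \<open>inj_on (%i. Xs i \<omega>) {1..n}\<close>]) (rule zz_nth(1))
        have shx: "sh x i = x (p i)" if "i \<in> {1..n}" for i using that by (simp add: sh_def)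
        have "right_neighbour n (sh x) = right_neighbour n (x \<circ> p)" by (rule right_neighbour_cong) (simp add: shx)
        then have rn: "right_neighbour n (sh x) 1 = p (right_neighbour n x j)"
          using right_neighbour_transpose[OF n inj pp inv(1), of 1] inv(2) by simp
        show "F 1 (sh (fst (zz n \<omega>))) = F j (fst (zz n \<omega>))"
          unfolding x_def[symmetric] F_def rn shx[OF one] shx[OF pin[OF right_neighbour_in[OF n]]] inv(2,3) ..
      qed
    qed
    also have "\<dots> = R j" unfolding R_def Fz[OF j] ..
    finally show ?thesis using RF[OF one] by simp
  qed
  have "n * DC n = (\<integral>\<omega>. (\<Sum>j=1..n. dd (Xs j \<omega>) (Xs (right_neighbour n (%k. Xs k \<omega>) j) \<omega>)) \<partial>M)"
    unfolding n_DC[OF n]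
  proof (rule Bochner_Integration.integral_cong[OF refl])
    fix \<omega>
    show "(\<Sum>i=1..n. dd (Xs (rank_perm_ext n (%k. Xs k \<omega>) i) \<omega>) (Xs (rank_perm_ext n (%k. Xs k \<omega>) (i + 1)) \<omega>)) =
      (\<Sum>j=1..n. dd (Xs j \<omega>) (Xs (right_neighbour n (%k. Xs k \<omega>) j) \<omega>))"
      by (rule sum_right_neighbour[OF n, of "%a b. dd (Xs a \<omega>) (Xs b \<omega>)", symmetric])
  qed
  also have "\<dots> = (\<Sum>j=1..n. R j)"
    unfolding R_def
    by (rule Bochner_Integration.integral_sum, rule dd_int) (auto intro: Xs_meas Xs_right_meas[OF n])
  also have "\<dots> = (\<Sum>j=1..n. R 1)" by (rule sum.cong[OF refl]) (rule Rj)
  also have "\<dots> = n * R 1" by simp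
  finally have "DC n = R 1" using n by simp
  then show ?thesis
    unfolding R_def using integral_dd[OF Xs_meas Xs_right_meas[OF n one], of 1] by simp
qed

section \<open>Convergence in law\<close>

text \<open>Levy continuity together with a deterministic bound on the distance to the normalised
  \<open>ZZ\<close>. The factor 6 scales the argument of the characteristic function and so turns
  \<open>VV\<close> into \<open>36 * VV\<close>.\<close>

lemma weak_limit:
  assumes A: "!!n. A n \<in> borel_measurable M"
    and d: "!!n. n \<ge> 1 ==> AE \<omega> in M. \<bar>A n \<omega> - 6 * (sqrt n * (ZZ n (zz n \<omega>) - cc + ED n / (2 * real n)))\<bar> <= d n"
    and d0: "d \<longlonglongrightarrow> 0"
  shows "weak_conv_m (%n. distr M borel (A n)) (normal_law 0 (36 * VV))"
proof (rule levy_continuity)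
  show "real_distribution (distr M borel (A n))" for n using A by (rule M.real_distribution_distr)
  show "real_distribution (normal_law 0 (36 * VV))" using VV_nonneg by (intro normal_law_char) simp
  fix s
  define B where "B n \<omega> = 6 * (sqrt n * (ZZ n (zz n \<omega>) - cc + ED n / (2 * real n)))" for n :: nat and \<omega>
  have Bm: "B n \<in> borel_measurable M" for n
    unfolding B_def using measurable_compose[OF zz_meas ZZ_meas] by measurable
  have cA: "char (distr M borel (A n)) s = (\<integral>\<omega>. iexp (s * A n \<omega>) \<partial>M)" for n
    unfolding char_def by (rule integral_distr[OF A]) simp
  have cB: "(%n. \<integral>\<omega>. iexp (s * B n \<omega>) \<partial>M) \<longlonglongrightarrow> char (normal_law 0 (36 * VV)) s"
  proof -
    have "(\<integral>\<omega>. iexp (s * B n \<omega>) \<partial>M) = (\<integral>z. iexp ((6 * s) * (sqrt n * (ZZ n z - cc + ED n / (2 * real n)))) \<partial>PM n)" if n: "n \<ge> 1" for n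
    proof -
      have "(%z. iexp ((6 * s) * (sqrt n * (ZZ n z - cc + ED n / (2 * real n))))) \<in> borel_measurable (PM n)" using ZZ_meas by measurable
      from transfer[OF n this] show ?thesis by (simp add: B_def mult_ac)
    qed
    then have "\<forall>\<^sub>F n in sequentially. (\<integral>z. iexp ((6 * s) * (sqrt n * (ZZ n z - cc + ED n / (2 * real n)))) \<partial>PM n) = (\<integral>\<omega>. iexp (s * B n \<omega>) \<partial>M)"
      by (intro eventually_mono[OF eventually_ge_at_top[of 1]]) auto
    from Lim_transform_eventually[OF char_ZZ this]
    have "(%n. \<integral>\<omega>. iexp (s * B n \<omega>) \<partial>M) \<longlonglongrightarrow> complex_of_real (exp (-((6 * s)\<^sup>2 * VV / 2)))" .
    moreover have "complex_of_real (exp (-((6 * s)\<^sup>2 * VV / 2))) = char (normal_law 0 (36 * VV)) s"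
      using VV_nonneg by (subst normal_law_char(2)) (simp_all add: power2_eq_square)
    ultimately show ?thesis by (simp only:)
  qed
  have "(%n. (\<integral>\<omega>. iexp (s * A n \<omega>) \<partial>M) - (\<integral>\<omega>. iexp (s * B n \<omega>) \<partial>M)) \<longlonglongrightarrow> 0"
  proof (rule Lim_null_comparison)
    show "(%n. \<bar>s\<bar> * d n) \<longlonglongrightarrow> 0" by (rule tendsto_mult_right_zero[OF d0])
    show "\<forall>\<^sub>F n in sequentially. norm ((\<integral>\<omega>. iexp (s * A n \<omega>) \<partial>M) - (\<integral>\<omega>. iexp (s * B n \<omega>) \<partial>M)) <= \<bar>s\<bar> * d n"
    proof (rule eventually_mono[OF eventually_ge_at_top[of 1]])
      fix n :: nat assume n: "1 <= n"
      have m: "(%\<omega>. s * A n \<omega>) \<in> borel_measurable M" "(%\<omega>. s * B n \<omega>) \<in> borel_measurable M" using A Bm by measurable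
      have ae: "AE \<omega> in M. \<bar>s * A n \<omega> - s * B n \<omega>\<bar> <= \<bar>s\<bar> * d n"
        using d[OF n]
      proof (rule eventually_mono)
        fix \<omega> assume "\<bar>A n \<omega> - 6 * (sqrt n * (ZZ n (zz n \<omega>) - cc + ED n / (2 * real n)))\<bar> <= d n"
        then have "\<bar>s\<bar> * \<bar>A n \<omega> - B n \<omega>\<bar> <= \<bar>s\<bar> * d n" unfolding B_def by (rule mult_left_mono) simp
        then show "\<bar>s * A n \<omega> - s * B n \<omega>\<bar> <= \<bar>s\<bar> * d n" by (simp add: abs_mult[symmetric] right_diff_distrib)
      qed
      have int: "integrable M (%\<omega>. \<bar>s * A n \<omega> - s * B n \<omega>\<bar>)"
        by (rule M.integrable_const_bound[where B="\<bar>s\<bar> * d n"]) (use ae m in auto)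
      show "norm ((\<integral>\<omega>. iexp (s * A n \<omega>) \<partial>M) - (\<integral>\<omega>. iexp (s * B n \<omega>) \<partial>M)) <= \<bar>s\<bar> * d n"
        by (rule order_trans[OF M.char_diff_le[OF m int] M.integral_le_const[OF int ae]])
    qed
  qed
  from tendsto_add[OF this cB] show "(%n. char (distr M borel (A n)) s) \<longlonglongrightarrow> char (normal_law 0 (36 * VV)) s"
    by (simp add: cA)
qed

text \<open>The free null sequence \<open>e\<close> serves both forms of the limit theorem:
  \<open>e = 0\<close> keeps the bias correction, and \<open>e\<close> equal to minus its rescaled
  value removes it when that tends to zero. The 9 is 6 from the cyclic pair in the statistic plus 3
  from the one in the bias.\<close>

lemma clt_gen:
  assumes e: "e \<longlonglongrightarrow> 0"
  shows "weak_conv_m (%n. distr M borel (%\<omega>. sqrt (real n) * (6 * RT n \<omega> - 6 * cc + 3 * DC n) + e n)) (normal_law 0 (36 * VV))"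
proof (rule weak_limit)
  show "(%\<omega>. sqrt (real n) * (6 * RT n \<omega> - 6 * cc + 3 * DC n) + e n) \<in> borel_measurable M" for n
  proof (cases "n = 0")
    case False
    then show ?thesis using RT_meas[of n] by (auto simp: One_nat_def)
  qed simp
  have "(%n. 9 * (sqrt (real n) / real n) + \<bar>e n\<bar>) \<longlonglongrightarrow> 9 * 0 + \<bar>0\<bar>"
    by (intro tendsto_intros sqrt_over_n_tendsto e)
  then show "(%n. 9 * (sqrt (real n) / real n) + \<bar>e n\<bar>) \<longlonglongrightarrow> 0" by simp
  fix n :: nat assume n: "n \<ge> 1"
  show "AE \<omega> in M. \<bar>sqrt (real n) * (6 * RT n \<omega> - 6 * cc + 3 * DC n) + e n - 6 * (sqrt n * (ZZ n (zz n \<omega>) - cc + ED n / (2 * real n)))\<bar>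
      <= 9 * (sqrt (real n) / real n) + \<bar>e n\<bar>"
    using no_ties
  proof (rule eventually_mono)
    fix \<omega> assume inj: "\<forall>n. inj_on (%i. Xs i \<omega>) {1..n}"
    define r where "r = sqrt (real n)"
    define a where "a = RT n \<omega> - ZZ n (zz n \<omega>)"
    define b where "b = DC n - ED n / n"
    have n0: "real n > 0" using n by simp
    have a: "\<bar>a\<bar> <= 1 / n" unfolding a_def by (rule RT_ZZ[OF n inj[rule_format]])
    have "b = (n * DC n - ED n) / n" unfolding b_def using n0 by (simp add: diff_divide_distrib)
    then have b: "\<bar>b\<bar> <= 1 / n" using DC_ED[OF n] n0 by (simp add: divide_right_mono)
    have "r * (6 * RT n \<omega> - 6 * cc + 3 * DC n) + e n - 6 * (r * (ZZ n (zz n \<omega>) - cc + ED n / (2 * real n))) = r * (6 * a + 3 * b) + e n"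
      unfolding a_def b_def by (simp add: algebra_simps)
    also have "\<bar>\<dots>\<bar> <= \<bar>r * (6 * a + 3 * b)\<bar> + \<bar>e n\<bar>" by (rule abs_triangle_ineq)
    also have "\<bar>r * (6 * a + 3 * b)\<bar> <= r * (9 * (1 / n))"
    proof -
      have "\<bar>6 * a + 3 * b\<bar> <= 9 * (1 / n)" using a b by linarith
      then have "r * \<bar>6 * a + 3 * b\<bar> <= r * (9 * (1 / n))" by (rule mult_left_mono) (simp add: r_def)
      moreover have "\<bar>r\<bar> = r" by (simp add: r_def)
      ultimately show ?thesis unfolding abs_mult by (simp only:)
    qed
    also have "r * (9 * (1 / n)) = 9 * (r / n)" by simp
    finally show "\<bar>sqrt (real n) * (6 * RT n \<omega> - 6 * cc + 3 * DC n) + e n - 6 * (sqrt n * (ZZ n (zz n \<omega>) - cc + ED n / (2 * real n)))\<bar>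
      <= 9 * (sqrt (real n) / real n) + \<bar>e n\<bar>" unfolding r_def by simp
  qed
qed

text \<open>The ordered positions form an increasing sequence, so for every level the neighbour sum
  of squares is at most \<open>K\<close>; integration over the level bounds \<open>DD\<close>. Hence
  Delta is O(1/n), with \<open>K + 1\<close> accounting for the cyclic pair.\<close>

lemma two_variation:
  assumes K: "!!t (m :: nat) (x :: nat => real). strict_mono_on {1..m} x ==> (\<Sum>i=1..<m. (ph t (x (i + 1)) - ph t (x i))\<^sup>2) <= K"
  shows "(%n. sqrt (real n) * DC n) \<longlonglongrightarrow> 0"
proof -
  have ED: "ED n <= K" if n: "n \<ge> 1" for n
    unfolding ED_zz[OF n]
  proof (rule M.integral_le_const[OF DD_zz_int])
    show "AE \<omega> in M. DD n (fst (zz n \<omega>)) <= K"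
      using no_ties
    proof (rule eventually_mono)
      fix \<omega> assume "\<forall>n. inj_on (%i. Xs i \<omega>) {1..n}"
      then have inj: "inj_on (%i. Xs i \<omega>) {1..n}" by blast
      let ?r = "rank_perm n (%i. Xs i \<omega>)" and ?l = "ord_list n (%i. Xs i \<omega>)"
      have sm: "strict_mono_on {1..n} (%i. Xs (?r i) \<omega>)" using ex_rank_perm[OF inj] by (simp add: is_rank_perm_def)
      have ln: "?l ! k = ?r (k + 1)" if "k < n" for k
        unfolding rank_perm_map[OF inj, symmetric] using that by (simp add: add.commute del: upt_Suc)
      have "(\<Sum>p\<in>adj ?l. (ph t (Xs (fst p) \<omega>) - ph t (Xs (snd p) \<omega>))\<^sup>2) <= K" for t
      proof -
        have "(\<Sum>p\<in>adj ?l. (ph t (Xs (fst p) \<omega>) - ph t (Xs (snd p) \<omega>))\<^sup>2) =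
            (\<Sum>k<n - 1. (ph t (Xs (?l ! k) \<omega>) - ph t (Xs (?l ! (k + 1)) \<omega>))\<^sup>2)"
          using sum_adj_nth[of ?l "%p. (ph t (Xs (fst p) \<omega>) - ph t (Xs (snd p) \<omega>))\<^sup>2"] by simp
        also have "\<dots> = (\<Sum>k<n - 1. (ph t (Xs (?r (k + 1 + 1)) \<omega>) - ph t (Xs (?r (k + 1)) \<omega>))\<^sup>2)"
        proof (rule sum.cong[OF refl])
          fix k assume "k \<in> {..<n - 1}"
          then have k: "k < n" "k + 1 < n" by auto
          show "(ph t (Xs (?l ! k) \<omega>) - ph t (Xs (?l ! (k + 1)) \<omega>))\<^sup>2 = (ph t (Xs (?r (k + 1 + 1)) \<omega>) - ph t (Xs (?r (k + 1)) \<omega>))\<^sup>2"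
            unfolding ln[OF k(1)] ln[OF k(2)] by (rule power2_commute)
        qed
        also have "\<dots> = (\<Sum>i=1..<n. (ph t (Xs (?r (i + 1)) \<omega>) - ph t (Xs (?r i) \<omega>))\<^sup>2)"
          by (rule sum.reindex_bij_witness[of _ "%i. i - 1" "%k. k + 1"]) auto
        also have "\<dots> <= K" by (rule K[OF sm])
        finally show ?thesis .
      qed
      then have le: "(\<integral>t. (\<Sum>p\<in>adj ?l. (ph t (Xs (fst p) \<omega>) - ph t (Xs (snd p) \<omega>))\<^sup>2) \<partial>lam) <= (\<integral>t. K \<partial>lam)"
      proof (intro integral_mono)
        show "integrable lam (%t. \<Sum>p\<in>adj ?l. (ph t (Xs (fst p) \<omega>) - ph t (Xs (snd p) \<omega>))\<^sup>2)"
          by (intro Bochner_Integration.integrable_sum int_ph_diff)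
      qed auto
      have "DD n (fst (zz n \<omega>)) = (\<integral>t. (\<Sum>p\<in>adj ?l. (ph t (Xs (fst p) \<omega>) - ph t (Xs (snd p) \<omega>))\<^sup>2) \<partial>lam)"
        unfolding DD_zz dd_ph
        by (rule Bochner_Integration.integral_sum[symmetric]) (rule int_ph_diff)
      with le show "DD n (fst (zz n \<omega>)) <= K" by (simp add: L.prob_space[simplified])
    qed
  qed
  show ?thesis
  proof (rule Lim_null_comparison)
    show "(%n. (K + 1) * (sqrt (real n) / real n)) \<longlonglongrightarrow> 0" by (rule tendsto_mult_right_zero[OF sqrt_over_n_tendsto])
    show "\<forall>\<^sub>F n in sequentially. norm (sqrt (real n) * DC n) <= (K + 1) * (sqrt (real n) / real n)"
    proof (rule eventually_mono[OF eventually_ge_at_top[of 1]])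
      fix n :: nat assume n: "1 <= n"
      have "\<bar>n * DC n\<bar> <= K + 1" using DC_ED[OF n] ED_bound(1)[of n] ED[OF n] by linarith
      then have "\<bar>DC n\<bar> * n <= K + 1" by (simp add: abs_mult mult.commute)
      then have "\<bar>DC n\<bar> <= (K + 1) / n" using n by (subst pos_le_divide_eq) auto
      then have "sqrt (real n) * \<bar>DC n\<bar> <= sqrt (real n) * ((K + 1) / n)" by (rule mult_left_mono) simp
      then show "norm (sqrt (real n) * DC n) <= (K + 1) * (sqrt (real n) / real n)" by (simp add: abs_mult mult.commute)
    qed
  qed
qed

end

section \<open>Reduction of the given random variables to the sample model\<close>

theorem theorem2p3:
  fixes M :: "'a measure"
    and X \<epsilon> Y :: "'a \<Rightarrow> real"
    and Xs \<epsilon>s Ys :: "nat \<Rightarrow> 'a \<Rightarrow> real"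
    and f :: "real \<times> real \<Rightarrow> real"
    and \<phi> :: "real \<Rightarrow> real \<Rightarrow> real"
  assumes "prob_space M"
    and "f \<in> borel_measurable borel"
    and "prob_space.indep_var M borel X borel \<epsilon>"
    and Y: "Y = (\<lambda>\<omega>. f (X \<omega>, \<epsilon> \<omega>))"
    and "prob_space.indep_vars M (\<lambda>_. borel) Xs {1..}"
    and "\<And>i. i \<ge> 1 \<Longrightarrow> distr M borel (Xs i) = distr M borel X"
    and "prob_space.indep_vars M (\<lambda>_. borel) \<epsilon>s {1..}"
    and "\<And>i. i \<ge> 1 \<Longrightarrow> distr M borel (\<epsilon>s i) = distr M borel \<epsilon>"
    and "prob_space.indep_var M
           (PiM {1..} (\<lambda>_. borel)) (\<lambda>\<omega>. \<lambda>i\<in>{1..}. Xs i \<omega>)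
           (PiM {1..} (\<lambda>_. borel)) (\<lambda>\<omega>. \<lambda>i\<in>{1..}. \<epsilon>s i \<omega>)"
    and Ys: "\<And>i. Ys i = (\<lambda>\<omega>. f (Xs i \<omega>, \<epsilon>s i \<omega>))"
    and phi: "\<phi> = cond_cdf M \<epsilon> f"
    and "continuous_on UNIV (cdf_of M X)"
    and "continuous_on UNIV (cdf_of M Y)"
  shows
    "(AE \<omega> in M. (\<lambda>n. rho_CvM_hat n (\<lambda>i. Xs i \<omega>) (\<lambda>i. Ys i \<omega>)) \<longlonglongrightarrow> rho_CvM M X Y \<phi>)
     \<and> (\<forall>n\<ge>1. Delta_CvM M Y \<phi> Xs n =
          (\<integral>t. (\<integral>\<omega>. (\<phi> t (Xs 1 \<omega>) - \<phi> t (Xs (right_neighbour n (\<lambda>k. Xs k \<omega>) 1) \<omega>))\<^sup>2 \<partial>M)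
             \<partial>interval_measure (cdf_of M Y)))
     \<and> Delta_CvM M Y \<phi> Xs \<longlonglongrightarrow> 0
     \<and> 0 \<le> sigma2_CvM M X Y \<phi>
     \<and> weak_conv_m
          (\<lambda>n. distr M borel (\<lambda>\<omega>. sqrt (real n) *
             (rho_CvM_hat n (\<lambda>i. Xs i \<omega>) (\<lambda>i. Ys i \<omega>) - rho_CvM M X Y \<phi>
              + 3 * Delta_CvM M Y \<phi> Xs n)))
          (normal_law 0 (sigma2_CvM M X Y \<phi>))
     \<and> ((\<lambda>n. sqrt (real n) * Delta_CvM M Y \<phi> Xs n) \<longlonglongrightarrow> 0 \<longrightarrow>
        weak_conv_m
          (\<lambda>n. distr M borel (\<lambda>\<omega>. sqrt (real n) *
             (rho_CvM_hat n (\<lambda>i. Xs i \<omega>) (\<lambda>i. Ys i \<omega>) - rho_CvM M X Y \<phi>)))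
          (normal_law 0 (sigma2_CvM M X Y \<phi>)))
     \<and> (uniformly_bounded_2_variation \<phi> \<longrightarrow>
        (\<lambda>n. sqrt (real n) * Delta_CvM M Y \<phi> Xs n) \<longlonglongrightarrow> 0)"
proof -
  interpret M: prob_space M by (rule assms(1))
  define \<mu> where "\<mu> = distr M borel X"
  define \<nu> where "\<nu> = distr M borel \<epsilon>"
  have X: "X \<in> borel_measurable M" by (rule M.indep_var_rv1[OF assms(3)])
  have e: "\<epsilon> \<in> borel_measurable M" by (rule M.indep_var_rv2[OF assms(3)])
  have fm: "f \<in> borel_measurable (borel \<Otimes>\<^sub>M borel)" using assms(2) by (simp add: borel_prod)
  have joint: "distr M (borel \<Otimes>\<^sub>M borel) (%\<omega>. (X \<omega>, \<epsilon> \<omega>)) = \<mu> \<Otimes>\<^sub>M \<nu>"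
    using assms(3) unfolding M.indep_var_distribution_eq \<mu>_def \<nu>_def by simp
  have Ym: "Y \<in> borel_measurable M"
    unfolding Y by (rule measurable_compose[OF measurable_Pair[OF X e] fm])
  have lawY: "distr (\<mu> \<Otimes>\<^sub>M \<nu>) borel f = distr M borel Y"
    unfolding joint[symmetric] Y by (subst distr_distr[OF fm measurable_Pair[OF X e]]) (simp add: comp_def)
  have RX: "real_distribution (distr M borel X)" and RY: "real_distribution (distr M borel Y)"
    using X Ym by simp_all
  interpret rX: real_distribution "distr M borel X" by (rule RX)
  interpret rY: real_distribution "distr M borel Y" by (rule RY)
  have atomX: "measure \<mu> {t} = 0" for t
    using assms(12) unfolding \<mu>_def rX.isCont_cdf[symmetric] by (simp add: continuous_on_eq_continuous_at)
  have atomY: "measure (distr M borel Y) {t} = 0" for t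
    using assms(13) unfolding rY.isCont_cdf[symmetric] by (simp add: continuous_on_eq_continuous_at)
  have rm: "rank_model \<mu> \<nu> f"
  proof (intro rank_model.intro two_laws.intro rank_model_axioms.intro)
    show "prob_space \<mu>" "prob_space \<nu>" unfolding \<mu>_def \<nu>_def by (rule M.prob_space_distr[OF X], rule M.prob_space_distr[OF e])
    show "sets \<mu> = sets borel" "sets \<nu> = sets borel" by (simp_all add: \<mu>_def \<nu>_def)
    show "measure (distr (\<mu> \<Otimes>\<^sub>M \<nu>) borel f) {t} = 0" for t unfolding lawY by (rule atomY)
  qed (rule fm)
  have sets: "sets \<mu> = sets borel" "sets \<nu> = sets borel" by (simp_all add: \<mu>_def \<nu>_def)
  have Xsm: "Xs i \<in> borel_measurable M" if "i \<ge> 1" for i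
    using assms(5) that unfolding M.indep_vars_def2 by auto
  have esm: "\<epsilon>s i \<in> borel_measurable M" if "i \<ge> 1" for i
    using assms(7) that unfolding M.indep_vars_def2 by auto
  \<comment> \<open>Independence of the two infinite sequences passes to their first n coordinates
    by composing with restriction; within each sequence, independence and equal marginals give a
    power of one law.\<close>
  have law: "distr M (PiM {1..n} (%_. \<mu>) \<Otimes>\<^sub>M PiM {1..n} (%_. \<nu>))
      (%\<omega>. (restrict (%i. Xs i \<omega>) {1..n}, restrict (%i. \<epsilon>s i \<omega>) {1..n})) = PiM {1..n} (%_. \<mu>) \<Otimes>\<^sub>M PiM {1..n} (%_. \<nu>)"
    if n: "n \<ge> 1" for n
  proof -
    let ?B = "PiM {1..n} (%_. borel :: real measure)"
    have comp: "distr M ?B (%\<omega>. restrict (%i. Z i \<omega>) {1..n}) = PiM {1..n} (%_. N)"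
      if Z: "prob_space.indep_vars M (%_. borel) Z {1..}" and d: "!!i. i \<ge> 1 ==> distr M borel (Z i) = N" for Z :: "nat \<Rightarrow> 'a \<Rightarrow> real" and N
    proof -
      have ne: "{1..n} ~= {}" using n by simp
      have iv: "M.indep_vars (%_. borel) Z {1..n}" by (rule M.indep_vars_subset[OF Z]) auto
      then have rv: "Z i \<in> borel_measurable M" if "i \<in> {1..n}" for i using that unfolding M.indep_vars_def2 by auto
      have "distr M ?B (%\<omega>. restrict (%i. Z i \<omega>) {1..n}) = PiM {1..n} (%i. distr M borel (Z i))"
        using iffD1[OF M.indep_vars_iff_distr_eq_PiM'[OF ne rv] iv] .
      also have "\<dots> = PiM {1..n} (%_. N)" by (rule PiM_cong[OF refl]) (simp add: d)
      finally show ?thesis .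
    qed
    have r: "(%x. restrict x {1..n}) \<in> measurable (PiM {1..} (%_. borel :: real measure)) ?B"
      by (rule measurable_restrict_subset) auto
    have c: "(%x. restrict x {1..n}) \<circ> (%\<omega>. restrict (%i. Z i \<omega>) {1..}) = (%\<omega>. restrict (%i. Z i \<omega>) {1..n})" for Z :: "nat \<Rightarrow> 'a \<Rightarrow> real"
      by (auto simp: fun_eq_iff restrict_def)
    have "M.indep_var ?B (%\<omega>. restrict (%i. Xs i \<omega>) {1..n}) ?B (%\<omega>. restrict (%i. \<epsilon>s i \<omega>) {1..n})"
      using M.indep_var_compose[OF assms(9) r r] unfolding c .
    then have "distr M ?B (%\<omega>. restrict (%i. Xs i \<omega>) {1..n}) \<Otimes>\<^sub>M distr M ?B (%\<omega>. restrict (%i. \<epsilon>s i \<omega>) {1..n}) =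
        distr M (?B \<Otimes>\<^sub>M ?B) (%\<omega>. (restrict (%i. Xs i \<omega>) {1..n}, restrict (%i. \<epsilon>s i \<omega>) {1..n}))"
      unfolding M.indep_var_distribution_eq by simp
    moreover have "distr M ?B (%\<omega>. restrict (%i. Xs i \<omega>) {1..n}) = PiM {1..n} (%_. \<mu>)"
      by (rule comp[OF assms(5)]) (simp add: assms(6) \<mu>_def)
    moreover have "distr M ?B (%\<omega>. restrict (%i. \<epsilon>s i \<omega>) {1..n}) = PiM {1..n} (%_. \<nu>)"
      by (rule comp[OF assms(7)]) (simp add: assms(8) \<nu>_def)
    \<comment> \<open>Only the sigma-algebra of the target matters for an image measure, and it is
      the same for \<open>\<mu>\<close>, \<open>\<nu>\<close> and \<open>borel\<close>.\<close>
    moreover have "distr M (PiM {1..n} (%_. \<mu>) \<Otimes>\<^sub>M PiM {1..n} (%_. \<nu>)) g = distr M (?B \<Otimes>\<^sub>M ?B) g" for g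
      by (rule distr_cong[OF refl sets_pair_measure_cong[OF sets_PiM_cong[OF refl] sets_PiM_cong[OF refl]] refl]) (simp_all only: sets)
    ultimately show ?thesis by simp
  qed
  interpret RS: rank_sample \<mu> \<nu> f M Xs \<epsilon>s
    by (intro rank_sample.intro rm assms(1) rank_sample_axioms.intro atomX Xsm esm law)
  have lam: "RS.lam = distr M borel Y" unfolding RS.lam_def by (rule lawY)
  \<comment> \<open>Stieltjes integration in dF_Y is integration against the law of
    \<open>Y\<close>.\<close>
  have imY: "interval_measure (cdf_of M Y) = RS.lam" unfolding lam by (rule interval_measure_cdf[OF RY])
  have cdfY: "cdf_of M Y = RS.GG" unfolding RS.GG_cdf lam ..
  \<comment> \<open>The probability over \<open>M\<close> defining \<open>\<phi>\<close> is the
    integral of an indicator, hence an integral against the law \<open>\<nu>\<close> of the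
    noise.\<close>
  have ph: "\<phi> = RS.ph"
  proof (intro ext)
    fix t x
    have m: "(%v. f (x, v)) \<in> borel_measurable borel" by (rule measurable_compose[OF measurable_Pair1' fm]) simp
    have ind: "(%v. indicator {..t} (f (x, v)) :: real) \<in> borel_measurable borel"
      by (rule RS.ind_meas[OF measurable_const m]) simp
    have "RS.ph t x = (\<integral>\<omega>. indicator {..t} (f (x, \<epsilon> \<omega>)) \<partial>M)"
      unfolding RS.ph_def unfolding \<nu>_def by (rule integral_distr[OF e ind])
    also have "\<dots> = (\<integral>\<omega>. indicator {\<omega> \<in> space M. f (x, \<epsilon> \<omega>) <= t} \<omega> \<partial>M)"
      by (rule Bochner_Integration.integral_cong) (auto simp: indicator_def)
    also have "\<dots> = measure M ({\<omega> \<in> space M. f (x, \<epsilon> \<omega>) <= t} \<inter> space M)" by simp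
    also have "{\<omega> \<in> space M. f (x, \<epsilon> \<omega>) <= t} \<inter> space M = {\<omega> \<in> space M. f (x, \<epsilon> \<omega>) <= t}" by blast
    finally show "\<phi> t x = RS.ph t x" unfolding phi cond_cdf_def by (rule sym)
  qed
  have EX: "(\<integral>\<omega>. g (X \<omega>) \<partial>M) = (\<integral>x. g x \<partial>\<mu>)" if "g \<in> borel_measurable borel" for g :: "real \<Rightarrow> real"
    unfolding \<mu>_def by (rule integral_distr[OF X that, symmetric])
  have TT: "T_fun M X \<phi> = RS.TT"
    unfolding T_fun_def[abs_def] RS.TT_def[abs_def] ph by (intro ext EX) measurable
  have imT: "interval_measure (T_fun M X \<phi>) = RS.tau" unfolding TT RS.tau_def ..
  have CXX: "C_XX M X \<phi> t s = RS.CXX t s" for t s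
  proof -
    have 1: "(\<integral>\<omega>. (RS.ph t (X \<omega>))\<^sup>2 * (RS.ph s (X \<omega>))\<^sup>2 \<partial>M) = (\<integral>x. (RS.ph t x)\<^sup>2 * (RS.ph s x)\<^sup>2 \<partial>\<mu>)" by (rule EX) measurable
    have 2: "(\<integral>\<omega>. (RS.ph c (X \<omega>))\<^sup>2 \<partial>M) = (\<integral>x. (RS.ph c x)\<^sup>2 \<partial>\<mu>)" for c by (rule EX) measurable
    have 3: "(\<integral>\<omega>. (RS.ph (min t s) (X \<omega>) + 3 * RS.ph t (X \<omega>) * RS.ph s (X \<omega>)) * (RS.ph (min t s) (X \<omega>) - RS.ph t (X \<omega>) * RS.ph s (X \<omega>)) \<partial>M)
        = (\<integral>x. (RS.ph (min t s) x + 3 * RS.ph t x * RS.ph s x) * (RS.ph (min t s) x - RS.ph t x * RS.ph s x) \<partial>\<mu>)"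
      by (rule EX) measurable
    show ?thesis unfolding C_XX_def RS.CXX_def ph 1 2 3 ..
  qed
  have CXY: "C_XY M X \<phi> t s = RS.CXY t s" for t s
  proof -
    have 1: "(\<integral>\<omega>. (RS.ph t (X \<omega>))\<^sup>2 * RS.ph s (X \<omega>) \<partial>M) = (\<integral>x. (RS.ph t x)\<^sup>2 * RS.ph s x \<partial>\<mu>)" by (rule EX) measurable
    have 2: "(\<integral>\<omega>. (RS.ph t (X \<omega>))\<^sup>2 \<partial>M) = (\<integral>x. (RS.ph t x)\<^sup>2 \<partial>\<mu>)" by (rule EX) measurable
    have 3: "(\<integral>\<omega>. RS.ph s (X \<omega>) \<partial>M) = (\<integral>x. RS.ph s x \<partial>\<mu>)" by (rule EX) measurable
    have 4: "(\<integral>\<omega>. 2 * RS.ph t (X \<omega>) * (RS.ph (min t s) (X \<omega>) - RS.ph t (X \<omega>) * RS.ph s (X \<omega>)) \<partial>M)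
        = (\<integral>x. 2 * RS.ph t x * (RS.ph (min t s) x - RS.ph t x * RS.ph s x) \<partial>\<mu>)"
      by (rule EX) measurable
    show ?thesis unfolding C_XY_def RS.CXY_def ph 1 2 3 4 ..
  qed
  have CYY: "C_YY M Y t s = RS.CYY t s" for t s unfolding C_YY_def RS.CYY_def cdfY ..
  have sigma: "sigma2_CvM M X Y \<phi> = 36 * RS.VV"
    unfolding sigma2_CvM_def imY imT CXX CXY CYY RS.VV_eq ..
  have rho: "rho_CvM M X Y \<phi> = 6 * RS.cc - 2"
  proof -
    have "(\<integral>\<omega>. (RS.ph t (X \<omega>) - RS.GG t)\<^sup>2 \<partial>M) = (\<integral>x. (RS.ph t x - RS.GG t)\<^sup>2 \<partial>\<mu>)" for t
      by (rule EX) measurable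
    then show ?thesis unfolding rho_CvM_def imY unfolding cdfY ph using RS.rho_eq by simp
  qed
  have Delta: "Delta_CvM M Y \<phi> Xs = RS.DC"
    unfolding Delta_CvM_def[abs_def] RS.DC_def[abs_def] imY ph ..
  have Yss: "(%i. Ys i \<omega>) = (%i. RS.ys i \<omega>)" for \<omega> unfolding Ys RS.ys_def ..
  have hat: "rho_CvM_hat n (%i. Xs i \<omega>) (%i. Ys i \<omega>) = 6 * RS.RT n \<omega> - 2" for n \<omega>
    unfolding rho_CvM_hat_def Yss RS.RT_def ..
  have as: "AE \<omega> in M. (%n. 6 * RS.RT n \<omega> - 2) \<longlonglongrightarrow> 6 * RS.cc - 2"
    using RS.RT_as by (rule eventually_mono) (intro tendsto_intros)
  have clt: "weak_conv_m (%n. distr M borel (%\<omega>. sqrt (real n) * (6 * RS.RT n \<omega> - 2 - (6 * RS.cc - 2) + 3 * RS.DC n))) (normal_law 0 (36 * RS.VV))"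
    using RS.clt_gen[OF tendsto_const[of 0]] by (simp add: algebra_simps)
  have clt0: "weak_conv_m (%n. distr M borel (%\<omega>. sqrt (real n) * (6 * RS.RT n \<omega> - 2 - (6 * RS.cc - 2)))) (normal_law 0 (36 * RS.VV))"
    if lim: "(%n. sqrt (real n) * RS.DC n) \<longlonglongrightarrow> 0"
  proof -
    \<comment> \<open>This choice of the null sequence in \<open>clt_gen\<close> cancels the bias
      term exactly.\<close>
    have "(%n. - 3 * (sqrt (real n) * RS.DC n)) \<longlonglongrightarrow> 0" by (rule tendsto_mult_right_zero[OF lim])
    from RS.clt_gen[OF this]
    show ?thesis by (simp add: algebra_simps)
  qed
  have var2: "(%n. sqrt (real n) * RS.DC n) \<longlonglongrightarrow> 0" if "uniformly_bounded_2_variation RS.ph"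
  proof -
    \<comment> \<open>The supremum lives in [0, \<infinity>]; being finite, its real part
      \<open>enn2real S\<close> is the constant for \<open>two_variation\<close>.\<close>
    define S where "S = (SUP t. SUP (m, x) \<in> {(m :: nat, x :: nat \<Rightarrow> real). strict_mono_on {1..m} x}.
        ennreal (\<Sum>i=1..<m. (RS.ph t (x (i + 1)) - RS.ph t (x i))\<^sup>2))"
    have S: "S < top" using that unfolding uniformly_bounded_2_variation_def S_def by simp
    show ?thesis
    proof (rule RS.two_variation)
      fix t :: real and m :: nat and x :: "nat \<Rightarrow> real" assume x: "strict_mono_on {1..m} x"
      have "ennreal (\<Sum>i=1..<m. (RS.ph t (x (i + 1)) - RS.ph t (x i))\<^sup>2) <= S"
        unfolding S_def
        by (rule SUP_upper2[of t], simp, rule SUP_upper2[of "(m, x)"]) (use x in auto)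
      then have "enn2real (ennreal (\<Sum>i=1..<m. (RS.ph t (x (i + 1)) - RS.ph t (x i))\<^sup>2)) <= enn2real S"
        using S by (rule enn2real_mono)
      then show "(\<Sum>i=1..<m. (RS.ph t (x (i + 1)) - RS.ph t (x i))\<^sup>2) <= enn2real S"
        by (simp add: sum_nonneg)
    qed
  qed
  have nn: "0 <= 36 * RS.VV" using RS.VV_nonneg by simp
  show ?thesis
    unfolding hat rho Delta sigma imY unfolding ph
    using as RS.DC_right_neighbour RS.DC_tendsto nn clt clt0 var2 by blast
qed

end
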